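(* Let $\alpha,\beta,\gamma,\delta\in\mathbb C$ be given. Let $a,\sigma\in\mathbb C$ with $a\neq0$ and $0<\Re\sigma<1$. Then the equation PVI admits a solution with a branch at $x=0$ having the following behavior when $x\to0$ with $\arg x$ bounded: $$y(x)=a\,x^{1-\sigma}\bigl(1+\delta(x)\bigr),\qquad \delta(x)=O\bigl(\max\{|x|^{1-\Re\sigma},|x|^{\Re\sigma}\}\bigr).$$ The higher order term $\delta(x)$ has an expansion, convergent for $0<|x|<\epsilon$ with $\epsilon$ sufficiently small ($\arg x$ bounded), of the form $$\delta(x)=-1+\sum_{n=0}^\infty x^n\sum_{m=-n}^{n+2}\tilde c_{nm}\,x^{m\sigma},\qquad \tilde c_{00}=1,$$ which can also be written $$\delta(x)=\sum_{\substack{m_2\ge0,\ 0\le m_1\le 2m_2+2\\ m_1+m_2\ge1}}\delta_{m_1m_2}\,x^{m_1\sigma}x^{m_2(1-\sigma)},\qquad \delta_{m_1m_2}=\tilde c_{m_2,m_1-m_2}.$$ The coefficients are rational functions of $\sigma$ and $a$ (depending on $\alpha,\beta,\gamma,\delta$), which can be computed by direct substitution into PVI. The exponent $\sigma$ is related to the monodromy data associated to $y(x)$ by $2\cos(\pi\sigma)=p_{0x}$.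
   Context: PVI is the equation $$y''=\tfrac12\Bigl[\tfrac1y+\tfrac1{y-1}+\tfrac1{y-x}\Bigr](y')^2-\Bigl[\tfrac1x+\tfrac1{x-1}+\tfrac1{y-x}\Bigr]y'+\frac{y(y-1)(y-x)}{x^2(x-1)^2}\Bigl[\alpha+\beta\frac{x}{y^2}+\gamma\frac{x-1}{(y-1)^2}+\delta\frac{x(x-1)}{(y-x)^2}\Bigr]$$ (the parameter $\delta$ is not to be confused with the function $\delta(x)$). Its solutions extend meromorphically to the universal covering of $\mathbb C\setminus\{0,1\}$; a branch is a determination for $|\arg x|<\pi$, $|\arg(1-x)|<\pi$. Parameters: $\theta_0^2=-2\beta$, $\theta_x^2=1-2\delta$, $\theta_1^2=2\gamma$, $(\theta_\infty-1)^2=2\alpha$, $\theta_\infty\ne0$. Monodromy data: PVI is the isomonodromy condition of $\frac{d\Psi}{d\lambda}=\Bigl[\frac{A_0(x)}{\lambda}+\frac{A_x(x)}{\lambda-x}+\frac{A_1(x)}{\lambda-1}\Bigr]\Psi$ with traceless $2\times2$ matrices $A_i$ having eigenvalues $\pm\theta_i/2$ ($i=0,x,1$), $A_0+A_x+A_1=-\frac{\theta_\infty}2\,\mathrm{diag}(1,-1)$, and satisfying the Schlesinger equations in $x$; the solution of PVI associated to such a system is $y(x)=\dfrac{x(A_0)_{12}}{x[(A_0)_{12}+(A_1)_{12}]-(A_1)_{12}}$. Under continuation of $\lambda$ along counterclockwise loops $\gamma_0,\gamma_x,\gamma_1$ around $0,x,1$ one has $\Psi\mapsto\Psi M_i$,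 $i=0,x,1$, the $M_i$ being independent of $x$. $p_{0x}=\mathrm{Tr}(M_0M_x)$, where $\gamma_0,\gamma_x$ are chosen so that, for small $x$, $\gamma_0\gamma_x$ is homotopic to a simple loop enclosing $0$ and $x$ (and the segment joining them) but not $1$. *)

theory Defs
  imports "HOL-Complex_Analysis.Complex_Analysis" "HOL-Library.Landau_Symbols"
begin

unbundle no Formal_Power_Series.fps_syntax  (* leaves "$" for vector components *)

text \<open>
  Multivalued functions of \<open>x\<close> near \<open>x = 0\<close> are functions on the universal covering of the
  punctured disc, i.e. functions of \<open>\<xi> = log x\<close>: the point \<open>\<xi>\<close> lies over \<open>x = exp \<xi>\<close>, with
  \<open>arg x = Im \<xi>\<close>, and \<open>x\<^sup>s = exp (s * \<xi>)\<close>.  The usual branch on the plane slit along the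
  nonpositive reals is \<open>\<lambda>x. y (Ln x)\<close>.
\<close>

definition cover_sector :: "real \<Rightarrow> real \<Rightarrow> complex set" where
  "cover_sector \<epsilon> \<phi> = {\<xi>. norm (exp \<xi>) < \<epsilon> \<and> \<bar>Im \<xi>\<bar> < \<phi>}"

text \<open>The filter for \<open>x \<rightarrow> 0\<close> with \<open>\<bar>arg x\<bar> < \<phi>\<close>:\<close>

definition cover_at_0 :: "real \<Rightarrow> complex filter" where
  "cover_at_0 \<phi> = inf (filtercomap Re at_bot) (principal {\<xi>. \<bar>Im \<xi>\<bar> < \<phi>})"

text \<open>The derivative with respect to \<open>x = exp \<xi>\<close> (not \<open>\<xi>\<close>) of a function on the covering:\<close>

definition deriv_x :: "(complex \<Rightarrow> complex) \<Rightarrow> complex \<Rightarrow> complex" where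
  "deriv_x f \<xi> = deriv f \<xi> / exp \<xi>"

definition PVI_rhs ::
  "complex \<Rightarrow> complex \<Rightarrow> complex \<Rightarrow> complex \<Rightarrow> complex \<Rightarrow> complex \<Rightarrow> complex \<Rightarrow> complex" where
  "PVI_rhs \<alpha> \<beta> \<gamma> \<delta> x y y' =
     1/2 * (1/y + 1/(y - 1) + 1/(y - x)) * y'^2
     - (1/x + 1/(x - 1) + 1/(y - x)) * y'
     + y * (y - 1) * (y - x) / (x^2 * (x - 1)^2)
       * (\<alpha> + \<beta> * (x / y^2) + \<gamma> * ((x - 1) / (y - 1)^2) + \<delta> * (x * (x - 1) / (y - x)^2))"

text \<open>The equation is singular where \<open>y \<in> {0, 1, x}\<close>; the conditions excluding these values keep
  the convention \<open>z / 0 = 0\<close> from giving it a meaning there.\<close>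

definition solves_PVI ::
  "complex \<Rightarrow> complex \<Rightarrow> complex \<Rightarrow> complex \<Rightarrow> complex set \<Rightarrow> (complex \<Rightarrow> complex) \<Rightarrow> bool" where
  "solves_PVI \<alpha> \<beta> \<gamma> \<delta> S y \<longleftrightarrow>
     y holomorphic_on S \<and>
     (\<forall>\<xi>\<in>S. exp \<xi> \<noteq> 1 \<and> y \<xi> \<noteq> 0 \<and> y \<xi> \<noteq> 1 \<and> y \<xi> \<noteq> exp \<xi> \<and>
        deriv_x (deriv_x y) \<xi> = PVI_rhs \<alpha> \<beta> \<gamma> \<delta> (exp \<xi>) (y \<xi>) (deriv_x y \<xi>))"

text \<open>A polynomial in two variables is a polynomial in the second one whose coefficients are
  polynomials in the first.\<close>

definition eval2 :: "complex poly poly \<Rightarrow> complex \<Rightarrow> complex \<Rightarrow> complex" where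
  "eval2 P s a = poly (poly P [:a:]) s"

definition rational_fun2_on ::
  "(complex \<times> complex) set \<Rightarrow> (complex \<Rightarrow> complex \<Rightarrow> complex) \<Rightarrow> bool" where
  "rational_fun2_on D f \<longleftrightarrow>
     (\<exists>P Q. \<forall>(s, a)\<in>D. eval2 Q s a \<noteq> 0 \<and> f s a = eval2 P s a / eval2 Q s a)"

type_synonym cmat2 = "complex^2^2"

definition diag2 :: "complex \<Rightarrow> complex \<Rightarrow> cmat2" where
  "diag2 p q = (\<chi> i j. if i = j then (if i = 1 then p else q) else 0)"

definition commutator :: "cmat2 \<Rightarrow> cmat2 \<Rightarrow> cmat2" where
  "commutator A B = A ** B - B ** A"

definition traceless_with_eigenvalues :: "complex \<Rightarrow> cmat2 \<Rightarrow> bool" where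
  "traceless_with_eigenvalues e A \<longleftrightarrow>
     trace A = 0 \<and> {\<mu>. \<exists>v. v \<noteq> 0 \<and> A *v v = \<mu> *s v} = {e, - e}"

text \<open>\<open>\<theta>i\<close> is the exponent at infinity.\<close>

definition PVI_exponents ::
  "complex \<Rightarrow> complex \<Rightarrow> complex \<Rightarrow> complex \<Rightarrow> complex \<Rightarrow> complex \<Rightarrow> complex \<Rightarrow> complex \<Rightarrow> bool" where
  "PVI_exponents \<alpha> \<beta> \<gamma> \<delta> \<theta>0 \<theta>x \<theta>1 \<theta>i \<longleftrightarrow>
     \<theta>0^2 = -2 * \<beta> \<and> \<theta>x^2 = 1 - 2 * \<delta> \<and> \<theta>1^2 = 2 * \<gamma> \<and> (\<theta>i - 1)^2 = 2 * \<alpha> \<and> \<theta>i \<noteq> 0"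

definition Schlesinger_system ::
  "complex \<Rightarrow> complex \<Rightarrow> complex \<Rightarrow> complex \<Rightarrow> complex set \<Rightarrow>
   (complex \<Rightarrow> cmat2) \<Rightarrow> (complex \<Rightarrow> cmat2) \<Rightarrow> (complex \<Rightarrow> cmat2) \<Rightarrow> bool" where
  "Schlesinger_system \<theta>0 \<theta>x \<theta>1 \<theta>i S A0 Ax A1 \<longleftrightarrow>
     (\<forall>i j. (\<lambda>\<xi>. A0 \<xi> $ i $ j) holomorphic_on S \<and>
            (\<lambda>\<xi>. Ax \<xi> $ i $ j) holomorphic_on S \<and>
            (\<lambda>\<xi>. A1 \<xi> $ i $ j) holomorphic_on S) \<and>
     (\<forall>\<xi>\<in>S.
        traceless_with_eigenvalues (\<theta>0 / 2) (A0 \<xi>) \<and>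
        traceless_with_eigenvalues (\<theta>x / 2) (Ax \<xi>) \<and>
        traceless_with_eigenvalues (\<theta>1 / 2) (A1 \<xi>) \<and>
        A0 \<xi> + Ax \<xi> + A1 \<xi> = diag2 (- \<theta>i / 2) (\<theta>i / 2) \<and>
        (\<forall>i j.
           deriv_x (\<lambda>\<zeta>. A0 \<zeta> $ i $ j) \<xi> = commutator (Ax \<xi>) (A0 \<xi>) $ i $ j / exp \<xi> \<and>
           deriv_x (\<lambda>\<zeta>. A1 \<zeta> $ i $ j) \<xi> = commutator (Ax \<xi>) (A1 \<xi>) $ i $ j / (exp \<xi> - 1) \<and>
           deriv_x (\<lambda>\<zeta>. Ax \<zeta> $ i $ j) \<xi> =
             commutator (A0 \<xi>) (Ax \<xi>) $ i $ j / exp \<xi> +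
             commutator (A1 \<xi>) (Ax \<xi>) $ i $ j / (exp \<xi> - 1)))"

definition associated_solution ::
  "complex set \<Rightarrow> (complex \<Rightarrow> cmat2) \<Rightarrow> (complex \<Rightarrow> cmat2) \<Rightarrow> (complex \<Rightarrow> complex) \<Rightarrow> bool" where
  "associated_solution S A0 A1 y \<longleftrightarrow>
     (\<forall>\<xi>\<in>S. let x = exp \<xi>; d = x * (A0 \<xi> $ 1 $ 2 + A1 \<xi> $ 1 $ 2) - A1 \<xi> $ 1 $ 2
            in d \<noteq> 0 \<and> y \<xi> = x * (A0 \<xi> $ 1 $ 2) / d)"

definition Fuchsian_coeff :: "cmat2 \<Rightarrow> cmat2 \<Rightarrow> cmat2 \<Rightarrow> complex \<Rightarrow> complex \<Rightarrow> cmat2" where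
  "Fuchsian_coeff B0 Bx B1 x z =
     (\<chi> i j. B0 $ i $ j / z + Bx $ i $ j / (z - x) + B1 $ i $ j / (z - 1))"

definition solves_linear_near ::
  "(complex \<Rightarrow> cmat2) \<Rightarrow> complex \<Rightarrow> (complex \<Rightarrow> cmat2) \<Rightarrow> bool" where
  "solves_linear_near A z \<Psi> \<longleftrightarrow>
     (\<forall>\<^sub>F w in nhds z. \<forall>i j.
        ((\<lambda>\<mu>. \<Psi> \<mu> $ i $ j) has_field_derivative (A w ** \<Psi> w) $ i $ j) (at w))"

text \<open>Continuation of the germ of \<open>\<Psi>\<close> along the loop \<open>g\<close>, by local solutions \<open>\<Phi> t\<close> near \<open>g t\<close>,
  turns \<open>\<Psi>\<close> into \<open>\<Psi> ** M\<close>.\<close>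

definition monodromy_along ::
  "(complex \<Rightarrow> cmat2) \<Rightarrow> (complex \<Rightarrow> cmat2) \<Rightarrow> (real \<Rightarrow> complex) \<Rightarrow> cmat2 \<Rightarrow> bool" where
  "monodromy_along A \<Psi> g M \<longleftrightarrow>
     (\<exists>\<Phi> :: real \<Rightarrow> complex \<Rightarrow> cmat2.
        (\<forall>t\<in>{0..1}. solves_linear_near A (g t) (\<Phi> t) \<and>
           (\<forall>\<^sub>F s in at t within {0..1}. \<forall>\<^sub>F w in nhds (g s). \<Phi> s w = \<Phi> t w)) \<and>
        (\<forall>\<^sub>F w in nhds (pathstart g). \<Phi> 0 w = \<Psi> w) \<and>
        (\<forall>\<^sub>F w in nhds (pathfinish g). \<Phi> 1 w = \<Psi> w ** M))"

definition ccw_loop_around :: "complex set \<Rightarrow> complex \<Rightarrow> (real \<Rightarrow> complex) \<Rightarrow> bool" where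
  "ccw_loop_around P p g \<longleftrightarrow>
     (\<exists>r>0. cball p r \<inter> P = {p} \<and> homotopic_loops (- P) g (circlepath p r))"

text \<open>The orientation of the simple loop \<open>c\<close> is forced by those of \<open>g0\<close> and \<open>gx\<close>.\<close>

definition admissible_loops :: "complex \<Rightarrow> (real \<Rightarrow> complex) \<Rightarrow> (real \<Rightarrow> complex) \<Rightarrow> bool" where
  "admissible_loops x g0 gx \<longleftrightarrow>
     pathstart g0 = pathstart gx \<and>
     ccw_loop_around {0, x, 1} 0 g0 \<and> ccw_loop_around {0, x, 1} x gx \<and>
     (\<exists>c. simple_path c \<and> pathfinish c = pathstart c \<and>
          closed_segment 0 x \<subseteq> inside (path_image c) \<and> 1 \<in> outside (path_image c) \<and>
          homotopic_loops (- {0, x, 1}) (g0 +++ gx) c)"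

text \<open>The trace does not depend on the fundamental solution \<open>\<Psi>\<close>, which may therefore be chosen for
  each \<open>x\<close> separately.\<close>

definition is_p0x :: "cmat2 \<Rightarrow> cmat2 \<Rightarrow> cmat2 \<Rightarrow> complex \<Rightarrow> complex \<Rightarrow> bool" where
  "is_p0x B0 Bx B1 x p \<longleftrightarrow>
     (\<exists>g0 gx \<Psi> M0 Mx.
        admissible_loops x g0 gx \<and>
        solves_linear_near (Fuchsian_coeff B0 Bx B1 x) (pathstart g0) \<Psi> \<and>
        det (\<Psi> (pathstart g0)) \<noteq> 0 \<and>
        monodromy_along (Fuchsian_coeff B0 Bx B1 x) \<Psi> g0 M0 \<and>
        monodromy_along (Fuchsian_coeff B0 Bx B1 x) \<Psi> gx Mx \<and>
        p = trace (M0 ** Mx))"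

end

theory Submission
  imports Defs
begin

text \<open>
  Put \<open>X = x\<^sup>\<sigma>\<close>, \<open>Y = x\<^sup>1\<^sup>-\<^sup>\<sigma>\<close> and let \<open>D\<close> be the derivation with respect to \<open>\<xi> = log x\<close>. In the variables
  \<open>g = D y / y\<close> and \<open>\<zeta>\<close>, defined by \<open>g = 1 - 2 (\<zeta> (1 - J) - \<rho>) - (1 - \<theta>\<^sub>\<infinity>) J\<close> with \<open>J = (y - x) / (1 - x)\<close> and
  \<open>\<rho> = - (\<theta>\<^sub>\<infinity> + \<theta>\<^sub>1) / 2\<close>, PVI is an equation \<open>D \<zeta> = G\<close> with \<open>G\<close> rational and without constant term in
  \<open>X\<close> and \<open>Y\<close>. As the eigenvalue \<open>\<sigma> i + (1 - \<sigma>) j\<close> of \<open>D\<close> on \<open>X\<^sup>i Y\<^sup>j\<close> vanishes only for \<open>i = j = 0\<close>,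
  it has a unique formal solution \<open>y = a Y (1 + \<dots>)\<close>, which converges because the inverse of \<open>D\<close> is bounded on
  majorants.

  A Schlesinger system with associated solution \<open>y\<close> is an explicit rational expression in \<open>x, y, \<zeta>\<close> and
  one exponential. As \<open>x \<rightarrow> 0\<close> the matrices \<open>A\<^sub>1\<close> and \<open>\<Lambda> = A\<^sub>0 + A\<^sub>x\<close> have limits, and the eigenvalues
  of the limit of \<open>\<Lambda>\<close> are \<open>\<plusminus>\<sigma>/2\<close>. Away from the segment from \<open>0\<close> to \<open>x\<close> a gauge transformation carries the
  limit system \<open>\<Lambda> / \<lambda> + A\<^sub>1 / (\<lambda> - 1)\<close> to the system at \<open>x\<close>. A loop around that segment therefore has
  the same trace for both, and for the limit system this trace is \<open>2 cos (\<pi> \<sigma>)\<close> by the power series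
  solutions at \<open>\<lambda> = 0\<close>.
\<close>

section \<open>Power series solutions at a regular singular point\<close>

text \<open>The statement asks for one branch \<open>y\<close> and one family of coefficients, but
  for all admissible exponents and for every Schlesinger system over the sector. So the series is
  built once, from fixed square roots, and afterwards \<open>\<zeta>\<close> is recovered from
  \<open>g\<close> for whatever exponents are given, since PVI sees only the squares of the three
  finite exponents and of \<theta>\<infinity> - 1. An arbitrary system with associated solution
  \<open>y\<close> is shown to be the explicit one up to the constant in the exponential, that is,
  up to conjugation by a constant diagonal matrix. The bound m <= n + 2 is invisible in the
  recursion for \<open>g\<close> and \<open>\<zeta>\<close>, which contains x / y; it comes from the
  Lax form of the equations. As x -> 0 the matrices A0 and Ax blow up separately, so traces can be
  compared only on a loop away from the segment from 0 to x. That loop is an arbitrary simple curve,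
  and contracting it in a plane with two punctures is what requires the Riemann map. Its orientation
  does not matter because the cosine is even.\<close>

lemma convolution_majorant:
  fixes a :: "nat \<Rightarrow> real"
  assumes "M \<ge> 0" "q \<ge> 0" and rec: "\<And>n. a (Suc n) \<le> M * (\<Sum>k\<le>n. q ^ k * a (n - k))"
    and "a 0 \<ge> 0"
  shows "a n \<le> a 0 * (q + M) ^ n"
proof (induction n rule: less_induct)
  case (less n)
  show ?case
  proof (cases n)
    case (Suc m)
    have "a n \<le> M * (\<Sum>k\<le>m. q ^ k * a (m - k))"
      using rec[of m] Suc by simp
    also have "\<dots> \<le> M * (\<Sum>k\<le>m. q ^ k * (a 0 * (q + M) ^ (m - k)))"
      using assms(1,2) less Suc by (intro mult_left_mono sum_mono) auto
    also have "\<dots> = a 0 * (M * (\<Sum>k\<le>m. q ^ k * (q + M) ^ (m - k)))"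
      by (simp add: sum_distrib_left mult_ac)
    \<comment> \<open>Here \<open>M\<close> is \<open>(q + M) - q\<close>, so this is the
      factorisation of a difference of powers; dropping \<open>q ^ Suc m\<close> gives the
      bound.\<close>
    also have "M * (\<Sum>k\<le>m. q ^ k * (q + M) ^ (m - k)) = (q + M) ^ Suc m - q ^ Suc m"
      using power_diff_sumr2[of q "Suc m" "q + M"]
      by (simp add: lessThan_Suc_atMost mult.commute algebra_simps)
    also have "a 0 * ((q + M) ^ Suc m - q ^ Suc m) \<le> a 0 * (q + M) ^ n"
      using assms Suc by (intro mult_left_mono) auto
    finally show ?thesis .
  qed simp
qed

lemma fps_coeff_geometric_bound:
  fixes F :: "complex fps"
  assumes "fps_conv_radius F > 0"
  obtains B q where "B \<ge> 0" "q > 0" "\<And>n. norm (fps_nth F n) \<le> B * q ^ n"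
proof -
  obtain r where r: "0 < r" "ereal r < fps_conv_radius F"
    using ereal_dense2[OF assms] by auto
  have "summable (\<lambda>n. norm (fps_nth F n * of_real r ^ n))"
    by (rule norm_summable_fps) (use r in auto)
  then have "Bseq (\<lambda>n. norm (fps_nth F n * of_real r ^ n))"
    using summable_LIMSEQ_zero convergentI convergent_imp_Bseq by blast
  then obtain B where "\<forall>n. norm (norm (fps_nth F n * of_real r ^ n)) \<le> B"
    unfolding Bseq_def by blast
  then have B: "norm (fps_nth F n) * r ^ n \<le> B" for n
    using r by (auto simp: norm_mult norm_power)
  have "norm (fps_nth F n) \<le> B * (1 / r) ^ n" for n
    using B[of n] r by (simp add: power_divide field_simps)
  moreover have "B \<ge> 0" using order_trans[OF norm_ge_zero[of "fps_nth F 0"]] B[of 0] by simp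
  ultimately show ?thesis using that[of B "1/r"] r by auto
qed

lemma fps_conv_radius_geometric:
  fixes F :: "complex fps"
  assumes "q > 0" "\<And>n. norm (fps_nth F n) \<le> B * q ^ n"
  shows "fps_conv_radius F \<ge> 1 / q"
  unfolding fps_conv_radius_def
proof (rule conv_radius_geI_ex')
  fix r :: real assume r: "0 < r" "ereal r < ereal (1 / q)"
  then have qr: "q * r < 1" using assms(1) by (simp add: field_simps)
  show "summable (\<lambda>n. fps_nth F n * of_real r ^ n)"
  proof (rule summable_comparison_test')
    show "summable (\<lambda>n. B * (q * r) ^ n)"
      using qr r assms(1) by (intro summable_mult summable_geometric) (auto simp: abs_mult)
    show "norm (fps_nth F n * of_real r ^ n) \<le> B * (q * r) ^ n" for n
      using mult_right_mono[OF assms(2)[of n], of "r ^ n"] r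
      by (simp add: norm_mult norm_power power_mult_distrib mult_ac)
  qed
qed

text \<open>Coefficients of \<open>v\<close> in the ansatz \<open>z^\<nu> v z\<close> for
  \<open>w' = (\<Lambda> / z + C) w\<close>, with \<open>c\<close> the Taylor coefficients of
  \<open>C\<close>. Comparing powers of \<open>z\<close> determines
  \<open>(n + 1 + \<nu> - \<Lambda>)\<close> applied to the coefficient \<open>n + 1\<close>;
  \<open>R (Suc n)\<close> stands for the inverse of that matrix.\<close>

fun frobenius_coeff ::
  "(nat \<Rightarrow> cmat2) \<Rightarrow> (nat \<Rightarrow> cmat2) \<Rightarrow> complex^2 \<Rightarrow> nat \<Rightarrow> complex^2" where
  "frobenius_coeff R c v0 0 = v0"
| "frobenius_coeff R c v0 (Suc n) = R (Suc n) *v (\<Sum>k\<le>n. c k *v frobenius_coeff R c v0 (n - k))"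

lemma matrix_vector_mult_sum_bound:
  fixes A :: cmat2
  assumes "\<And>i j. norm (A $ i $ j) \<le> b"
  shows "(\<Sum>i\<in>UNIV. norm ((A *v v) $ i)) \<le> 2 * b * (\<Sum>i\<in>UNIV. norm (v $ i))"
proof -
  have "norm ((A *v v) $ i) \<le> b * (\<Sum>i\<in>UNIV. norm (v $ i))" for i
  proof -
    have "norm ((A *v v) $ i) \<le> (\<Sum>j\<in>UNIV. norm (A $ i $ j * v $ j))"
      unfolding matrix_vector_mult_def by (simp add: norm_sum)
    also have "\<dots> \<le> (\<Sum>j\<in>UNIV. b * norm (v $ j))"
      by (intro sum_mono) (simp add: norm_mult mult_right_mono assms)
    finally show ?thesis by (simp add: sum_distrib_left)
  qed
  from sum_mono[of UNIV "\<lambda>i. norm ((A *v v) $ i)", OF this] show ?thesis by simp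
qed

text \<open>\<open>z^\<nu> v z\<close> solves \<open>w' = (\<Lambda> / z + C) w\<close>. The uniform
  bound on the resolvents \<open>R n\<close> says that there is no resonance and makes the
  coefficients grow at most geometrically. The equation is kept multiplied by \<open>z\<close>, so
  that it also makes sense at \<open>z = 0\<close>.\<close>

lemma frobenius_solution:
  fixes C :: "complex \<Rightarrow> cmat2" and \<Lambda> :: cmat2 and v0 :: "complex^2"
  assumes r: "r > 0" and C: "\<And>i j. (\<lambda>z. C z $ i $ j) holomorphic_on ball 0 r"
    and v0: "\<Lambda> *v v0 = \<nu> *s v0"
    and R: "\<And>n v. n \<ge> 1 \<Longrightarrow> (of_nat n + \<nu>) *s (R n *v v) - \<Lambda> *v (R n *v v) = v"
    and Rb: "\<And>n i j. n \<ge> 1 \<Longrightarrow> norm (R n $ i $ j) \<le> b"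
  obtains \<rho> v where "\<rho> > 0" "\<rho> \<le> r" "v 0 = v0"
    "\<And>z i. z \<in> ball 0 \<rho> \<Longrightarrow> \<exists>d. ((\<lambda>z. v z $ i) has_field_derivative d) (at z) \<and>
        z * d + \<nu> * v z $ i = (\<Lambda> *v v z) $ i + z * (C z *v v z) $ i"
proof -
  define Cf where "Cf = (\<lambda>i j. fps_expansion (\<lambda>z. C z $ i $ j) 0)"
  have crad: "fps_conv_radius (Cf i j) \<ge> r" for i j
    unfolding Cf_def by (rule conv_radius_fps_expansion) (use C in auto)
  have Ceval: "eval_fps (Cf i j) z = C z $ i $ j" if "z \<in> ball 0 r" for i j z
    unfolding Cf_def using eval_fps_expansion'[of "\<lambda>z. C z $ i $ j" 0 "ereal r" z] C that by auto
  have "\<exists>B q. B \<ge> 0 \<and> q > 0 \<and> (\<forall>n. norm (fps_nth (Cf i j) n) \<le> B * q ^ n)" for i j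
    using fps_coeff_geometric_bound[of "Cf i j"] crad[of i j] r
    by (metis ereal_less(2) order_less_le_trans)
  then obtain Bf qf where Bq: "\<And>i j. Bf i j \<ge> 0" "\<And>i j. qf i j > 0"
    "\<And>i j n. norm (fps_nth (Cf i j) n) \<le> Bf i j * qf i j ^ n" by metis
  define B where "B = (\<Sum>i\<in>UNIV. \<Sum>j\<in>UNIV. Bf i j)"
  define q where "q = (\<Sum>i\<in>UNIV. \<Sum>j\<in>UNIV. qf i j)"
  have BB: "Bf i j \<le> B" and qq: "qf i j \<le> q" for i j :: 2
    unfolding B_def q_def using Bq(1) less_imp_le[OF Bq(2)]
    by (auto intro!: order_trans[OF member_le_sum[of j UNIV "Bf i"]]
        order_trans[OF member_le_sum[of j UNIV "qf i"]] member_le_sum sum_nonneg)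
  have q0: "q > 0" using qq[of 1 1] Bq(2)[of 1 1] by linarith
  have B0: "B \<ge> 0" using BB[of 1 1] Bq(1)[of 1 1] by linarith
  define c :: "nat \<Rightarrow> cmat2" where "c n = (\<chi> i j. fps_nth (Cf i j) n)" for n
  have cb: "norm (c n $ i $ j) \<le> B * q ^ n" for n i j
    using Bq(3)[of i j n] mult_mono[OF BB[of i j] power_mono[OF qq[of i j], of n]] Bq(1,2)[of i j] B0
    by (simp add: c_def order_trans)
  define V where "V = frobenius_coeff R c v0"
  define a where "a n = (\<Sum>i\<in>UNIV. norm (V n $ i))" for n
  have b0: "b \<ge> 0" using Rb[of 1 1 1] norm_ge_zero order_trans by blast
  \<comment> \<open>The 4 is 2 * 2: \<open>matrix_vector_mult_sum_bound\<close> costs a factor 2 for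
    \<open>R (Suc n)\<close> and another one for the \<open>c k\<close>.\<close>
  have "a (Suc n) \<le> (4 * b * B) * (\<Sum>k\<le>n. q ^ k * a (n - k))" for n
  proof -
    let ?s = "\<Sum>k\<le>n. c k *v V (n - k)"
    have "a (Suc n) \<le> 2 * b * (\<Sum>i\<in>UNIV. norm (?s $ i))"
      unfolding a_def V_def frobenius_coeff.simps
      by (rule matrix_vector_mult_sum_bound) (use Rb in auto)
    also have "(\<Sum>i\<in>UNIV. norm (?s $ i)) \<le> (\<Sum>i\<in>UNIV. \<Sum>k\<le>n. norm ((c k *v V (n - k)) $ i))"
      by (intro sum_mono) (simp add: norm_sum)
    also have "\<dots> = (\<Sum>k\<le>n. \<Sum>i\<in>UNIV. norm ((c k *v V (n - k)) $ i))"
      by (rule sum.swap)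
    also have "\<dots> \<le> (\<Sum>k\<le>n. 2 * (B * q ^ k) * a (n - k))"
      unfolding a_def by (intro sum_mono matrix_vector_mult_sum_bound cb)
    also have "\<dots> = 2 * B * (\<Sum>k\<le>n. q ^ k * a (n - k))"
      by (simp add: sum_distrib_left mult_ac)
    finally show ?thesis using b0 by (simp add: mult_left_mono mult_right_mono mult_ac)
  qed
  then have abound: "a n \<le> a 0 * (q + 4 * b * B) ^ n" for n
    using convolution_majorant[of "4 * b * B" q a n] b0 B0 q0
    by (simp add: a_def sum_nonneg)
  define q' where "q' = q + 4 * b * B"
  have q'0: "q' > 0" unfolding q'_def using q0 b0 B0 by (simp add: add_pos_nonneg)
  define F where "F i = Abs_fps (\<lambda>n. V n $ i)" for i
  have Frad: "fps_conv_radius (F i) \<ge> 1 / q'" for i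
  proof (rule fps_conv_radius_geometric[OF q'0])
    show "norm (fps_nth (F i) n) \<le> a 0 * q' ^ n" for n
      using abound[of n] member_le_sum[of i UNIV "\<lambda>i. norm (V n $ i)"]
      by (simp add: F_def a_def q'_def)
  qed
  define \<rho> where "\<rho> = min r (1 / q')"
  have \<rho>: "\<rho> > 0" "\<rho> \<le> r" using r q'0 by (auto simp: \<rho>_def)
  define v :: "complex \<Rightarrow> complex^2" where "v z = (\<chi> i. eval_fps (F i) z)" for z
  \<comment> \<open>The differential equation as an identity of formal power series: the coefficient
    0 is the eigenvector condition on \<open>v0\<close>, the coefficient \<open>Suc m\<close> is the
    recursion undone by \<open>R\<close>.\<close>
  have feq: "fps_X * fps_deriv (F i) + fps_const \<nu> * F i =
     (\<Sum>j\<in>UNIV. fps_const (\<Lambda> $ i $ j) * F j) + fps_X * (\<Sum>j\<in>UNIV. Cf i j * F j)" for i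
  proof (rule fps_ext)
    fix n
    show "fps_nth (fps_X * fps_deriv (F i) + fps_const \<nu> * F i) n =
      fps_nth ((\<Sum>j\<in>UNIV. fps_const (\<Lambda> $ i $ j) * F j) + fps_X * (\<Sum>j\<in>UNIV. Cf i j * F j)) n"
    proof (cases n)
      case 0
      have "(\<Lambda> *v v0) $ i = \<nu> * v0 $ i" using v0 by simp
      then show ?thesis using 0
        by (simp add: F_def V_def fps_sum_nth matrix_vector_mult_def)
    next
      case (Suc m)
      let ?s = "\<Sum>k\<le>m. c k *v V (m - k)"
      have "(of_nat (Suc m) + \<nu>) *s V (Suc m) - \<Lambda> *v V (Suc m) = ?s"
        unfolding V_def frobenius_coeff.simps by (rule R) simp
      then have "(of_nat (Suc m) + \<nu>) * V (Suc m) $ i - (\<Lambda> *v V (Suc m)) $ i = ?s $ i"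
        by (metis vector_minus_component vector_smult_component)
      also have "?s $ i = (\<Sum>j\<in>UNIV. \<Sum>k\<le>m. fps_nth (Cf i j) k * V (m - k) $ j)"
        by (subst sum.swap) (simp add: matrix_vector_mult_def c_def)
      finally have 1: "(of_nat (Suc m) + \<nu>) * V (Suc m) $ i - (\<Lambda> *v V (Suc m)) $ i =
          (\<Sum>j\<in>UNIV. \<Sum>k\<le>m. fps_nth (Cf i j) k * V (m - k) $ j)" .
      have 2: "fps_nth (Cf i j * F j) m = (\<Sum>k\<le>m. fps_nth (Cf i j) k * V (m - k) $ j)" for j
        by (simp add: fps_mult_nth atLeast0AtMost F_def)
      have 3: "fps_nth (fps_X * fps_deriv (F i) + fps_const \<nu> * F i) (Suc m) = (of_nat (Suc m) + \<nu>) * V (Suc m) $ i"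
        by (simp add: F_def algebra_simps del: of_nat_Suc)
      have 4: "fps_nth ((\<Sum>j\<in>UNIV. fps_const (\<Lambda> $ i $ j) * F j) + fps_X * (\<Sum>j\<in>UNIV. Cf i j * F j)) (Suc m) =
          (\<Lambda> *v V (Suc m)) $ i + (\<Sum>j\<in>UNIV. fps_nth (Cf i j * F j) m)"
        by (simp add: fps_sum_nth matrix_vector_mult_def F_def)
      show ?thesis using 1 unfolding Suc 3 4 2 by (simp add: algebra_simps)
    qed
  qed
  have main: "\<exists>d. ((\<lambda>z. v z $ i) has_field_derivative d) (at z) \<and>
        z * d + \<nu> * v z $ i = (\<Lambda> *v v z) $ i + z * (C z *v v z) $ i" if z: "z \<in> ball 0 \<rho>" for z i
  proof (intro exI conjI)
    have zr: "ereal (norm z) < fps_conv_radius (F j)" "ereal (norm z) < fps_conv_radius (Cf k j)" for k j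
      using z Frad[of j] crad[of k j] unfolding \<rho>_def
      by (auto intro: less_le_trans[of _ "ereal (1/q')"] less_le_trans[of _ "ereal r"])
    have zrp: "ereal (norm z) < fps_conv_radius (fps_const u * F j)" for u j
      using zr(1)[of j] fps_conv_radius_mult[of "fps_const u" "F j"] by (auto intro: less_le_trans)
    have zrq: "ereal (norm z) < fps_conv_radius (Cf i j * F j)" for j
      using zr(1)[of j] zr(2)[of i j] fps_conv_radius_mult[of "Cf i j" "F j"]
      by (metis less_le_trans min_less_iff_conj)
    have zd: "ereal (norm z) < fps_conv_radius (fps_deriv (F j))" for j
      using zr(1)[of j] fps_conv_radius_deriv[of "F j"] by (auto intro: less_le_trans)
    have zX: "ereal (norm z) < fps_conv_radius (fps_X * f)" if "ereal (norm z) < fps_conv_radius f" for f :: "complex fps"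
      using that fps_conv_radius_mult[of fps_X f] by (auto intro: less_le_trans)
    have zA: "ereal (norm z) < fps_conv_radius (f + g)"
      if "ereal (norm z) < fps_conv_radius f" "ereal (norm z) < fps_conv_radius g" for f g :: "complex fps"
      using that fps_conv_radius_add[of f g] by (metis less_le_trans min_less_iff_conj)
    show "((\<lambda>z. v z $ i) has_field_derivative eval_fps (fps_deriv (F i)) z) (at z)"
      unfolding v_def using has_field_derivative_eval_fps[of z "F i" UNIV] zr(1)[of i]
      by (simp add: eval_fps_deriv)
    have "eval_fps (fps_X * fps_deriv (F i) + fps_const \<nu> * F i) z =
      z * eval_fps (fps_deriv (F i)) z + \<nu> * v z $ i"
      by (simp add: eval_fps_add eval_fps_mult zr zX zrp zd v_def)
    moreover have "eval_fps ((\<Sum>j\<in>UNIV. fps_const (\<Lambda> $ i $ j) * F j) + fps_X * (\<Sum>j\<in>UNIV. Cf i j * F j)) z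
       = (\<Lambda> *v v z) $ i + z * (C z *v v z) $ i"
      using z \<rho> by (simp add: sum_2 eval_fps_add eval_fps_mult zr zX zrp zrq zd v_def zA matrix_vector_mult_def Ceval)
    ultimately show "z * eval_fps (fps_deriv (F i)) z + \<nu> * v z $ i = (\<Lambda> *v v z) $ i + z * (C z *v v z) $ i"
      using feq[of i] by simp
  qed
  have "v 0 = v0" by (simp add: v_def eval_fps_at_0 F_def V_def vec_eq_iff)
  then show ?thesis using that[of \<rho> v] \<rho> main by blast
qed

section \<open>Analytic continuation of linear systems\<close>

definition solves_on :: "(complex \<Rightarrow> cmat2) \<Rightarrow> complex set \<Rightarrow> (complex \<Rightarrow> cmat2) \<Rightarrow> bool" where
  "solves_on A S \<Phi> \<longleftrightarrow>
     (\<forall>w\<in>S. \<forall>i j. ((\<lambda>\<mu>. \<Phi> \<mu> $ i $ j) has_field_derivative (A w ** \<Phi> w) $ i $ j) (at w))"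

definition germ_eq :: "complex \<Rightarrow> (complex \<Rightarrow> cmat2) \<Rightarrow> (complex \<Rightarrow> cmat2) \<Rightarrow> bool" where
  "germ_eq z \<Phi> \<Psi> \<longleftrightarrow> (\<forall>\<^sub>F w in nhds z. \<Phi> w = \<Psi> w)"

text \<open>The continuation condition of \<open>monodromy_along\<close> on an arbitrary parameter
  interval, so that continuations can be cut and joined.\<close>

definition continues_along ::
  "(complex \<Rightarrow> cmat2) \<Rightarrow> (real \<Rightarrow> complex) \<Rightarrow> real \<Rightarrow> real \<Rightarrow> (real \<Rightarrow> complex \<Rightarrow> cmat2) \<Rightarrow> bool" where
  "continues_along A g a b \<Phi> \<longleftrightarrow>
     (\<forall>t\<in>{a..b}. solves_linear_near A (g t) (\<Phi> t) \<and>
        (\<forall>\<^sub>F s in at t within {a..b}. germ_eq (g s) (\<Phi> s) (\<Phi> t)))"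

lemma solves_near_iff: "solves_linear_near A z \<Phi> \<longleftrightarrow> (\<exists>r>0. solves_on A (ball z r) \<Phi>)"
  unfolding solves_linear_near_def solves_on_def eventually_nhds_metric
  by (auto simp: dist_commute)

lemma solves_on_subset: "solves_on A S \<Phi> \<Longrightarrow> T \<subseteq> S \<Longrightarrow> solves_on A T \<Phi>"
  by (auto simp: solves_on_def)

lemma solves_on_imp_near:
  assumes "solves_on A S \<Phi>" "open S" "z \<in> S"
  shows "solves_linear_near A z \<Phi>"
  using assms solves_near_iff solves_on_subset open_contains_ball by metis

lemma solves_on_holomorphic:
  assumes "solves_on A S \<Phi>"
  shows "(\<lambda>w. \<Phi> w $ i $ j) holomorphic_on S"
  using assms unfolding solves_on_def holomorphic_on_def field_differentiable_def
  by (metis has_field_derivative_at_within)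

lemma germ_eq_refl [simp]: "germ_eq z \<Phi> \<Phi>"
  and germ_eq_sym: "germ_eq z \<Phi> \<Psi> \<Longrightarrow> germ_eq z \<Psi> \<Phi>"
  by (auto simp: germ_eq_def elim: eventually_mono)

lemma germ_eq_trans: "germ_eq z \<Phi> \<Psi> \<Longrightarrow> germ_eq z \<Psi> \<Xi> \<Longrightarrow> germ_eq z \<Phi> \<Xi>"
  unfolding germ_eq_def by (auto elim: eventually_elim2)

lemma germ_eqI_ball: "r > 0 \<Longrightarrow> (\<And>w. w \<in> ball z r \<Longrightarrow> \<Phi> w = \<Psi> w) \<Longrightarrow> germ_eq z \<Phi> \<Psi>"
  unfolding germ_eq_def eventually_nhds_metric by (auto simp: dist_commute)

lemma germ_eq_ballE:
  assumes "germ_eq z \<Phi> \<Psi>"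
  obtains r where "r > 0" "\<And>w. w \<in> ball z r \<Longrightarrow> \<Phi> w = \<Psi> w"
  using assms unfolding germ_eq_def eventually_nhds_metric by (auto simp: dist_commute)

text \<open>Identity theorem on the ball: equality of germs does not depend on the point
  \<open>w\<close>. This makes it a locally constant property along a path.\<close>

lemma germ_eq_ball_iff:
  assumes "solves_on A (ball z r) \<Phi>" "solves_on A (ball z r) \<Psi>" "w \<in> ball z r"
  shows "germ_eq w \<Phi> \<Psi> \<longleftrightarrow> (\<forall>u\<in>ball z r. \<Phi> u = \<Psi> u)"
proof
  assume "germ_eq w \<Phi> \<Psi>"
  then obtain e where e: "e > 0" "\<And>u. u \<in> ball w e \<Longrightarrow> \<Phi> u = \<Psi> u"
    by (rule germ_eq_ballE) auto
  have "\<Phi> u $ i $ j = \<Psi> u $ i $ j" if u: "u \<in> ball z r" for u i j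
  proof (rule analytic_continuation_open[of "ball w e \<inter> ball z r" "ball z r"
        "\<lambda>w. \<Phi> w $ i $ j" "\<lambda>w. \<Psi> w $ i $ j"])
    show "ball w e \<inter> ball z r \<noteq> {}" using assms(3) e(1) centre_in_ball by blast
    show "(\<lambda>w. \<Phi> w $ i $ j) holomorphic_on ball z r" "(\<lambda>w. \<Psi> w $ i $ j) holomorphic_on ball z r"
      using assms(1,2) solves_on_holomorphic by auto
  qed (use e u in auto)
  then show "\<forall>u\<in>ball z r. \<Phi> u = \<Psi> u" by (simp add: vec_eq_iff)
next
  assume R: "\<forall>u\<in>ball z r. \<Phi> u = \<Psi> u"
  obtain e where "e > 0" "ball w e \<subseteq> ball z r"
    using assms(3) open_contains_ball open_ball by metis
  then show "germ_eq w \<Phi> \<Psi>" using R by (intro germ_eqI_ball[of e]) auto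
qed

lemma matrix_mult_right_component:
  fixes X C :: cmat2 shows "(X ** C) $ i $ j = X $ i $ 1 * C $ 1 $ j + X $ i $ 2 * C $ 2 $ j"
  by (simp add: matrix_matrix_mult_def sum_2)

lemma solves_near_mult:
  assumes "solves_linear_near A z \<Phi>"
  shows "solves_linear_near A z (\<lambda>w. \<Phi> w ** C)"
proof -
  obtain r where r: "r > 0" "solves_on A (ball z r) \<Phi>" using assms solves_near_iff by blast
  have "solves_on A (ball z r) (\<lambda>w. \<Phi> w ** C)"
    unfolding solves_on_def
  proof (intro ballI allI)
    fix w i j assume "w \<in> ball z r"
    then have d: "((\<lambda>\<mu>. \<Phi> \<mu> $ i $ k) has_field_derivative (A w ** \<Phi> w) $ i $ k) (at w)" for k
      using r(2) by (auto simp: solves_on_def)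
    show "((\<lambda>\<mu>. (\<Phi> \<mu> ** C) $ i $ j) has_field_derivative (A w ** (\<Phi> w ** C)) $ i $ j) (at w)"
      unfolding matrix_mul_assoc matrix_mult_right_component[of _ C]
      by (intro DERIV_add DERIV_cmult_right d)
  qed
  then show ?thesis using r solves_near_iff by blast
qed

lemma germ_eq_mult: "germ_eq z \<Phi> \<Psi> \<Longrightarrow> germ_eq z (\<lambda>w. \<Phi> w ** C) (\<lambda>w. \<Psi> w ** C)"
  by (auto simp: germ_eq_def elim: eventually_mono)

lemma continues_along_mult:
  assumes "continues_along A g a b \<Phi>"
  shows "continues_along A g a b (\<lambda>t w. \<Phi> t w ** C)"
  using assms unfolding continues_along_def
  by (auto intro: solves_near_mult elim!: eventually_mono simp: germ_eq_mult)

lemma continues_along_local: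
  assumes "continues_along A g a b \<Phi>" "continuous_on {a..b} g" "t \<in> {a..b}"
  obtains r d where "r > 0" "d > 0" "solves_on A (ball (g t) r) (\<Phi> t)"
    "\<And>s. s \<in> {a..b} \<Longrightarrow> \<bar>s - t\<bar> < d \<Longrightarrow> g s \<in> ball (g t) r \<and> germ_eq (g s) (\<Phi> s) (\<Phi> t)"
proof -
  obtain r where r: "r > 0" "solves_on A (ball (g t) r) (\<Phi> t)"
    using assms(1,3) unfolding continues_along_def solves_near_iff by blast
  have "\<forall>\<^sub>F s in at t within {a..b}. germ_eq (g s) (\<Phi> s) (\<Phi> t)"
    using assms(1,3) by (auto simp: continues_along_def)
  then obtain d1 where d1: "d1 > 0"
    "\<And>s. s \<in> {a..b} \<Longrightarrow> s \<noteq> t \<Longrightarrow> dist s t < d1 \<Longrightarrow> germ_eq (g s) (\<Phi> s) (\<Phi> t)"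
    unfolding eventually_at by auto
  obtain d2 where d2: "d2 > 0" "\<And>s. s \<in> {a..b} \<Longrightarrow> dist s t < d2 \<Longrightarrow> dist (g s) (g t) < r"
    using assms(2,3) r(1) unfolding continuous_on_iff by metis
  show ?thesis
  proof (rule that[OF r(1) _ r(2), of "min d1 d2"])
    fix s assume "s \<in> {a..b}" "\<bar>s - t\<bar> < min d1 d2"
    then show "g s \<in> ball (g t) r \<and> germ_eq (g s) (\<Phi> s) (\<Phi> t)"
      using d1(2)[of s] d2(2)[of s] by (cases "s = t") (auto simp: dist_real_def dist_commute)
  qed (use d1 d2 in auto)
qed

text \<open>Near each parameter both families are represented by two fixed solutions on a common
  ball, where agreement is all or nothing; connectedness of the interval does the rest.\<close>

lemma continues_along_unique:
  assumes \<Phi>: "continues_along A g a b \<Phi>" and \<Psi>: "continues_along A g a b \<Psi>"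
    and g: "continuous_on {a..b} g" and eq: "germ_eq (g a) (\<Phi> a) (\<Psi> a)" and t: "t \<in> {a..b}"
  shows "germ_eq (g t) (\<Phi> t) (\<Psi> t)"
proof (rule connected_induction_simple[of "{a..b}" a t "\<lambda>t. germ_eq (g t) (\<Phi> t) (\<Psi> t)"])
  fix t assume t: "t \<in> {a..b}"
  obtain r1 d1 where 1: "r1 > 0" "d1 > 0" "solves_on A (ball (g t) r1) (\<Phi> t)"
    "\<And>s. s \<in> {a..b} \<Longrightarrow> \<bar>s - t\<bar> < d1 \<Longrightarrow> g s \<in> ball (g t) r1 \<and> germ_eq (g s) (\<Phi> s) (\<Phi> t)"
    using continues_along_local[OF \<Phi> g t] by metis
  obtain r2 d2 where 2: "r2 > 0" "d2 > 0" "solves_on A (ball (g t) r2) (\<Psi> t)"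
    "\<And>s. s \<in> {a..b} \<Longrightarrow> \<bar>s - t\<bar> < d2 \<Longrightarrow> g s \<in> ball (g t) r2 \<and> germ_eq (g s) (\<Psi> s) (\<Psi> t)"
    using continues_along_local[OF \<Psi> g t] by metis
  let ?B = "ball (g t) (min r1 r2)"
  have B: "solves_on A ?B (\<Phi> t)" "solves_on A ?B (\<Psi> t)"
    using 1(3) 2(3) by (auto intro: solves_on_subset)
  let ?T = "{a..b} \<inter> ball t (min d1 d2)"
  have key: "germ_eq (g s) (\<Phi> s) (\<Psi> s) \<longleftrightarrow> (\<forall>u\<in>?B. \<Phi> t u = \<Psi> t u)" if s: "s \<in> ?T" for s
  proof -
    have s': "s \<in> {a..b}" "\<bar>s - t\<bar> < d1" "\<bar>s - t\<bar> < d2"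
      using s by (auto simp: dist_real_def)
    have "g s \<in> ?B" using 1(4)[OF s'(1,2)] 2(4)[OF s'(1,3)] by auto
    from germ_eq_ball_iff[OF B this] show ?thesis
      using 1(4)[OF s'(1,2)] 2(4)[OF s'(1,3)] germ_eq_trans germ_eq_sym by metis
  qed
  show "\<exists>T. openin (top_of_set {a..b}) T \<and> t \<in> T \<and>
      (\<forall>x\<in>T. \<forall>y\<in>T. germ_eq (g x) (\<Phi> x) (\<Psi> x) \<longrightarrow> germ_eq (g y) (\<Phi> y) (\<Psi> y))"
    using 1(2) 2(2) t key by (intro exI[of _ ?T]) (auto simp: openin_open)
qed (use eq t in auto)

lemma continues_along_join:
  assumes \<Phi>: "continues_along A g a b \<Phi>" and \<Psi>: "continues_along A g b c \<Psi>"
    and g: "continuous_on {a..c} g" and eq: "germ_eq (g b) (\<Phi> b) (\<Psi> b)" and ab: "a \<le> b" "b \<le> c"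
  shows "continues_along A g a c (\<lambda>t. if t \<le> b then \<Phi> t else \<Psi> t)"
  unfolding continues_along_def
proof (intro ballI conjI)
  fix t assume t: "t \<in> {a..c}"
  let ?X = "\<lambda>t. if t \<le> b then \<Phi> t else \<Psi> t"
  show "solves_linear_near A (g t) (?X t)"
    using \<Phi> \<Psi> t by (auto simp: continues_along_def)
  have g1: "continuous_on {a..b} g" "continuous_on {b..c} g"
    using g ab by (auto elim: continuous_on_subset)
  have "\<exists>d>0. \<forall>s\<in>{a..c}. \<bar>s - t\<bar> < d \<longrightarrow> germ_eq (g s) (?X s) (?X t)"
  proof (cases t b rule: linorder_cases)
    case less
    then obtain r d where "d > 0" "\<And>s. s \<in> {a..b} \<Longrightarrow> \<bar>s - t\<bar> < d \<Longrightarrow> germ_eq (g s) (\<Phi> s) (\<Phi> t)"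
      using continues_along_local[OF \<Phi> g1(1), of t] t by (metis atLeastAtMost_iff less_imp_le)
    then show ?thesis using less by (intro exI[of _ "min d (b - t)"]) auto
  next
    case greater
    then obtain r d where "d > 0" "\<And>s. s \<in> {b..c} \<Longrightarrow> \<bar>s - t\<bar> < d \<Longrightarrow> germ_eq (g s) (\<Psi> s) (\<Psi> t)"
      using continues_along_local[OF \<Psi> g1(2), of t] t by (metis atLeastAtMost_iff less_imp_le)
    then show ?thesis using greater by (intro exI[of _ "min d (t - b)"]) auto
  next
    case equal
    obtain r1 d1 where 1: "r1 > 0" "d1 > 0" "solves_on A (ball (g t) r1) (\<Phi> t)"
      "\<And>s. s \<in> {a..b} \<Longrightarrow> \<bar>s - t\<bar> < d1 \<Longrightarrow> g s \<in> ball (g t) r1 \<and> germ_eq (g s) (\<Phi> s) (\<Phi> t)"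
      using continues_along_local[OF \<Phi> g1(1), of t] equal ab by (metis atLeastAtMost_iff order_refl)
    obtain r2 d2 where 2: "r2 > 0" "d2 > 0" "solves_on A (ball (g t) r2) (\<Psi> t)"
      "\<And>s. s \<in> {b..c} \<Longrightarrow> \<bar>s - t\<bar> < d2 \<Longrightarrow> g s \<in> ball (g t) r2 \<and> germ_eq (g s) (\<Psi> s) (\<Psi> t)"
      using continues_along_local[OF \<Psi> g1(2), of t] equal ab by (metis atLeastAtMost_iff order_refl)
    \<comment> \<open>For \<open>s > b\<close> the germ of \<open>\<Psi> s\<close> must be compared
      with \<open>\<Phi> b\<close>, which agrees with \<open>\<Psi> b\<close> only near
      \<open>g b\<close>; \<open>d3\<close> keeps \<open>g s\<close> inside that
      neighbourhood.\<close>
    obtain e where e: "e > 0" "\<And>w. w \<in> ball (g b) e \<Longrightarrow> \<Phi> b w = \<Psi> b w"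
      using eq by (rule germ_eq_ballE) auto
    obtain d3 where d3: "d3 > 0" "\<And>s. s \<in> {a..c} \<Longrightarrow> dist s t < d3 \<Longrightarrow> dist (g s) (g t) < e"
      using g t e(1) unfolding continuous_on_iff by metis
    have "germ_eq (g s) (?X s) (?X t)" if s: "s \<in> {a..c}" "\<bar>s - t\<bar> < min d1 (min d2 d3)" for s
    proof (cases "s \<le> b")
      case True
      then show ?thesis using 1(4)[of s] s equal by auto
    next
      case False
      have gs: "g s \<in> ball (g b) e" using d3(2)[of s] s equal by (auto simp: dist_commute dist_real_def)
      then obtain e' where "e' > 0" "ball (g s) e' \<subseteq> ball (g b) e"
        using open_contains_ball open_ball by metis
      then have "germ_eq (g s) (\<Phi> b) (\<Psi> b)" using e(2) by (intro germ_eqI_ball[of e']) auto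
      moreover have "germ_eq (g s) (\<Psi> s) (\<Psi> b)" using 2(4)[of s] s False equal by auto
      ultimately have "germ_eq (g s) (\<Psi> s) (\<Phi> b)" using germ_eq_trans germ_eq_sym by blast
      then show ?thesis using False equal by simp
    qed
    then show ?thesis using 1(2) 2(2) d3(1) by (intro exI[of _ "min d1 (min d2 d3)"]) auto
  qed
  then show "\<forall>\<^sub>F s in at t within {a..c}. germ_eq (g s) (?X s) (?X t)"
    unfolding eventually_at dist_real_def by blast
qed

lemma det_2x2: "det (X :: cmat2) = X $ 1 $ 1 * X $ 2 $ 2 - X $ 1 $ 2 * X $ 2 $ 1"
  by (rule det_2)

text \<open>\<open>c1\<close> and \<open>c2\<close> are the rows of the inverse of
  \<open>\<Psi>\<close> times \<open>\<Phi>\<close>, written by Cramer's rule; their derivatives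
  vanish because both matrices solve the same linear system.\<close>

lemma solution_ratio:
  assumes \<Phi>: "solves_on A (ball z r) \<Phi>" and \<Psi>: "solves_on A (ball z r) \<Psi>"
    and nz: "\<And>w. w \<in> ball z r \<Longrightarrow> det (\<Psi> w) \<noteq> 0"
  obtains C where "\<And>w. w \<in> ball z r \<Longrightarrow> \<Phi> w = \<Psi> w ** C"
proof (cases "r > 0")
  case False
  then have "ball z r = {}" by (simp add: ball_empty)
  then show ?thesis using that[of 0] by (metis empty_iff)
next
  case True
  define c1 where "c1 j w = (\<Phi> w $ 1 $ j * \<Psi> w $ 2 $ 2 - \<Psi> w $ 1 $ 2 * \<Phi> w $ 2 $ j) / det (\<Psi> w)" for j w
  define c2 where "c2 j w = (\<Psi> w $ 1 $ 1 * \<Phi> w $ 2 $ j - \<Phi> w $ 1 $ j * \<Psi> w $ 2 $ 1) / det (\<Psi> w)" for j w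
  have d\<Phi>: "((\<lambda>\<mu>. \<Phi> \<mu> $ i $ j) has_field_derivative A w $ i $ 1 * \<Phi> w $ 1 $ j + A w $ i $ 2 * \<Phi> w $ 2 $ j) (at w)"
    and d\<Psi>: "((\<lambda>\<mu>. \<Psi> \<mu> $ i $ j) has_field_derivative A w $ i $ 1 * \<Psi> w $ 1 $ j + A w $ i $ 2 * \<Psi> w $ 2 $ j) (at w)"
    if "w \<in> ball z r" for w i j
    using \<Phi> \<Psi> that unfolding solves_on_def matrix_mult_right_component by auto
  have z: "(c1 j has_field_derivative 0) (at w)" "(c2 j has_field_derivative 0) (at w)"
    if w: "w \<in> ball z r" for w j
    using nz[OF w] unfolding c1_def[abs_def] c2_def[abs_def] det_2x2
    by (auto intro!: derivative_eq_intros d\<Phi>[OF w] d\<Psi>[OF w] simp: field_simps)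
  have const0: "f w = f z" if "\<And>w. w \<in> ball z r \<Longrightarrow> (f has_field_derivative 0) (at w)" "w \<in> ball z r"
    for f :: "complex \<Rightarrow> complex" and w
    using has_field_derivative_zero_constant[of "ball z r" f] that True
    by (metis centre_in_ball convex_ball has_field_derivative_at_within)
  have const: "c1 j w = c1 j z" "c2 j w = c2 j z" if w: "w \<in> ball z r" for w j
    using const0[OF z(1) w] const0[OF z(2) w] by auto
  show ?thesis
  proof (rule that[of "\<chi> i j. if i = 1 then c1 j z else c2 j z"])
    fix w assume w: "w \<in> ball z r"
    have "\<Phi> w $ i $ j = \<Psi> w $ i $ 1 * c1 j w + \<Psi> w $ i $ 2 * c2 j w" for i j
      using nz[OF w] exhaust_2[of i] unfolding c1_def c2_def det_2x2
      by (auto simp: divide_simps) (simp_all add: algebra_simps)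
    then show "\<Phi> w = \<Psi> w ** (\<chi> i j. if i = 1 then c1 j z else c2 j z)"
      using const[OF w] by (simp add: vec_eq_iff matrix_mult_right_component)
  qed
qed

lemma solves_on_isCont_det:
  assumes "solves_on A S \<Phi>" "z \<in> S"
  shows "isCont (\<lambda>w. det (\<Phi> w)) z"
proof -
  have "isCont (\<lambda>w. \<Phi> w $ i $ j) z" for i j
    using assms DERIV_isCont unfolding solves_on_def by blast
  then show ?thesis unfolding det_2x2 by (intro isCont_diff isCont_mult)
qed

lemma germ_ratio:
  assumes \<Phi>: "solves_linear_near A z \<Phi>" and \<Psi>: "solves_linear_near A z \<Psi>" and nz: "det (\<Psi> z) \<noteq> 0"
  obtains C where "germ_eq z \<Phi> (\<lambda>w. \<Psi> w ** C)"
proof -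
  obtain r1 r2 where r: "r1 > 0" "solves_on A (ball z r1) \<Phi>" "r2 > 0" "solves_on A (ball z r2) \<Psi>"
    using \<Phi> \<Psi> solves_near_iff by blast
  have "isCont (\<lambda>w. det (\<Psi> w)) z"
    using solves_on_isCont_det r by (metis centre_in_ball)
  then obtain r3 where r3: "r3 > 0" "\<And>w. dist z w < r3 \<Longrightarrow> det (\<Psi> w) \<noteq> 0"
    using continuous_at_avoid[of z "\<lambda>w. det (\<Psi> w)" 0] nz by auto
  define r where "r = min r1 (min r2 r3)"
  obtain C where "\<And>w. w \<in> ball z r \<Longrightarrow> \<Phi> w = \<Psi> w ** C"
    by (rule solution_ratio[of A z r \<Phi> \<Psi>])
      (use r r3 in \<open>auto simp: r_def intro: solves_on_subset\<close>)
  then show ?thesis using that germ_eqI_ball[of r] r r3 by (metis r_def min_less_iff_conj)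
qed

text \<open>An ordinary point is treated as a regular singular point with
  \<open>\<Lambda> = 0\<close> and \<open>\<nu> = 0\<close>. The Frobenius equation then carries a
  factor \<open>u\<close> and is void at \<open>u = 0\<close>, where the differential equation is
  recovered by the identity theorem. The two columns start from the unit vectors.\<close>

lemma holomorphic_linear_local_fundamental:
  assumes A: "\<And>i j. (\<lambda>z. A z $ i $ j) holomorphic_on \<Omega>" and "open \<Omega>" "z \<in> \<Omega>"
  obtains r \<Phi> where "r > 0" "solves_on A (ball z r) \<Phi>" "\<And>w. w \<in> ball z r \<Longrightarrow> det (\<Phi> w) \<noteq> 0"
proof -
  obtain r where r: "r > 0" "ball z r \<subseteq> \<Omega>" using assms(2,3) open_contains_ball by metis
  have hol: "(\<lambda>u. A (z + u) $ i $ j) holomorphic_on ball 0 r" for i j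
  proof -
    have "((\<lambda>w. A w $ i $ j) \<circ> (\<lambda>u. z + u)) holomorphic_on ball 0 r"
      by (rule holomorphic_on_compose_gen[OF _ A]) (use r in \<open>auto intro!: holomorphic_intros simp: subset_eq dist_norm\<close>)
    then show ?thesis by (simp add: o_def)
  qed
  define R :: "nat \<Rightarrow> cmat2" where "R n = (\<chi> i j. if i = j then 1 / of_nat n else 0)" for n
  have RR: "(R n *v v) $ i = v $ i / of_nat n" for n v i
    using exhaust_2[of i] by (auto simp: matrix_vector_mult_def R_def sum_2)
  define PP where "PP v0 \<rho> v \<longleftrightarrow> \<rho> > 0 \<and> \<rho> \<le> r \<and> v 0 = (v0 :: complex^2) \<and> (\<forall>u\<in>ball 0 \<rho>. \<forall>i. \<exists>d.
     ((\<lambda>u. v u $ i) has_field_derivative d) (at u) \<and> u * d + 0 * v u $ i = (0 *v v u) $ i + u * (A (z + u) *v v u) $ i)"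
    for v0 \<rho> v
  have "\<exists>\<rho> v. PP v0 \<rho> v" for v0
  proof -
    have 1: "0 *v v0 = 0 *s v0" by simp
    have 2: "(of_nat n + 0) *s (R n *v v) - 0 *v (R n *v v) = v" if "n \<ge> 1" for n v
      using that by (simp add: vec_eq_iff RR)
    have 3: "norm (R n $ i $ j) \<le> 1" if "n \<ge> 1" for n i j
      using that by (auto simp: R_def norm_divide)
    obtain \<rho> v where "\<rho> > 0" "\<rho> \<le> r" "v 0 = v0"
      "\<And>u i. u \<in> ball 0 \<rho> \<Longrightarrow> \<exists>d. ((\<lambda>u. v u $ i) has_field_derivative d) (at u) \<and>
        u * d + 0 * v u $ i = (0 *v v u) $ i + u * (A (z + u) *v v u) $ i"
      using frobenius_solution[OF r(1) hol 1 2 3] by blast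
    then have "PP v0 \<rho> v" unfolding PP_def by blast
    then show ?thesis by blast
  qed
  then obtain \<rho> v where "\<And>v0. PP v0 (\<rho> v0) (v v0)" by metis
  then have v: "\<rho> v0 > 0" "\<rho> v0 \<le> r" "v v0 0 = (v0 :: complex^2)"
    "u \<in> ball 0 (\<rho> v0) \<Longrightarrow> \<exists>d. ((\<lambda>u. v v0 u $ i) has_field_derivative d) (at u) \<and>
       u * d = u * (A (z + u) *v v v0 u) $ i" for v0 u i
    unfolding PP_def by (auto simp del: mult_cancel_left mem_ball)
  define e :: "2 \<Rightarrow> complex^2" where "e k = (\<chi> i. if i = k then 1 else 0)" for k
  define s where "s = min (\<rho> (e 1)) (\<rho> (e 2))"
  have s0: "s > 0" using v(1) by (simp add: s_def)
  have d: "((\<lambda>u. v (e k) u $ i) has_field_derivative (A (z + u) *v v (e k) u) $ i) (at u)"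
    if u: "u \<in> ball 0 s" for u i k
  proof -
    have sk: "s \<le> \<rho> (e k)" using exhaust_2[of k] by (auto simp: s_def)
    have *: "((\<lambda>u. v (e k) u $ i) has_field_derivative (A (z + u) *v v (e k) u) $ i) (at u)"
      if "u \<in> ball 0 s" "u \<noteq> 0" for u i
      using v(4)[of u "e k" i] that sk by auto
    have hv: "(\<lambda>u. v (e k) u $ i) holomorphic_on ball 0 s" for i
      unfolding holomorphic_on_open[OF open_ball] using v(4)[of _ "e k" i] sk by (meson less_le_trans mem_ball)
    have "deriv (\<lambda>u. v (e k) u $ i) u = (A (z + u) *v v (e k) u) $ i"
    proof (rule analytic_continuation_open[of "ball 0 s - {0}" "ball 0 s" "deriv (\<lambda>u. v (e k) u $ i)"
            "\<lambda>u. (A (z + u) *v v (e k) u) $ i"])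
      show "ball 0 s - {0} \<noteq> ({} :: complex set)"
        using s0 by (auto simp: set_eq_iff intro!: exI[of _ "of_real (s / 2)"])
      show "deriv (\<lambda>u. v (e k) u $ i) holomorphic_on ball 0 s"
        by (intro holomorphic_deriv hv) auto
      show "(\<lambda>u. (A (z + u) *v v (e k) u) $ i) holomorphic_on ball 0 s"
        unfolding matrix_vector_mult_def using hv v(2)[of "e k"] sk
        by (auto intro!: holomorphic_intros holomorphic_on_subset[OF hol])
      show "deriv (\<lambda>u. v (e k) u $ i) u = (A (z + u) *v v (e k) u) $ i" if "u \<in> ball 0 s - {0}" for u
        using *[of u i] that DERIV_imp_deriv by blast
    qed (use u in \<open>auto intro: open_delete\<close>)
    then show ?thesis using holomorphic_derivI[OF hv[of i] open_ball u, of UNIV] by simp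
  qed
  define \<Phi> :: "complex \<Rightarrow> cmat2" where "\<Phi> w = (\<chi> i j. v (e j) (w - z) $ i)" for w
  have sol: "solves_on A (ball z s) \<Phi>"
    unfolding solves_on_def
  proof (intro ballI allI)
    fix w i j assume w: "w \<in> ball z s"
    have "((\<lambda>u. v (e j) u $ i) has_field_derivative (A (z + (w - z)) *v v (e j) (w - z)) $ i) (at (w - z))"
      by (rule d) (use w in \<open>simp add: dist_norm norm_minus_commute\<close>)
    then have "((\<lambda>\<mu>. v (e j) (\<mu> - z) $ i) has_field_derivative (A (z + (w - z)) *v v (e j) (w - z)) $ i * 1) (at w)"
      by (rule DERIV_chain2[where g = "\<lambda>\<mu>. \<mu> - z"]) (auto intro!: derivative_eq_intros)
    then show "((\<lambda>\<mu>. \<Phi> \<mu> $ i $ j) has_field_derivative (A w ** \<Phi> w) $ i $ j) (at w)"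
      by (simp add: \<Phi>_def matrix_matrix_mult_def matrix_vector_mult_def)
  qed
  have "det (\<Phi> z) \<noteq> 0" unfolding det_2x2 by (simp add: \<Phi>_def v(3) e_def)
  moreover have "isCont (\<lambda>w. det (\<Phi> w)) z"
    using sol s0 by (auto intro: solves_on_isCont_det)
  ultimately obtain t where t: "t > 0" "\<And>w. dist z w < t \<Longrightarrow> det (\<Phi> w) \<noteq> 0"
    using continuous_at_avoid[of z "\<lambda>w. det (\<Phi> w)" 0] by auto
  show ?thesis
    by (rule that[of "min s t" \<Phi>]) (use sol s0 t in \<open>auto intro: solves_on_subset\<close>)
qed

lemma continues_along_const:
  assumes "solves_on A (ball z r) \<Phi>" "\<And>t. t \<in> {a..b} \<Longrightarrow> g t \<in> ball z r"
  shows "continues_along A g a b (\<lambda>_. \<Phi>)"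
  unfolding continues_along_def using solves_on_imp_near[OF assms(1) open_ball assms(2)] by simp

text \<open>Bisection of the interval. Two adjacent pieces come with unrelated fundamental
  solutions; multiplying the second on the right by the constant \<open>C\<close> makes it continue
  the first, and \<open>C\<close> is invertible since both determinants are nonzero.\<close>

lemma continuation_exists:
  assumes A: "\<And>i j. (\<lambda>z. A z $ i $ j) holomorphic_on \<Omega>" and "open \<Omega>"
    and g: "continuous_on {a..b} g" "g ` {a..b} \<subseteq> \<Omega>" and ab: "a \<le> b"
  obtains \<Phi> where "continues_along A g a b \<Phi>" "\<And>t. t \<in> {a..b} \<Longrightarrow> det (\<Phi> t (g t)) \<noteq> 0"
proof -
  have "a \<le> a \<and> b \<le> b \<longrightarrow> (\<exists>\<Phi>. continues_along A g a b \<Phi> \<and> (\<forall>t\<in>{a..b}. det (\<Phi> t (g t)) \<noteq> 0))"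
    (is "?P a b") using ab
  proof (induction rule: Bolzano[where P = "\<lambda>u v. a \<le> u \<and> v \<le> b \<longrightarrow> (\<exists>\<Phi>. continues_along A g u v \<Phi> \<and> (\<forall>t\<in>{u..v}. det (\<Phi> t (g t)) \<noteq> 0))"])
    case (trans u v w)
    show ?case
    proof
      assume uw: "a \<le> u \<and> w \<le> b"
      then have le: "a \<le> u \<and> v \<le> b" "a \<le> v \<and> w \<le> b" using trans(3,4) by auto
      obtain \<Phi> where \<Phi>: "continues_along A g u v \<Phi>" "\<forall>t\<in>{u..v}. det (\<Phi> t (g t)) \<noteq> 0"
        using trans(1) le by blast
      obtain \<Psi> where \<Psi>: "continues_along A g v w \<Psi>" "\<forall>t\<in>{v..w}. det (\<Psi> t (g t)) \<noteq> 0"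
        using trans(2) le by blast
      obtain C where C: "germ_eq (g v) (\<Phi> v) (\<lambda>z. \<Psi> v z ** C)"
        by (rule germ_ratio[of A "g v" "\<Phi> v" "\<Psi> v"])
          (use \<Phi> \<Psi> trans in \<open>auto simp: continues_along_def\<close>)
      have "\<Phi> v (g v) = \<Psi> v (g v) ** C"
        using C by (auto simp: germ_eq_def dest: eventually_nhds_x_imp_x)
      moreover have "det (\<Phi> v (g v)) \<noteq> 0" using \<Phi>(2) trans(3) by auto
      ultimately have "det C \<noteq> 0" by (auto simp: det_mul)
      then have "\<forall>t\<in>{u..w}. det ((if t \<le> v then \<Phi> t else (\<lambda>w. \<Psi> t w ** C)) (g t)) \<noteq> 0"
        using \<Phi>(2) \<Psi>(2) by (auto simp: det_mul)
      moreover have "continuous_on {u..w} g"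
        using g(1) uw by (auto elim: continuous_on_subset)
      ultimately show "\<exists>\<Phi>. continues_along A g u w \<Phi> \<and> (\<forall>t\<in>{u..w}. det (\<Phi> t (g t)) \<noteq> 0)"
        using continues_along_join[OF \<Phi>(1) continues_along_mult[OF \<Psi>(1), of C] _ C] trans(3,4) by blast
    qed
  next
    case (local t)
    obtain r \<Phi> where r: "r > 0" "solves_on A (ball (g t) r) \<Phi>" "\<And>w. w \<in> ball (g t) r \<Longrightarrow> det (\<Phi> w) \<noteq> 0"
      by (rule holomorphic_linear_local_fundamental[OF A assms(2), of "g t"]) (use g(2) local in auto)
    obtain d where d: "d > 0" "\<And>s. s \<in> {a..b} \<Longrightarrow> dist s t < d \<Longrightarrow> dist (g s) (g t) < r"
      using g(1) local r(1) unfolding continuous_on_iff by (metis atLeastAtMost_iff)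
    show ?case
    proof (intro exI[of _ d] conjI allI impI d)
      fix u v assume *: "u \<le> t \<and> t \<le> v \<and> v - u < d" "a \<le> u \<and> v \<le> b"
      have gs: "g s \<in> ball (g t) r" if "s \<in> {u..v}" for s
        using d(2)[of s] that * by (auto simp: dist_real_def dist_commute)
      then have "continues_along A g u v (\<lambda>_. \<Phi>)"
        using r by (intro continues_along_const)
      then show "\<exists>\<Phi>. continues_along A g u v \<Phi> \<and> (\<forall>t\<in>{u..v}. det (\<Phi> t (g t)) \<noteq> 0)"
        using r(3) gs by blast
    qed
  qed
  then show ?thesis using that by auto
qed

text \<open>A continuation along \<open>g\<close> also serves all nearby paths: the local solutions
  live on balls, and a path close to \<open>g\<close> runs through the same balls. The germs at both
  ends are controlled so that monodromy can be read off the same matrices.\<close>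

lemma continues_along_nearby:
  assumes \<Phi>: "continues_along A g a b \<Phi>" and g: "continuous_on {a..b} g" and ab: "a \<le> b"
  obtains d where "d > 0" "\<And>h. continuous_on {a..b} h \<Longrightarrow> (\<And>t. t \<in> {a..b} \<Longrightarrow> dist (h t) (g t) < d) \<Longrightarrow>
     \<exists>\<Psi>. continues_along A h a b \<Psi> \<and> germ_eq (h a) (\<Psi> a) (\<Phi> a) \<and> germ_eq (h b) (\<Psi> b) (\<Phi> b)"
proof -
  define Q where "Q u v d h \<longleftrightarrow> (continuous_on {u..v} h \<longrightarrow> (\<forall>t\<in>{u..v}. dist (h t) (g t) < d) \<longrightarrow>
     (\<exists>\<Psi>. continues_along A h u v \<Psi> \<and> germ_eq (h u) (\<Psi> u) (\<Phi> u) \<and> germ_eq (h v) (\<Psi> v) (\<Phi> v)))"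
    for u v d and h :: "real \<Rightarrow> complex"
  have "a \<le> a \<and> b \<le> b \<longrightarrow> (\<exists>d>0. \<forall>h. Q a b d h)" using ab
  proof (induction rule: Bolzano[where P = "\<lambda>u v. a \<le> u \<and> v \<le> b \<longrightarrow> (\<exists>d>0. \<forall>h. Q u v d h)"])
    case (trans u v w)
    show ?case
    proof
      assume uw: "a \<le> u \<and> w \<le> b"
      then have le: "a \<le> u \<and> v \<le> b" "a \<le> v \<and> w \<le> b" using trans(3,4) by auto
      obtain d1 d2 where d: "d1 > 0" "d2 > 0" "\<And>h. Q u v d1 h" "\<And>h. Q v w d2 h"
        using trans(1,2) le by blast
      have "Q u w (min d1 d2) h" for h
        unfolding Q_def
      proof (intro impI)
        assume h: "continuous_on {u..w} h" "\<forall>t\<in>{u..w}. dist (h t) (g t) < min d1 d2"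
        have c: "continuous_on {u..v} h" "continuous_on {v..w} h"
          using h(1) trans(3,4) by (auto elim: continuous_on_subset)
        obtain \<Psi>1 where 1: "continues_along A h u v \<Psi>1" "germ_eq (h u) (\<Psi>1 u) (\<Phi> u)" "germ_eq (h v) (\<Psi>1 v) (\<Phi> v)"
          using d(3)[of h] h(2) c(1) trans(4) unfolding Q_def by fastforce
        obtain \<Psi>2 where 2: "continues_along A h v w \<Psi>2" "germ_eq (h v) (\<Psi>2 v) (\<Phi> v)" "germ_eq (h w) (\<Psi>2 w) (\<Phi> w)"
          using d(4)[of h] h(2) c(2) trans(3) unfolding Q_def by fastforce
        have 3: "germ_eq (h v) (\<Psi>1 v) (\<Psi>2 v)" using 1(3) 2(2) germ_eq_trans germ_eq_sym by blast
        have "continues_along A h u w (\<lambda>t. if t \<le> v then \<Psi>1 t else \<Psi>2 t)"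
          by (rule continues_along_join[OF 1(1) 2(1) h(1) 3]) (use trans(3,4) in auto)
        moreover have "germ_eq (h w) (if w \<le> v then \<Psi>1 w else \<Psi>2 w) (\<Phi> w)"
          using 1(3) 2(3) trans(3,4) by (cases "w = v") auto
        ultimately show "\<exists>\<Psi>. continues_along A h u w \<Psi> \<and> germ_eq (h u) (\<Psi> u) (\<Phi> u) \<and> germ_eq (h w) (\<Psi> w) (\<Phi> w)"
          using 1(2) trans(3,4) by (intro exI[of _ "\<lambda>t. if t \<le> v then \<Psi>1 t else \<Psi>2 t"]) auto
      qed
      then show "\<exists>d>0. \<forall>h. Q u w d h" using d(1,2) by (intro exI[of _ "min d1 d2"]) auto
    qed
  next
    case (local t)
    obtain r d where r: "r > 0" "d > 0" "solves_on A (ball (g t) r) (\<Phi> t)"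
      "\<And>s. s \<in> {a..b} \<Longrightarrow> \<bar>s - t\<bar> < d \<Longrightarrow> g s \<in> ball (g t) r \<and> germ_eq (g s) (\<Phi> s) (\<Phi> t)"
      using continues_along_local[OF \<Phi> g, of t] local by (metis atLeastAtMost_iff)
    obtain d' where d': "d' > 0" "\<And>s. s \<in> {a..b} \<Longrightarrow> dist s t < d' \<Longrightarrow> dist (g s) (g t) < r / 2"
      using g local r(1) unfolding continuous_on_iff by (metis atLeastAtMost_iff half_gt_zero)
    show ?case
    proof (rule exI[of _ "min d d'"], intro conjI allI impI)
      fix u v assume *: "u \<le> t \<and> t \<le> v \<and> v - u < min d d'" "a \<le> u \<and> v \<le> b"
      have uv: "germ_eq (g u) (\<Phi> u) (\<Phi> t)" "germ_eq (g v) (\<Phi> v) (\<Phi> t)"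
        using r(4)[of u] r(4)[of v] * by auto
      obtain e1 where e1: "e1 > 0" "\<And>w. w \<in> ball (g u) e1 \<Longrightarrow> \<Phi> u w = \<Phi> t w"
        using uv(1) by (rule germ_eq_ballE) auto
      obtain e2 where e2: "e2 > 0" "\<And>w. w \<in> ball (g v) e2 \<Longrightarrow> \<Phi> v w = \<Phi> t w"
        using uv(2) by (rule germ_eq_ballE) auto
      \<comment> \<open>\<open>r / 2\<close> keeps \<open>h\<close> in the ball of the single
        solution \<open>\<Phi> t\<close>; \<open>e1\<close> and \<open>e2\<close> keep the end
        points of \<open>h\<close> where \<open>\<Phi> u\<close> and \<open>\<Phi> v\<close>
        coincide with \<open>\<Phi> t\<close>.\<close>
      define e where "e = min (r / 2) (min e1 e2)"
      have "Q u v e h" for h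
        unfolding Q_def
      proof (intro impI)
        assume h: "continuous_on {u..v} h" "\<forall>t\<in>{u..v}. dist (h t) (g t) < e"
        have "h s \<in> ball (g t) r" if s: "s \<in> {u..v}" for s
        proof -
          have "dist (g s) (g t) < r / 2" using d'(2)[of s] s * by (auto simp: dist_real_def)
          moreover have "dist (h s) (g s) < r / 2" using h(2) s by (auto simp: e_def)
          ultimately show ?thesis using dist_triangle[of "h s" "g t" "g s"] by (auto simp: dist_commute)
        qed
        then have 1: "continues_along A h u v (\<lambda>_. \<Phi> t)" by (rule continues_along_const[OF r(3)])
        have near: "germ_eq z (\<Phi> t) (\<Phi> s)" if near: "z \<in> ball (g s) e'" "\<And>w. w \<in> ball (g s) e' \<Longrightarrow> \<Phi> s w = \<Phi> t w" for z s e'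
        proof -
          obtain \<epsilon> where "\<epsilon> > 0" "ball z \<epsilon> \<subseteq> ball (g s) e'"
            using near(1) open_contains_ball open_ball by metis
          then show ?thesis using near(2) by (intro germ_eqI_ball[of \<epsilon>]) auto
        qed
        have "h u \<in> ball (g u) e1" "h v \<in> ball (g v) e2" using h(2) * by (auto simp: e_def dist_commute)
        then show "\<exists>\<Psi>. continues_along A h u v \<Psi> \<and> germ_eq (h u) (\<Psi> u) (\<Phi> u) \<and> germ_eq (h v) (\<Psi> v) (\<Phi> v)"
          using 1 near e1(2) e2(2) by blast
      qed
      then show "\<exists>d>0. \<forall>h. Q u v d h" using r(1) e1(1) e2(1) by (intro exI[of _ e]) (auto simp: e_def)
    qed (use r(2) d'(1) in auto)
  qed
  then obtain d where "d > 0" "\<And>h. Q a b d h" by auto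
  then show ?thesis using that[of d] unfolding Q_def by auto
qed

text \<open>The trace of the monodromy matrix, for any fundamental solution along the loop. Unlike
  the matrix it needs no base point, so it is an invariant of free homotopy.\<close>

definition loop_trace :: "(complex \<Rightarrow> cmat2) \<Rightarrow> (real \<Rightarrow> complex) \<Rightarrow> complex \<Rightarrow> bool" where
  "loop_trace A g T \<longleftrightarrow> (\<exists>\<Phi> M. continues_along A g 0 1 \<Phi> \<and> det (\<Phi> 0 (g 0)) \<noteq> 0 \<and>
      germ_eq (g 0) (\<Phi> 1) (\<lambda>w. \<Phi> 0 w ** M) \<and> T = trace M)"

lemma loop_trace_exists:
  assumes A: "\<And>i j. (\<lambda>z. A z $ i $ j) holomorphic_on \<Omega>" and "open \<Omega>"
    and g: "path g" "path_image g \<subseteq> \<Omega>" "pathfinish g = pathstart g"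
  shows "\<exists>T. loop_trace A g T"
proof -
  obtain \<Phi> where \<Phi>: "continues_along A g 0 1 \<Phi>" "\<And>t. t \<in> {0..1} \<Longrightarrow> det (\<Phi> t (g t)) \<noteq> 0"
    by (rule continuation_exists[OF A assms(2), of 0 1 g]) (use g in \<open>auto simp: path_def path_image_def\<close>)
  have "solves_linear_near A (g 0) (\<Phi> 0)" "solves_linear_near A (g 1) (\<Phi> 1)"
    using \<Phi>(1) by (simp_all add: continues_along_def)
  moreover have "g 1 = g 0" using g(3) by (simp add: pathstart_def pathfinish_def)
  ultimately have 1: "solves_linear_near A (g 0) (\<Phi> 0)" "solves_linear_near A (g 0) (\<Phi> 1)" by simp_all
  obtain M where "germ_eq (g 0) (\<Phi> 1) (\<lambda>w. \<Phi> 0 w ** M)"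
    by (rule germ_ratio[OF 1(2,1)]) (use \<Phi>(2) in auto)
  then show ?thesis using \<Phi> unfolding loop_trace_def by (intro exI[of _ "trace M"]) force
qed

lemma germ_eq_at: "germ_eq z \<Phi> \<Psi> \<Longrightarrow> \<Phi> z = \<Psi> z"
  by (auto simp: germ_eq_def dest: eventually_nhds_x_imp_x)

lemma trace_conjugate:
  fixes M C M' :: cmat2
  assumes "M ** C = C ** M'" "det C \<noteq> 0"
  shows "trace M = trace M'"
proof -
  obtain D where D: "C ** D = mat 1" "D ** C = mat 1"
    using assms(2) invertible_det_nz[of C] unfolding invertible_def by auto
  have "M' = D ** (M ** C)" using D(2) by (simp add: assms(1) matrix_mul_assoc)
  then have "trace M' = trace ((M ** C) ** D)" by (simp only: trace_mul_sym[of D])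
  also have "(M ** C) ** D = M" by (metis D(1) matrix_mul_assoc matrix_mul_rid)
  finally show ?thesis by simp
qed

text \<open>Two fundamental solutions differ by a constant invertible \<open>C\<close> at the start,
  hence all along the loop, so their monodromy matrices are conjugate by \<open>C\<close>.\<close>

lemma loop_trace_unique:
  assumes T: "loop_trace A g T" "loop_trace A g T'" and g: "path g" "pathfinish g = pathstart g"
  shows "T = T'"
proof -
  obtain \<Phi> M where \<Phi>: "continues_along A g 0 1 \<Phi>" "det (\<Phi> 0 (g 0)) \<noteq> 0"
    "germ_eq (g 0) (\<Phi> 1) (\<lambda>w. \<Phi> 0 w ** M)" "T = trace M"
    using T(1) unfolding loop_trace_def by auto
  obtain \<Psi> N where \<Psi>: "continues_along A g 0 1 \<Psi>" "det (\<Psi> 0 (g 0)) \<noteq> 0"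
    "germ_eq (g 0) (\<Psi> 1) (\<lambda>w. \<Psi> 0 w ** N)" "T' = trace N"
    using T(2) unfolding loop_trace_def by auto
  have cg: "continuous_on {0..1} g" using g by (simp add: path_def)
  have g01: "g 1 = g 0" using g by (simp add: pathstart_def pathfinish_def)
  obtain C where C: "germ_eq (g 0) (\<Psi> 0) (\<lambda>w. \<Phi> 0 w ** C)"
    by (rule germ_ratio[of A "g 0" "\<Psi> 0" "\<Phi> 0"]) (use \<Phi> \<Psi> in \<open>auto simp: continues_along_def\<close>)
  have "germ_eq (g 1) (\<Psi> 1) (\<lambda>w. \<Phi> 1 w ** C)"
    by (rule continues_along_unique[OF \<Psi>(1) continues_along_mult[OF \<Phi>(1)] cg C]) auto
  from germ_eq_at[OF this] have "\<Psi> 1 (g 0) = \<Phi> 1 (g 0) ** C" using g01 by simp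
  then have "\<Psi> 0 (g 0) ** N = \<Phi> 0 (g 0) ** M ** C"
    using germ_eq_at[OF \<Phi>(3)] germ_eq_at[OF \<Psi>(3)] by simp
  moreover have e0: "\<Psi> 0 (g 0) = \<Phi> 0 (g 0) ** C" by (rule germ_eq_at[OF C])
  ultimately have e: "\<Phi> 0 (g 0) ** (C ** N) = \<Phi> 0 (g 0) ** (M ** C)" by (simp add: matrix_mul_assoc)
  obtain D where D: "D ** \<Phi> 0 (g 0) = mat 1"
    using \<Phi>(2) invertible_det_nz[of "\<Phi> 0 (g 0)"] unfolding invertible_def by auto
  have "C ** N = M ** C" using arg_cong[OF e, of "\<lambda>X. D ** X"] D by (simp add: matrix_mul_assoc)
  moreover have "det C \<noteq> 0" using e0 \<Psi>(2) by (auto simp: det_mul)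
  ultimately show ?thesis using trace_conjugate[of M C N] \<Phi>(4) \<Psi>(4) by simp
qed

lemma loop_trace_nearby:
  assumes T: "loop_trace A g T" and g: "path g" "pathfinish g = pathstart g"
  obtains d where "d > 0" "\<And>h. path h \<Longrightarrow> pathfinish h = pathstart h \<Longrightarrow>
     (\<And>t. t \<in> {0..1} \<Longrightarrow> dist (h t) (g t) < d) \<Longrightarrow> loop_trace A h T"
proof -
  obtain \<Phi> M where \<Phi>: "continues_along A g 0 1 \<Phi>" "det (\<Phi> 0 (g 0)) \<noteq> 0"
    "germ_eq (g 0) (\<Phi> 1) (\<lambda>w. \<Phi> 0 w ** M)" "T = trace M"
    using T(1) unfolding loop_trace_def by auto
  have cg: "continuous_on {0..1} g" using g by (simp add: path_def)
  have g01: "g 1 = g 0" using g by (simp add: pathstart_def pathfinish_def)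
  obtain d1 where d1: "d1 > 0" "\<And>h. continuous_on {0..1} h \<Longrightarrow> (\<And>t. t \<in> {0..1} \<Longrightarrow> dist (h t) (g t) < d1) \<Longrightarrow>
     \<exists>\<Psi>. continues_along A h 0 1 \<Psi> \<and> germ_eq (h 0) (\<Psi> 0) (\<Phi> 0) \<and> germ_eq (h 1) (\<Psi> 1) (\<Phi> 1)"
    using continues_along_nearby[OF \<Phi>(1) cg] by auto
  obtain r where r: "r > 0" "solves_on A (ball (g 0) r) (\<Phi> 0)"
    using \<Phi>(1) unfolding continues_along_def solves_near_iff by (meson atLeastAtMost_iff order_refl zero_le_one)
  have "isCont (\<lambda>w. det (\<Phi> 0 w)) (g 0)" using solves_on_isCont_det[OF r(2)] r(1) by auto
  then obtain d2 where d2: "d2 > 0" "\<And>w. dist (g 0) w < d2 \<Longrightarrow> det (\<Phi> 0 w) \<noteq> 0"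
    using continuous_at_avoid[of "g 0" "\<lambda>w. det (\<Phi> 0 w)" 0] \<Phi>(2) by auto
  obtain d3 where d3: "d3 > 0" "\<And>w. w \<in> ball (g 0) d3 \<Longrightarrow> \<Phi> 1 w = \<Phi> 0 w ** M"
    using \<Phi>(3) by (rule germ_eq_ballE) auto
  show ?thesis
  proof (rule that[of "min d1 (min d2 d3)"])
    fix h assume h: "path h" "pathfinish h = pathstart h" "\<And>t. t \<in> {0..1} \<Longrightarrow> dist (h t) (g t) < min d1 (min d2 d3)"
    have h01: "h 1 = h 0" using h by (simp add: pathstart_def pathfinish_def)
    obtain \<Psi> where \<Psi>: "continues_along A h 0 1 \<Psi>" "germ_eq (h 0) (\<Psi> 0) (\<Phi> 0)" "germ_eq (h 1) (\<Psi> 1) (\<Phi> 1)"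
      using d1(2)[of h] h by (auto simp: path_def)
    have h0: "h 0 \<in> ball (g 0) d3" "dist (g 0) (h 0) < d2" using h(3)[of 0] by (auto simp: dist_commute)
    obtain e where e: "e > 0" "ball (h 0) e \<subseteq> ball (g 0) d3"
      using h0(1) open_contains_ball open_ball by metis
    have "germ_eq (h 0) (\<Phi> 1) (\<lambda>w. \<Phi> 0 w ** M)" using d3(2) e by (intro germ_eqI_ball[of e]) auto
    then have "germ_eq (h 0) (\<Psi> 1) (\<lambda>w. \<Psi> 0 w ** M)"
      using germ_eq_trans[OF germ_eq_trans[OF \<Psi>(3)[unfolded h01]] germ_eq_mult[OF germ_eq_sym[OF \<Psi>(2)], of M]] by blast
    moreover have "det (\<Psi> 0 (h 0)) \<noteq> 0" using germ_eq_at[OF \<Psi>(2)] d2(2) h0(2) by simp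
    ultimately show "loop_trace A h T" unfolding loop_trace_def using \<Psi>(1) \<Phi>(4) by blast
  qed (use d1 d2 d3 in auto)
qed

text \<open>Uniform continuity makes neighbouring loops of the homotopy uniformly close, and by
  \<open>loop_trace_nearby\<close> close loops share their trace. The trace is thus locally constant
  in the deformation parameter.\<close>

lemma loop_trace_homotopic:
  assumes A: "\<And>i j. (\<lambda>z. A z $ i $ j) holomorphic_on \<Omega>" and "open \<Omega>"
    and hom: "homotopic_loops \<Omega> p q" and T: "loop_trace A p T"
  shows "loop_trace A q T"
proof -
  obtain h :: "real \<times> real \<Rightarrow> complex" where h0: "continuous_on ({0..1} \<times> {0..1}) h \<and> h \<in> {0..1} \<times> {0..1} \<rightarrow> \<Omega> \<and>
    (\<forall>x\<in>{0..1}. h (0, x) = p x) \<and> (\<forall>x\<in>{0..1}. h (1, x) = q x) \<and>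
    (\<forall>t\<in>{0..1}. pathfinish (h \<circ> Pair t) = pathstart (h \<circ> Pair t))"
    using hom unfolding homotopic_loops by blast
  then have h: "continuous_on ({0..1} \<times> {0..1}) h" "h ` ({0..1} \<times> {0..1}) \<subseteq> \<Omega>"
    "\<And>x. x \<in> {0..1} \<Longrightarrow> h (0, x) = p x" "\<And>x. x \<in> {0..1} \<Longrightarrow> h (1, x) = q x"
    "\<And>t. t \<in> {0..1} \<Longrightarrow> pathfinish (h \<circ> Pair t) = pathstart (h \<circ> Pair t)"
    by (blast+)
  define H where "H s t = h (s, t)" for s t
  have H: "path (H s)" "path_image (H s) \<subseteq> \<Omega>" "pathfinish (H s) = pathstart (H s)" if s: "s \<in> {0..1}" for s
  proof -
    show "path (H s)" unfolding path_def H_def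
      by (rule continuous_on_compose2[OF h(1)]) (use s in \<open>auto intro!: continuous_intros\<close>)
    show "path_image (H s) \<subseteq> \<Omega>" using h(2) s by (auto simp: path_image_def H_def)
    show "pathfinish (H s) = pathstart (H s)" using h(5)[OF s] by (simp add: H_def pathfinish_def pathstart_def)
  qed
  have uc: "uniformly_continuous_on ({0..1} \<times> {0..1}) h"
    using h(1) by (intro compact_uniformly_continuous compact_Times) auto
  have cong: "loop_trace A g T \<Longrightarrow> (\<And>t. t \<in> {0..1} \<Longrightarrow> g t = g' t) \<Longrightarrow> loop_trace A g' T" for g g'
  proof -
    assume a: "loop_trace A g T" "\<And>t. t \<in> {0..1} \<Longrightarrow> g t = g' t"
    have "continues_along A g 0 1 \<Phi> \<Longrightarrow> continues_along A g' 0 1 \<Phi>" for \<Phi>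
      unfolding continues_along_def using a(2) by (auto simp: eventually_at_filter elim!: eventually_mono)
    then show "loop_trace A g' T" using a unfolding loop_trace_def by (metis atLeastAtMost_iff order_refl zero_le_one)
  qed
  have "loop_trace A (H 1) T"
  proof (rule connected_induction_simple[of "{0..1::real}" 0 1 "\<lambda>s. loop_trace A (H s) T"])
    show "loop_trace A (H 0) T" by (rule cong[OF T]) (simp add: H_def h(3))
  next
    fix s :: real assume s: "s \<in> {0..1}"
    obtain T' where T': "loop_trace A (H s) T'" using loop_trace_exists[OF A assms(2) H[OF s]] by blast
    obtain d where d: "d > 0" "\<And>g. path g \<Longrightarrow> pathfinish g = pathstart g \<Longrightarrow>
       (\<And>t. t \<in> {0..1} \<Longrightarrow> dist (g t) (H s t) < d) \<Longrightarrow> loop_trace A g T'"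
      using loop_trace_nearby[OF T' H(1,3)[OF s]] by blast
    obtain e where e: "e > 0" "\<And>x y. x \<in> {0..1} \<times> {0..1} \<Longrightarrow> y \<in> {0..1} \<times> {0..1} \<Longrightarrow> dist y x < e \<Longrightarrow> dist (h y) (h x) < d"
      using uc d(1) unfolding uniformly_continuous_on_def by metis
    have "loop_trace A (H s') T'" if s': "s' \<in> {0..1} \<inter> ball s e" for s'
    proof (rule d(2))
      show "dist (H s' t) (H s t) < d" if "t \<in> {0..1}" for t
        unfolding H_def using e(2)[of "(s, t)" "(s', t)"] s s' that by (auto simp: dist_Pair_Pair dist_commute)
    qed (use H s' in auto)
    \<comment> \<open>By uniqueness of the trace, having trace \<open>T\<close> means
      \<open>T = T'\<close> for all loops in this range, a condition that does not involve
      \<open>x\<close>.\<close>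
    then have "\<forall>x\<in>{0..1} \<inter> ball s e. loop_trace A (H x) T \<longleftrightarrow> T = T'"
      using loop_trace_unique H by (metis IntD1)
    then show "\<exists>X. openin (top_of_set {0..1}) X \<and> s \<in> X \<and> (\<forall>x\<in>X. \<forall>y\<in>X. loop_trace A (H x) T \<longrightarrow> loop_trace A (H y) T)"
      using s e(1) by (intro exI[of _ "{0..1} \<inter> ball s e"]) (auto simp: openin_open)
  qed auto
  then show ?thesis by (rule cong) (simp add: H_def h(4))
qed

section \<open>Simple loops around the origin\<close>

text \<open>A circle about 0 with orientation \<open>\<kappa>\<close>, which will be 1 or -1: a
  simple closed curve may run either way.\<close>

definition turn_path :: "real \<Rightarrow> real \<Rightarrow> real \<Rightarrow> complex" where
  "turn_path \<kappa> r t = of_real r * exp (2 * of_real pi * \<i> * of_real (\<kappa> * t))"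

lemma norm_turn_path: "r > 0 \<Longrightarrow> norm (turn_path \<kappa> r t) = r"
  by (simp add: turn_path_def norm_mult)

lemma turn_path_closed: "\<kappa> \<in> {1, -1} \<Longrightarrow> turn_path \<kappa> r 1 = turn_path \<kappa> r 0"
  using exp_two_pi_i by (auto simp: turn_path_def exp_minus)

lemma path_turn_path: "path (turn_path \<kappa> r)"
  unfolding path_def turn_path_def by (intro continuous_intros)

lemma turn_path_winding:
  assumes "r > 0" "\<kappa> \<in> {1, -1}"
  shows "winding_number (turn_path \<kappa> r) 0 = of_real \<kappa>"
proof -
  have 1: "turn_path 1 r = circlepath 0 r"
    by (auto simp: turn_path_def circlepath fun_eq_iff)
  have 2: "turn_path (-1) r = reversepath (circlepath 0 r)"
    by (auto simp: turn_path_def circlepath reversepath_def fun_eq_iff exp_minus algebra_simps exp_diff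
        simp flip: exp_of_real)
      (simp add: exp_eq_1 algebra_simps inverse_eq_divide exp_diff[symmetric])
  show ?thesis
    using assms 1 2 winding_number_circlepath_centre[of r 0]
    by (auto simp: winding_number_reversepath)
qed

text \<open>An arc in the outside of the curve joins \<open>b\<close> to the complement of a large
  disc. Removing both leaves a set whose component around \<open>c\<close> has connected unbounded
  complement, hence is simply connected.\<close>

lemma simply_connected_cut_plane:
  fixes c :: "real \<Rightarrow> complex"
  assumes c: "simple_path c" "pathfinish c = pathstart c"
    and b: "b \<in> outside (path_image c)" and a: "a \<in> inside (path_image c)"
  obtains U where "open U" "simply_connected U" "b \<notin> U" "path_image c \<subseteq> U" "a \<in> U"
proof -
  let ?I = "inside (path_image c)" and ?O = "outside (path_image c)"
  have J: "open ?I" "connected ?I" "open ?O" "connected ?O" "frontier ?I = path_image c" "?I \<union> ?O = - path_image c"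
    "?I \<inter> ?O = {}" "\<not> bounded ?O"
    using Jordan_inside_outside[OF c] by auto
  have cc: "compact (path_image c)" using c(1) by (simp add: compact_simple_path_image)
  have clI: "closure ?I = ?I \<union> path_image c" using J(5) by (metis closure_Un_frontier)
  have bK: "bounded (?I \<union> path_image c)"
    using bounded_inside[of "path_image c"] cc by (auto simp: compact_imp_bounded)
  then obtain R where R: "?I \<union> path_image c \<subseteq> ball 0 R" using bounded_subset_ballD by blast
  have "\<exists>w\<in>?O. norm w \<ge> R"
    using J(8) unfolding bounded_iff by (metis linear)
  then obtain w where w: "w \<in> ?O" "norm w \<ge> R" by blast
  have "path_connected ?O" using J(3,4) connected_open_path_connected by blast
  then obtain p where p: "path p" "path_image p \<subseteq> ?O" "pathstart p = b" "pathfinish p = w"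
    using b w unfolding path_connected_def by blast
  \<comment> \<open>The end point \<open>w\<close> of the arc has norm at least \<open>R\<close>, so
    the two parts of \<open>C\<close> meet and \<open>C\<close> is connected and unbounded.\<close>
  define C where "C = path_image p \<union> - ball 0 R"
  have "connected (- ball (0 :: complex) R)"
    by (rule connected_complement_bounded_convex) auto
  moreover have "w \<in> path_image p" using p(4) pathfinish_in_path_image by blast
  ultimately have connC: "connected C"
    unfolding C_def using p(1) w(2) by (intro connected_Un connected_path_image) auto
  have closedC: "closed C" unfolding C_def using p(1) by (intro closed_Un closed_path_image) (auto simp: closed_Compl)
  have unbC: "\<not> bounded C"
    unfolding C_def using cobounded_imp_unbounded[of "- ball (0::complex) R"] by auto
  define U where "U = connected_component_set (- C) a"
  have KC: "?I \<union> path_image c \<subseteq> - C"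
    unfolding C_def using p(2) R J(6,7) by blast
  have "connected (?I \<union> path_image c)" using J(2) clI connected_imp_connected_closure by metis
  then have KU: "?I \<union> path_image c \<subseteq> U"
    unfolding U_def using a KC by (intro connected_component_maximal) auto
  have "b \<in> C" using p(3) pathstart_in_path_image unfolding C_def by blast
  have openU: "open U" unfolding U_def using closedC by (intro open_connected_component) auto
  have UC: "U \<subseteq> - C" unfolding U_def by (rule connected_component_subset)
  have "U \<in> components (- C)" unfolding U_def using a KC by (intro componentsI) auto
  then have "connected (- U)" by (rule component_complement_connected[OF connC])
  have "simply_connected U"
    unfolding simply_connected_eq_unbounded_complement_components[OF openU]
  proof (intro conjI ballI)
    show "connected U" unfolding U_def by simp
    fix D assume "D \<in> components (- U)"
    then have "D = - U" using \<open>connected (- U)\<close> connected_eq_components_subset_sing by auto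
    then show "\<not> bounded D" using unbC UC bounded_subset by (metis compl_le_swap1)
  qed
  then show ?thesis using that[of U] openU KU UC \<open>b \<in> C\<close> a by blast
qed

text \<open>The exponent is scaled from 0 to 1; the factor \<open>exp\<close> never vanishes on the
  way.\<close>

lemma homotopic_loops_exp_factor:
  fixes g :: "real \<Rightarrow> complex" and H :: "complex \<Rightarrow> complex"
  assumes g: "path g" "pathfinish g = pathstart g" "0 \<notin> path_image g" and H: "continuous_on (path_image g) H"
  shows "homotopic_loops (- {0}) g (\<lambda>t. g t * exp (H (g t)))"
proof -
  have gc: "continuous_on {0..1} g" using g(1) by (simp add: path_def)
  have gc2: "continuous_on ({0..1} \<times> {0..1}) (\<lambda>x. g (snd x))"
    by (rule continuous_on_compose2[OF gc]) (auto intro!: continuous_intros)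
  have gH2: "continuous_on ({0..1} \<times> {0..1}) (\<lambda>x. H (g (snd x)))"
    by (rule continuous_on_compose2[OF H gc2]) (auto simp: path_image_def)
  have g0: "g t \<noteq> 0" if "t \<in> {0..1}" for t using g(3) that by (auto simp: path_image_def)
  have g1: "g 1 = g 0" using g(2) by (simp add: pathfinish_def pathstart_def)
  show ?thesis
    unfolding homotopic_loops
  proof (intro exI[of _ "\<lambda>x. g (snd x) * exp (of_real (fst x) * H (g (snd x)))"] conjI)
    show "continuous_on ({0..1} \<times> {0..1}) (\<lambda>x. g (snd x) * exp (of_real (fst x) * H (g (snd x))))"
      by (intro continuous_intros gc2 gH2)
  qed (use g0 g1 in \<open>auto simp: pathfinish_def pathstart_def\<close>)
qed

text \<open>The winding number classifies loops in the once punctured plane, but here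
  \<open>b\<close> must be avoided too. A Riemann map \<open>f\<close> takes a simply connected
  region that contains the curve but not \<open>b\<close> to the unit disc. There the homotopy known
  in the plane without 0 is compressed into the disc without \<open>f 0\<close>, and the inverse map
  brings it back, away from both 0 and \<open>b\<close>.\<close>

lemma simple_loop_homotopic_turn_path:
  assumes c: "simple_path c" "pathfinish c = pathstart c"
    and in0: "0 \<in> inside (path_image c)" and out: "b \<in> outside (path_image c)" and "R > 0"
  obtains \<kappa> r where "\<kappa> \<in> {1, -1}" "0 < r" "r < R" "homotopic_loops (- {0, b}) (turn_path \<kappa> r) c"
proof -
  obtain U where U: "open U" "simply_connected U" "b \<notin> U" "path_image c \<subseteq> U" "0 \<in> U"
    by (rule simply_connected_cut_plane[OF c out in0])
  have c0: "0 \<notin> path_image c" using in0 inside_no_overlap by blast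
  have wn: "winding_number c 0 = 1 \<or> winding_number c 0 = -1"
    using simple_closed_path_winding_number_inside[OF c(1)] in0 by metis
  define \<kappa> :: real where "\<kappa> = (if winding_number c 0 = 1 then 1 else -1)"
  have \<kappa>: "\<kappa> \<in> {1, -1}" "winding_number c 0 = of_real \<kappa>" using wn by (auto simp: \<kappa>_def)
  obtain e where e: "e > 0" "ball 0 e \<subseteq> U" using U(1,5) open_contains_ball by metis
  define r where "r = min e R / 2"
  have r: "0 < r" "r < R" "r < e" using e(1) \<open>R > 0\<close> by (auto simp: r_def)
  define q where "q = turn_path \<kappa> r"
  have q: "path q" "pathfinish q = pathstart q" "path_image q \<subseteq> U" "0 \<notin> path_image q" "winding_number q 0 = of_real \<kappa>"
    using path_turn_path turn_path_closed[OF \<kappa>(1)] e(2) r norm_turn_path[OF r(1)] turn_path_winding[OF r(1) \<kappa>(1)]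
    by (auto simp: q_def pathfinish_def pathstart_def path_image_def subset_eq) (metis norm_zero less_irrefl)
  have pc: "path c" using c(1) by (rule simple_path_imp_path)
  have "U \<noteq> UNIV" "U \<noteq> {}" using U(3,5) by auto
  then obtain f g where fg: "f holomorphic_on U" "g holomorphic_on ball 0 1"
    "\<And>z. z \<in> U \<Longrightarrow> f z \<in> ball 0 1 \<and> g (f z) = z" "\<And>z. z \<in> ball 0 1 \<Longrightarrow> g z \<in> U \<and> f (g z) = z"
    using U(2) unfolding simply_connected_eq_biholomorphic_to_disc[OF U(1)] by metis
  define p0 where "p0 = f 0"
  have p0: "norm p0 < 1" using fg(3)[OF U(5)] by (simp add: p0_def)
  \<comment> \<open>The difference quotient of \<open>f\<close> at 0: holomorphic, and free of zeros
    because \<open>f\<close> is injective. Its logarithm \<open>H\<close> gives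
    \<open>f z - f 0 = z * exp (H z)\<close>, so that \<open>f\<close> does not change homotopy
    classes around the puncture.\<close>
  define h where "h z = (if z = 0 then deriv f 0 else (f z - f 0) / (z - 0))" for z
  have hh: "h holomorphic_on U" unfolding h_def[abs_def]
    by (rule pole_lemma) (use fg(1) U(1,5) in \<open>auto simp: interior_open\<close>)
  have inj: "inj_on f U" using fg(3) by (metis inj_onI)
  have h0: "h z \<noteq> 0" if "z \<in> U" for z
  proof (cases "z = 0")
    case True
    then show ?thesis using holomorphic_injective_imp_regular[OF fg(1) U(1) inj U(5)] by (simp add: h_def)
  next
    case False
    then have "f z \<noteq> f 0" using inj that U(5) by (meson inj_onD)
    then show ?thesis using False by (simp add: h_def)
  qed
  obtain H where H: "H holomorphic_on U" "\<And>z. z \<in> U \<Longrightarrow> h z = exp (H z)"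
    using U(2) hh h0 unfolding simply_connected_eq_holomorphic_log[OF U(1)] by metis
  have fH: "f z - p0 = z * exp (H z)" if "z \<in> U" for z
    using H(2)[OF that] by (auto simp: h_def p0_def field_simps split: if_splits)
  have Hc: "continuous_on U H" "continuous_on U f" using H(1) fg(1) holomorphic_on_imp_continuous_on by auto
  have im: "homotopic_loops (- {0}) g (\<lambda>t. f (g t) - p0)"
    if g: "path g" "pathfinish g = pathstart g" "path_image g \<subseteq> U" "0 \<notin> path_image g" for g
  proof -
    have 1: "homotopic_loops (- {0}) g (\<lambda>t. g t * exp (H (g t)))"
      using g Hc(1) by (intro homotopic_loops_exp_factor) (auto elim: continuous_on_subset)
    have "homotopic_loops (- {0}) (\<lambda>t. g t * exp (H (g t))) (\<lambda>t. f (g t) - p0)"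
    proof (rule homotopic_loops_eq)
      show "path (\<lambda>t. g t * exp (H (g t)))" "path_image (\<lambda>t. g t * exp (H (g t))) \<subseteq> - {0}"
         "pathfinish (\<lambda>t. g t * exp (H (g t))) = pathstart (\<lambda>t. g t * exp (H (g t)))"
        using homotopic_loops_imp_path[OF 1] homotopic_loops_imp_subset[OF 1] homotopic_loops_imp_loop[OF 1] by auto
      show "g t * exp (H (g t)) = f (g t) - p0" if "t \<in> {0..1}" for t
        using fH[of "g t"] that g(3) by (auto simp: path_image_def image_subset_iff)
    qed
    then show ?thesis using 1 homotopic_loops_trans by blast
  qed
  have "homotopic_loops (- {0}) q c"
    using winding_number_homotopic_loops_eq[of q 0 c] q pc c c0 \<kappa>(2) by simp
  then have 1: "homotopic_loops (- {0}) (\<lambda>t. f (q t) - p0) (\<lambda>t. f (c t) - p0)"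
    using im[OF q(1-4)] im[OF pc c(2) U(4) c0] homotopic_loops_trans homotopic_loops_sym by metis
  \<comment> \<open>Chosen so that \<open>s w * norm w < 1 - norm p0\<close>: rescaling by
    \<open>s w\<close> moves the whole plane, recentred at \<open>p0\<close>, into the unit disc
    while keeping directions.\<close>
  define s :: "complex \<Rightarrow> real" where "s w = (1 - norm p0) / (1 + norm w)" for w
  have s0: "s w > 0" for w using p0 unfolding s_def by (smt (verit) divide_pos_pos norm_ge_zero)
  have sc: "continuous_on UNIV s"
    unfolding s_def by (intro continuous_intros) (metis add_cancel_left_right add_nonneg_eq_0_iff norm_ge_zero zero_le_one zero_neq_one)
  have s1: "norm (p0 + of_real (s w) * w) < 1" for w
  proof -
    have "norm (of_real (s w) * w) = s w * norm w"
      using s0[of w] by (simp add: norm_mult)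
    also have "\<dots> = (1 - norm p0) * (norm w / (1 + norm w))" by (simp add: s_def)
    also have "\<dots> < (1 - norm p0) * 1"
      using p0 by (intro mult_strict_left_mono) (auto simp: divide_less_eq add_pos_nonneg)
    finally show ?thesis using norm_triangle_ineq[of p0 "of_real (s w) * w"] by simp
  qed
  let ?B = "ball 0 1 - {p0}"
  define \<rho> where "\<rho> w = p0 + of_real (s w) * w" for w
  have 2: "homotopic_loops ?B (\<rho> \<circ> (\<lambda>t. f (q t) - p0)) (\<rho> \<circ> (\<lambda>t. f (c t) - p0))"
  proof (rule homotopic_loops_continuous_image[OF 1])
    show "continuous_on (- {0}) \<rho>" unfolding \<rho>_def
      by (intro continuous_intros continuous_on_subset[OF sc]) auto
    show "\<rho> \<in> - {0} \<rightarrow> ?B"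
    proof
      fix w :: complex assume "w \<in> - {0}"
      then have "of_real (s w) * w \<noteq> 0" using s0[of w] by simp
      then show "\<rho> w \<in> ?B" using s1[of w] by (simp add: \<rho>_def)
    qed
  qed
  \<comment> \<open>Both points are \<open>p0\<close> plus a positive multiple of the same
    \<open>w\<close>, so the segment between them misses \<open>p0\<close>; it stays in the disc by
    convexity.\<close>
  have seg: "homotopic_loops ?B (f \<circ> g) (\<rho> \<circ> (\<lambda>t. f (g t) - p0))"
    if g: "path g" "pathfinish g = pathstart g" "path_image g \<subseteq> U" "0 \<notin> path_image g"
      and hl: "path (\<rho> \<circ> (\<lambda>t. f (g t) - p0))" "pathfinish (\<rho> \<circ> (\<lambda>t. f (g t) - p0)) = pathstart (\<rho> \<circ> (\<lambda>t. f (g t) - p0))" for g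
  proof (rule homotopic_loops_linear)
    show "path (f \<circ> g)" using g Hc(2) by (intro path_continuous_image) (auto elim: continuous_on_subset)
    show "pathfinish (f \<circ> g) = pathstart (f \<circ> g)" using g(2) by (simp add: pathfinish_compose pathstart_compose)
    fix t :: real assume t: "t \<in> {0..1}"
    have gt: "g t \<in> U" "g t \<noteq> 0" using t g by (auto simp: path_image_def)
    define w where "w = f (g t) - p0"
    have w0: "w \<noteq> 0" using fH[OF gt(1)] gt(2) by (simp add: w_def)
    have a: "(f \<circ> g) t = p0 + w" "norm (p0 + w) < 1" using fg(3)[OF gt(1)] by (auto simp: w_def)
    have b: "(\<rho> \<circ> (\<lambda>t. f (g t) - p0)) t = p0 + of_real (s w) * w" by (simp add: \<rho>_def w_def)
    show "closed_segment ((f \<circ> g) t) ((\<rho> \<circ> (\<lambda>t. f (g t) - p0)) t) \<subseteq> ?B"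
    proof
      fix z assume z: "z \<in> closed_segment ((f \<circ> g) t) ((\<rho> \<circ> (\<lambda>t. f (g t) - p0)) t)"
      moreover have "(f \<circ> g) t \<in> ball 0 1" unfolding a(1) using a(2) by simp
      moreover have "(\<rho> \<circ> (\<lambda>t. f (g t) - p0)) t \<in> ball 0 1" unfolding b using s1[of w] by simp
      ultimately have "z \<in> ball 0 1" using closed_segment_subset[OF _ _ convex_ball] by blast
      moreover obtain u where u: "0 \<le> u" "u \<le> 1" "z = (1 - u) *\<^sub>R (p0 + w) + u *\<^sub>R (p0 + of_real (s w) * w)"
        using z unfolding closed_segment_def a b by blast
      have z1: "z - p0 = of_real ((1 - u) + u * s w) * w"
        unfolding u(3) by (simp add: scaleR_conv_of_real algebra_simps)
      have "(1 - u) + u * s w > 0"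
        using u(1,2) s0[of w] by (cases "u = 0") (auto intro: add_nonneg_pos)
      then have "of_real ((1 - u) + u * s w) \<noteq> (0 :: complex)" unfolding of_real_eq_0_iff by linarith
      then have "z - p0 \<noteq> 0" unfolding z1 using w0 by simp
      ultimately show "z \<in> ?B" by auto
    qed
  qed (use hl in auto)
  have "homotopic_loops ?B (f \<circ> q) (\<rho> \<circ> (\<lambda>t. f (q t) - p0))"
    by (rule seg[OF q(1-4)]) (use homotopic_loops_imp_path[OF 2] homotopic_loops_imp_loop[OF 2] in auto)
  moreover have "homotopic_loops ?B (f \<circ> c) (\<rho> \<circ> (\<lambda>t. f (c t) - p0))"
    by (rule seg[OF pc c(2) U(4) c0]) (use homotopic_loops_imp_path[OF 2] homotopic_loops_imp_loop[OF 2] in auto)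
  ultimately have "homotopic_loops ?B (f \<circ> q) (f \<circ> c)"
    using homotopic_loops_trans[OF homotopic_loops_trans[OF _ 2]] homotopic_loops_sym by blast
  then have "homotopic_loops (U - {0}) (g \<circ> (f \<circ> q)) (g \<circ> (f \<circ> c))"
  proof (rule homotopic_loops_continuous_image)
    show "continuous_on ?B g" using fg(2) holomorphic_on_imp_continuous_on continuous_on_subset by blast
    show "g \<in> ?B \<rightarrow> U - {0}" using fg(4) unfolding p0_def by fastforce
  qed
  then have 3: "homotopic_loops (- {0, b}) (g \<circ> (f \<circ> q)) (g \<circ> (f \<circ> c))"
    by (rule homotopic_loops_subset) (use U(3) in auto)
  have gf: "homotopic_loops (- {0, b}) p (g \<circ> (f \<circ> p))"
    if p: "path p" "pathfinish p = pathstart p" "path_image p \<subseteq> U" "0 \<notin> path_image p" for p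
    by (rule homotopic_loops_eq) (use p U(3) fg(3) in \<open>auto simp: path_image_def image_subset_iff\<close>)
  have "homotopic_loops (- {0, b}) q c"
    using homotopic_loops_trans[OF homotopic_loops_trans[OF gf[OF q(1-4)] 3]]
      homotopic_loops_sym[OF gf[OF pc c(2) U(4) c0]] by blast
  then show ?thesis using that[OF \<kappa>(1) r(1,2)] by (simp add: q_def)
qed

section \<open>The trace of a small loop around a simple pole\<close>

lemma matrix_vector_mult_component:
  fixes X :: cmat2 shows "(X *v v) $ i = X $ i $ 1 * v $ 1 + X $ i $ 2 * v $ 2"
  by (simp add: matrix_vector_mult_def sum_2)

text \<open>\<open>(q, \<nu> - p)\<close> solves both equations but vanishes when
  \<open>q = 0\<close> and \<open>\<nu> = p\<close>. Then \<open>(2 p, s)\<close> is used, and if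
  this vanishes as well the matrix is 0.\<close>

lemma traceless_eigenvector:
  fixes \<Lambda> :: cmat2
  assumes "\<Lambda> $ 2 $ 2 = - \<Lambda> $ 1 $ 1" "\<Lambda> $ 1 $ 1 ^ 2 + \<Lambda> $ 1 $ 2 * \<Lambda> $ 2 $ 1 = \<nu> ^ 2"
  obtains v where "v \<noteq> 0" "\<Lambda> *v v = \<nu> *s v"
proof -
  note eigenvector = that
  define p q s where "p = \<Lambda> $ 1 $ 1" and "q = \<Lambda> $ 1 $ 2" and "s = \<Lambda> $ 2 $ 1"
  have e: "p^2 + q * s = \<nu>^2" using assms(2) by (simp add: p_def q_def s_def)
  have c: "\<Lambda> *v v = \<nu> *s v \<longleftrightarrow> p * v$1 + q * v$2 = \<nu> * v$1 \<and> s * v$1 - p * v$2 = \<nu> * v$2" for v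
    by (simp add: vec_eq_iff forall_2 matrix_vector_mult_component assms(1) p_def q_def s_def)
  have witness: thesis if v: "v \<noteq> 0" "p * v$1 + q * v$2 = \<nu> * v$1" "s * v$1 - p * v$2 = \<nu> * v$2" for v :: "complex^2"
    by (rule eigenvector[OF v(1)]) (simp add: c v(2,3))
  show ?thesis
  proof (cases "q = 0 \<and> \<nu> = p")
    case True
    show ?thesis
    proof (cases "p = 0 \<and> s = 0")
      case True
      then show ?thesis using \<open>q = 0 \<and> \<nu> = p\<close>
        by (intro witness[of "vector [1, 0]"]) (auto simp: vec_eq_iff forall_2)
    next
      case False
      then show ?thesis using True
        by (intro witness[of "vector [2 * p, s]"]) (auto simp: vec_eq_iff forall_2 algebra_simps)
    qed
  next
    case False
    have "q * s = (\<nu> - p) * (\<nu> + p)" using e by (simp add: power2_eq_square algebra_simps)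
    then show ?thesis using False
      by (intro witness[of "vector [q, \<nu> - p]"]) (auto simp: vec_eq_iff forall_2 algebra_simps)
  qed
qed

text \<open>By Cayley-Hamilton \<open>\<Lambda>\<close> squares to \<open>\<nu>^2\<close>, so with
  \<open>N = n + \<nu>\<close> the inverse of \<open>N - \<Lambda>\<close> is
  \<open>(N + \<Lambda>) / (N^2 - \<nu>^2)\<close>, whose denominator is
  \<open>D n = n (n + 2 \<nu>)\<close>. The bound on \<open>Re (2 \<nu>)\<close> keeps the second
  factor away from 0; numerator and denominator both grow like \<open>n\<close>.\<close>

lemma frobenius_resolvent:
  fixes \<Lambda> :: cmat2
  assumes \<Lambda>: "\<Lambda> $ 2 $ 2 = - \<Lambda> $ 1 $ 1" "\<Lambda> $ 1 $ 1 ^ 2 + \<Lambda> $ 1 $ 2 * \<Lambda> $ 2 $ 1 = \<nu> ^ 2"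
    and \<nu>: "\<bar>Re (2 * \<nu>)\<bar> < 1"
  obtains R :: "nat \<Rightarrow> cmat2" and b where
    "\<And>n v. n \<ge> 1 \<Longrightarrow> (of_nat n + \<nu>) *s (R n *v v) - \<Lambda> *v (R n *v v) = v"
    "\<And>n i j. n \<ge> 1 \<Longrightarrow> norm (R n $ i $ j) \<le> b"
proof -
  define D :: "nat \<Rightarrow> complex" where "D n = of_nat n * (of_nat n + 2 * \<nu>)" for n
  define R :: "nat \<Rightarrow> cmat2" where "R n = (\<chi> i j. ((if i = j then of_nat n + \<nu> else 0) + \<Lambda> $ i $ j) / D n)" for n
  define k where "k = 1 - \<bar>Re (2 * \<nu>)\<bar>"
  have k: "k > 0" using \<nu> by (simp add: k_def)
  have Dn: "norm (D n) \<ge> of_nat n * k" if "n \<ge> 1" for n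
  proof -
    have "k \<le> Re (of_nat n + 2 * \<nu>)" using that by (auto simp: k_def abs_if split: if_splits)
    also have "\<dots> \<le> norm (of_nat n + 2 * \<nu>)" by (rule complex_Re_le_cmod)
    finally show ?thesis by (simp add: D_def norm_mult mult_left_mono)
  qed
  have D0: "D n \<noteq> 0" if "n \<ge> 1" for n
  proof -
    have "0 < of_nat n * k" using that k by simp
    then show ?thesis using Dn[OF that] by (metis norm_zero not_less)
  qed
  define B where "B = 1 + norm \<nu> + (\<Sum>i\<in>UNIV. \<Sum>j\<in>UNIV. norm (\<Lambda> $ i $ j))"
  have B: "1 + norm \<nu> + norm (\<Lambda> $ i $ j) \<le> B" for i j
    unfolding B_def
    by (auto intro!: order_trans[OF member_le_sum[of j UNIV "\<lambda>j. norm (\<Lambda> $ i $ j)"]] member_le_sum sum_nonneg)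
  show ?thesis
  proof (rule that[of R "B / k"])
    fix n :: nat and v :: "complex^2" assume n: "n \<ge> 1"
    have d: "D n = (of_nat n + \<nu>)^2 - \<nu>^2" by (simp add: D_def power2_eq_square algebra_simps)
    define N where "N = of_nat n + \<nu>"
    define p q s where "p = \<Lambda> $ 1 $ 1" and "q = \<Lambda> $ 1 $ 2" and "s = \<Lambda> $ 2 $ 1"
    have dd: "D n = N^2 - (p^2 + q * s)" using d \<Lambda>(2) by (simp add: N_def p_def q_def s_def)
    have R1: "(R n *v v) $ 1 = ((N + p) * v $ 1 + q * v $ 2) / D n"
      and R2: "(R n *v v) $ 2 = (s * v $ 1 + (N - p) * v $ 2) / D n"
      by (simp_all add: R_def matrix_vector_mult_component N_def p_def q_def s_def \<Lambda>(1) add_divide_distrib diff_divide_distrib algebra_simps)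
    define x y where "x = v $ 1" and "y = v $ 2"
    have "N * ((N + p) * x + q * y) - (p * ((N + p) * x + q * y) + q * (s * x + (N - p) * y)) = D n * x"
      "N * (s * x + (N - p) * y) - (s * ((N + p) * x + q * y) - p * (s * x + (N - p) * y)) = D n * y"
      by (simp_all add: dd power2_eq_square algebra_simps)
    then have "N * (((N + p) * x + q * y) / D n) - (p * (((N + p) * x + q * y) / D n) + q * ((s * x + (N - p) * y) / D n)) = x"
      "N * ((s * x + (N - p) * y) / D n) - (s * (((N + p) * x + q * y) / D n) - p * ((s * x + (N - p) * y) / D n)) = y"
      using D0[OF n] by (simp_all add: divide_simps)
    then have "N * (R n *v v) $ 1 - (p * (R n *v v) $ 1 + q * (R n *v v) $ 2) = v $ 1"
      "N * (R n *v v) $ 2 - (s * (R n *v v) $ 1 - p * (R n *v v) $ 2) = v $ 2"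
      by (simp_all only: R1 R2 x_def y_def)
    then show "(of_nat n + \<nu>) *s (R n *v v) - \<Lambda> *v (R n *v v) = v"
      unfolding vec_eq_iff forall_2
      by (simp add: matrix_vector_mult_component[of \<Lambda>] \<Lambda>(1) N_def p_def q_def s_def distrib_right)
  next
    fix n :: nat and i j assume n: "n \<ge> 1"
    have "norm ((if i = j then of_nat n + \<nu> else 0) + \<Lambda> $ i $ j) \<le> of_nat n + norm \<nu> + norm (\<Lambda> $ i $ j)"
      by (auto intro!: order_trans[OF norm_triangle_ineq] add_mono)
    also have "\<dots> \<le> of_nat n * B"
    proof -
      have "of_nat n + norm \<nu> + norm (\<Lambda> $ i $ j) \<le> of_nat n * (1 + norm \<nu> + norm (\<Lambda> $ i $ j))"
        using n mult_right_mono[of 1 "real n" "norm \<nu> + norm (\<Lambda> $ i $ j)"] by (simp add: algebra_simps)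
      also have "\<dots> \<le> of_nat n * B" using B by (intro mult_left_mono) auto
      finally show ?thesis .
    qed
    finally have 1: "norm ((if i = j then of_nat n + \<nu> else 0) + \<Lambda> $ i $ j) \<le> of_nat n * B" .
    have "norm (R n $ i $ j) = norm ((if i = j then of_nat n + \<nu> else 0) + \<Lambda> $ i $ j) / norm (D n)"
      by (simp only: R_def vec_lambda_beta norm_divide)
    also have "\<dots> \<le> (of_nat n * B) / (of_nat n * k)"
      using 1 Dn[OF n] n k by (intro frac_le) (auto intro: order_trans[OF norm_ge_zero 1])
    finally have "norm (R n $ i $ j) \<le> (of_nat n * B) / (of_nat n * k)" .
    then show "norm (R n $ i $ j) \<le> B / k" using n by simp
  qed
qed

text \<open>On the ball the quotient by its centre lies in the right half plane, so its logarithm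
  has argument below \<open>pi / 2\<close>; a further turn by less than \<open>pi / 2\<close> stays
  within the principal branch.\<close>

lemma Ln_translate:
  assumes z: "z0 \<noteq> 0" and w: "w \<in> ball (z0 * exp (\<i> * of_real s)) (norm z0)" and st: "\<bar>s - t\<bar> < pi / 2"
  shows "Ln (w / (z0 * exp (\<i> * of_real t))) = Ln (w / (z0 * exp (\<i> * of_real s))) + \<i> * of_real (s - t)"
proof (rule Ln_unique)
  let ?u = "w / (z0 * exp (\<i> * of_real s))"
  have "norm (?u - 1) = norm (w - z0 * exp (\<i> * of_real s)) / norm z0"
    proof -
    have "?u - 1 = (w - z0 * exp (\<i> * of_real s)) / (z0 * exp (\<i> * of_real s))"
      using z by (simp add: field_simps)
    then show ?thesis by (simp add: norm_divide norm_mult)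
  qed
  also have "\<dots> < 1" using w z by (simp add: dist_norm norm_minus_commute)
  finally have "Re ?u > 0" using abs_Re_le_cmod[of "?u - 1"] by (auto simp: abs_if split: if_splits)
  then have u: "?u \<noteq> 0" "\<bar>Im (Ln ?u)\<bar> < pi / 2"
    using Re_Ln_pos_lt[of ?u] by (metis less_irrefl zero_complex.simps(1))+
  show "exp (Ln ?u + \<i> * of_real (s - t)) = w / (z0 * exp (\<i> * of_real t))"
    using u z by (simp add: exp_add exp_diff algebra_simps field_simps)
  show "- pi < Im (Ln ?u + \<i> * of_real (s - t))" "Im (Ln ?u + \<i> * of_real (s - t)) \<le> pi"
    using u(2) st by (auto simp: abs_if split: if_splits)
qed

text \<open>The exponents \<open>\<sigma> / 2\<close> and \<open>- \<sigma> / 2\<close> differ by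
  the non-integer \<open>\<sigma>\<close>, so both give a Frobenius solution
  \<open>z^\<nu> v\<close> without logarithms. One turn multiplies them by
  \<open>exp (\<plusminus> i pi \<sigma>)\<close>, whose sum is even in the orientation.\<close>

lemma small_loop_trace:
  fixes \<Lambda> :: cmat2 and C A :: "complex \<Rightarrow> cmat2"
  assumes \<Lambda>: "\<Lambda> $ 2 $ 2 = - \<Lambda> $ 1 $ 1" "\<Lambda> $ 1 $ 1 ^ 2 + \<Lambda> $ 1 $ 2 * \<Lambda> $ 2 $ 1 = \<sigma> ^ 2 / 4"
    and \<sigma>: "0 < Re \<sigma>" "Re \<sigma> < 1"
    and C: "\<And>i j. (\<lambda>z. C z $ i $ j) holomorphic_on ball 0 R" and "R > 0"
    and A: "\<And>z i j. z \<in> ball 0 R \<Longrightarrow> A z $ i $ j = \<Lambda> $ i $ j / z + C z $ i $ j"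
  obtains \<rho> where "\<rho> > 0" "\<And>r \<kappa>. 0 < r \<Longrightarrow> r < \<rho> \<Longrightarrow> \<kappa> \<in> {1, -1} \<Longrightarrow>
     loop_trace A (turn_path \<kappa> r) (2 * cos (of_real pi * \<sigma>))"
proof -
  define \<nu> :: "2 \<Rightarrow> complex" where "\<nu> k = (if k = 1 then \<sigma> / 2 else - \<sigma> / 2)" for k
  have \<nu>2: "\<nu> k ^ 2 = \<sigma>^2 / 4" for k by (simp add: \<nu>_def power2_eq_square)
  have ex: "\<exists>v0 \<rho> v. v0 \<noteq> 0 \<and> \<Lambda> *v v0 = \<nu> k *s v0 \<and> \<rho> > 0 \<and> \<rho> \<le> R \<and> v 0 = v0 \<and>
     (\<forall>z\<in>ball 0 \<rho>. \<forall>i. \<exists>d. ((\<lambda>z. v z $ i) has_field_derivative d) (at z) \<and>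
        z * d + \<nu> k * v z $ i = (\<Lambda> *v v z) $ i + z * (C z *v v z) $ i)" for k
  proof -
    obtain v0 where v0: "v0 \<noteq> 0" "\<Lambda> *v v0 = \<nu> k *s v0"
      by (rule traceless_eigenvector[OF \<Lambda>(1), of "\<nu> k"]) (simp only: \<Lambda>(2) \<nu>2)
    have L2: "\<Lambda> $ 1 $ 1 ^ 2 + \<Lambda> $ 1 $ 2 * \<Lambda> $ 2 $ 1 = \<nu> k ^ 2" by (simp only: \<Lambda>(2) \<nu>2)
    obtain S :: "nat \<Rightarrow> cmat2" and b where S:
      "\<And>n v. n \<ge> 1 \<Longrightarrow> (of_nat n + \<nu> k) *s (S n *v v) - \<Lambda> *v (S n *v v) = v"
      "\<And>n i j. n \<ge> 1 \<Longrightarrow> norm (S n $ i $ j) \<le> b"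
      by (rule frobenius_resolvent[OF \<Lambda>(1) L2]) (use \<sigma> in \<open>auto simp: \<nu>_def\<close>)
    obtain \<rho> v where "\<rho> > 0" "\<rho> \<le> R" "v 0 = v0"
      "\<And>z i. z \<in> ball 0 \<rho> \<Longrightarrow> \<exists>d. ((\<lambda>z. v z $ i) has_field_derivative d) (at z) \<and>
        z * d + \<nu> k * v z $ i = (\<Lambda> *v v z) $ i + z * (C z *v v z) $ i"
      using frobenius_solution[OF \<open>R > 0\<close> C v0(2) S] by blast
    then show ?thesis using v0 by blast
  qed
  define PP where "PP k v0 \<rho> v \<longleftrightarrow> v0 \<noteq> 0 \<and> \<Lambda> *v v0 = \<nu> k *s v0 \<and> \<rho> > 0 \<and> \<rho> \<le> R \<and> v 0 = v0 \<and>
     (\<forall>z\<in>ball 0 \<rho>. \<forall>i. \<exists>d. ((\<lambda>z. v z $ i) has_field_derivative d) (at z) \<and>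
        z * d + \<nu> k * v z $ i = (\<Lambda> *v v z) $ i + z * (C z *v v z) $ i)" for k v0 \<rho> and v :: "complex \<Rightarrow> complex^2"
  have "\<exists>v0 \<rho> v. PP k v0 \<rho> v" for k unfolding PP_def by (rule ex)
  then obtain v0 \<rho>0 v where "\<And>k. PP k (v0 k) (\<rho>0 k) (v k)" by metis
  then have v: "v0 k \<noteq> 0" "\<Lambda> *v v0 k = \<nu> k *s v0 k" "\<rho>0 k > 0" "\<rho>0 k \<le> R" "v k 0 = v0 k"
    "z \<in> ball 0 (\<rho>0 k) \<Longrightarrow> \<exists>d. ((\<lambda>z. v k z $ i) has_field_derivative d) (at z) \<and>
        z * d + \<nu> k * v k z $ i = (\<Lambda> *v v k z) $ i + z * (C z *v v k z) $ i" for k z i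
    unfolding PP_def by blast+
  \<comment> \<open>The determinant of the fundamental matrix without its power factors. At 0 it is
    the determinant of eigenvectors for the distinct eigenvalues
    \<open>\<plusminus> \<sigma> / 2\<close>.\<close>
  define W where "W z = v 1 z $ 1 * v 2 z $ 2 - v 2 z $ 1 * v 1 z $ 2" for z
  have "W 0 \<noteq> 0"
  proof
    assume W0: "W 0 = 0"
    define a b c d where "a = v0 1 $ 1" "b = v0 1 $ 2" "c = v0 2 $ 1" "d = v0 2 $ 2"
    define p q s where "p = \<Lambda> $ 1 $ 1" and "q = \<Lambda> $ 1 $ 2" and "s = \<Lambda> $ 2 $ 1"
    have w: "a * d = c * b" using W0 by (simp add: W_def v(5) a_b_c_d_def)
    have "p * a + q * b = \<sigma> / 2 * a" "s * a - p * b = \<sigma> / 2 * b" "p * c + q * d = - \<sigma> / 2 * c" "s * c - p * d = - \<sigma> / 2 * d"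
      using v(2)[of 1] v(2)[of 2] unfolding vec_eq_iff forall_2 matrix_vector_mult_component
      by (simp_all add: \<Lambda>(1) \<nu>_def a_b_c_d_def p_def q_def s_def)
    moreover from this have "\<sigma> * (a * d) = 0" "\<sigma> * (a * c) = 0" "\<sigma> * (b * d) = 0" "\<sigma> * (b * c) = 0" using w by algebra+
    moreover have "\<sigma> \<noteq> 0" using \<sigma> by auto
    moreover have "a \<noteq> 0 \<or> b \<noteq> 0" "c \<noteq> 0 \<or> d \<noteq> 0" using v(1)[of 1] v(1)[of 2]
      by (auto simp: vec_eq_iff forall_2 a_b_c_d_def)
    ultimately show False by auto
  qed
  have vc: "isCont (\<lambda>z. v k z $ i) 0" for k i
    using v(6)[of 0 k i] v(3)[of k] DERIV_isCont by auto
  have "isCont W 0" unfolding W_def[abs_def] using vc by (intro isCont_diff isCont_mult)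
  then obtain \<rho>1 where \<rho>1: "\<rho>1 > 0" "\<And>z. dist 0 z < \<rho>1 \<Longrightarrow> W z \<noteq> 0"
    using continuous_at_avoid[of 0 W 0] \<open>W 0 \<noteq> 0\<close> by auto
  define \<rho> where "\<rho> = min \<rho>1 (min (\<rho>0 1) (\<rho>0 2)) / 2"
  have \<rho>: "\<rho> > 0" "2 * \<rho> \<le> \<rho>1" "2 * \<rho> \<le> \<rho>0 k" for k
    using \<rho>1(1) v(3)[of 1] v(3)[of 2] exhaust_2[of k] by (auto simp: \<rho>_def min_def)
  show ?thesis
  proof (rule that[OF \<rho>(1)])
    fix r \<kappa> :: real assume r: "0 < r" "r < \<rho>" and \<kappa>: "\<kappa> \<in> {1, -1}"
    define g where "g = turn_path \<kappa> r"
    have g: "g t = of_real r * exp (\<i> * of_real (2 * pi * \<kappa> * t))" for t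
      by (simp add: g_def turn_path_def algebra_simps)
    have gn: "norm (g t) = r" "g t \<noteq> 0" for t using norm_turn_path[OF r(1)] r(1) unfolding g_def by (auto, metis norm_zero less_irrefl)
    \<comment> \<open>The branch of \<open>log w\<close> near \<open>g t\<close> obtained by
      following the circle: \<open>Ln\<close> is applied only to the quotient \<open>w / g t\<close>
      near 1, and the accumulated angle is added.\<close>
    define lg where "lg t w = Ln (w / g t) + of_real (ln r) + \<i> * of_real (2 * pi * \<kappa> * t)" for t w
    define \<Phi> :: "real \<Rightarrow> complex \<Rightarrow> cmat2" where "\<Phi> t w = (\<chi> i k. exp (\<nu> k * lg t w) * v k w $ i)" for t w
    have lgd: "(lg t has_field_derivative 1 / w) (at w)" if "w \<in> ball (g t) r" for t w
    proof -
      have "norm (w / g t - 1) = norm (w - g t) / r"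
        using gn[of t] r(1) by (simp add: norm_divide[symmetric] diff_divide_distrib flip: gn(1)[of t])
      also have "\<dots> < 1" using that r(1) by (simp add: dist_norm norm_minus_commute)
      finally have "Re (w / g t) > 0" using abs_Re_le_cmod[of "w / g t - 1"] by (auto simp: abs_if split: if_splits)
      then have *: "w / g t \<notin> \<real>\<^sub>\<le>\<^sub>0" "w \<noteq> 0" by (auto simp: complex_nonpos_Reals_iff)
      show ?thesis unfolding lg_def[abs_def]
        using * gn(2)[of t] by (auto intro!: derivative_eq_intros simp: field_simps)
    qed
    have ball: "w \<in> ball 0 (\<rho>0 k)" "dist 0 w < \<rho>1" "w \<noteq> 0" if "w \<in> ball (g t) r" for w t k
    proof -
      have "norm w < 2 * r" using that gn(1)[of t] norm_triangle_ineq2[of w "g t"] by (auto simp: dist_norm norm_minus_commute)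
      then show "w \<in> ball 0 (\<rho>0 k)" "dist 0 w < \<rho>1" using r(2) \<rho>(2) \<rho>(3)[of k] by auto
      show "w \<noteq> 0" using that gn(1)[of t] by auto
    qed
    have sol: "solves_on A (ball (g t) r) (\<Phi> t)" for t
      unfolding solves_on_def
    proof (intro ballI allI)
      fix w i k assume w: "w \<in> ball (g t) r"
      obtain d where d: "((\<lambda>z. v k z $ i) has_field_derivative d) (at w)"
        "w * d + \<nu> k * v k w $ i = (\<Lambda> *v v k w) $ i + w * (C w *v v k w) $ i"
        using v(6)[OF ball(1)[OF w]] by blast
      have w0: "w \<noteq> 0" by (rule ball(3)[OF w])
      have wR: "w \<in> ball 0 R" using ball(1)[OF w, of 1] v(4)[of 1] by auto
      have "(A w *v v k w) $ i * w = (\<Lambda> *v v k w) $ i + w * (C w *v v k w) $ i"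
        using w0 by (simp add: matrix_vector_mult_component A[OF wR] field_simps)
      then have "(A w *v v k w) $ i = d + \<nu> k * v k w $ i / w" using d(2) w0 by (simp add: field_simps)
      moreover have "((\<lambda>\<mu>. exp (\<nu> k * lg t \<mu>) * v k \<mu> $ i) has_field_derivative
          exp (\<nu> k * lg t w) * (d + \<nu> k * v k w $ i / w)) (at w)"
        by (auto intro!: derivative_eq_intros lgd[OF w] d(1) simp: algebra_simps)
      moreover have "(A w ** \<Phi> t w) $ i $ k = exp (\<nu> k * lg t w) * (A w *v v k w) $ i"
        by (simp add: \<Phi>_def matrix_matrix_mult_def matrix_vector_mult_def sum_2 algebra_simps)
      ultimately show "((\<lambda>\<mu>. \<Phi> t \<mu> $ i $ k) has_field_derivative (A w ** \<Phi> t w) $ i $ k) (at w)"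
        by (simp add: \<Phi>_def)
    qed
    have det: "det (\<Phi> t w) \<noteq> 0" if "w \<in> ball (g t) r" for t w
    proof -
      have "det (\<Phi> t w) = exp (\<nu> 1 * lg t w) * exp (\<nu> 2 * lg t w) * W w"
        unfolding det_2x2 by (simp add: \<Phi>_def W_def algebra_simps)
      then show ?thesis using \<rho>1(2)[OF ball(2)[OF that]] by simp
    qed
    have cont: "continues_along A g 0 1 \<Phi>"
      unfolding continues_along_def
    proof (intro ballI conjI)
      fix t :: real assume "t \<in> {0..1}"
      show "solves_linear_near A (g t) (\<Phi> t)" using solves_on_imp_near[OF sol] r(1) by auto
      have "germ_eq (g s) (\<Phi> s) (\<Phi> t)" if "\<bar>s - t\<bar> < 1 / 4" for s
      proof (rule germ_eqI_ball[OF r(1)])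
        fix w assume w: "w \<in> ball (g s) r"
        have "\<bar>2 * pi * \<kappa> * s - 2 * pi * \<kappa> * t\<bar> = 2 * pi * \<bar>s - t\<bar>"
          using \<kappa> by (auto simp: abs_mult simp flip: right_diff_distrib)
        also have "\<dots> < pi / 2" using that by simp
        finally have "Ln (w / g t) = Ln (w / g s) + \<i> * of_real (2 * pi * \<kappa> * s - 2 * pi * \<kappa> * t)"
          unfolding g using w r(1) by (intro Ln_translate) (auto simp: g)
        then have "lg t w = lg s w" by (simp add: lg_def algebra_simps)
        then show "\<Phi> s w = \<Phi> t w" by (simp add: \<Phi>_def)
      qed
      then show "\<forall>\<^sub>F s in at t within {0..1}. germ_eq (g s) (\<Phi> s) (\<Phi> t)"
        unfolding eventually_at dist_real_def by (intro exI[of _ "1/4"]) auto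
    qed
    \<comment> \<open>Over a full turn \<open>lg\<close> gains \<open>2 pi i \<kappa>\<close>, which
      multiplies the column \<open>k\<close> by a constant.\<close>
    define M :: cmat2 where "M = (\<chi> i j. if i = j then exp (\<nu> i * (\<i> * of_real (2 * pi * \<kappa>))) else 0)"
    have g10: "g 1 = g 0" unfolding g_def by (rule turn_path_closed[OF \<kappa>])
    have "\<Phi> 1 w = \<Phi> 0 w ** M" for w
      unfolding vec_eq_iff forall_2 matrix_mult_right_component
      by (simp add: \<Phi>_def M_def lg_def g10 exp_add[symmetric] algebra_simps)
    then have "germ_eq (g 0) (\<Phi> 1) (\<lambda>w. \<Phi> 0 w ** M)" by (simp add: germ_eq_def)
    moreover have "trace M = 2 * cos (of_real pi * \<sigma>)"
      using \<kappa> by (auto simp: trace_def sum_2 M_def \<nu>_def cos_exp_eq algebra_simps exp_minus)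
    ultimately show "loop_trace A (turn_path \<kappa> r) (2 * cos (of_real pi * \<sigma>))"
      unfolding loop_trace_def using cont det[of "g 0" 0] r(1) g_def by force
  qed
qed

section \<open>Isomonodromic gauge transformations\<close>

definition smult :: "complex \<Rightarrow> cmat2 \<Rightarrow> cmat2" where
  "smult c A = (\<chi> i j. c * A $ i $ j)"

lemma bounded_bilinear_matrix_mult: "bounded_bilinear ((**) :: cmat2 \<Rightarrow> cmat2 \<Rightarrow> cmat2)"
proof -
  have "(r *\<^sub>R A) ** B = r *\<^sub>R (A ** B)" "A ** (r *\<^sub>R B) = r *\<^sub>R (A ** B)" for r and A B :: cmat2
    by (simp_all add: vec_eq_iff matrix_mult_right_component scaleR_add_right)
  then show ?thesis
    unfolding bilinear_conv_bounded_bilinear[symmetric] bilinear_def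
    by (auto intro!: linearI simp: matrix_add_ldistrib vec_eq_iff matrix_mult_right_component distrib_right)
qed

lemma bounded_bilinear_smult: "bounded_bilinear smult"
  unfolding bilinear_conv_bounded_bilinear[symmetric] bilinear_def
  by (intro conjI allI linearI; simp add: vec_eq_iff smult_def distrib_left distrib_right)

interpretation mm: bounded_bilinear "(**) :: cmat2 \<Rightarrow> cmat2 \<Rightarrow> cmat2"
  by (rule bounded_bilinear_matrix_mult)

interpretation sm: bounded_bilinear smult
  by (rule bounded_bilinear_smult)

lemma smult_assoc: "smult c A ** B = smult c (A ** B)" "A ** smult c B = smult c (A ** B)"
  "smult c (smult d A) = smult (c * d) A"
  by (simp_all add: vec_eq_iff smult_def matrix_mult_right_component algebra_simps)

lemma real_power_bound_integral:
  fixes V K :: real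
  assumes "0 \<le> t"
  shows "((\<lambda>r. K * (V * (K * r) ^ k / fact k)) has_integral (V * (K * t) ^ Suc k / fact (Suc k))) {0..t}"
proof -
  have "((\<lambda>r. V * (K * r) ^ Suc k / fact (Suc k)) has_real_derivative
      V * (of_nat (Suc k) * (K * r) ^ k * K) / fact (Suc k)) (at r within {0..t})" for r
    by (rule DERIV_cdivide DERIV_cmult DERIV_power_Suc DERIV_ident derivative_eq_intros refl)+ simp
  moreover have "V * (of_nat (Suc k) * (K * r) ^ k * K) / fact (Suc k) = K * (V * (K * r) ^ k / fact k)" for r
    by (simp add: divide_simps del: of_nat_Suc)
  ultimately have "((\<lambda>r. V * (K * r) ^ Suc k / fact (Suc k)) has_real_derivative K * (V * (K * r) ^ k / fact k)) (at r within {0..t})" for r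
    by metis
  then have "((\<lambda>r. K * (V * (K * r) ^ k / fact k)) has_integral
      (V * (K * t) ^ Suc k / fact (Suc k) - V * (K * 0) ^ Suc k / fact (Suc k))) {0..t}"
    using assms by (intro fundamental_theorem_of_calculus) (auto simp: has_real_derivative_iff_has_vector_derivative)
  then show ?thesis by simp
qed

text \<open>Picard iteration as a series: \<open>D k\<close> is the k-fold iterated integral,
  bounded by \<open>norm V * (K t)^k / k!\<close>.\<close>

lemma linear_ode_exists:
  fixes b :: "real \<Rightarrow> cmat2" and V :: cmat2
  assumes b: "continuous_on {0..1} b"
  obtains P where "P 0 = V" "\<And>t. t \<in> {0..1} \<Longrightarrow> (P has_vector_derivative b t ** P t) (at t within {0..1})"
proof -
  obtain M where M: "M > 0" "norm (A ** B) \<le> norm A * norm B * M" for A B :: cmat2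
    using mm.pos_bounded by blast
  have "bounded (b ` {0..1})" by (intro compact_imp_bounded compact_continuous_image b) auto
  then obtain N where "N > 0" "\<forall>x\<in>b ` {0..1}. norm x \<le> N"
    unfolding bounded_pos by blast
  then have N: "N > 0" "\<And>t. t \<in> {0..1} \<Longrightarrow> norm (b t) \<le> N" by blast+
  define K where "K = N * M"
  have K0: "K > 0" using M(1) N(1) by (simp add: K_def)
  have K: "norm (b t ** X) \<le> K * norm X" if "t \<in> {0..1}" for t and X :: cmat2
  proof -
    have "norm (b t ** X) \<le> norm (b t) * (norm X * M)" using M(2)[of "b t" X] by (simp add: mult_ac)
    also have "\<dots> \<le> N * (norm X * M)" using N(2)[OF that] M(1) by (intro mult_right_mono) auto
    finally show ?thesis by (simp add: K_def mult_ac)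
  qed
  define D where "D = rec_nat (\<lambda>t. V) (\<lambda>k f t. integral {0..t} (\<lambda>r. b r ** f r))"
  have D0: "D 0 t = V" and DS: "D (Suc k) t = integral {0..t} (\<lambda>r. b r ** D k r)" for k t
    by (simp_all add: D_def)
  have Dc: "continuous_on {0..1} (D k)" for k
  proof (induction k)
    case 0 then show ?case by (simp add: D0[abs_def])
  next
    case (Suc k)
    have "continuous_on {0..1} (\<lambda>r. b r ** D k r)" by (intro mm.continuous_on b Suc)
    then show ?case unfolding DS[abs_def]
      by (intro indefinite_integral_continuous_1 integrable_continuous_real)
  qed
  have bDc: "continuous_on {0..1} (\<lambda>r. b r ** D k r)" for k by (intro mm.continuous_on b Dc)
  have Db: "norm (D k t) \<le> norm V * (K * t) ^ k / fact k" if "t \<in> {0..1}" for k t using that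
  proof (induction k arbitrary: t)
    case 0 then show ?case by (simp add: D0)
  next
    case (Suc k)
    have "norm (D (Suc k) t) \<le> integral {0..t} (\<lambda>r. K * (norm V * (K * r) ^ k / fact k))"
      unfolding DS
    proof (rule integral_norm_bound_integral)
      show "(\<lambda>r. b r ** D k r) integrable_on {0..t}"
        using Suc.prems by (intro integrable_continuous_real continuous_on_subset[OF bDc]) auto
      show "(\<lambda>r. K * (norm V * (K * r) ^ k / fact k)) integrable_on {0..t}"
        using real_power_bound_integral Suc.prems by (meson atLeastAtMost_iff has_integral_integrable)
      fix r assume "r \<in> {0..t}"
      then have r: "r \<in> {0..1}" using Suc.prems by auto
      show "norm (b r ** D k r) \<le> K * (norm V * (K * r) ^ k / fact k)"
        using K[OF r, of "D k r"] mult_left_mono[OF Suc.IH[OF r] less_imp_le[OF K0]] by linarith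
    qed
    also have "\<dots> = norm V * (K * t) ^ Suc k / fact (Suc k)"
      using real_power_bound_integral Suc.prems by (meson atLeastAtMost_iff integral_unique)
    finally show ?case .
  qed
  have Db1: "norm (D k t) \<le> norm V * (K ^ k / fact k)" if "t \<in> {0..1}" for k t
  proof -
    have "(K * t) ^ k \<le> K ^ k" using that K0 by (intro power_mono) (auto simp: mult_left_le)
    then have "norm V * (K * t) ^ k / fact k \<le> norm V * K ^ k / fact k"
      by (intro divide_right_mono mult_left_mono) auto
    then show ?thesis using Db[OF that, of k] by simp
  qed
  have sK: "summable (\<lambda>k. norm V * (K ^ k / fact k))"
    using summable_exp[of K] by (intro summable_mult) (simp add: inverse_eq_divide)
  define P where "P t = (\<Sum>k. D k t)" for t
  have ul: "uniform_limit {0..1} (\<lambda>n t. \<Sum>i<n. D i t) P sequentially"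
    unfolding P_def by (rule Weierstrass_m_test[OF Db1 sK])
  have Psum: "(\<lambda>k. D k t) sums P t" if "t \<in> {0..1}" for t
    unfolding P_def by (intro summable_sums summable_comparison_test'[OF sK] Db1 that)
  \<comment> \<open>The derivative of \<open>D (Suc k)\<close> is \<open>b ** D k\<close>, while
    \<open>D 0\<close> is constant; the partial sums of derivatives therefore lag by one index, as
    in \<open>dsum\<close>.\<close>
  define d where "d k t = (case k of 0 \<Rightarrow> 0 | Suc k \<Rightarrow> b t ** D k t)" for k t
  have dsum: "(\<Sum>i<n. d i t) = b t ** (\<Sum>i<n - 1. D i t)" for n t
    by (cases n) (simp_all add: d_def sum.lessThan_Suc_shift mm.sum_right mm.zero_right del: sum.lessThan_Suc)
  have "\<exists>g. \<forall>t\<in>{0..1}. (\<lambda>k. D k t) sums g t \<and> (g has_derivative (\<lambda>h. h *\<^sub>R (b t ** P t))) (at t within {0..1})"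
  proof (rule has_derivative_series)
    show "(D k has_derivative (\<lambda>h. h *\<^sub>R d k t)) (at t within {0..1})" if "t \<in> {0..1}" for k t
    proof (cases k)
      case 0
      then show ?thesis by (simp add: D0[abs_def] d_def)
    next
      case (Suc m)
      then show ?thesis
        using integral_has_vector_derivative[OF bDc that, of m]
        by (simp add: d_def DS[abs_def] has_vector_derivative_def)
    qed
    show "\<forall>\<^sub>F n in sequentially. \<forall>t\<in>{0..1}. \<forall>h. norm ((\<Sum>i<n. h *\<^sub>R d i t) - h *\<^sub>R (b t ** P t)) \<le> e * norm h"
      if "e > 0" for e
    proof -
      have "\<forall>\<^sub>F n in sequentially. \<forall>t\<in>{0..1}. dist (\<Sum>i<n. D i t) (P t) < e / K"
        using ul that K0 unfolding uniform_limit_iff by simp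
      then obtain n0 where n0: "\<And>n t. n \<ge> n0 \<Longrightarrow> t \<in> {0..1} \<Longrightarrow> dist (\<Sum>i<n. D i t) (P t) < e / K"
        unfolding eventually_sequentially by blast
      show ?thesis
        unfolding eventually_sequentially
      proof (intro exI[of _ "Suc n0"] allI impI ballI)
        fix n t and h :: real assume n: "Suc n0 \<le> n" and t: "t \<in> {0..1::real}"
        have "(\<Sum>i<n. h *\<^sub>R d i t) - h *\<^sub>R (b t ** P t) = h *\<^sub>R (b t ** ((\<Sum>i<n - 1. D i t) - P t))"
          by (simp add: dsum mm.diff_right scaleR_diff_right flip: scaleR_sum_right)
        also have "norm \<dots> \<le> \<bar>h\<bar> * (K * norm ((\<Sum>i<n - 1. D i t) - P t))"
          using K[OF t] by (simp add: mult_left_mono)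
        also have "\<dots> \<le> \<bar>h\<bar> * (K * (e / K))"
        proof -
          have "n0 \<le> n - 1" using n by linarith
          then show ?thesis using n0[of "n - 1" t] t K0 by (intro mult_left_mono) (auto simp: dist_norm)
        qed
        finally show "norm ((\<Sum>i<n. h *\<^sub>R d i t) - h *\<^sub>R (b t ** P t)) \<le> e * norm h"
          using K0 by (simp add: mult_ac)
      qed
    qed
    show "(\<lambda>k. D k 0) sums P 0" by (rule Psum) simp
  qed auto
  then obtain g where g: "\<And>t. t \<in> {0..1} \<Longrightarrow> (\<lambda>k. D k t) sums g t"
    "\<And>t. t \<in> {0..1} \<Longrightarrow> (g has_vector_derivative b t ** P t) (at t within {0..1})"
    unfolding has_vector_derivative_def by blast
  have gP: "g t = P t" if "t \<in> {0..1}" for t using sums_unique2[OF g(1)[OF that] Psum[OF that]] .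
  have "D k 0 = (if k = 0 then V else 0)" for k by (cases k) (simp_all add: D0 DS)
  then have "P 0 = V" unfolding P_def using sums_unique[OF sums_single[of 0 "\<lambda>_. V"]] by simp
  moreover have "(P has_vector_derivative b t ** P t) (at t within {0..1})" if "t \<in> {0..1}" for t
    using has_vector_derivative_transform[OF that _ g(2)[OF that]] gP by simp
  ultimately show ?thesis using that by blast
qed

text \<open>The squared norm is compared, since the norm itself need not be differentiable at 0:
  \<open>exp (- L t) * |f|^2 - c^2 t\<close> is nonincreasing.\<close>

lemma gronwall:
  fixes f :: "real \<Rightarrow> 'a :: real_inner"
  assumes cont: "continuous_on {0..1} f" and f0: "f 0 = 0"
    and d: "\<And>t. t \<in> {0<..<1} \<Longrightarrow> (f has_vector_derivative f' t) (at t)"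
    and b: "\<And>t. t \<in> {0<..<1} \<Longrightarrow> norm (f' t) \<le> K * norm (f t) + c"
    and "c \<ge> 0" and t: "t \<in> {0..1}"
  shows "norm (f t) \<le> c * exp (\<bar>K\<bar> + 1 / 2)"
proof -
  \<comment> \<open>\<open>2 |K|\<close> accounts for the linear term and 1 for
    \<open>2 c |f| \<le> |f|^2 + c^2\<close>; half of \<open>L\<close> is the exponent in the
    claim.\<close>
  define L where "L = 2 * \<bar>K\<bar> + 1"
  define \<phi> where "\<phi> t = exp (- (L * t)) * (f t \<bullet> f t) - c\<^sup>2 * t" for t
  have "\<phi> 0 \<ge> \<phi> t"
  proof (rule DERIV_nonpos_imp_decreasing_open[of 0 t \<phi>])
    show "0 \<le> t" using t by simp
    show "continuous_on {0..t} \<phi>"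
      unfolding \<phi>_def using t by (intro continuous_intros continuous_on_subset[OF cont]) auto
    fix s assume s: "0 < s" "s < t"
    then have s1: "s \<in> {0<..<1}" using t by auto
    have df: "(f has_derivative (\<lambda>h. h *\<^sub>R f' s)) (at s)" using d[OF s1] by (simp add: has_vector_derivative_def)
    have "((\<lambda>t. f t \<bullet> f t) has_derivative (\<lambda>h. f s \<bullet> (h *\<^sub>R f' s) + (h *\<^sub>R f' s) \<bullet> f s)) (at s)"
      by (rule has_derivative_inner[OF df df])
    then have "((\<lambda>t. f t \<bullet> f t) has_real_derivative 2 * (f s \<bullet> f' s)) (at s)"
      unfolding has_field_derivative_def by (rule has_derivative_eq_rhs) (auto simp: inner_commute)
    then have D: "(\<phi> has_real_derivative (exp (- (L * s)) * (2 * (f s \<bullet> f' s)) - L * exp (- (L * s)) * (f s \<bullet> f s) - c\<^sup>2)) (at s)"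
      unfolding \<phi>_def by (auto intro!: derivative_eq_intros)
    have "norm (f' s) \<le> \<bar>K\<bar> * norm (f s) + c"
      using b[OF s1] mult_right_mono[OF abs_ge_self[of K], of "norm (f s)"] by simp
    note b' = mult_left_mono[OF this, of "norm (f s)"]
    have "f s \<bullet> f' s \<le> norm (f s) * norm (f' s)" by (rule norm_cauchy_schwarz)
    also have "\<dots> \<le> norm (f s) * (\<bar>K\<bar> * norm (f s) + c)"
      using b' by simp
    also have "2 * \<dots> \<le> L * (norm (f s))\<^sup>2 + c\<^sup>2"
      using zero_le_power2[of "norm (f s) - c"] by (simp add: L_def power2_eq_square algebra_simps)
    finally have "2 * (f s \<bullet> f' s) - L * (f s \<bullet> f s) \<le> c\<^sup>2" by (simp add: power2_norm_eq_inner)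
    then have "exp (- (L * s)) * (2 * (f s \<bullet> f' s) - L * (f s \<bullet> f s)) \<le> exp (- (L * s)) * c\<^sup>2"
      by (intro mult_left_mono) auto
    also have "\<dots> \<le> 1 * c\<^sup>2" using s by (intro mult_right_mono) (auto simp: L_def)
    finally have "exp (- (L * s)) * (2 * (f s \<bullet> f' s)) - L * exp (- (L * s)) * (f s \<bullet> f s) - c\<^sup>2 \<le> 0"
      by (simp add: algebra_simps)
    then show "\<exists>y. (\<phi> has_real_derivative y) (at s) \<and> y \<le> 0" using D by blast
  qed
  then have "exp (- (L * t)) * (norm (f t))\<^sup>2 \<le> c\<^sup>2 * t"
    by (simp add: \<phi>_def f0 power2_norm_eq_inner)
  also have "\<dots> \<le> c\<^sup>2" using t by (simp add: mult_left_le)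
  finally have "(norm (f t))\<^sup>2 \<le> exp (L * t) * c\<^sup>2" by (simp add: exp_minus field_simps)
  also have "\<dots> \<le> exp L * c\<^sup>2" using t by (intro mult_right_mono) (auto simp: L_def mult_left_le)
  also have "\<dots> = (c * exp (\<bar>K\<bar> + 1 / 2))\<^sup>2"
    by (simp add: power_mult_distrib L_def flip: exp_double)
  finally show ?thesis by (rule power2_le_imp_le) (use \<open>c \<ge> 0\<close> in simp)
qed

text \<open>For the dependence of a transport on a parameter, Gronwall yields exactly such an error
  bound, with the derivative already identified.\<close>

lemma derivative_from_quadratic_error:
  fixes f :: "complex \<Rightarrow> complex"
  assumes "\<delta> > 0" "\<And>h. norm h < \<delta> \<Longrightarrow> norm (f (z + h) - f z - h * D) \<le> C * (norm h)\<^sup>2"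
  shows "(f has_field_derivative D) (at z)"
  unfolding DERIV_def
proof (rule Lim_transform[of "\<lambda>_. D", rotated])
  show "((\<lambda>_. D) \<longlongrightarrow> D) (at 0)" by simp
  show "((\<lambda>h. (f (z + h) - f z) / h - D) \<longlongrightarrow> 0) (at 0)"
  proof (rule Lim_null_comparison)
    have "\<forall>\<^sub>F h in at 0. h \<in> ball 0 \<delta> - {0}"
      using assms(1) by (auto simp: eventually_at dist_commute intro!: exI[of _ \<delta>])
    then show "\<forall>\<^sub>F h in at 0. norm ((f (z + h) - f z) / h - D) \<le> C * norm h"
    proof eventually_elim
      case (elim h)
      have "(f (z + h) - f z) / h - D = (f (z + h) - f z - h * D) / h" using elim by (simp add: field_simps)
      then have "norm ((f (z + h) - f z) / h - D) = norm (f (z + h) - f z - h * D) / norm h" by (simp add: norm_divide)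
      also have "\<dots> \<le> C * (norm h)\<^sup>2 / norm h"
        using assms(2)[of h] elim by (intro divide_right_mono) auto
      finally show ?case using elim by (simp add: power2_eq_square)
    qed
    show "((\<lambda>h. C * norm h) \<longlongrightarrow> 0) (at (0 :: complex))"
      by (auto intro!: tendsto_eq_intros)
  qed
qed

lemma norm_matrix_component_le: "norm (X $ i $ j) \<le> norm (X :: cmat2)"
  by (rule order_trans[OF Finite_Cartesian_Product.norm_nth_le Finite_Cartesian_Product.norm_nth_le])

text \<open>
  The derivative of \<open>\<A>\<close> is the zero-curvature condition for \<open>\<A>\<close> and \<open>\<beta> / (l - X)\<close>, so the gauge
  transformation is the transport in \<open>t\<close> by \<open>\<beta> / (l - X)\<close>.
\<close>

lemma isomonodromic_gauge:
  fixes \<beta> :: "real \<Rightarrow> cmat2" and \<A> :: "real \<Rightarrow> complex \<Rightarrow> cmat2" and X :: "real \<Rightarrow> complex"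
  assumes \<beta>: "continuous_on {0..1} \<beta>" "\<And>t. t \<in> {0..1} \<Longrightarrow> \<beta> t $ 2 $ 2 = - \<beta> t $ 1 $ 1"
    and X: "continuous_on {0..1} X" and \<Omega>: "\<And>l t. l \<in> \<Omega> \<Longrightarrow> t \<in> {0..1} \<Longrightarrow> l \<noteq> X t"
    and \<A>c: "\<And>l. l \<in> \<Omega> \<Longrightarrow> continuous_on {0..1} (\<lambda>t. \<A> t l)"
    and \<A>d: "\<And>l t. l \<in> \<Omega> \<Longrightarrow> t \<in> {0<..<1} \<Longrightarrow> ((\<lambda>t. \<A> t l) has_vector_derivative
        smult (- 1 / (l - X t)\<^sup>2) (\<beta> t) + smult (1 / (l - X t)) (\<beta> t ** \<A> t l - \<A> t l ** \<beta> t)) (at t)"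
  obtains P :: "complex \<Rightarrow> cmat2" where "\<And>l. l \<in> \<Omega> \<Longrightarrow> det (P l) \<noteq> 0"
    "\<And>l i j. l \<in> \<Omega> \<Longrightarrow> ((\<lambda>l. P l $ i $ j) has_field_derivative (\<A> 1 l ** P l - P l ** \<A> 0 l) $ i $ j) (at l)"
proof -
  define b where "b l t = smult (1 / (l - X t)) (\<beta> t)" for l t
  have \<Omega>': "continuous_on {0..1} (b l)" if "\<And>t. t \<in> {0..1} \<Longrightarrow> l \<noteq> X t" for l
    unfolding b_def using that by (intro sm.continuous_on \<beta>(1) continuous_intros X) auto
  have "\<exists>P. P 0 = mat 1 \<and> (\<forall>t\<in>{0..1}. (P has_vector_derivative b l t ** P t) (at t within {0..1}))"
    if "\<And>t. t \<in> {0..1} \<Longrightarrow> l \<noteq> X t" for l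
    using linear_ode_exists[OF \<Omega>'[OF that], of "mat 1"] by metis
  then obtain P where P: "\<And>l. (\<And>t. t \<in> {0..1} \<Longrightarrow> l \<noteq> X t) \<Longrightarrow> P l 0 = mat 1"
    "\<And>l t. (\<And>t. t \<in> {0..1} \<Longrightarrow> l \<noteq> X t) \<Longrightarrow> t \<in> {0..1} \<Longrightarrow> (P l has_vector_derivative b l t ** P l t) (at t within {0..1})"
    by metis
  have Pc: "continuous_on {0..1} (P l)" if "\<And>t. t \<in> {0..1} \<Longrightarrow> l \<noteq> X t" for l
    unfolding continuous_on_eq_continuous_within using P(2)[OF that] has_vector_derivative_continuous by blast
  have Pd: "(P l has_vector_derivative b l t ** P l t) (at t)"
    if "\<And>t. t \<in> {0..1} \<Longrightarrow> l \<noteq> X t" "t \<in> {0<..<1}" for l t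
    using P(2)[OF that(1), of t] that(2) by (simp add: at_within_Icc_at)
  \<comment> \<open>Liouville: the coefficient \<open>b l t\<close> is traceless, so the determinant
    is constant in \<open>t\<close>.\<close>
  have det1: "det (P l 1) = 1" if l: "\<And>t. t \<in> {0..1} \<Longrightarrow> l \<noteq> X t" for l
  proof -
    have c: "((\<lambda>t. P l t $ i $ j) has_vector_derivative (b l t ** P l t) $ i $ j) (at t within {0..1})"
      if "t \<in> {0..1}" for t i j
      using bounded_linear.has_vector_derivative[OF bounded_linear_compose[OF bounded_linear_vec_nth bounded_linear_vec_nth] P(2)[OF l that]] .
    have "((\<lambda>t. det (P l t)) has_vector_derivative 0) (at t within {0..1})" if t: "t \<in> {0..1}" for t
      unfolding det_2x2
      by (rule has_vector_derivative_eq_rhs[OF has_vector_derivative_diff[OF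
            has_vector_derivative_mult[OF c[OF t] c[OF t]] has_vector_derivative_mult[OF c[OF t] c[OF t]]]])
        (simp add: matrix_mult_right_component b_def smult_def \<beta>(2)[OF t] algebra_simps)
    then obtain c where "\<And>t. t \<in> {0..1} \<Longrightarrow> det (P l t) = c"
      using has_vector_derivative_zero_constant[of "{0..1}" "\<lambda>t. det (P l t)"] by auto
    then have "det (P l 1) = det (P l 0)" by auto
    then show ?thesis using P(1)[OF l] by simp
  qed
  obtain M where M: "M > 0" "norm (A ** B) \<le> norm A * norm B * M" for A B :: cmat2
    using mm.pos_bounded by blast
  obtain S where S: "S > 0" "norm (smult c A) \<le> norm c * norm A * S" for c and A :: cmat2
    using sm.pos_bounded by blast
  have "bounded (\<beta> ` {0..1})" by (intro compact_imp_bounded compact_continuous_image \<beta>) auto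
  then obtain N0 where "N0 > 0" "\<forall>x\<in>\<beta> ` {0..1}. norm x \<le> N0"
    unfolding bounded_pos by blast
  then have N0: "N0 > 0" "\<And>t. t \<in> {0..1} \<Longrightarrow> norm (\<beta> t) \<le> N0" by blast+
  show ?thesis
  proof (rule that[of "\<lambda>l. P l 1"])
    fix z assume z: "z \<in> \<Omega>"
    show "det (P z 1) \<noteq> 0" using det1[of z] \<Omega>[OF z] by auto
    fix i j
    have "compact (X ` {0..1})" using X by (intro compact_continuous_image) auto
    moreover have "z \<notin> X ` {0..1}" using \<Omega>[OF z] by blast
    ultimately obtain \<delta> where \<delta>: "\<delta> > 0" "\<And>x. x \<in> X ` {0..1} \<Longrightarrow> \<delta> \<le> dist z x"
      using separate_point_closed compact_imp_closed by metis
    \<comment> \<open>Half the distance from \<open>z\<close> to the curve \<open>X\<close>: shifts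
      by less than \<open>e\<close> stay at distance \<open>e\<close> from it.\<close>
    define e where "e = \<delta> / 2"
    have e: "e > 0" "e \<le> norm (z + h - X t)" "e \<le> norm (z - X t)" if "t \<in> {0..1}" "norm h < e" for t h
    proof -
      have "2 * e \<le> norm (z - X t)" using \<delta>(2)[of "X t"] that(1) by (simp add: e_def dist_norm)
      moreover have "norm (z - X t) \<le> norm (z + h - X t) + norm h"
        using norm_triangle_ineq4[of "z + h - X t" h] by simp
      ultimately show "e > 0" "e \<le> norm (z + h - X t)" "e \<le> norm (z - X t)"
        using that(2) \<delta>(1) by (auto simp: e_def)
    qed
    have e0: "e > 0" using \<delta>(1) by (simp add: e_def)
    have ne: "z + h \<noteq> X t" if "t \<in> {0..1}" "norm h < e" for t h
      using e(2)[OF that] e0 by auto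
    have ie: "norm (1 / (z + h - X t)) \<le> 1 / e" "norm (1 / (z - X t)) \<le> 1 / e" if "t \<in> {0..1}" "norm h < e" for t h
      using e[OF that] by (simp_all add: norm_divide frac_le)
    define B where "B = 1 / e * N0 * S"
    have B0: "B > 0" using e0 N0 S by (simp add: B_def)
    have bB: "norm (b (z + h) t) \<le> B" if t: "t \<in> {0..1}" and h: "norm h < e" for t h
    proof -
      have "norm (b (z + h) t) \<le> norm (1 / (z + h - X t)) * norm (\<beta> t) * S" unfolding b_def by (rule S(2))
      also have "\<dots> \<le> 1 / e * N0 * S"
        using e0 S(1) N0(1) by (intro mult_mono ie[OF t h] N0(2)[OF t]) auto
      finally show ?thesis by (simp add: B_def)
    qed
    define q where "q = B * norm (mat 1 :: cmat2) * M * exp (\<bar>B * M\<bar> + 1/2)"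
    have Pq: "norm (P (z + h) t - mat 1) \<le> q" if t: "t \<in> {0..1}" and h: "norm h < e" for t h
      unfolding q_def
    proof (rule gronwall[where f' = "\<lambda>t. b (z + h) t ** P (z + h) t"])
      show "continuous_on {0..1} (\<lambda>t. P (z + h) t - mat 1)" using Pc[of "z + h"] ne h by (intro continuous_intros) auto
      show "P (z + h) 0 - mat 1 = 0" using P(1)[of "z + h"] ne h by auto
      show "((\<lambda>t. P (z + h) t - mat 1) has_vector_derivative b (z + h) t ** P (z + h) t) (at t)" if "t \<in> {0<..<1}" for t
        using Pd[of "z + h" t] ne h that by (auto intro!: derivative_eq_intros)
      show "norm (b (z + h) t ** P (z + h) t) \<le> B * M * norm (P (z + h) t - mat 1) + B * norm (mat 1 :: cmat2) * M"
        if "t \<in> {0<..<1}" for t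
      proof -
        have t: "t \<in> {0..1}" using that by auto
        have "norm (b (z + h) t ** P (z + h) t) \<le> norm (b (z + h) t) * norm (P (z + h) t) * M" by (rule M(2))
        also have "\<dots> \<le> B * (norm (P (z + h) t - mat 1) + norm (mat 1 :: cmat2)) * M"
          using bB[OF t h] M(1) B0 norm_triangle_ineq[of "P (z + h) t - mat 1" "mat 1"] by (intro mult_mono) auto
        finally show ?thesis by (simp add: algebra_simps)
      qed
    qed (use t B0 M in auto)
    define p where "p = q + norm (mat 1 :: cmat2)"
    have p: "norm (P (z + h) t) \<le> p" if "t \<in> {0..1}" "norm h < e" for t h
      using Pq[OF that] norm_triangle_ineq[of "P (z + h) t - mat 1" "mat 1"] by (simp add: p_def)
    have p0: "p \<ge> 0" using order_trans[OF norm_ge_zero p[of 0 0]] e0 by simp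
    define b1 where "b1 t = smult (- 1 / (z - X t)\<^sup>2) (\<beta> t)" for t
    define c1 where "c1 = 1 / e * (1 / e) * N0 * S"
    define c2 where "c2 = 1 / e * (1 / e * (1 / e)) * N0 * S"
    have c12: "c1 \<ge> 0" "c2 \<ge> 0" using e0 N0(1) S(1) by (auto simp: c1_def c2_def)
    have db: "norm (b (z + h) t - b z t) \<le> norm h * c1" if t: "t \<in> {0..1}" and h: "norm h < e" for t h
    proof -
      have n: "z + h - X t \<noteq> 0" "z - X t \<noteq> 0" using ne[OF t h] ne[OF t, of 0] e0 by auto
      have "b (z + h) t - b z t = smult (- h * (1 / (z + h - X t) * (1 / (z - X t)))) (\<beta> t)"
        unfolding b_def sm.diff_left[symmetric] using n by (intro arg_cong2[of _ _ _ _ smult]) (auto simp: field_simps)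
      also have "norm \<dots> \<le> norm (- h * (1 / (z + h - X t) * (1 / (z - X t)))) * norm (\<beta> t) * S" by (rule S(2))
      also have "\<dots> \<le> (norm h * (1 / e * (1 / e))) * N0 * S"
        unfolding norm_mult using e0 S(1) N0(1) by (intro mult_mono ie[OF t h] N0(2)[OF t]) auto
      finally show ?thesis by (simp add: c1_def mult_ac)
    qed
    have ddb: "norm (b (z + h) t - b z t - smult h (b1 t)) \<le> (norm h)\<^sup>2 * c2" if t: "t \<in> {0..1}" and h: "norm h < e" for t h
    proof -
      have n: "z + h - X t \<noteq> 0" "z - X t \<noteq> 0" using ne[OF t h] ne[OF t, of 0] e0 by auto
      have "1 / (z + h - X t) - 1 / (z - X t) - h * (- 1 / (z - X t)\<^sup>2) = h\<^sup>2 * (1 / (z + h - X t) * (1 / (z - X t) * (1 / (z - X t))))"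
        using n by (simp add: divide_simps power2_eq_square) (simp add: algebra_simps)
      then have "b (z + h) t - b z t - smult h (b1 t) = smult (h\<^sup>2 * (1 / (z + h - X t) * (1 / (z - X t) * (1 / (z - X t))))) (\<beta> t)"
        unfolding b_def b1_def smult_assoc sm.diff_left[symmetric] by simp
      also have "norm \<dots> \<le> norm (h\<^sup>2 * (1 / (z + h - X t) * (1 / (z - X t) * (1 / (z - X t))))) * norm (\<beta> t) * S" by (rule S(2))
      also have "\<dots> \<le> ((norm h)\<^sup>2 * (1 / e * (1 / e * (1 / e)))) * N0 * S"
        unfolding norm_mult norm_power using e0 S(1) N0(1) by (intro mult_mono ie[OF t h] N0(2)[OF t]) auto
      finally show ?thesis by (simp add: c2_def mult_ac)
    qed
    define E where "E = exp (\<bar>B * M\<bar> + 1/2)"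
    have E0: "E \<ge> 0" by (simp add: E_def)
    have PP: "norm (P (z + h) t - P z t) \<le> (norm h * c1 * p * M) * E" if t: "t \<in> {0..1}" and h: "norm h < e" for t h
      unfolding E_def
    proof (rule gronwall[where f' = "\<lambda>t. b (z + h) t ** P (z + h) t - b z t ** P z t"])
      show "continuous_on {0..1} (\<lambda>t. P (z + h) t - P z t)"
        using Pc[of "z + h"] Pc[of z] ne[OF _ h] ne[of _ 0] e0 by (intro continuous_intros) auto
      show "P (z + h) 0 - P z 0 = 0" using P(1)[of "z + h"] P(1)[of z] ne[OF _ h] ne[of _ 0] e0 by auto
      show "((\<lambda>t. P (z + h) t - P z t) has_vector_derivative b (z + h) t ** P (z + h) t - b z t ** P z t) (at t)" if "t \<in> {0<..<1}" for t
        using Pd[of "z + h" t] Pd[of z t] ne[OF _ h] ne[of _ 0] e0 that by (intro has_vector_derivative_diff) auto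
      show "norm (b (z + h) t ** P (z + h) t - b z t ** P z t) \<le> B * M * norm (P (z + h) t - P z t) + norm h * c1 * p * M"
        if "t \<in> {0<..<1}" for t
      proof -
        have t: "t \<in> {0..1}" using that by auto
        have "b (z + h) t ** P (z + h) t - b z t ** P z t = b z t ** (P (z + h) t - P z t) + (b (z + h) t - b z t) ** P (z + h) t"
          by (simp add: mm.diff_left mm.diff_right)
        also have "norm \<dots> \<le> norm (b z t) * norm (P (z + h) t - P z t) * M + norm (b (z + h) t - b z t) * norm (P (z + h) t) * M"
          by (intro order_trans[OF norm_triangle_ineq] add_mono M(2))
        also have "\<dots> \<le> B * norm (P (z + h) t - P z t) * M + (norm h * c1) * p * M"
          using bB[OF t, of 0] db[OF t h] p[OF t h] M(1) B0 e0 c12 p0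
          by (intro add_mono mult_mono) auto
        finally show ?thesis by (simp add: mult_ac)
      qed
    qed (use t c12 p0 M in auto)
    \<comment> \<open>The candidate for the derivative of \<open>P z t\<close> in \<open>z\<close>.
      Zero curvature says exactly that it solves the variational equation
      \<open>N' = b1 P + b N\<close>, and it vanishes at \<open>t = 0\<close>.\<close>
    define Nn where "Nn t = \<A> t z ** P z t - P z t ** \<A> 0 z" for t
    have zne: "\<And>t. t \<in> {0..1} \<Longrightarrow> z \<noteq> X t" using \<Omega>[OF z] by blast
    have Nc: "continuous_on {0..1} Nn" unfolding Nn_def
      by (intro continuous_intros mm.continuous_on Pc[OF zne] \<A>c[OF z])
    have Nd: "(Nn has_vector_derivative b1 t ** P z t + b z t ** Nn t) (at t)" if t: "t \<in> {0<..<1}" for t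
    proof -
      have "(Nn has_vector_derivative (\<A> t z ** (b z t ** P z t) + (smult (- 1 / (z - X t)\<^sup>2) (\<beta> t) + smult (1 / (z - X t)) (\<beta> t ** \<A> t z - \<A> t z ** \<beta> t)) ** P z t)
        - (P z t ** 0 + (b z t ** P z t) ** \<A> 0 z)) (at t)"
        unfolding Nn_def
        by (intro has_vector_derivative_diff mm.has_vector_derivative Pd[OF zne t] \<A>d[OF z t] has_vector_derivative_const)
      then show ?thesis
        by (rule has_vector_derivative_eq_rhs)
          (simp add: b_def b1_def Nn_def mm.diff_left mm.diff_right mm.add_left mm.zero_right sm.diff_right smult_assoc matrix_mul_assoc)
    qed
    define C where "C = (c1 * (c1 * p * M * E) * M + c2 * p * M) * E"
    have eq: "B' * x * M' + ((h' * c) * ((h' * c * p' * M') * E') * M' + (h'\<^sup>2 * d) * p' * M') =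
        B' * M' * x + h'\<^sup>2 * (c * (c * p' * M' * E') * M' + d * p' * M')" for B' x M' h' c p' E' d :: real
      by (simp add: power2_eq_square algebra_simps)
    \<comment> \<open>The error \<open>P (z + h) - P z - h N\<close> starts at 0 and solves the
      linear equation with coefficient \<open>b z\<close> up to an inhomogeneity of order
      \<open>h^2\<close>: the product of two first order differences (\<open>db\<close>,
      \<open>PP\<close>) and the second order remainder of \<open>b\<close>
      (\<open>ddb\<close>).\<close>
    have main: "norm (P (z + h) 1 - P z 1 - smult h (Nn 1)) \<le> C * (norm h)\<^sup>2" if h: "norm h < e" for h
    proof -
      have "norm (P (z + h) 1 - P z 1 - smult h (Nn 1)) \<le> ((norm h)\<^sup>2 * (c1 * (c1 * p * M * E) * M + c2 * p * M)) * exp (\<bar>B * M\<bar> + 1/2)"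
      proof (rule gronwall[where f' = "\<lambda>t. b (z + h) t ** P (z + h) t - b z t ** P z t - smult h (b1 t ** P z t + b z t ** Nn t)"])
        show "continuous_on {0..1} (\<lambda>t. P (z + h) t - P z t - smult h (Nn t))"
          using Pc[of "z + h"] Pc[of z] ne[OF _ h] zne Nc by (intro continuous_intros sm.continuous_on) auto
        show "P (z + h) 0 - P z 0 - smult h (Nn 0) = 0"
          using P(1)[of "z + h"] P(1)[of z] ne[OF _ h] zne by (simp add: Nn_def sm.zero_right)
        show "((\<lambda>t. P (z + h) t - P z t - smult h (Nn t)) has_vector_derivative
            b (z + h) t ** P (z + h) t - b z t ** P z t - smult h (b1 t ** P z t + b z t ** Nn t)) (at t)" if "t \<in> {0<..<1}" for t
          using Pd[of "z + h" t] Pd[of z t] ne[OF _ h] zne that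
          by (intro has_vector_derivative_diff bounded_linear.has_vector_derivative[OF sm.bounded_linear_right] Nd) auto
        show "norm (b (z + h) t ** P (z + h) t - b z t ** P z t - smult h (b1 t ** P z t + b z t ** Nn t))
            \<le> B * M * norm (P (z + h) t - P z t - smult h (Nn t)) + (norm h)\<^sup>2 * (c1 * (c1 * p * M * E) * M + c2 * p * M)"
          if "t \<in> {0<..<1}" for t
        proof -
          have t: "t \<in> {0..1}" using that by auto
          have e1: "b (z + h) t ** P (z + h) t - b z t ** P z t - smult h (b1 t ** P z t + b z t ** Nn t) =
            b z t ** (P (z + h) t - P z t - smult h (Nn t)) + ((b (z + h) t - b z t) ** (P (z + h) t - P z t)
             + (b (z + h) t - b z t - smult h (b1 t)) ** P z t)"
            by (simp add: mm.diff_left mm.diff_right smult_assoc sm.add_right)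
          have "norm (b (z + h) t ** P (z + h) t - b z t ** P z t - smult h (b1 t ** P z t + b z t ** Nn t)) \<le> norm (b z t) * norm (P (z + h) t - P z t - smult h (Nn t)) * M +
             (norm (b (z + h) t - b z t) * norm (P (z + h) t - P z t) * M + norm (b (z + h) t - b z t - smult h (b1 t)) * norm (P z t) * M)"
            unfolding e1 by (intro order_trans[OF norm_triangle_ineq] add_mono M(2))
          also have "\<dots> \<le> B * norm (P (z + h) t - P z t - smult h (Nn t)) * M +
             ((norm h * c1) * ((norm h * c1 * p * M) * E) * M + ((norm h)\<^sup>2 * c2) * p * M)"
          proof (intro add_mono)
            show "norm (b z t) * norm (P (z + h) t - P z t - smult h (Nn t)) * M \<le> B * norm (P (z + h) t - P z t - smult h (Nn t)) * M"
              using bB[OF t, of 0] M(1) e0 by (intro mult_right_mono) auto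
            show "norm (b (z + h) t - b z t) * norm (P (z + h) t - P z t) * M \<le> (norm h * c1) * ((norm h * c1 * p * M) * E) * M"
              using M(1) c12(1) by (intro mult_right_mono mult_mono db[OF t h] PP[OF t h]) auto
            show "norm (b (z + h) t - b z t - smult h (b1 t)) * norm (P z t) * M \<le> ((norm h)\<^sup>2 * c2) * p * M"
              using M(1) c12(2) p[OF t, of 0] e0 by (intro mult_right_mono mult_mono ddb[OF t h]) auto
          qed
          also have "\<dots> = B * M * norm (P (z + h) t - P z t - smult h (Nn t)) + (norm h)\<^sup>2 * (c1 * (c1 * p * M * E) * M + c2 * p * M)"
            by (rule eq)
          finally show ?thesis .
        qed
        show "0 \<le> (norm h)\<^sup>2 * (c1 * (c1 * p * M * E) * M + c2 * p * M)"
          using c12 p0 M(1) E0 by (intro mult_nonneg_nonneg add_nonneg_nonneg) auto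
      qed simp
      also have "\<dots> = C * (norm h)\<^sup>2" unfolding C_def E_def by (simp only: mult_ac)
      finally show ?thesis .
    qed
    show "((\<lambda>l. P l 1 $ i $ j) has_field_derivative (\<A> 1 z ** P z 1 - P z 1 ** \<A> 0 z) $ i $ j) (at z)"
    proof (rule derivative_from_quadratic_error[OF e0])
      fix h :: complex assume h: "norm h < e"
      have "P (z + h) 1 $ i $ j - P z 1 $ i $ j - h * (\<A> 1 z ** P z 1 - P z 1 ** \<A> 0 z) $ i $ j
         = (P (z + h) 1 - P z 1 - smult h (Nn 1)) $ i $ j" by (simp add: Nn_def smult_def)
      then show "norm (P (z + h) 1 $ i $ j - P z 1 $ i $ j - h * (\<A> 1 z ** P z 1 - P z 1 ** \<A> 0 z) $ i $ j) \<le> C * (norm h)\<^sup>2"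
        using main[OF h] norm_matrix_component_le[of "P (z + h) 1 - P z 1 - smult h (Nn 1)" i j] by simp
    qed
  qed
qed

text \<open>The derivative of \<open>P\<close> says that \<open>P ** \<Psi>\<close> solves the
  system of \<open>A\<close> whenever \<open>\<Psi>\<close> solves that of \<open>A0\<close>. Left
  multiplication by \<open>P\<close> leaves the right factor \<open>M\<close> untouched.\<close>

lemma loop_trace_gauge:
  assumes P: "\<And>l. l \<in> \<Omega> \<Longrightarrow> det (P l) \<noteq> 0"
    "\<And>l i j. l \<in> \<Omega> \<Longrightarrow> ((\<lambda>l. P l $ i $ j) has_field_derivative (A l ** P l - P l ** A0 l) $ i $ j) (at l)"
    and "open \<Omega>" and g: "path_image g \<subseteq> \<Omega>" and T: "loop_trace A0 g T"
  shows "loop_trace A g T"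
proof -
  obtain \<Phi> M where \<Phi>: "continues_along A0 g 0 1 \<Phi>" "det (\<Phi> 0 (g 0)) \<noteq> 0"
    "germ_eq (g 0) (\<Phi> 1) (\<lambda>w. \<Phi> 0 w ** M)" "T = trace M"
    using T unfolding loop_trace_def by auto
  have near: "solves_linear_near A z (\<lambda>w. P w ** \<Psi> w)" if z: "z \<in> \<Omega>" and sol: "solves_linear_near A0 z \<Psi>" for z \<Psi>
  proof -
    obtain r where r: "r > 0" "solves_on A0 (ball z r) \<Psi>" using solves_near_iff sol by blast
    obtain e where e: "e > 0" "ball z e \<subseteq> \<Omega>" using z \<open>open \<Omega>\<close> open_contains_ball by metis
    have "solves_on A (ball z (min r e)) (\<lambda>w. P w ** \<Psi> w)"
      unfolding solves_on_def
    proof (intro ballI allI)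
      fix w i j assume w: "w \<in> ball z (min r e)"
      have wO: "w \<in> \<Omega>" using w e(2) by auto
      have d: "((\<lambda>\<mu>. \<Psi> \<mu> $ i $ j) has_field_derivative (A0 w ** \<Psi> w) $ i $ j) (at w)" for i j
        using r(2) w by (auto simp: solves_on_def)
      have "((\<lambda>\<mu>. (P \<mu> ** \<Psi> \<mu>) $ i $ j) has_field_derivative
        ((A w ** P w - P w ** A0 w) ** \<Psi> w + P w ** (A0 w ** \<Psi> w)) $ i $ j) (at w)"
        unfolding matrix_mult_right_component[of "P _"]
        by (auto intro!: derivative_eq_intros P(2)[OF wO] d simp: matrix_mult_right_component[of "A w ** P w - P w ** A0 w"] matrix_mult_right_component[of "P w"] algebra_simps)
      then show "((\<lambda>\<mu>. (P \<mu> ** \<Psi> \<mu>) $ i $ j) has_field_derivative (A w ** (P w ** \<Psi> w)) $ i $ j) (at w)"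
        by (simp add: mm.diff_left matrix_mul_assoc)
    qed
    then show ?thesis using r(1) e(1) solves_near_iff by (metis min_less_iff_conj)
  qed
  have germ: "germ_eq z (\<lambda>w. P w ** \<Phi>1 w) (\<lambda>w. P w ** \<Phi>2 w)" if "germ_eq z \<Phi>1 \<Phi>2" for z \<Phi>1 \<Phi>2
    using that by (auto simp: germ_eq_def elim: eventually_mono)
  have "continues_along A g 0 1 (\<lambda>t w. P w ** \<Phi> t w)"
    using \<Phi>(1) g unfolding continues_along_def
    by (auto intro!: near elim!: eventually_mono simp: germ path_image_def image_subset_iff)
  moreover have "det (P (g 0) ** \<Phi> 0 (g 0)) \<noteq> 0"
    using \<Phi>(2) P(1)[of "g 0"] g by (auto simp: det_mul path_image_def image_subset_iff)
  moreover have "germ_eq (g 0) (\<lambda>w. P w ** \<Phi> 1 w) (\<lambda>w. (P w ** \<Phi> 0 w) ** M)"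
    using germ[OF \<Phi>(3)] by (simp add: matrix_mul_assoc)
  ultimately show ?thesis unfolding loop_trace_def using \<Phi>(4) by (intro exI[of _ "\<lambda>t w. P w ** \<Phi> t w"] exI[of _ M]) auto
qed

section \<open>Double power series\<close>

type_synonym bps = "complex fps fps"

text \<open>The coefficient of \<open>X^i Y^j\<close>: the outer variable of \<open>bps\<close> is
  \<open>Y\<close>, the inner one \<open>X\<close>.\<close>

definition cf :: "bps \<Rightarrow> nat \<Rightarrow> nat \<Rightarrow> complex" where
  "cf f i j = fps_nth (fps_nth f j) i"

definition bX :: bps where "bX = fps_const fps_X"
definition bY :: bps where "bY = fps_X"
definition bC :: "complex \<Rightarrow> bps" where "bC c = fps_const (fps_const c)"

lemma bps_eqI: "(\<And>i j. cf f i j = cf g i j) \<Longrightarrow> f = g"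
  by (simp add: cf_def fps_eq_iff)

lemma cf_add [simp]: "cf (f + g) i j = cf f i j + cf g i j"
  and cf_diff [simp]: "cf (f - g) i j = cf f i j - cf g i j"
  and cf_uminus [simp]: "cf (- f) i j = - cf f i j"
  and cf_0 [simp]: "cf 0 i j = 0"
  and cf_1 [simp]: "cf 1 i j = (if i = 0 \<and> j = 0 then 1 else 0)"
  and cf_bC [simp]: "cf (bC c) i j = (if i = 0 \<and> j = 0 then c else 0)"
  and cf_bC_mult [simp]: "cf (bC c * f) i j = c * cf f i j"
  and cf_bX_mult [simp]: "cf (bX * f) i j = (if i = 0 then 0 else cf f (i - 1) j)"
  and cf_bY_mult [simp]: "cf (bY * f) i j = (if j = 0 then 0 else cf f i (j - 1))"
  by (auto simp: cf_def bC_def bX_def bY_def)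

lemma cf_bX: "cf bX i j = (if i = 1 \<and> j = 0 then 1 else 0)"
  and cf_bY: "cf bY i j = (if i = 0 \<and> j = 1 then 1 else 0)"
  by (auto simp: cf_def bX_def bY_def fps_X_def)

lemma cf_mult: "cf (f * g) i j = (\<Sum>l\<le>j. \<Sum>k\<le>i. cf f k l * cf g (i - k) (j - l))"
  by (simp add: cf_def fps_mult_nth fps_sum_nth atLeast0AtMost)

lemma bC_simps: "bC 0 = 0" "bC 1 = 1" "bC (c + d) = bC c + bC d" "bC (c * d) = bC c * bC d" "bC (- c) = - bC c"
  "bC (c - d) = bC c - bC d" "bC (c ^ n) = bC c ^ n" "bC (numeral k) = numeral k"
  by (simp_all add: bC_def fps_const_power numeral_fps_const)

text \<open>\<open>bD s\<close> is the derivation with \<open>D X = s X\<close>, \<open>D Y = (1 - s) Y\<close>, i.e. \<open>d/d\<xi>\<close> for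
  \<open>X = exp (s \<xi>)\<close> and \<open>Y = exp ((1 - s) \<xi>)\<close>.\<close>

definition weight :: "complex \<Rightarrow> nat \<Rightarrow> nat \<Rightarrow> complex" where
  "weight s i j = s * of_nat i + (1 - s) * of_nat j"

definition bD :: "complex \<Rightarrow> bps \<Rightarrow> bps" where
  "bD s f = Abs_fps (\<lambda>j. Abs_fps (\<lambda>i. weight s i j * cf f i j))"

text \<open>A right inverse of \<open>bD s\<close> on series without constant term. For
  \<open>i = j = 0\<close> the weight is 0 and the division returns 0, so \<open>bI s f\<close>
  never has a constant term.\<close>

definition bI :: "complex \<Rightarrow> bps \<Rightarrow> bps" where
  "bI s f = Abs_fps (\<lambda>j. Abs_fps (\<lambda>i. cf f i j / weight s i j))"

lemma cf_bD [simp]: "cf (bD s f) i j = weight s i j * cf f i j"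
  and cf_bI [simp]: "cf (bI s f) i j = cf f i j / weight s i j"
  by (simp_all add: cf_def bD_def bI_def)

lemma weight_0 [simp]: "weight s 0 0 = 0" by (simp add: weight_def)

text \<open>There are no small divisors: both \<open>s\<close> and \<open>1 - s\<close> have
  positive real part, so nothing cancels in the real part of the weight.\<close>

lemma weight_lower:
  assumes "0 < Re s" "Re s < 1"
  shows "min (Re s) (1 - Re s) * real (i + j) \<le> norm (weight s i j)"
proof -
  have "min (Re s) (1 - Re s) * real i + min (Re s) (1 - Re s) * real j \<le> Re s * real i + (1 - Re s) * real j"
    by (intro add_mono mult_right_mono) auto
  also have "\<dots> = Re (weight s i j)" by (simp add: weight_def)
  also have "\<dots> \<le> norm (weight s i j)" by (rule complex_Re_le_cmod)
  finally show ?thesis by (simp add: algebra_simps)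
qed

lemma weight_nz:
  assumes "0 < Re s" "Re s < 1" "i + j \<noteq> 0"
  shows "weight s i j \<noteq> 0"
proof -
  have "0 < min (Re s) (1 - Re s) * real (i + j)" using assms by (intro mult_pos_pos) auto
  then show ?thesis using weight_lower[OF assms(1,2), of i j] by auto
qed

lemma bD_bI:
  assumes "0 < Re s" "Re s < 1" "cf f 0 0 = 0"
  shows "bD s (bI s f) = f"
proof (rule bps_eqI)
  fix i j show "cf (bD s (bI s f)) i j = cf f i j"
    using weight_nz[OF assms(1,2), of i j] assms(3) by (cases "i + j = 0") auto
qed

lemma bD_add [simp]: "bD s (f + g) = bD s f + bD s g"
  and bD_diff [simp]: "bD s (f - g) = bD s f - bD s g"
  and bD_uminus [simp]: "bD s (- f) = - bD s f"
  and bD_bC [simp]: "bD s (bC c) = 0"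
  and bD_1 [simp]: "bD s 1 = 0"
  and bD_bX: "bD s bX = bC s * bX"
  and bD_bY: "bD s bY = bC (1 - s) * bY"
  by (rule bps_eqI; auto simp: algebra_simps weight_def cf_bX cf_bY le_Suc_eq)+

lemma bD_numeral [simp]: "bD s (numeral k) = 0"
  using bD_bC[of s "numeral k"] by (simp add: bC_simps)

lemma bD_mult: "bD s (f * g) = bD s f * g + f * bD s g"
proof (rule bps_eqI)
  fix i j
  have w: "weight s i j = weight s k l + weight s (i - k) (j - l)" if "k \<le> i" "l \<le> j" for k l
    using that by (simp add: weight_def of_nat_diff algebra_simps)
  show "cf (bD s (f * g)) i j = cf (bD s f * g + f * bD s g) i j"
    unfolding cf_bD cf_add cf_mult sum_distrib_left sum.distrib[symmetric]
    by (intro sum.cong refl) (simp add: w algebra_simps)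
qed

lemma bD_eq_0:
  assumes "0 < Re s" "Re s < 1" "bD s f = 0"
  shows "f = bC (cf f 0 0)"
proof (rule bps_eqI)
  fix i j
  have "weight s i j * cf f i j = 0" using assms(3) by (metis cf_0 cf_bD)
  then show "cf f i j = cf (bC (cf f 0 0)) i j"
    using weight_nz[OF assms(1,2), of i j] by auto
qed

section \<open>Agreement of series up to total degree\<close>

definition eqN :: "nat \<Rightarrow> bps \<Rightarrow> bps \<Rightarrow> bool" where
  "eqN n f g \<longleftrightarrow> (\<forall>i j. i + j < n \<longrightarrow> cf f i j = cf g i j)"

lemma eqN_refl [simp]: "eqN n f f" and eqN_0 [simp]: "eqN 0 f g"
  by (simp_all add: eqN_def)

lemma eqN_trans: "eqN n f g \<Longrightarrow> eqN n g h \<Longrightarrow> eqN n f h" by (simp add: eqN_def)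
lemma eqN_sym: "eqN n f g \<Longrightarrow> eqN n g f" by (simp add: eqN_def)
lemma eqN_mono: "eqN n f g \<Longrightarrow> m \<le> n \<Longrightarrow> eqN m f g" by (simp add: eqN_def)

lemma eqN_add: "eqN n f f' \<Longrightarrow> eqN n g g' \<Longrightarrow> eqN n (f + g) (f' + g')"
  and eqN_diff: "eqN n f f' \<Longrightarrow> eqN n g g' \<Longrightarrow> eqN n (f - g) (f' - g')"
  and eqN_bI: "eqN n f f' \<Longrightarrow> eqN n (bI s f) (bI s f')"
  and eqN_bX: "eqN n f f' \<Longrightarrow> eqN (Suc n) (bX * f) (bX * f')"
  and eqN_bY: "eqN n f f' \<Longrightarrow> eqN (Suc n) (bY * f) (bY * f')"
  by (auto simp: eqN_def)

lemma eqN_mult: "eqN n f f' \<Longrightarrow> eqN n g g' \<Longrightarrow> eqN n (f * g) (f' * g')"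
  unfolding eqN_def cf_mult by (auto intro!: sum.cong arg_cong2[of _ _ _ _ "(*)"])

text \<open>A factor without constant term gains one degree: the coefficients of degree
  \<open>n\<close> of the other factor only meet \<open>cf f 0 0 = 0\<close>.\<close>

lemma eqN_mult_strict:
  assumes f: "eqN (Suc n) f f'" and 0: "cf f 0 0 = 0" "cf f' 0 0 = 0" and g: "eqN n g g'"
  shows "eqN (Suc n) (f * g) (f' * g')"
  unfolding eqN_def cf_mult
proof (intro allI impI sum.cong refl)
  fix i j l k assume "i + j < Suc n" "l \<in> {..j}" "k \<in> {..i}"
  then show "cf f k l * cf g (i - k) (j - l) = cf f' k l * cf g' (i - k) (j - l)"
    using f g 0 by (cases "k + l = 0") (auto simp: eqN_def)
qed

lemma eqN_all: "(\<And>n. eqN n f g) \<Longrightarrow> f = g"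
  by (rule bps_eqI) (auto simp: eqN_def)

section \<open>Majorants: weighted absolute sums on a bidisc\<close>

definition majorized :: "real \<Rightarrow> bps \<Rightarrow> real \<Rightarrow> bool" where
  "majorized r f M \<longleftrightarrow> (\<forall>n. (\<Sum>j<n. \<Sum>i<n. norm (cf f i j) * r ^ (i + j)) \<le> M)"

lemma majorized_mono: "majorized r f M \<Longrightarrow> M \<le> N \<Longrightarrow> majorized r f N"
  unfolding majorized_def by (meson order_trans)

lemma majorized_add: "majorized r f M \<Longrightarrow> majorized r g N \<Longrightarrow> 0 \<le> r \<Longrightarrow> majorized r (f + g) (M + N)"
  and majorized_diff: "majorized r f M \<Longrightarrow> majorized r g N \<Longrightarrow> 0 \<le> r \<Longrightarrow> majorized r (f - g) (M + N)"
proof -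
  assume a: "majorized r f M" "majorized r g N" "0 \<le> r"
  have "(\<Sum>j<n. \<Sum>i<n. (norm (cf f i j) + norm (cf g i j)) * r ^ (i + j)) \<le> M + N" for n
    using a(1,2) by (auto simp: majorized_def distrib_right sum.distrib intro!: add_mono)
  moreover have "(\<Sum>j<n. \<Sum>i<n. norm (cf (f + g) i j) * r ^ (i + j)) \<le> (\<Sum>j<n. \<Sum>i<n. (norm (cf f i j) + norm (cf g i j)) * r ^ (i + j))"
    "(\<Sum>j<n. \<Sum>i<n. norm (cf (f - g) i j) * r ^ (i + j)) \<le> (\<Sum>j<n. \<Sum>i<n. (norm (cf f i j) + norm (cf g i j)) * r ^ (i + j))" for n
    using a(3) by (intro sum_mono mult_right_mono; simp add: norm_triangle_ineq norm_triangle_ineq4)+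
  ultimately show "majorized r (f + g) (M + N)" "majorized r (f - g) (M + N)"
    unfolding majorized_def using order_trans by blast+
qed

lemma majorized_const: "majorized r (bC c) (norm c)"
  unfolding majorized_def
proof
  fix n
  have "(\<Sum>j<n. \<Sum>i<n. norm (cf (bC c) i j) * r ^ (i + j)) = (\<Sum>j<n. \<Sum>i<n. if i = 0 \<and> j = 0 then norm c else 0)"
    by (intro sum.cong) auto
  also have "\<dots> = (\<Sum>j<n. if j = 0 then (\<Sum>i<n. if i = 0 then norm c else 0) else 0)"
    by (intro sum.cong) auto
  also have "\<dots> \<le> norm c" by simp
  finally show "(\<Sum>j<n. \<Sum>i<n. norm (cf (bC c) i j) * r ^ (i + j)) \<le> norm c" .
qed

lemma majorized_1: "majorized r 1 1"
  using majorized_const[of r 1] by (simp add: bC_simps)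

lemma majorized_nonneg: "majorized r f M \<Longrightarrow> 0 \<le> M"
  unfolding majorized_def by (drule spec[of _ 0]) simp

text \<open>The Cauchy product runs over the triangle \<open>k + l < n\<close>, which lies in the
  square of the product.\<close>

lemma convolution_sum_le:
  fixes a b :: "nat \<Rightarrow> real"
  assumes "\<And>k. a k \<ge> 0" "\<And>k. b k \<ge> 0"
  shows "(\<Sum>j<n. \<Sum>k\<le>j. a k * b (j - k)) \<le> (\<Sum>k<n. a k) * (\<Sum>k<n. b k)"
proof -
  have "(\<Sum>j<n. \<Sum>k\<le>j. a k * b (j - k)) = (\<Sum>(k, l)\<in>{(k, l). k + l < n}. a k * b l)"
    by (subst sum.triangle_reindex) (simp add: sum.nested_swap)
  also have "\<dots> \<le> (\<Sum>(k, l)\<in>{..<n} \<times> {..<n}. a k * b l)"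
    using assms by (intro sum_mono2) auto
  also have "\<dots> = (\<Sum>k<n. a k) * (\<Sum>k<n. b k)"
    by (simp add: sum_product sum.cartesian_product)
  finally show ?thesis .
qed

text \<open>The weighted absolute sum is submultiplicative; the Cauchy product estimate is applied
  in \<open>X\<close> within each row and then in \<open>Y\<close> to the row sums.\<close>

lemma majorized_mult:
  assumes "majorized r f M" "majorized r g N" "0 \<le> r"
  shows "majorized r (f * g) (M * N)"
  unfolding majorized_def
proof
  fix n
  define A where "A j = (\<Sum>i<n. norm (cf f i j) * r ^ i)" for j
  define B where "B j = (\<Sum>i<n. norm (cf g i j) * r ^ i)" for j
  have A0: "A j \<ge> 0" "B j \<ge> 0" for j using assms(3) by (auto simp: A_def B_def intro!: sum_nonneg)
  have row: "(\<Sum>i<n. norm (cf (f * g) i j) * r ^ i) \<le> (\<Sum>l\<le>j. A l * B (j - l))" for j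
  proof -
    have "norm (cf (f * g) i j) * r ^ i \<le> (\<Sum>l\<le>j. \<Sum>k\<le>i. (norm (cf f k l) * r ^ k) * (norm (cf g (i - k) (j - l)) * r ^ (i - k)))" for i
    proof -
      have "norm (cf (f * g) i j) * r ^ i \<le> (\<Sum>l\<le>j. \<Sum>k\<le>i. norm (cf f k l * cf g (i - k) (j - l))) * r ^ i"
        unfolding cf_mult using assms(3)
        by (intro mult_right_mono order_trans[OF norm_sum] sum_mono norm_sum) auto
      also have "\<dots> = (\<Sum>l\<le>j. \<Sum>k\<le>i. (norm (cf f k l) * r ^ k) * (norm (cf g (i - k) (j - l)) * r ^ (i - k)))"
        unfolding sum_distrib_right
        by (intro sum.cong refl) (simp add: norm_mult power_add[symmetric] algebra_simps flip: mult.assoc power_add)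
      finally show ?thesis .
    qed
    then have "(\<Sum>i<n. norm (cf (f * g) i j) * r ^ i) \<le> (\<Sum>i<n. \<Sum>l\<le>j. \<Sum>k\<le>i. (norm (cf f k l) * r ^ k) * (norm (cf g (i - k) (j - l)) * r ^ (i - k)))"
      by (rule sum_mono)
    also have "\<dots> = (\<Sum>l\<le>j. \<Sum>i<n. \<Sum>k\<le>i. (norm (cf f k l) * r ^ k) * (norm (cf g (i - k) (j - l)) * r ^ (i - k)))"
      by (rule sum.swap)
    also have "\<dots> \<le> (\<Sum>l\<le>j. A l * B (j - l))"
      unfolding A_def B_def using assms(3) by (intro sum_mono convolution_sum_le[of "\<lambda>k. norm (cf f k _) * r ^ k" "\<lambda>k. norm (cf g k _) * r ^ k"]) auto
    finally show ?thesis .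
  qed
  have "(\<Sum>j<n. \<Sum>i<n. norm (cf (f * g) i j) * r ^ (i + j)) = (\<Sum>j<n. (\<Sum>i<n. norm (cf (f * g) i j) * r ^ i) * r ^ j)"
    by (simp add: sum_distrib_right sum_distrib_left power_add mult_ac)
  also have "\<dots> \<le> (\<Sum>j<n. (\<Sum>l\<le>j. A l * B (j - l)) * r ^ j)"
    using assms(3) by (intro sum_mono mult_right_mono row) auto
  also have "\<dots> = (\<Sum>j<n. \<Sum>l\<le>j. (A l * r ^ l) * (B (j - l) * r ^ (j - l)))"
    unfolding sum_distrib_right by (intro sum.cong refl) (simp add: algebra_simps flip: power_add)
  also have "\<dots> \<le> (\<Sum>l<n. A l * r ^ l) * (\<Sum>l<n. B l * r ^ l)"
    using A0 assms(3) by (intro convolution_sum_le) auto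
  also have "\<dots> \<le> M * N"
  proof (rule mult_mono)
    show "(\<Sum>l<n. A l * r ^ l) \<le> M" "(\<Sum>l<n. B l * r ^ l) \<le> N"
      using assms(1,2) by (auto simp: majorized_def A_def B_def sum_distrib_right sum_distrib_left power_add mult_ac)
  qed (use A0 assms majorized_nonneg in \<open>auto intro!: sum_nonneg\<close>)
  finally show "(\<Sum>j<n. \<Sum>i<n. norm (cf (f * g) i j) * r ^ (i + j)) \<le> M * N" .
qed

text \<open>All weights except the one of the constant term have modulus at least
  \<open>min (Re s) (1 - Re s)\<close>; the constant term is removed by \<open>bI\<close>.\<close>

lemma majorized_bI:
  assumes f: "majorized r f M" and r: "0 \<le> r" and s: "0 < Re s" "Re s < 1"
  shows "majorized r (bI s f) (M / min (Re s) (1 - Re s))"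
  unfolding majorized_def
proof
  fix n
  let ?\<kappa> = "min (Re s) (1 - Re s)"
  have \<kappa>: "?\<kappa> > 0" using s by simp
  have "norm (cf (bI s f) i j) \<le> norm (cf f i j) / ?\<kappa>" for i j
  proof (cases "i + j = 0")
    case True
    then show ?thesis using \<kappa> by simp
  next
    case False
    then have "?\<kappa> * 1 \<le> ?\<kappa> * real (i + j)" using \<kappa> by (intro mult_left_mono) auto
    also have "\<dots> \<le> norm (weight s i j)" by (rule weight_lower[OF s])
    finally have "?\<kappa> \<le> norm (weight s i j)" by simp
    then show ?thesis using \<kappa> by (simp add: norm_divide frac_le del: min_less_iff_conj)
  qed
  then have "(\<Sum>j<n. \<Sum>i<n. norm (cf (bI s f) i j) * r ^ (i + j)) \<le> (\<Sum>j<n. \<Sum>i<n. (norm (cf f i j) / ?\<kappa>) * r ^ (i + j))"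
    using r by (intro sum_mono mult_right_mono) auto
  also have "\<dots> = (\<Sum>j<n. \<Sum>i<n. norm (cf f i j) * r ^ (i + j)) / ?\<kappa>"
    by (simp add: sum_divide_distrib)
  also have "\<dots> \<le> M / ?\<kappa>" using f \<kappa> by (intro divide_right_mono) (auto simp: majorized_def)
  finally show "(\<Sum>j<n. \<Sum>i<n. norm (cf (bI s f) i j) * r ^ (i + j)) \<le> M / ?\<kappa>" .
qed

lemma majorized_bX: "0 \<le> r \<Longrightarrow> majorized r bX r"
  and majorized_bY: "0 \<le> r \<Longrightarrow> majorized r bY r"
proof -
  assume r: "0 \<le> r"
  have "(\<Sum>j<n. \<Sum>i<n. norm (cf bX i j) * r ^ (i + j)) \<le> r" for n
  proof -
    have "norm (cf bX i j) * r ^ (i + j) = (if j = 0 then if i = 1 then r else 0 else 0)" for i j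
      by (auto simp: cf_bX)
    then have "(\<Sum>j<n. \<Sum>i<n. norm (cf bX i j) * r ^ (i + j)) = (\<Sum>j<n. \<Sum>i<n. if j = 0 then if i = 1 then r else 0 else 0)"
      by (intro sum.cong refl)
    also have "\<dots> = (\<Sum>j<n. if j = 0 then (\<Sum>i<n. if i = 1 then r else 0) else 0)"
      by (intro sum.cong refl) auto
    also have "\<dots> \<le> r" using r by simp
    finally show ?thesis .
  qed
  then show "majorized r bX r" unfolding majorized_def by blast
  have "(\<Sum>j<n. \<Sum>i<n. norm (cf bY i j) * r ^ (i + j)) \<le> r" for n
  proof -
    have "norm (cf bY i j) * r ^ (i + j) = (if j = 1 then if i = 0 then r else 0 else 0)" for i j
      by (auto simp: cf_bY)
    then have "(\<Sum>j<n. \<Sum>i<n. norm (cf bY i j) * r ^ (i + j)) = (\<Sum>j<n. \<Sum>i<n. if j = 1 then if i = 0 then r else 0 else 0)"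
      by (intro sum.cong refl)
    also have "\<dots> = (\<Sum>j<n. if j = 1 then (\<Sum>i<n. if i = 0 then r else 0) else 0)"
      by (intro sum.cong refl) auto
    also have "\<dots> \<le> r" using r by simp
    finally show ?thesis .
  qed
  then show "majorized r bY r" unfolding majorized_def by blast
qed

lemma majorized_eqN:
  assumes "\<And>n. eqN n f (g n)" "\<And>n. majorized r (g n) M"
  shows "majorized r f M"
  unfolding majorized_def
proof
  fix n
  \<comment> \<open>Indices in the \<open>n\<close> by \<open>n\<close> square have total degree
    below \<open>2 * n\<close>, so one approximant covers the whole partial sum.\<close>
  have "(\<Sum>j<n. \<Sum>i<n. norm (cf f i j) * r ^ (i + j)) = (\<Sum>j<n. \<Sum>i<n. norm (cf (g (2 * n)) i j) * r ^ (i + j))"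
    using assms(1)[of "2 * n"] by (intro sum.cong refl) (auto simp: eqN_def)
  then show "(\<Sum>j<n. \<Sum>i<n. norm (cf f i j) * r ^ (i + j)) \<le> M"
    using assms(2) by (auto simp: majorized_def)
qed

section \<open>The series solution\<close>

text \<open>\<open>ti\<close> is the exponent at infinity, \<open>A = \<theta>0^2 / 4\<close> and
  \<open>B = rho^2 - \<theta>x^2 / 4\<close>. They are free parameters here, so that the dependence
  on \<open>s\<close> and \<open>a\<close> alone can be studied with the others fixed.\<close>

locale pvi_series =
  fixes ti A rho B s a :: complex
begin

text \<open>
  With \<open>x = X Y\<close>, the unknowns \<open>(E, F, z, P, K)\<close> encode \<open>y = a Y E\<close>, \<open>e = x / y = X F / a\<close>,
  \<open>\<zeta> = rho + s / 2 + z\<close>, \<open>P = 1 / (1 - e)\<close> and \<open>K = 1 / (1 - x)\<close>; \<open>J = (y - x) / (1 - x)\<close> and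
  \<open>h = D E / E\<close>. PVI is the system \<open>D y = (h + 1 - s) y\<close>, \<open>D \<zeta> = G\<close>. The term \<open>-2 bI s G\<close> in \<open>h\<close> stands
  for \<open>-2 z\<close>; with it each step of the iteration gains a degree.
\<close>

definition "e_of F = bX * (bC (1 / a) * F)"
definition "y_of E = bY * (bC a * E)"
definition "z_of z = bC (rho + s / 2) + z"
definition "J_of E F K = y_of E * (K * (1 - e_of F))"
definition "Q_of F P = e_of F * P"
definition "G_of E F z P K = J_of E F K * (bC (1 - ti) * z_of z - z_of z * z_of z)
   + Q_of F P * (bC (2 * rho) * z_of z - z_of z * z_of z - bC B)
   - e_of F * (bC A * K * (1 - e_of F))"
definition "h_of E F z P K = J_of E F K * (2 * z_of z - bC (1 - ti)) - 2 * bI s (G_of E F z P K)"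

text \<open>Inverses are unknowns with fixed point equations of their own: \<open>F\<close> for
  \<open>1 / E\<close>, and \<open>P\<close>, \<open>K\<close> for geometric series. So only ring
  operations and \<open>bI\<close> occur, which respect degree agreement, majorants and rational
  dependence on the parameters.\<close>

definition step :: "bps \<times> bps \<times> bps \<times> bps \<times> bps \<Rightarrow> bps \<times> bps \<times> bps \<times> bps \<times> bps" where
  "step = (\<lambda>(E, F, z, P, K).
     (1 + bI s (h_of E F z P K * E), 1 - bI s (h_of E F z P K * F), bI s (G_of E F z P K),
      1 + e_of F * P, 1 + bX * (bY * K)))"

definition iter :: "nat \<Rightarrow> bps \<times> bps \<times> bps \<times> bps \<times> bps" where
  "iter n = (step ^^ n) (1, 1, 0, 1, 1)"

lemma iter_Suc: "iter (Suc n) = step (iter n)" by (simp add: iter_def)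

lemma zero_coeffs: "cf (e_of F) 0 0 = 0" "cf (y_of E) 0 0 = 0" "cf (J_of E F K) 0 0 = 0" "cf (Q_of F P) 0 0 = 0"
  "cf (G_of E F z P K) 0 0 = 0" "cf (h_of E F z P K) 0 0 = 0"
  by (simp_all add: e_of_def y_of_def J_of_def Q_of_def G_of_def h_of_def cf_mult cf_bX cf_bY)

definition eq5 :: "nat \<Rightarrow> bps \<times> bps \<times> bps \<times> bps \<times> bps \<Rightarrow> bps \<times> bps \<times> bps \<times> bps \<times> bps \<Rightarrow> bool" where
  "eq5 n w w' \<longleftrightarrow> eqN n (fst w) (fst w') \<and> eqN n (fst (snd w)) (fst (snd w')) \<and> eqN n (fst (snd (snd w))) (fst (snd (snd w'))) \<and>
     eqN n (fst (snd (snd (snd w)))) (fst (snd (snd (snd w')))) \<and> eqN n (snd (snd (snd (snd w)))) (snd (snd (snd (snd w'))))"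

text \<open>Every unknown enters either with an explicit factor \<open>bX\<close> or
  \<open>bY\<close>, through \<open>e_of\<close> and \<open>y_of\<close>, or multiplied by a series
  without constant term.\<close>

lemma step_contracts: "eq5 n w w' \<Longrightarrow> eq5 (Suc n) (step w) (step w')"
proof -
  obtain E F z P K where w: "w = (E, F, z, P, K)" by (cases w) auto
  obtain E' F' z' P' K' where w': "w' = (E', F', z', P', K')" by (cases w') auto
  assume "eq5 n w w'"
  then have h: "eqN n E E'" "eqN n F F'" "eqN n z z'" "eqN n P P'" "eqN n K K'"
    by (auto simp: eq5_def w w')
  have e: "eqN (Suc n) (e_of F) (e_of F')" unfolding e_of_def by (intro eqN_bX eqN_mult h eqN_refl)
  have y: "eqN (Suc n) (y_of E) (y_of E')" unfolding y_of_def by (intro eqN_bY eqN_mult h eqN_refl)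
  have e': "eqN n (e_of F) (e_of F')" by (rule eqN_mono[OF e]) simp
  have zz: "eqN n (z_of z) (z_of z')" unfolding z_of_def by (intro eqN_add h eqN_refl)
  have J: "eqN (Suc n) (J_of E F K) (J_of E' F' K')" unfolding J_of_def
    by (intro eqN_mult_strict y zero_coeffs eqN_mult h eqN_diff e' eqN_refl)
  have Q: "eqN (Suc n) (Q_of F P) (Q_of F' P')" unfolding Q_of_def
    by (intro eqN_mult_strict e zero_coeffs h)
  have G: "eqN (Suc n) (G_of E F z P K) (G_of E' F' z' P' K')" unfolding G_of_def
    by (intro eqN_add eqN_diff[of "Suc n"] eqN_mult_strict J Q e zero_coeffs eqN_mult eqN_diff[of n] zz h e' eqN_refl)
  have H: "eqN (Suc n) (h_of E F z P K) (h_of E' F' z' P' K')" unfolding h_of_def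
    by (intro eqN_diff[of "Suc n"] eqN_mult_strict J zero_coeffs eqN_mult[of n] eqN_diff[of n] zz eqN_refl eqN_mult[of "Suc n"] eqN_bI G)
  show ?thesis
    unfolding w w' eq5_def step_def prod.case fst_conv snd_conv
    by (intro conjI eqN_add eqN_diff eqN_bI eqN_mult_strict H G e zero_coeffs h eqN_bX eqN_refl
        eqN_mono[OF eqN_bY[OF h(5)]]) simp_all
qed

lemma eq5_mono: "eq5 n w w' \<Longrightarrow> m \<le> n \<Longrightarrow> eq5 m w w'"
  by (auto simp: eq5_def intro: eqN_mono)

lemma eq5_trans: "eq5 n w w' \<Longrightarrow> eq5 n w' w'' \<Longrightarrow> eq5 n w w''"
  by (auto simp: eq5_def intro: eqN_trans)

lemma eq5_refl: "eq5 n w w" by (auto simp: eq5_def)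

lemma iter_stable: "n \<le> m \<Longrightarrow> eq5 n (iter n) (iter m)"
proof (induction m rule: dec_induct)
  case base
  then show ?case by (rule eq5_refl)
next
  case (step m)
  have "eq5 m (iter m) (iter (Suc m))" for m
  proof (induction m)
    case 0
    then show ?case by (auto simp: eq5_def)
  next
    case (Suc m)
    then show ?case unfolding iter_Suc[of "Suc m"] iter_Suc[of m] by (rule step_contracts)
  qed
  then show ?case using step eq5_mono eq5_trans by blast
qed

text \<open>The coefficient of total degree \<open>i + j\<close> no longer changes after
  \<open>i + j + 1\<close> steps.\<close>

definition lim5 :: "(bps \<times> bps \<times> bps \<times> bps \<times> bps \<Rightarrow> bps) \<Rightarrow> bps" where
  "lim5 \<pi> = Abs_fps (\<lambda>j. Abs_fps (\<lambda>i. cf (\<pi> (iter (Suc (i + j)))) i j))"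

definition "sE = lim5 fst"
definition "sF = lim5 (fst \<circ> snd)"
definition "sz = lim5 (fst \<circ> snd \<circ> snd)"
definition "sP = lim5 (fst \<circ> snd \<circ> snd \<circ> snd)"
definition "sK = lim5 (snd \<circ> snd \<circ> snd \<circ> snd)"

lemma cf_lim5: "cf (lim5 \<pi>) i j = cf (\<pi> (iter (Suc (i + j)))) i j"
  by (simp add: lim5_def cf_def)

lemma sol_eq5: "eq5 n (sE, sF, sz, sP, sK) (iter n)"
proof -
  have *: "eqN n (lim5 \<pi>) (\<pi> (iter n))" if "\<And>m w w'. eq5 m w w' \<Longrightarrow> eqN m (\<pi> w) (\<pi> w')" for \<pi>
    unfolding eqN_def cf_lim5 using that[OF iter_stable] by (auto simp: eqN_def Suc_le_eq)
  show ?thesis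
    unfolding sE_def sF_def sz_def sP_def sK_def
    using *[of fst] *[of "fst \<circ> snd"] *[of "fst \<circ> snd \<circ> snd"] *[of "fst \<circ> snd \<circ> snd \<circ> snd"] *[of "snd \<circ> snd \<circ> snd \<circ> snd"]
    by (simp add: eq5_def)
qed

lemma sol_fixed: "step (sE, sF, sz, sP, sK) = (sE, sF, sz, sP, sK)"
proof -
  let ?w = "(sE, sF, sz, sP, sK)"
  have "eq5 n (step ?w) ?w" for n
  proof -
    have 1: "eq5 (Suc n) (step ?w) (iter (Suc n))" unfolding iter_Suc by (rule step_contracts[OF sol_eq5])
    have 2: "eq5 (Suc n) ?w (iter (Suc n))" by (rule sol_eq5)
    show ?thesis
      using 1 2 unfolding eq5_def by (auto intro: eqN_mono[OF eqN_trans[OF _ eqN_sym]])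
  qed
  then show ?thesis unfolding eq5_def by (intro prod_eqI) (auto intro!: eqN_all)
qed

lemma sol_eqs: "sE = 1 + bI s (h_of sE sF sz sP sK * sE)" "sF = 1 - bI s (h_of sE sF sz sP sK * sF)"
  "sz = bI s (G_of sE sF sz sP sK)" "sP = 1 + e_of sF * sP" "sK = 1 + bX * (bY * sK)"
  using sol_fixed unfolding step_def prod.case by (metis prod.inject)+

definition bounded5 :: "real \<Rightarrow> bps \<times> bps \<times> bps \<times> bps \<times> bps \<Rightarrow> bool" where
  "bounded5 r w \<longleftrightarrow> majorized r (fst w - 1) (1/2) \<and> majorized r (fst (snd w) - 1) (1/2) \<and> majorized r (fst (snd (snd w))) 1 \<and>
     majorized r (fst (snd (snd (snd w)))) 2 \<and> majorized r (snd (snd (snd (snd w)))) 2"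

text \<open>\<open>e_of\<close> and \<open>y_of\<close> carry a factor \<open>r\<close>, hence so do
  the majorants of \<open>J\<close>, \<open>Q\<close>, \<open>G\<close> and \<open>h\<close>;
  \<open>CJ\<close>, \<open>CQ\<close>, \<open>CG\<close>, \<open>CH\<close> are what remains, using
  the bound 2 for \<open>E\<close>, \<open>F\<close>, \<open>P\<close>, \<open>K\<close> and 1 for
  \<open>z\<close>. For small \<open>r\<close> the set \<open>bounded5 r\<close> is mapped into
  itself.\<close>

lemma step_bounded:
  assumes s: "0 < Re s" "Re s < 1" and a: "a \<noteq> 0"
  obtains r where "r > 0" "r < 1" "r * norm a \<le> 1/4" "r / norm a \<le> 1/4" "\<And>w. bounded5 r w \<Longrightarrow> bounded5 r (step w)"
proof -
  define \<kappa> where "\<kappa> = min (Re s) (1 - Re s)"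
  have \<kappa>: "\<kappa> > 0" using s by (simp add: \<kappa>_def)
  define na ia where "na = norm a" and "ia = norm (1 / a)"
  have na: "na > 0" "ia > 0" using a by (auto simp: na_def ia_def)
  define Z where "Z = norm (rho + s / 2) + 1"
  have Z: "Z > 0" unfolding Z_def by (smt (verit) norm_ge_zero)
  define CJ where "CJ = na * 2 * (2 * (1 + ia * 2))"
  define CQ where "CQ = ia * 2 * 2"
  define CG where "CG = CJ * (norm (1 - ti) * Z + Z * Z) + CQ * (norm (2 * rho) * Z + Z * Z + norm B) + ia * 2 * (norm A * 2 * (1 + ia * 2))"
  define CH where "CH = CJ * (norm (2 :: complex) * Z + norm (1 - ti)) + norm (2 :: complex) * (CG / \<kappa>)"
  have C: "CJ \<ge> 0" "CQ \<ge> 0" "CG \<ge> 0" "CH \<ge> 0"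
    using na Z \<kappa> by (auto simp: CJ_def CQ_def CG_def CH_def)
  \<comment> \<open>Each summand is one smallness requirement on \<open>r\<close>; with
    \<open>r = 1 / (2 * D)\<close> all of them hold in the form
    \<open>r * c \<le> 1/2\<close>.\<close>
  define D where "D = 1 + na * 4 + ia * 4 + CG / \<kappa> + 4 * CH / \<kappa>"
  have D: "D > 0" "na * 4 \<le> D" "ia * 4 \<le> D" "CG / \<kappa> \<le> D" "4 * CH / \<kappa> \<le> D" "1 \<le> D"
    using na C \<kappa> by (auto simp: D_def add_nonneg_nonneg add_pos_nonneg)
  define r where "r = 1 / (2 * D)"
  have r: "r > 0" "r < 1" using D by (auto simp: r_def divide_simps)
  have rD: "r * c \<le> 1/2" if "c \<le> D" for c using that D(1) by (simp add: r_def divide_simps)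
  show ?thesis
  proof (rule that[OF r])
    show "r * norm a \<le> 1/4" using rD[OF D(2)] r by (simp add: na_def)
    show "r / norm a \<le> 1/4" using rD[OF D(3)] r by (simp add: ia_def norm_divide)
    fix w assume "bounded5 r w"
    obtain E F z P K where w: "w = (E, F, z, P, K)" by (cases w) auto
    have b: "majorized r (E - 1) (1/2)" "majorized r (F - 1) (1/2)" "majorized r z 1" "majorized r P 2" "majorized r K 2"
      using \<open>bounded5 r w\<close> by (auto simp: bounded5_def w)
    have r0: "0 \<le> r" using r by simp
    have "majorized r ((E - 1) + 1) (1/2 + 1)" by (intro majorized_add b majorized_1 r0)
    from majorized_mono[OF this, of 2] have bE: "majorized r E 2" by simp
    have "majorized r ((F - 1) + 1) (1/2 + 1)" by (intro majorized_add b majorized_1 r0)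
    from majorized_mono[OF this, of 2] have bF: "majorized r F 2" by simp
    note M = majorized_mult[OF _ _ r0] majorized_add[OF _ _ r0] majorized_diff[OF _ _ r0] majorized_const majorized_1
    have e: "majorized r (e_of F) (r * (ia * 2))" unfolding e_of_def ia_def by (intro M majorized_bX r0 bF)
    have y: "majorized r (y_of E) (r * (na * 2))" unfolding y_of_def na_def by (intro M majorized_bY r0 bE)
    have e1: "majorized r (1 - e_of F) (1 + ia * 2)"
    proof (rule majorized_mono)
      show "majorized r (1 - e_of F) (1 + r * (ia * 2))" by (intro M e)
      show "1 + r * (ia * 2) \<le> 1 + ia * 2" using r na by (simp add: mult_left_le_one_le)
    qed
    have zz: "majorized r (z_of z) Z" unfolding z_of_def Z_def by (intro M b)
    have J: "majorized r (J_of E F K) (r * CJ)"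
    proof -
      have "majorized r (J_of E F K) (r * (na * 2) * (2 * (1 + ia * 2)))" unfolding J_of_def by (intro M y b e1)
      then show ?thesis by (simp add: CJ_def mult_ac)
    qed
    have Q: "majorized r (Q_of F P) (r * CQ)"
    proof -
      have "majorized r (Q_of F P) (r * (ia * 2) * 2)" unfolding Q_of_def by (intro M e b)
      then show ?thesis by (simp add: CQ_def mult_ac)
    qed
    have G: "majorized r (G_of E F z P K) (r * CG)"
    proof -
      have "majorized r (G_of E F z P K) (r * CJ * (norm (1 - ti) * Z + Z * Z) + r * CQ * (norm (2 * rho) * Z + Z * Z + norm B) + r * (ia * 2) * (norm A * 2 * (1 + ia * 2)))"
        unfolding G_of_def by (intro M J Q e e1 zz b)
      then show ?thesis by (simp add: CG_def distrib_left mult_ac)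
    qed
    have IG: "majorized r (bI s (G_of E F z P K)) (r * CG / \<kappa>)"
      unfolding \<kappa>_def by (intro majorized_bI G r0 s)
    have two: "majorized r 2 (norm (2 :: complex))" using majorized_const[of r 2] by (simp add: bC_simps)
    have H: "majorized r (h_of E F z P K) (r * CH)"
    proof -
      have "majorized r (h_of E F z P K) (r * CJ * (norm (2 :: complex) * Z + norm (1 - ti)) + norm (2 :: complex) * (r * CG / \<kappa>))"
        unfolding h_of_def by (intro M J zz two IG)
      then show ?thesis by (simp add: CH_def distrib_left mult_ac)
    qed
    have HX: "majorized r (bI s (h_of E F z P K * X)) (1/2)" if X: "majorized r X 2" for X
    proof (rule majorized_mono)
      show "majorized r (bI s (h_of E F z P K * X)) (r * CH * 2 / \<kappa>)"
        unfolding \<kappa>_def by (intro majorized_bI M H X r0 s)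
      show "r * CH * 2 / \<kappa> \<le> 1/2"
        using rD[OF D(5)] by simp
    qed
    have H2: "majorized r (0 - bI s (h_of E F z P K * F)) (0 + 1/2)"
      using majorized_const[of r 0] by (intro M HX bF) (simp add: bC_simps)
    have P1: "majorized r (1 + e_of F * P) 2"
    proof (rule majorized_mono)
      show "majorized r (1 + e_of F * P) (1 + r * (ia * 2) * 2)" by (intro M e b)
      show "1 + r * (ia * 2) * 2 \<le> 2" using rD[OF D(3)] by simp
    qed
    have K1: "majorized r (1 + bX * (bY * K)) 2"
    proof (rule majorized_mono)
      show "majorized r (1 + bX * (bY * K)) (1 + r * (r * 2))" by (intro M majorized_bX majorized_bY r0 b)
      have "r * r \<le> r * 1" using r by (intro mult_left_mono) auto
      then show "1 + r * (r * 2) \<le> 2" using rD[OF D(6)] by simp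
    qed
    have "r * CG / \<kappa> \<le> 1 / 2" using rD[OF D(4)] by (simp only: times_divide_eq_right)
    then have "majorized r (bI s (G_of E F z P K)) 1"
      by (intro majorized_mono[OF IG]) linarith
    then show "bounded5 r (step w)"
      using HX[OF bE] H2 P1 K1 by (simp add: w step_def bounded5_def)
  qed
qed

lemma sol_bounded:
  assumes "0 < Re s" "Re s < 1" "a \<noteq> 0"
  obtains r where "r > 0" "r < 1" "r * norm a \<le> 1/4" "r / norm a \<le> 1/4" "bounded5 r (sE, sF, sz, sP, sK)"
proof -
  obtain r where r: "r > 0" "r < 1" "r * norm a \<le> 1/4" "r / norm a \<le> 1/4" "\<And>w. bounded5 r w \<Longrightarrow> bounded5 r (step w)"
    using step_bounded[OF assms] by metis
  have b: "bounded5 r (iter n)" for n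
  proof (induction n)
    case 0
    have "majorized r 0 c" if "c \<ge> 0" for c using that by (simp add: majorized_def)
    moreover have "majorized r 1 2" by (rule majorized_mono[OF majorized_1]) simp
    ultimately show ?case by (simp add: iter_def bounded5_def)
  next
    case (Suc n)
    then show ?case unfolding iter_Suc by (rule r(5))
  qed
  have "bounded5 r (sE, sF, sz, sP, sK)"
    unfolding bounded5_def fst_conv snd_conv
  proof (intro conjI)
    have b1: "majorized r (fst (iter n) - 1) (1/2)" "majorized r (fst (snd (iter n)) - 1) (1/2)" "majorized r (fst (snd (snd (iter n)))) 1"
      "majorized r (fst (snd (snd (snd (iter n))))) 2" "majorized r (snd (snd (snd (snd (iter n))))) 2" for n
      using b[of n] by (auto simp: bounded5_def)
    have e1: "eqN n sE (fst (iter n))" "eqN n sF (fst (snd (iter n)))" "eqN n sz (fst (snd (snd (iter n))))"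
      "eqN n sP (fst (snd (snd (snd (iter n)))))" "eqN n sK (snd (snd (snd (snd (iter n)))))" for n
      using sol_eq5[of n] by (auto simp: eq5_def)
    show "majorized r (sE - 1) (1/2)" by (rule majorized_eqN[OF eqN_diff[OF e1(1) eqN_refl] b1(1)])
    show "majorized r (sF - 1) (1/2)" by (rule majorized_eqN[OF eqN_diff[OF e1(2) eqN_refl] b1(2)])
    show "majorized r sz 1" by (rule majorized_eqN[OF e1(3) b1(3)])
    show "majorized r sP 2" by (rule majorized_eqN[OF e1(4) b1(4)])
    show "majorized r sK 2" by (rule majorized_eqN[OF e1(5) b1(5)])
  qed
  then show ?thesis using that r by blast
qed

end

section \<open>Rational dependence of the coefficients on \<open>s\<close> and
  \<open>a\<close>\<close>

abbreviation (input) pvi_domain :: "(complex \<times> complex) set" where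
  "pvi_domain \<equiv> {(s, a). a \<noteq> 0 \<and> 0 < Re s \<and> Re s < 1}"

lemma eval2_ops: "eval2 (P + Q) s a = eval2 P s a + eval2 Q s a" "eval2 (P - Q) s a = eval2 P s a - eval2 Q s a"
  "eval2 (P * Q) s a = eval2 P s a * eval2 Q s a" "eval2 [:[:c:]:] s a = c" "eval2 [:[:0, 1:]:] s a = s" "eval2 [:0, 1:] s a = a"
  by (simp_all add: eval2_def)

lemma rational_fun2_on_iff:
  "rational_fun2_on D f \<longleftrightarrow> (\<exists>P Q. \<forall>s a. (s, a) \<in> D \<longrightarrow> eval2 Q s a \<noteq> 0 \<and> f s a = eval2 P s a / eval2 Q s a)"
  unfolding rational_fun2_on_def by (intro ex_cong1) auto

lemma rational_fun2_on_poly: "(\<And>s a. f s a = eval2 P s a) \<Longrightarrow> rational_fun2_on D f"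
  unfolding rational_fun2_on_iff by (rule exI[of _ P], rule exI[of _ "[:[:1:]:]"]) (simp add: eval2_ops)

lemma rational_fun2_on_const: "rational_fun2_on D (\<lambda>s a. c)"
  by (rule rational_fun2_on_poly[of _ "[:[:c:]:]"]) (simp add: eval2_ops)

lemma rational_fun2_on_fst: "rational_fun2_on D (\<lambda>s a. s)"
  by (rule rational_fun2_on_poly[of _ "[:[:0, 1:]:]"]) (simp add: eval2_ops)

lemma rational_fun2_on_snd: "rational_fun2_on D (\<lambda>s a. a)"
  by (rule rational_fun2_on_poly[of _ "[:0, 1:]"]) (simp add: eval2_ops)

lemma rational_fun2_on_add:
  assumes "rational_fun2_on D f" "rational_fun2_on D g"
  shows "rational_fun2_on D (\<lambda>s a. f s a + g s a)"
proof -
  obtain P Q P' Q' where PQ: "\<And>s a. (s, a) \<in> D \<Longrightarrow> eval2 Q s a \<noteq> 0 \<and> f s a = eval2 P s a / eval2 Q s a"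
    "\<And>s a. (s, a) \<in> D \<Longrightarrow> eval2 Q' s a \<noteq> 0 \<and> g s a = eval2 P' s a / eval2 Q' s a"
    using assms unfolding rational_fun2_on_iff by blast
  show ?thesis unfolding rational_fun2_on_iff
    by (intro exI[of _ "P * Q' + P' * Q"] exI[of _ "Q * Q'"]) (use PQ in \<open>auto simp: eval2_ops add_frac_eq\<close>)
qed

lemma rational_fun2_on_mult:
  assumes "rational_fun2_on D f" "rational_fun2_on D g"
  shows "rational_fun2_on D (\<lambda>s a. f s a * g s a)"
proof -
  obtain P Q P' Q' where PQ: "\<And>s a. (s, a) \<in> D \<Longrightarrow> eval2 Q s a \<noteq> 0 \<and> f s a = eval2 P s a / eval2 Q s a"
    "\<And>s a. (s, a) \<in> D \<Longrightarrow> eval2 Q' s a \<noteq> 0 \<and> g s a = eval2 P' s a / eval2 Q' s a"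
    using assms unfolding rational_fun2_on_iff by blast
  show ?thesis unfolding rational_fun2_on_iff
    by (intro exI[of _ "P * P'"] exI[of _ "Q * Q'"]) (use PQ in \<open>auto simp: eval2_ops\<close>)
qed

lemma rational_fun2_on_inverse:
  assumes "rational_fun2_on D f" "\<And>s a. (s, a) \<in> D \<Longrightarrow> f s a \<noteq> 0"
  shows "rational_fun2_on D (\<lambda>s a. 1 / f s a)"
proof -
  obtain P Q where PQ: "\<And>s a. (s, a) \<in> D \<Longrightarrow> eval2 Q s a \<noteq> 0 \<and> f s a = eval2 P s a / eval2 Q s a"
    using assms unfolding rational_fun2_on_iff by blast
  then have "eval2 P s a \<noteq> 0" if "(s, a) \<in> D" for s a using assms(2)[OF that] PQ[OF that] by auto
  then show ?thesis unfolding rational_fun2_on_iff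
    by (intro exI[of _ Q] exI[of _ P]) (use PQ in auto)
qed

lemma rational_fun2_on_sum:
  "(\<And>k. k \<in> I \<Longrightarrow> rational_fun2_on D (f k)) \<Longrightarrow> rational_fun2_on D (\<lambda>s a. \<Sum>k\<in>I. f k s a)"
  by (induction I rule: infinite_finite_induct) (auto intro: rational_fun2_on_const rational_fun2_on_add)

definition rational_bps :: "(complex \<Rightarrow> complex \<Rightarrow> bps) \<Rightarrow> bool" where
  "rational_bps f \<longleftrightarrow> (\<forall>i j. rational_fun2_on pvi_domain (\<lambda>s a. cf (f s a) i j))"

lemma rational_bps_add: "rational_bps f \<Longrightarrow> rational_bps g \<Longrightarrow> rational_bps (\<lambda>s a. f s a + g s a)"
  by (simp add: rational_bps_def rational_fun2_on_add)

lemma rational_bps_mult: "rational_bps f \<Longrightarrow> rational_bps g \<Longrightarrow> rational_bps (\<lambda>s a. f s a * g s a)"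
  by (simp add: rational_bps_def cf_mult rational_fun2_on_mult rational_fun2_on_sum)

lemma rational_bps_bC: "rational_fun2_on pvi_domain c \<Longrightarrow> rational_bps (\<lambda>s a. bC (c s a))"
  unfolding rational_bps_def cf_bC
  by (intro allI, rename_tac i j, case_tac "i = 0 \<and> j = 0") (simp_all only: if_True if_False simp_thms rational_fun2_on_const)

lemma rational_bps_const: "(\<And>i j. cf f i j = c i j) \<Longrightarrow> rational_bps (\<lambda>s a. f)"
  by (simp add: rational_bps_def rational_fun2_on_const)

lemma rational_bps_diff:
  assumes "rational_bps f" "rational_bps g"
  shows "rational_bps (\<lambda>s a. f s a - g s a)"
proof -
  have "rational_bps (\<lambda>s a. f s a + bC (- 1) * g s a)"
    by (intro rational_bps_add assms rational_bps_mult rational_bps_bC rational_fun2_on_const)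
  then show ?thesis by (simp add: bC_simps)
qed

text \<open>The weight is linear in \<open>s\<close> and, apart from the constant term, has no zero
  in the strip; so it may become a denominator on the whole domain.\<close>

lemma rational_bps_bI:
  assumes "rational_bps f"
  shows "rational_bps (\<lambda>s a. bI s (f s a))"
  unfolding rational_bps_def
proof (intro allI)
  fix i j
  show "rational_fun2_on pvi_domain (\<lambda>s a. cf (bI s (f s a)) i j)"
  proof (cases "i + j = 0")
    case True
    then show ?thesis by (simp add: rational_fun2_on_const)
  next
    case False
    have 1: "rational_fun2_on pvi_domain (\<lambda>s a. weight s i j)"
      by (rule rational_fun2_on_poly[of _ "[:[:of_nat j, of_nat i - of_nat j:]:]"]) (simp add: eval2_def weight_def algebra_simps)
    have "rational_fun2_on pvi_domain (\<lambda>s a. cf (f s a) i j * (1 / weight s i j))"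
      using assms False weight_nz by (intro rational_fun2_on_mult rational_fun2_on_inverse 1) (auto simp: rational_bps_def)
    then show ?thesis by simp
  qed
qed

text \<open>Each coefficient is one of a finite iterate, and the iteration starts from constants and
  divides only by \<open>a\<close> and by weights.\<close>

lemma rational_sE: "rational_fun2_on pvi_domain (\<lambda>s a. cf (pvi_series.sE ti A rho B s a) i j)"
proof -
  define E where "E n s a = fst (pvi_series.iter ti A rho B s a n)" for n s a
  define F where "F n s a = fst (snd (pvi_series.iter ti A rho B s a n))" for n s a
  define z where "z n s a = fst (snd (snd (pvi_series.iter ti A rho B s a n)))" for n s a
  define P where "P n s a = fst (snd (snd (snd (pvi_series.iter ti A rho B s a n))))" for n s a
  define K where "K n s a = snd (snd (snd (snd (pvi_series.iter ti A rho B s a n))))" for n s a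
  have it: "pvi_series.iter ti A rho B s a n = (E n s a, F n s a, z n s a, P n s a, K n s a)" for n s a
    by (simp add: E_def F_def z_def P_def K_def)
  have "rational_bps (E n) \<and> rational_bps (F n) \<and> rational_bps (z n) \<and> rational_bps (P n) \<and> rational_bps (K n)" for n
  proof (induction n)
    case 0
    have "(E 0 s a, F 0 s a, z 0 s a, P 0 s a, K 0 s a) = (1, 1, 0, 1, 1)" for s a
      unfolding it[symmetric] by (simp add: pvi_series.iter_def)
    then have "E 0 = (\<lambda>s a. 1)" "F 0 = (\<lambda>s a. 1)" "z 0 = (\<lambda>s a. 0)" "P 0 = (\<lambda>s a. 1)" "K 0 = (\<lambda>s a. 1)"
      by (auto simp: fun_eq_iff)
    then show ?case by (simp only:) (intro conjI rational_bps_const[OF refl])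
  next
    case (Suc n)
    then have IH: "rational_bps (E n)" "rational_bps (F n)" "rational_bps (z n)" "rational_bps (P n)" "rational_bps (K n)" by auto
    note R = rational_bps_add rational_bps_mult rational_bps_diff rational_bps_bI rational_bps_bC rational_bps_const[OF refl, of 1] rational_bps_const[OF refl, of bX] rational_bps_const[OF refl, of bY] rational_bps_const[OF refl, of 2] IH
      rational_fun2_on_const rational_fun2_on_fst rational_fun2_on_snd rational_fun2_on_mult rational_fun2_on_add
    have ia: "rational_fun2_on pvi_domain (\<lambda>s a. 1 / a)"
      by (rule rational_fun2_on_inverse) (auto intro: R)
    have s2: "rational_fun2_on pvi_domain (\<lambda>s a. rho + s / 2)"
      using rational_fun2_on_add[OF rational_fun2_on_const[of _ rho] rational_fun2_on_mult[OF rational_fun2_on_fst rational_fun2_on_const[of _ "1/2"]]] by simp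
    have e: "rational_bps (\<lambda>s a. pvi_series.e_of a (F n s a))" unfolding pvi_series.e_of_def by (intro R ia)
    have y: "rational_bps (\<lambda>s a. pvi_series.y_of a (E n s a))" unfolding pvi_series.y_of_def by (intro R)
    have zz: "rational_bps (\<lambda>s a. pvi_series.z_of rho s (z n s a))" unfolding pvi_series.z_of_def by (intro R s2)
    have J: "rational_bps (\<lambda>s a. pvi_series.J_of a (E n s a) (F n s a) (K n s a))" unfolding pvi_series.J_of_def by (intro R e y)
    have Q: "rational_bps (\<lambda>s a. pvi_series.Q_of a (F n s a) (P n s a))" unfolding pvi_series.Q_of_def by (intro R e)
    have G: "rational_bps (\<lambda>s a. pvi_series.G_of ti A rho B s a (E n s a) (F n s a) (z n s a) (P n s a) (K n s a))"
      unfolding pvi_series.G_of_def by (intro R e zz J Q)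
    have H: "rational_bps (\<lambda>s a. pvi_series.h_of ti A rho B s a (E n s a) (F n s a) (z n s a) (P n s a) (K n s a))"
      unfolding pvi_series.h_of_def by (intro R zz J G)
    have st: "(E (Suc n) s a, F (Suc n) s a, z (Suc n) s a, P (Suc n) s a, K (Suc n) s a) =
      pvi_series.step ti A rho B s a (E n s a, F n s a, z n s a, P n s a, K n s a)" for s a
      unfolding it[symmetric] by (rule pvi_series.iter_Suc)
    have "E (Suc n) = (\<lambda>s a. 1 + bI s (pvi_series.h_of ti A rho B s a (E n s a) (F n s a) (z n s a) (P n s a) (K n s a) * E n s a))"
      "F (Suc n) = (\<lambda>s a. 1 - bI s (pvi_series.h_of ti A rho B s a (E n s a) (F n s a) (z n s a) (P n s a) (K n s a) * F n s a))"
      "z (Suc n) = (\<lambda>s a. bI s (pvi_series.G_of ti A rho B s a (E n s a) (F n s a) (z n s a) (P n s a) (K n s a)))"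
      "P (Suc n) = (\<lambda>s a. 1 + pvi_series.e_of a (F n s a) * P n s a)" "K (Suc n) = (\<lambda>s a. 1 + bX * (bY * K n s a))"
      using st by (auto simp: fun_eq_iff pvi_series.step_def)
    then show ?case by (simp only:) (intro conjI R H G e)
  qed
  then show ?thesis
    by (simp add: pvi_series.sE_def pvi_series.cf_lim5 rational_bps_def E_def)
qed

section \<open>Algebraic identities between PVI and the equation for \<open>\<zeta>\<close>\<close>

lemma one_minus_J:
  fixes e y K :: "'a :: idom"
  assumes K: "K = 1 + y * e * K" and J: "J = y * (K * (1 - e))"
  shows "1 - J = K * (1 - y)"
  unfolding J using K by algebra

text \<open>For \<open>D y = g y\<close> and \<open>D z = G\<close> the left-hand side is
  \<open>D ((y / x) z)\<close> divided by \<open>y / x\<close>. It is stated over an integral domain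
  because it is applied both to formal series and to function values.\<close>

lemma G_identity:
  fixes e y z A B rho ti P K :: "'a :: idom"
  assumes P: "P = 1 + e * P" and K: "K = 1 + y * e * K" and J: "J = y * (K * (1 - e))"
    and G: "G = J * ((1 - ti) * z - z * z) + (e * P) * (2 * rho * z - z * z - B) - e * (A * K * (1 - e))"
    and g: "g = 1 - 2 * (z * (1 - J) - rho) - (1 - ti) * J"
    and Om: "Om = A * e + (1 - y * e) * P * (B * e - 2 * rho * z) + (1 - y) * P * z * z"
  shows "(g - 1) * z + G = K * (1 - y) * (A * e * e - z * z) - Om * K + A * K * y * e * e - y * K * z * z"
proof -
  have L: "1 - J = K * (1 - y)" by (rule one_minus_J[OF K J])
  have OK: "Om * K = A * e * K + P * (B * e - 2 * rho * z) + (K * (1 - y)) * P * z * z"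
    unfolding Om using K by algebra
  have Jp: "J * P = K * y" unfolding J using P by algebra
  show ?thesis
    unfolding G g OK L[symmetric] using P K Jp J by algebra
qed

text \<open>The left-hand side is \<open>D Om\<close>, expanded by the product rule with
  \<open>D z = G\<close> and \<open>D P = P^2 D e\<close>. Divided by \<open>ti\<close>,
  \<open>Om\<close> becomes the parameter \<open>\<eta>\<close> of the Schlesinger system.\<close>

lemma Om_identity:
  fixes e y z A B rho ti P K :: "'a :: idom"
  assumes P: "P = 1 + e * P" and K: "K = 1 + y * e * K" and J: "J = y * (K * (1 - e))"
    and G: "G = J * ((1 - ti) * z - z * z) + (e * P) * (2 * rho * z - z * z - B) - e * (A * K * (1 - e))"
    and g: "g = 1 - 2 * (z * (1 - J) - rho) - (1 - ti) * J"
    and Om: "Om = A * e + (1 - y * e) * P * (B * e - 2 * rho * z) + (1 - y) * P * z * z"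
    and De: "De = (1 - g) * e" and Dy: "Dy = g * y"
  shows "A * De + (- (Dy * e + y * De)) * P * (B * e - 2 * rho * z) + (1 - y * e) * (P * P * De) * (B * e - 2 * rho * z)
     + (1 - y * e) * P * (B * De - 2 * rho * G) - Dy * P * z * z + (1 - y) * (P * P * De) * z * z + (1 - y) * P * (2 * z * G)
    = - ti * (y * e * K * Om - A * y * e * K * e + y * K * z * z) + (1 - ti) * J * Om"
  unfolding De Dy Om g G J using P K by algebra

text \<open>Two expressions for \<open>D g\<close>: the left side differentiates the definition of
  \<open>g\<close> through \<open>z\<close>, with \<open>D z = G\<close> and \<open>DJ\<close> for
  \<open>D J\<close>; the right side is PVI for the logarithmic derivative \<open>g\<close> of
  \<open>y\<close>. It is read in both directions, to obtain PVI from \<open>D z = G\<close> and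
  conversely.\<close>

lemma PVI_identity:
  fixes x y z t0 tx t1 ti :: complex
  assumes n: "x \<noteq> 0" "x \<noteq> 1" "y \<noteq> 0" "y \<noteq> 1" "y \<noteq> x"
    and e: "e = x / y" and K: "K = 1 / (1 - x)" and P: "P = 1 / (1 - e)"
    and J: "J = y * (K * (1 - e))" and rho: "rho = - (ti + t1) / 2"
    and A: "A = t0\<^sup>2 / 4" and B: "B = rho\<^sup>2 - tx\<^sup>2 / 4"
    and G: "G = J * ((1 - ti) * z - z * z) + (e * P) * (2 * rho * z - z * z - B) - e * (A * K * (1 - e))"
    and g: "g = 1 - 2 * (z * (1 - J) - rho) - (1 - ti) * J"
    and DJ: "DJ = (g * y - x) / (1 - x) + (y - x) * x / (1 - x)\<^sup>2"
    and th: "t0\<^sup>2 = - 2 * \<beta>" "tx\<^sup>2 = 1 - 2 * \<delta>" "t1\<^sup>2 = 2 * \<gamma>" "(ti - 1)\<^sup>2 = 2 * \<alpha>"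
  shows "- 2 * G * (1 - J) + (2 * z - 1 + ti) * DJ =
     1/2 * (1 + y/(y - 1) + y/(y - x)) * g\<^sup>2 - (1 + x/(x - 1) + x/(y - x)) * g
     + (y - 1) * (y - x) / (x - 1)\<^sup>2 * (\<alpha> + \<beta> * (x / y\<^sup>2) + \<gamma> * ((x - 1) / (y - 1)\<^sup>2) + \<delta> * (x * (x - 1) / (y - x)\<^sup>2))
     - g\<^sup>2 + g"
proof -
  have be: "\<beta> = - t0\<^sup>2 / 2" "\<delta> = (1 - tx\<^sup>2) / 2" "\<gamma> = t1\<^sup>2 / 2" "\<alpha> = (ti - 1)\<^sup>2 / 2"
    using th by (simp_all add: field_simps)
  have nn: "1 - x \<noteq> 0" "x - 1 \<noteq> 0" "y - 1 \<noteq> 0" "y - x \<noteq> 0" "1 - e \<noteq> 0" using n by (auto simp: e field_simps)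
  define v q m i where "v = 1 / (1 - x)" and "q = 1 / (y - x)" and "m = 1 / (y - 1)" and "i = 1 / y"
  have r: "v * (1 - x) = 1" "q * (y - x) = 1" "m * (y - 1) = 1" "i * y = 1"
    using n nn by (simp_all add: v_def q_def m_def i_def)
  have Jx: "J = (y - x) * v" and Q: "e * P = x * q" and eK: "e * (A * K * (1 - e)) = A * x * (y - x) * i\<^sup>2 * v"
    using n nn by (simp_all add: J K P e v_def q_def i_def field_simps power2_eq_square)
  have J1: "1 - J = - ((y - 1) * v)" using r(1) by (simp add: Jx algebra_simps)
  have "2 * rho = - (ti + t1)" using rho by (simp add: mult.commute[of 2])
  then have t1: "t1 = - 2 * rho - ti" by algebra
  have D: "DJ = (g * y - x) * v + (y - x) * x * v\<^sup>2" by (simp add: DJ v_def power_divide)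
  have R: "1/2 * (1 + y/(y - 1) + y/(y - x)) * g\<^sup>2 - (1 + x/(x - 1) + x/(y - x)) * g
     + (y - 1) * (y - x) / (x - 1)\<^sup>2 * (\<alpha> + \<beta> * (x / y\<^sup>2) + \<gamma> * ((x - 1) / (y - 1)\<^sup>2) + \<delta> * (x * (x - 1) / (y - x)\<^sup>2))
     - g\<^sup>2 + g = 1/2 * (1 + m + x * q) * g\<^sup>2 + (x * v - x * q) * g
     + \<alpha> * (y - 1) * (y - x) * v\<^sup>2 + \<beta> * x * (y - 1) * (y - x) * i\<^sup>2 * v\<^sup>2 - \<gamma> * (y - x) * v * m - \<delta> * x * (y - 1) * v * q"
  proof -
    have 1: "y/(y - 1) = 1 + m" "y/(y - x) = 1 + x * q" "x/(x - 1) = - (x * v)" "x/(y - x) = x * q"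
      using nn by (simp_all add: m_def q_def v_def field_simps)
    have 2: "(y - 1) * (y - x) / (x - 1)\<^sup>2 = (y - 1) * (y - x) * v\<^sup>2" "x / y\<^sup>2 = x * i\<^sup>2"
      "(x - 1) / (y - 1)\<^sup>2 = (x - 1) * m\<^sup>2" "x * (x - 1) / (y - x)\<^sup>2 = x * (x - 1) * q\<^sup>2"
      by (simp_all add: m_def q_def v_def i_def power_divide power2_commute[of 1 x])
    have 3: "(y - 1) * (y - x) * v\<^sup>2 * ((x - 1) * m\<^sup>2) = (m * (y - 1)) * (v * (x - 1)) * ((y - x) * v * m)"
      "(y - 1) * (y - x) * v\<^sup>2 * (x * (x - 1) * q\<^sup>2) = (q * (y - x)) * (v * (x - 1)) * (x * (y - 1) * v * q)"
      by (simp_all only: power2_eq_square mult_ac)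
    have 4: "v * (x - 1) = - 1" using r(1) by (simp add: algebra_simps)
    have "(y - 1) * (y - x) * v\<^sup>2 * (\<alpha> + \<beta> * (x * i\<^sup>2) + \<gamma> * ((x - 1) * m\<^sup>2) + \<delta> * (x * (x - 1) * q\<^sup>2)) =
      \<alpha> * (y - 1) * (y - x) * v\<^sup>2 + \<beta> * x * (y - 1) * (y - x) * i\<^sup>2 * v\<^sup>2
      + \<gamma> * ((y - 1) * (y - x) * v\<^sup>2 * ((x - 1) * m\<^sup>2)) + \<delta> * ((y - 1) * (y - x) * v\<^sup>2 * (x * (x - 1) * q\<^sup>2))"
      by (simp only: distrib_left mult_ac)
    also have "\<dots> = \<alpha> * (y - 1) * (y - x) * v\<^sup>2 + \<beta> * x * (y - 1) * (y - x) * i\<^sup>2 * v\<^sup>2 - \<gamma> * (y - x) * v * m - \<delta> * x * (y - 1) * v * q"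
      unfolding 3 4 r by (simp add: algebra_simps)
    finally have fin: "(y - 1) * (y - x) * v\<^sup>2 * (\<alpha> + \<beta> * (x * i\<^sup>2) + \<gamma> * ((x - 1) * m\<^sup>2) + \<delta> * (x * (x - 1) * q\<^sup>2)) =
      \<alpha> * (y - 1) * (y - x) * v\<^sup>2 + \<beta> * x * (y - 1) * (y - x) * i\<^sup>2 * v\<^sup>2 - \<gamma> * (y - x) * v * m - \<delta> * x * (y - 1) * v * q" .
    have e: "\<And>w. 1/2 * (1 + (1 + m) + (1 + x * q)) * g\<^sup>2 - (1 + - (x * v) + x * q) * g + w - g\<^sup>2 + g
      = 1/2 * (1 + m + x * q) * g\<^sup>2 + (x * v - x * q) * g + w"
      by (simp add: field_simps)
    show ?thesis unfolding 1 2 fin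
      using e[of "\<alpha> * (y - 1) * (y - x) * v\<^sup>2 + \<beta> * x * (y - 1) * (y - x) * i\<^sup>2 * v\<^sup>2 - \<gamma> * (y - x) * v * m - \<delta> * x * (y - 1) * v * q"]
      by (simp only: add_diff_eq add.assoc[symmetric])
  qed
  have gg: "g = 1 + 2 * (z * ((y - 1) * v) + rho) - (1 - ti) * ((y - x) * v)"
  proof -
    have "g = 1 - 2 * (z * (- ((y - 1) * v)) - rho) - (1 - ti) * J" using g unfolding J1 .
    then show ?thesis unfolding Jx by (simp add: algebra_simps)
  qed
  have "2 * (- 2 * G * (1 - J) + (2 * z - 1 + ti) * DJ) = 2 * (1/2 * (1 + m + x * q) * g\<^sup>2 + (x * v - x * q) * g
     + \<alpha> * (y - 1) * (y - x) * v\<^sup>2 + \<beta> * x * (y - 1) * (y - x) * i\<^sup>2 * v\<^sup>2 - \<gamma> * (y - x) * v * m - \<delta> * x * (y - 1) * v * q)"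
  proof -
    have b2: "2 * \<beta> = - 4 * A" "2 * \<delta> = 1 - 4 * (rho\<^sup>2 - B)" "2 * \<gamma> = (2 * rho + ti)\<^sup>2" "2 * \<alpha> = (ti - 1)\<^sup>2"
      using be by (simp_all add: A B t1 power2_eq_square algebra_simps)
    have G': "G = ((y - x) * v) * ((1 - ti) * z - z * z) + (x * q) * (2 * rho * z - z * z - B) - A * x * (y - x) * i\<^sup>2 * v"
      unfolding G Q eK Jx ..
    \<comment> \<open>The poles 1 of \<open>x\<close> and 1, \<open>x\<close> of \<open>y\<close>
      become the coordinates \<open>t\<close>, \<open>n\<close> and \<open>p = n + t\<close>, so all
      denominators are monomials; in \<open>b\<close> and \<open>c\<close> the remaining parameters
      enter only through \<open>b - 1\<close>, \<open>c\<close> and \<open>b - c\<close>.\<close>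
    define t n p b c where "t = 1 - x" and "n = y - 1" and "p = y - x" and "b = 1 + 2 * rho" and "c = 1 - ti"
    have tn: "x = 1 - t" "y = n + 1" "ti = 1 - c" "rho = (b - 1) / 2" "p = n + t" by (simp_all add: t_def n_def p_def b_def c_def)
    have nz: "t \<noteq> 0" "n \<noteq> 0" "p \<noteq> 0" using nn by (auto simp: t_def n_def p_def)
    define g' where "g' = b * t + 2 * z * n - c * p"
    have g: "g = g' * v"
    proof -
      have "g' * v = b * (v * t) + 2 * z * n * v - c * p * v" by (simp add: g'_def algebra_simps)
      also have "v * t = 1" using r(1) by (simp add: t_def)
      finally show ?thesis unfolding gg by (simp add: b_def c_def n_def p_def algebra_simps)
    qed
    have poly: "4 * n\<^sup>2 * p\<^sup>2 * (c * z - z * z) + 4 * n\<^sup>2 * t * (1 - t) * ((b - 1) * z - z * z) + 2 * (2 * z - c) * n * p * (g' * (n + 1) - t * (1 - t) + p * (1 - t))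
      = (n * p + p + (1 - t) * n) * g'\<^sup>2 + 2 * (1 - t) * n\<^sup>2 * g' + c\<^sup>2 * n\<^sup>2 * p\<^sup>2 - p\<^sup>2 * t * (b - c)\<^sup>2 - (1 - t) * n\<^sup>2 * t * (1 - (b - 1)\<^sup>2)"
      unfolding g'_def tn(5) by (simp add: power2_eq_square algebra_simps)
    have v: "v = 1 / t" "m = 1 / n" "q = 1 / p" by (simp_all add: v_def m_def q_def t_def n_def p_def)
    \<comment> \<open>\<open>LL\<close> and \<open>RR\<close> are twice the two sides without the
      terms in \<open>A\<close> and \<open>B\<close>, which match separately; what is left becomes
      \<open>poly\<close> after multiplication by \<open>t^2 n p\<close>.\<close>
    define LL where "LL = 4 * (n * v) * ((p * v) * (c * z - z * z) + (x * q) * ((b - 1) * z - z * z)) + 2 * (2 * z - c) * ((g * y - x) * v + p * x * v\<^sup>2)"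
    define RR where "RR = (1 + m + x * q) * g\<^sup>2 + 2 * (x * v - x * q) * g + c\<^sup>2 * n * p * v\<^sup>2 - (b - c)\<^sup>2 * p * v * m - (1 - (b - 1)\<^sup>2) * x * n * v * q"
    have "LL * (t\<^sup>2 * n * p) = 4 * n\<^sup>2 * p\<^sup>2 * (c * z - z * z) + 4 * n\<^sup>2 * t * (1 - t) * ((b - 1) * z - z * z) + 2 * (2 * z - c) * n * p * (g' * (n + 1) - t * (1 - t) + p * (1 - t))"
      unfolding LL_def g v tn(1,2) using nz by (simp add: divide_simps) (simp add: power2_eq_square algebra_simps)
    moreover have "RR * (t\<^sup>2 * n * p) = (n * p + p + (1 - t) * n) * g'\<^sup>2 + 2 * (1 - t) * n * (p - t) * g' + c\<^sup>2 * n\<^sup>2 * p\<^sup>2 - p\<^sup>2 * t * (b - c)\<^sup>2 - (1 - t) * n\<^sup>2 * t * (1 - (b - 1)\<^sup>2)"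
      unfolding RR_def g v tn(1,2) using nz by (simp add: divide_simps) (simp add: power2_eq_square algebra_simps)
    moreover have "2 * (1 - t) * n * (p - t) * g' = 2 * (1 - t) * n\<^sup>2 * g'" by (simp add: tn(5) power2_eq_square)
    ultimately have "LL * (t\<^sup>2 * n * p) = RR * (t\<^sup>2 * n * p)" using poly by (simp only:)
    then have LR: "LL = RR" using nz by simp
    have "2 * (- 2 * G * (1 - J) + (2 * z - 1 + ti) * DJ) = LL - 4 * A * x * p * i\<^sup>2 * v * (n * v) - 4 * B * (x * q) * (n * v)"
      unfolding LL_def G' J1 D n_def[symmetric] p_def[symmetric] tn(3,4) by (simp add: algebra_simps add_divide_distrib diff_divide_distrib)
    also have "LL = RR" by (rule LR)
    also have "RR - 4 * A * x * p * i\<^sup>2 * v * (n * v) - 4 * B * (x * q) * (n * v) =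
       (1 + m + x * q) * g\<^sup>2 + 2 * (x * v - x * q) * g + (2 * \<alpha>) * n * p * v\<^sup>2 + (2 * \<beta>) * x * n * p * i\<^sup>2 * v\<^sup>2 - (2 * \<gamma>) * p * v * m - (2 * \<delta>) * x * n * v * q"
      unfolding b2 RR_def tn(3,4) by (simp add: power2_eq_square algebra_simps add_divide_distrib diff_divide_distrib)
    finally show ?thesis unfolding n_def p_def by (simp add: algebra_simps)
  qed
  then have "- 2 * G * (1 - J) + (2 * z - 1 + ti) * DJ = 1/2 * (1 + m + x * q) * g\<^sup>2 + (x * v - x * q) * g
     + \<alpha> * (y - 1) * (y - x) * v\<^sup>2 + \<beta> * x * (y - 1) * (y - x) * i\<^sup>2 * v\<^sup>2 - \<gamma> * (y - x) * v * m - \<delta> * x * (y - 1) * v * q"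
    by (metis mult_cancel_left zero_neq_numeral)
  then show ?thesis unfolding R .
qed

section \<open>The degree in X of the coefficients\<close>

locale pvi_solution = pvi_series +
  assumes s: "0 < Re s" "Re s < 1" and a: "a \<noteq> 0"
begin

definition "fe = e_of sF"
definition "fy = y_of sE"
definition "fz = z_of sz"
definition "fJ = J_of sE sF sK"
definition "fG = G_of sE sF sz sP sK"
definition "fh = h_of sE sF sz sP sK"

lemma fh_eq: "fh = fJ * (2 * fz - bC (1 - ti)) - 2 * sz"
proof -
  have "bI s (G_of sE sF sz sP sK) = sz" by (rule sol_eqs(3)[symmetric])
  then show ?thesis by (simp only: fh_def h_of_def fJ_def fz_def)
qed

lemma D_sE: "bD s sE = fh * sE"
proof -
  have "bD s sE = bD s (1 + bI s (fh * sE))" using sol_eqs(1) by (simp add: fh_def)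
  then show ?thesis by (simp add: bD_bI[OF s] fh_def cf_mult zero_coeffs)
qed

lemma D_sF: "bD s sF = - fh * sF"
proof -
  have "bD s sF = bD s (1 - bI s (fh * sF))" using sol_eqs(2) by (simp add: fh_def)
  then show ?thesis by (simp add: bD_bI[OF s] fh_def cf_mult zero_coeffs)
qed

lemma D_fz: "bD s fz = fG"
proof -
  have "bD s fz = bD s (bI s fG)" using sol_eqs(3) by (simp add: fz_def z_of_def fG_def)
  then show ?thesis by (simp add: bD_bI[OF s] fG_def zero_coeffs)
qed

text \<open>\<open>E\<close> and \<open>F\<close> are iterated independently. That they are inverse
  to each other follows from \<open>D (E F) = 0\<close>, since only constants are killed by
  \<open>D\<close>.\<close>

lemma sE_sF: "sE * sF = 1"
proof -
  have "bD s (sE * sF) = 0" by (simp add: bD_mult D_sE D_sF algebra_simps)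
  then have "sE * sF = bC (cf (sE * sF) 0 0)" by (rule bD_eq_0[OF s])
  also have "cf (sE * sF) 0 0 = 1"
    using arg_cong[OF sol_eqs(1), of "\<lambda>f. cf f 0 0"] arg_cong[OF sol_eqs(2), of "\<lambda>f. cf f 0 0"] by (simp add: cf_mult)
  finally show ?thesis by (simp add: bC_simps)
qed

lemma sP_eq: "sP = 1 + fe * sP" and fye: "fy * fe = bX * bY" and sK_eq: "sK = 1 + fy * fe * sK"
proof -
  show "sP = 1 + fe * sP" unfolding fe_def by (rule sol_eqs(4))
  have "fy * fe = bX * bY * (bC (a * (1 / a))) * (sE * sF)"
    unfolding fy_def fe_def y_of_def e_of_def bC_simps by (simp only: mult_ac)
  then show ye: "fy * fe = bX * bY" using a by (simp add: sE_sF bC_simps)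
  show "sK = 1 + fy * fe * sK" unfolding ye using sol_eqs(5) by (simp add: mult.assoc)
qed

lemma fJ_eq: "fJ = fy * (sK * (1 - fe))"
  by (simp add: fJ_def J_of_def fy_def fe_def)

lemma fG_eq: "fG = fJ * ((1 - bC ti) * fz - fz * fz) + (fe * sP) * (2 * bC rho * fz - fz * fz - bC B) - fe * (bC A * sK * (1 - fe))"
  by (simp add: fG_def G_of_def fJ_def Q_of_def fe_def fz_def bC_simps)

definition "fg = 1 - 2 * (fz * (1 - fJ) - bC rho) - (1 - bC ti) * fJ"

lemma fh_fg: "fh = fg - 1 + bC s"
proof -
  have "bC s = 2 * bC (s / 2)" by (simp flip: bC_simps)
  then show ?thesis unfolding fh_eq fg_def by (simp add: fz_def z_of_def bC_simps algebra_simps)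
qed

lemma D_fe: "bD s fe = (1 - fg) * fe"
proof -
  have "bD s fe = (bC s - fh) * fe"
    unfolding fe_def e_of_def bD_mult bD_bX bD_bC D_sF by (simp add: algebra_simps)
  then show ?thesis by (simp add: fh_fg)
qed

lemma D_fy: "bD s fy = fg * fy"
proof -
  have "bD s fy = (bC (1 - s) + fh) * fy"
    unfolding fy_def y_of_def bD_mult bD_bY bD_bC D_sE by (simp add: algebra_simps)
  then show ?thesis by (simp add: fh_fg bC_simps)
qed

lemma D_sP: "bD s sP = sP * sP * bD s fe"
proof -
  have "bD s sP = bD s fe * sP + fe * bD s sP"
    using arg_cong[OF sP_eq, of "bD s"] by (simp add: bD_mult)
  then show ?thesis using sP_eq by algebra
qed

text \<open>
  The series below satisfy a system of Lax type (\<open>lax_U\<close>, \<open>lax_Z\<close>, \<open>lax_W\<close>, \<open>lax_Om\<close>) whose nonlinear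
  terms carry a factor \<open>bY\<close>, so the part of degree \<open>n\<close> in \<open>Y\<close> solves a linear system with a right-hand
  side of lower degree in \<open>Y\<close>. That linear system is singular only at the weights \<open>0\<close>, \<open>s\<close> and \<open>2 s\<close>,
  which bounds the degree in \<open>X\<close> by \<open>2 n + 2\<close>.
\<close>

definition "fOm = bC A * fe + (1 - fy * fe) * sP * (bC B * fe - 2 * bC rho * fz) + (1 - fy) * sP * fz * fz"
definition "fU = bC a * sE"
definition "fZ = fU * fz"
definition "fW = bC A * bX * fe - fU * fz * fz"
definition "fk = sK * (bX - fU)"
definition "ff = sK * (bX * fOm - fW)"

lemma fy_fU: "fy = bY * fU" by (simp add: fy_def y_of_def fU_def)

lemma fU_fe: "fU * fe = bX"
proof -
  have "fU * fe = bX * bC (a * (1 / a)) * (sE * sF)"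
    unfolding fU_def fe_def e_of_def bC_simps by (simp only: mult_ac)
  then show ?thesis using a by (simp add: sE_sF bC_simps)
qed

lemma D_fU: "bD s fU = fh * fU"
  by (simp add: fU_def bD_mult D_sE mult_ac)

lemma fU_nz: "fU \<noteq> 0"
  using a fU_fe cf_bX[of 1 0] by (metis cf_0 mult_zero_left zero_neq_one)

lemma fJ_fk: "fJ = - (bY * fk)"
proof -
  have "fJ = bY * sK * fU - bY * sK * (fU * fe)" unfolding fJ_eq fy_fU by (simp add: algebra_simps)
  then show ?thesis unfolding fU_fe fk_def by (simp add: algebra_simps)
qed

lemma lax_U: "bD s fU = bC s * fU + (2 * bC rho * fU - 2 * fZ) + bY * ((bC (1 - ti)) * fk * fU - 2 * fZ * fk)"
  unfolding D_fU fh_fg fg_def fJ_fk fZ_def by (simp add: bC_simps algebra_simps)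

lemma bY_ff: "bY * ff = fy * fe * sK * fOm - bC A * fy * fe * sK * fe + fy * sK * fz * fz"
proof -
  have "bY * ff = sK * (bX * bY) * fOm - sK * bY * (bC A * bX * fe - fU * fz * fz)"
    unfolding ff_def fW_def by (simp add: algebra_simps)
  also have "sK * bY * (bC A * bX * fe - fU * fz * fz) = sK * (bC A * (bX * bY) * fe) - sK * (fy * fz * fz)"
    unfolding fy_fU by (simp add: algebra_simps)
  finally show ?thesis unfolding fye[symmetric] by (simp add: algebra_simps)
qed

lemma lax_Z: "bD s fZ = bC s * fZ + (fW - fU * fOm) + bY * (fk * fW - fU * ff)"
proof -
  have L: "1 - fJ = sK * (1 - fy)" by (rule one_minus_J[OF sK_eq fJ_eq])
  have G: "(fg - 1) * fz + fG = sK * (1 - fy) * (bC A * fe * fe - fz * fz) - fOm * sK + bC A * sK * fy * fe * fe - fy * sK * fz * fz"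
    by (rule G_identity[OF sP_eq sK_eq fJ_eq fG_eq fg_def fOm_def])
  have K: "fOm * sK = fOm + fy * fe * sK * fOm" using sK_eq by algebra
  have W: "fW = fU * (bC A * fe * fe - fz * fz)" unfolding fW_def fU_fe[symmetric] by (simp add: algebra_simps)
  have "bD s fZ = fU * (bC s * fz + ((fg - 1) * fz + fG))"
    unfolding fZ_def bD_mult D_fU D_fz fh_fg by (simp add: algebra_simps)
  also have "\<dots> = bC s * fZ + (1 - fJ) * fW - fU * fOm - fU * (bY * ff)"
    unfolding G L W fZ_def bY_ff K by (simp add: algebra_simps)
  finally show ?thesis unfolding fJ_fk by (simp add: algebra_simps)
qed

lemma lax_W: "bD s fW = bC s * fW + (2 * fOm * fZ - 2 * bC rho * fW) + bY * (2 * ff * fZ - bC (1 - ti) * fk * fW)"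
proof -
  \<comment> \<open>The quadratic relation between the three series. Differentiating it and
    cancelling \<open>fU\<close> yields the equation for \<open>fW\<close> from the other
    two.\<close>
  have det: "fU * fW = bC A * bX * bX - fZ * fZ"
  proof -
    have "fU * fW = bC A * bX * (fU * fe) - fZ * fZ" unfolding fW_def fZ_def by (simp add: algebra_simps)
    then show ?thesis by (simp add: fU_fe)
  qed
  have "bD s (fU * fW) = 2 * bC s * (bC A * bX * bX) - 2 * fZ * bD s fZ"
    unfolding det by (simp add: bD_mult bD_bX algebra_simps)
  then have "fU * bD s fW = 2 * bC s * (fU * fW + fZ * fZ) - 2 * fZ * bD s fZ - bD s fU * fW"
    using bD_mult[of s fU fW] det by algebra
  also have "\<dots> = fU * (bC s * fW + (2 * fOm * fZ - 2 * bC rho * fW) + bY * (2 * ff * fZ - bC (1 - ti) * fk * fW))"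
    unfolding lax_Z lax_U by (simp add: algebra_simps)
  finally show ?thesis using fU_nz by (metis mult_cancel_left)
qed

lemma lax_Om: "bD s fOm = bY * (- bC ti * ff - bC (1 - ti) * fk * fOm)"
proof -
  have "bD s fOm = bC A * bD s fe + (- (bD s fy * fe + fy * bD s fe)) * sP * (bC B * fe - 2 * bC rho * fz)
     + (1 - fy * fe) * (sP * sP * bD s fe) * (bC B * fe - 2 * bC rho * fz)
     + (1 - fy * fe) * sP * (bC B * bD s fe - 2 * bC rho * fG) - bD s fy * sP * fz * fz
     + (1 - fy) * (sP * sP * bD s fe) * fz * fz + (1 - fy) * sP * (2 * fz * fG)"
    unfolding fOm_def by (simp add: bD_mult D_sP D_fz algebra_simps)
  also have "\<dots> = - bC ti * (fy * fe * sK * fOm - bC A * fy * fe * sK * fe + fy * sK * fz * fz) + (1 - bC ti) * fJ * fOm"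
    by (rule Om_identity[OF sP_eq sK_eq fJ_eq fG_eq fg_def fOm_def D_fe D_fy])
  finally show ?thesis unfolding bY_ff[symmetric] fJ_fk by (simp add: bC_simps algebra_simps)
qed

lemma cf_fOm_00: "cf fOm 0 0 = s\<^sup>2 / 4 - rho\<^sup>2"
proof -
  have P: "cf sP 0 0 = 1" using arg_cong[OF sP_eq, of "\<lambda>f. cf f 0 0"] by (simp add: cf_mult zero_coeffs fe_def)
  have z: "cf fz 0 0 = rho + s / 2" using arg_cong[OF sol_eqs(3), of "\<lambda>f. cf f 0 0"] by (simp add: fz_def z_of_def)
  have two: "cf 2 0 0 = 2" using cf_bC[of 2 0 0] by (simp add: bC_simps)
  show ?thesis
    unfolding fOm_def by (simp add: cf_mult P z two zero_coeffs fe_def fy_def power2_eq_square field_simps)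
qed

end

text \<open>The rows \<open>j < n\<close> have degree at most \<open>2 * j + c\<close> in
  \<open>X\<close>. A factor \<open>bY\<close> shifts the rows by one and thereby lowers
  \<open>c\<close> by 2, which just pays for a product of two series with
  \<open>c = 2\<close>.\<close>

definition supported :: "nat \<Rightarrow> nat \<Rightarrow> bps \<Rightarrow> bool" where
  "supported c n f \<longleftrightarrow> (\<forall>i j. j < n \<longrightarrow> 2 * j + c < i \<longrightarrow> cf f i j = 0)"

lemma supported_diff: "supported c n f \<Longrightarrow> supported c n g \<Longrightarrow> supported c n (f - g)"
  and supported_bX: "supported 1 n bX"
  and supported_mono: "supported c n f \<Longrightarrow> c \<le> d \<Longrightarrow> supported d n f"
  and supported_bY_mult: "supported (c + 2) n f \<Longrightarrow> supported c (Suc n) (bY * f)"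
  by (auto simp: supported_def cf_bX)

lemma supported_mult:
  assumes "supported c n f" "supported d n g"
  shows "supported (c + d) n (f * g)"
  unfolding supported_def cf_mult
proof (intro allI impI sum.neutral ballI)
  fix i j l k assume h: "j < n" "2 * j + (c + d) < i" "l \<in> {..j}" "k \<in> {..i}"
  have "2 * l + c < k \<or> 2 * (j - l) + d < i - k" using h by auto
  then show "cf f k l * cf g (i - k) (j - l) = 0" using assms h by (auto simp: supported_def)
qed

lemma supported_mult_le: "supported c n f \<Longrightarrow> supported d n g \<Longrightarrow> c + d \<le> e \<Longrightarrow> supported e n (f * g)"
  by (rule supported_mono[OF supported_mult])

context pvi_solution
begin

lemma sK_coeffs: "cf sK i j = (if i = j then 1 else 0)"
proof (induction j arbitrary: i)
  case 0
  then show ?case using arg_cong[OF sol_eqs(5), of "\<lambda>f. cf f i 0"] by simp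
next
  case (Suc j)
  then show ?case using arg_cong[OF sol_eqs(5), of "\<lambda>f. cf f i (Suc j)"] by auto
qed

lemma supported_U: "supported 2 n fU \<and> supported 2 n fZ \<and> supported 2 n fW \<and> supported 0 n fOm"
proof (induction n)
  case 0
  then show ?case by (simp add: supported_def)
next
  case (Suc n)
  then have U: "supported 2 n fU" and Z: "supported 2 n fZ" and W: "supported 2 n fW" and Om: "supported 0 n fOm" by auto
  have K: "supported 0 n sK" by (auto simp: supported_def sK_coeffs)
  have X2: "supported 2 n bX" by (rule supported_mono[OF supported_bX]) simp
  have k: "supported 2 n fk" unfolding fk_def
    by (rule supported_mult_le[OF K supported_diff[OF X2 U]]) simp
  have XOm: "supported 2 n (bX * fOm)"
    by (rule supported_mult_le[OF X2 Om]) simp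
  have f: "supported 2 n ff" unfolding ff_def
    by (rule supported_mult_le[OF K supported_diff[OF XOm W]]) simp
  have m4: "supported 4 n (f * g)" if "supported 2 n f" "supported 2 n g" for f g
    by (rule supported_mult_le[OF that]) simp
  have m2: "supported 2 n (f * g)" if "supported 2 n f" "supported 0 n g" for f g
    by (rule supported_mult_le[OF that]) simp
  have c: "supported d n (bC u * f)" if "supported d n f" for d u f
    using that by (simp add: supported_def)
  have c2: "supported d n (2 * f)" if "supported d n f" for d f
    using c[OF that, of 2] by (simp add: bC_simps)
  have RU: "supported 2 (Suc n) (bY * ((bC (1 - ti)) * fk * fU - 2 * fZ * fk))"
    unfolding mult.assoc by (intro supported_bY_mult supported_diff c c2) (simp_all add: m4 k U Z)
  have RZ: "supported 2 (Suc n) (bY * (fk * fW - fU * ff))"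
    by (intro supported_bY_mult supported_diff) (simp_all add: m4 k U W f)
  have RW: "supported 2 (Suc n) (bY * (2 * ff * fZ - bC (1 - ti) * fk * fW))"
    unfolding mult.assoc by (intro supported_bY_mult supported_diff c c2) (simp_all add: m4 k W Z f)
  have o1: "supported 2 n (- bC ti * ff)" using c[OF f, of "- ti"] by (simp only: bC_simps)
  have o2: "supported 2 n (bC (1 - ti) * (fk * fOm))" by (intro c m2 k Om)
  have ROm: "supported 0 (Suc n) (bY * (- bC ti * ff - bC (1 - ti) * fk * fOm))"
    by (rule supported_bY_mult) (use supported_diff[OF o1 o2] in \<open>simp only: mult.assoc add_0\<close>)
  \<comment> \<open>\<open>D fOm\<close> has a factor \<open>bY\<close>, so row \<open>n\<close> of
    \<open>fOm\<close> is known from lower rows after division by nonzero weights. It is settled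
    before the other three series, whose equations involve it.\<close>
  have Om': "supported 0 (Suc n) fOm"
    unfolding supported_def
  proof (intro allI impI)
    fix i j assume ij: "j < Suc n" "2 * j + 0 < i"
    have "weight s i j * cf fOm i j = 0"
      using arg_cong[OF lax_Om, of "\<lambda>f. cf f i j"] ROm ij by (simp add: supported_def)
    then show "cf fOm i j = 0" using weight_nz[OF s, of i j] ij by auto
  qed
  define w0 where "w0 = s\<^sup>2 / 4 - rho\<^sup>2"
  have key: "cf fU i n = 0 \<and> cf fZ i n = 0 \<and> cf fW i n = 0" if i: "2 * n + 2 < i" for i
  proof -
    \<comment> \<open>Beyond the expected support every term of the convolution dies except the one
      with the constant term of \<open>fOm\<close>, so the product acts on this coefficient as
      multiplication by \<open>w0\<close>.\<close>
    have prod: "cf (F * fOm) i n = cf F i n * w0" if F: "supported 2 n F" for F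
    proof -
      have z: "cf F k l * cf fOm (i - k) (n - l) = (if l = n \<and> k = i then cf F i n * w0 else 0)" if "l \<le> n" "k \<le> i" for l k
      proof (cases "l = n")
        case True
        then show ?thesis using Om' that cf_fOm_00 by (auto simp: supported_def w0_def)
      next
        case False
        then have "l < n" using that by simp
        moreover have "2 * l + 2 < k \<or> 2 * (n - l) < i - k" using that i by auto
        ultimately show ?thesis using F Om' by (auto simp: supported_def)
      qed
      have "cf (F * fOm) i n = (\<Sum>l\<le>n. \<Sum>k\<le>i. if l = n \<and> k = i then cf F i n * w0 else 0)"
        unfolding cf_mult by (intro sum.cong refl z) auto
      also have "\<dots> = (\<Sum>l\<le>n. if l = n then (\<Sum>k\<le>i. if k = i then cf F i n * w0 else 0) else 0)"
        by (intro sum.cong) auto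
      finally show ?thesis by simp
    qed
    define u z w m where "u = cf fU i n" and "z = cf fZ i n" and "w = cf fW i n" and "m = weight s i n - s"
    have two: "cf (2 * f) i n = 2 * cf f i n" for f using cf_bC_mult[of 2 f i n] by (simp add: bC_simps)
    have e1: "m * u = 2 * (rho * u) - 2 * z"
      using arg_cong[OF lax_U, of "\<lambda>f. cf f i n"] RU i by (simp add: supported_def two u_def z_def m_def algebra_simps)
    have e2: "m * z = w - u * w0"
      using arg_cong[OF lax_Z, of "\<lambda>f. cf f i n"] RZ i prod[OF U] by (simp add: supported_def u_def z_def w_def m_def algebra_simps)
    have e3: "m * w = 2 * (z * w0) - 2 * (rho * w)"
      using arg_cong[OF lax_W, of "\<lambda>f. cf f i n"] RW i prod[OF Z] by (simp add: supported_def two w_def z_def m_def algebra_simps)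
    have w0': "s\<^sup>2 = 4 * w0 + 4 * rho\<^sup>2" by (simp add: w0_def)
    have z2: "2 * z = (2 * rho - m) * u" using e1 by (simp add: algebra_simps)
    have w2: "2 * w = (m * (2 * rho - m) + 2 * w0) * u" using e2 z2 by algebra
    have "m * (2 * w) = 2 * (2 * z) * w0 - 2 * rho * (2 * w)" using e3 by algebra
    then have "m * ((m * (2 * rho - m) + 2 * w0) * u) = 2 * ((2 * rho - m) * u) * w0 - 2 * rho * ((m * (2 * rho - m) + 2 * w0) * u)"
      unfolding w2 z2 .
    \<comment> \<open>Eliminating \<open>z\<close> and \<open>w\<close> leaves the determinant of
      the linear system times \<open>u\<close>. As \<open>4 * w0 + 4 * rho^2\<close> equals
      \<open>s^2\<close>, its roots are \<open>m = 0\<close>, \<open>s\<close>, \<open>- s\<close>;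
      the index bound on \<open>i\<close> excludes them by real parts.\<close>
    then have "m * (4 * w0 + 4 * rho\<^sup>2 - m\<^sup>2) * u = 0"
      by (simp add: algebra_simps power2_eq_square)
    then have "m * (s + m) * (s - m) * u = 0"
      unfolding w0'[symmetric] by (simp add: power2_eq_square algebra_simps)
    moreover have "m \<noteq> 0"
    proof -
      have "0 < Re s * (real i - 1) + (1 - Re s) * real n" using s i by (intro add_pos_nonneg mult_pos_pos) auto
      also have "\<dots> = Re m" by (simp add: m_def weight_def algebra_simps)
      finally show ?thesis by auto
    qed
    moreover have "s - m \<noteq> 0"
    proof -
      have "0 < Re s * (real i - 2) + (1 - Re s) * real n" using s i by (intro add_pos_nonneg mult_pos_pos) auto
      also have "\<dots> = Re (- (s - m))" by (simp add: m_def weight_def algebra_simps)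
      finally show ?thesis by auto
    qed
    moreover have "s + m \<noteq> 0" using weight_nz[OF s, of i n] i by (auto simp: m_def)
    ultimately have u0: "u = 0" by simp
    then have "z = 0" using e1 by simp
    then show ?thesis using e2 u0 by (simp add: u_def z_def w_def)
  qed
  show ?case
    using key U Z W Om' unfolding supported_def less_Suc_eq by auto
qed

lemma sE_support: "2 * j + 2 < i \<Longrightarrow> cf sE i j = 0"
  using supported_U[of "Suc j"] a by (auto simp: supported_def fU_def)

lemma cf_sE_00: "cf sE 0 0 = 1"
  using arg_cong[OF sol_eqs(1), of "\<lambda>f. cf f 0 0"] by simp

end

section \<open>Sums of double power series\<close>

definition row_fps :: "bps \<Rightarrow> complex \<Rightarrow> complex fps" where
  "row_fps f X = Abs_fps (\<lambda>j. eval_fps (fps_nth f j) X)"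

text \<open>An iterated sum, first in \<open>X\<close> along each row and then in \<open>Y\<close>,
  so that one-variable power series apply; absolute convergence is a separate statement.\<close>

definition ev :: "bps \<Rightarrow> complex \<Rightarrow> complex \<Rightarrow> complex" where
  "ev f X Y = eval_fps (row_fps f X) Y"

definition convergent_bps :: "real \<Rightarrow> bps \<Rightarrow> bool" where
  "convergent_bps r f \<longleftrightarrow> 0 < r \<and> (\<exists>M. majorized r f M)"

lemma convergent_bps_arith:
  assumes "convergent_bps r f" "convergent_bps r g"
  shows "convergent_bps r (f + g)" "convergent_bps r (f - g)" "convergent_bps r (f * g)"
  using assms majorized_add[of r f _ g] majorized_diff[of r f _ g] majorized_mult[of r f _ g]
  unfolding convergent_bps_def by (meson less_imp_le)+

lemma convergent_bps_const: "0 < r \<Longrightarrow> convergent_bps r (bC c)" "0 < r \<Longrightarrow> convergent_bps r 1"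
  "0 < r \<Longrightarrow> convergent_bps r bX" "0 < r \<Longrightarrow> convergent_bps r bY" "0 < r \<Longrightarrow> convergent_bps r (numeral k)"
  using majorized_const[of r c] majorized_1[of r] majorized_bX[of r] majorized_bY[of r] majorized_const[of r "numeral k"]
  unfolding convergent_bps_def by (auto simp: bC_simps)

lemma convergent_bps_bI: "convergent_bps r f \<Longrightarrow> 0 < Re s \<Longrightarrow> Re s < 1 \<Longrightarrow> convergent_bps r (bI s f)"
  unfolding convergent_bps_def using majorized_bI by (meson less_imp_le)

lemma majorized_row:
  assumes f: "majorized r f M" and r: "0 < r"
  shows "(\<Sum>i<n. norm (cf f i j) * r ^ i) \<le> M * (1 / r) ^ j"
proof -
  define m where "m = max n (Suc j)"
  have "(\<Sum>i<n. norm (cf f i j) * r ^ i) \<le> (\<Sum>i<m. norm (cf f i j) * r ^ i)"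
    using r by (intro sum_mono2) (auto simp: m_def)
  moreover have "(\<Sum>i<m. norm (cf f i j) * r ^ (i + j)) \<le> (\<Sum>j<m. \<Sum>i<m. norm (cf f i j) * r ^ (i + j))"
    using r by (intro member_le_sum[of j "{..<m}" "\<lambda>j. \<Sum>i<m. norm (cf f i j) * r ^ (i + j)"] sum_nonneg) (auto simp: m_def)
  moreover have "(\<Sum>j<m. \<Sum>i<m. norm (cf f i j) * r ^ (i + j)) \<le> M" using f by (simp add: majorized_def)
  moreover have "(\<Sum>i<m. norm (cf f i j) * r ^ (i + j)) = (\<Sum>i<m. norm (cf f i j) * r ^ i) * r ^ j"
    by (simp add: sum_distrib_left sum_distrib_right power_add mult_ac)
  moreover have "(\<Sum>i<n. norm (cf f i j) * r ^ i) * r ^ j \<le> (\<Sum>i<m. norm (cf f i j) * r ^ i) * r ^ j"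
    using calculation(1) r by (intro mult_right_mono) auto
  ultimately have "(\<Sum>i<n. norm (cf f i j) * r ^ i) * r ^ j \<le> M" by linarith
  then show ?thesis using r by (simp add: power_divide field_simps)
qed

lemma row_radius:
  assumes "convergent_bps r f"
  shows "fps_conv_radius (fps_nth f j) \<ge> r"
proof -
  obtain M where M: "majorized r f M" "r > 0" using assms by (auto simp: convergent_bps_def)
  have "norm (fps_nth (fps_nth f j) i) \<le> M * (1 / r) ^ j * (1 / r) ^ i" for i
  proof -
    have "norm (cf f i j) * r ^ i \<le> (\<Sum>i<Suc i. norm (cf f i j) * r ^ i)"
      using M(2) by (intro member_le_sum[of i "{..<Suc i}" "\<lambda>i. norm (cf f i j) * r ^ i"]) auto
    also have "\<dots> \<le> M * (1 / r) ^ j" by (rule majorized_row[OF M])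
    finally have "norm (cf f i j) \<le> M * (1 / r) ^ j / r ^ i" using M(2) by (simp add: field_simps)
    then show ?thesis by (simp add: cf_def power_divide)
  qed
  from fps_conv_radius_geometric[OF _ this] show ?thesis using M(2) by simp
qed

lemma row_sums:
  assumes "convergent_bps r f" "norm X < r"
  shows "(\<lambda>i. cf f i j * X ^ i) sums fps_nth (row_fps f X) j"
  using sums_eval_fps[of X "fps_nth f j"] row_radius[OF assms(1), of j] assms(2)
  by (simp add: row_fps_def cf_def less_le_trans[of "ereal (norm X)" "ereal r"])

lemma row_abs_sum:
  assumes c: "convergent_bps r f" "norm X < r" and f: "majorized t f M" "0 < t" "norm X \<le> t"
  shows "(\<Sum>j<n. norm (fps_nth (row_fps f X) j) * t ^ j) \<le> M"
proof (rule LIMSEQ_le_const2)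
  show "(\<lambda>m. \<Sum>j<n. norm (\<Sum>i<m. cf f i j * X ^ i) * t ^ j) \<longlonglongrightarrow> (\<Sum>j<n. norm (fps_nth (row_fps f X) j) * t ^ j)"
    using row_sums[OF c] unfolding sums_def by (intro tendsto_intros)
  have "(\<Sum>j<n. norm (\<Sum>i<m. cf f i j * X ^ i) * t ^ j) \<le> M" if "n \<le> m" for m
  proof -
    have "(\<Sum>j<n. norm (\<Sum>i<m. cf f i j * X ^ i) * t ^ j) \<le> (\<Sum>j<n. (\<Sum>i<m. norm (cf f i j) * t ^ i) * t ^ j)"
      using f(2,3) by (intro sum_mono mult_right_mono order_trans[OF norm_sum]) (auto simp: norm_mult norm_power intro!: mult_left_mono power_mono)
    also have "\<dots> \<le> (\<Sum>j<m. (\<Sum>i<m. norm (cf f i j) * t ^ i) * t ^ j)"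
      using that f(2) by (intro sum_mono2) (auto intro!: mult_nonneg_nonneg sum_nonneg)
    also have "\<dots> = (\<Sum>j<m. \<Sum>i<m. norm (cf f i j) * t ^ (i + j))"
      by (simp add: sum_distrib_left sum_distrib_right power_add mult_ac)
    also have "\<dots> \<le> M" using f(1) by (simp add: majorized_def)
    finally show ?thesis .
  qed
  then show "\<exists>N. \<forall>m\<ge>N. (\<Sum>j<n. norm (\<Sum>i<m. cf f i j * X ^ i) * t ^ j) \<le> M" by blast
qed

lemma row_coeff_bound:
  assumes c: "convergent_bps r f" "norm X < r" and f: "majorized r f M"
  shows "norm (fps_nth (row_fps f X) j) \<le> M * (1 / r) ^ j"
proof -
  have r: "r > 0" using c(1) by (simp add: convergent_bps_def)
  have "norm (fps_nth (row_fps f X) j) * r ^ j \<le> (\<Sum>j<Suc j. norm (fps_nth (row_fps f X) j) * r ^ j)"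
    using r by (intro member_le_sum[of j "{..<Suc j}" "\<lambda>j. norm (fps_nth (row_fps f X) j) * r ^ j"]) auto
  also have "\<dots> \<le> M" by (rule row_abs_sum[OF c f r less_imp_le[OF c(2)]])
  finally show ?thesis using r by (simp add: field_simps power_divide)
qed

lemma outer_radius:
  assumes "convergent_bps r f" "norm X < r"
  shows "fps_conv_radius (row_fps f X) \<ge> r"
proof -
  obtain M where M: "majorized r f M" "r > 0" using assms by (auto simp: convergent_bps_def)
  from fps_conv_radius_geometric[OF _ row_coeff_bound[OF assms M(1)]] show ?thesis using M(2) by simp
qed

lemma ev_sums:
  assumes "convergent_bps r f" "norm X < r" "norm Y < r"
  shows "(\<lambda>j. fps_nth (row_fps f X) j * Y ^ j) sums ev f X Y"
  unfolding ev_def using outer_radius[OF assms(1,2)] assms(3)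
  by (intro sums_eval_fps) (simp add: less_le_trans[of "ereal (norm Y)" "ereal r"])

text \<open>Two radii: \<open>r\<close> ensures convergence, while \<open>t\<close> may be smaller
  and carry a better bound. The vanishing at the origin is exploited in this way.\<close>

lemma norm_ev_le:
  assumes c: "convergent_bps r f" "norm X < r" "norm Y < r" and f: "majorized t f M" "0 < t" "norm X \<le> t" "norm Y \<le> t"
  shows "norm (ev f X Y) \<le> M"
proof (rule LIMSEQ_le_const2)
  show "(\<lambda>n. norm (\<Sum>j<n. fps_nth (row_fps f X) j * Y ^ j)) \<longlonglongrightarrow> norm (ev f X Y)"
    using ev_sums[OF c] unfolding sums_def by (rule tendsto_norm)
  have "norm (\<Sum>j<n. fps_nth (row_fps f X) j * Y ^ j) \<le> M" for n
  proof -
    have "norm (\<Sum>j<n. fps_nth (row_fps f X) j * Y ^ j) \<le> (\<Sum>j<n. norm (fps_nth (row_fps f X) j) * t ^ j)"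
      using f(2,4) by (intro order_trans[OF norm_sum] sum_mono) (auto simp: norm_mult norm_power intro!: mult_left_mono power_mono)
    also have "\<dots> \<le> M" by (rule row_abs_sum[OF c(1,2) f(1-3)])
    finally show ?thesis .
  qed
  then show "\<exists>N. \<forall>n\<ge>N. norm (\<Sum>j<n. fps_nth (row_fps f X) j * Y ^ j) \<le> M" by blast
qed

lemma row_fps_arith:
  assumes f: "convergent_bps r f" and g: "convergent_bps r g" and X: "norm X < r"
  shows "row_fps (f + g) X = row_fps f X + row_fps g X" "row_fps (f - g) X = row_fps f X - row_fps g X"
    "row_fps (f * g) X = row_fps f X * row_fps g X"
proof -
  have R: "ereal (norm X) < fps_conv_radius (fps_nth f j)" "ereal (norm X) < fps_conv_radius (fps_nth g j)" for j
    using row_radius[OF f, of j] row_radius[OF g, of j] X by (auto intro: less_le_trans[of _ "ereal r"])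
  show "row_fps (f + g) X = row_fps f X + row_fps g X" "row_fps (f - g) X = row_fps f X - row_fps g X"
    by (simp_all add: fps_eq_iff row_fps_def eval_fps_add eval_fps_diff R)
  show "row_fps (f * g) X = row_fps f X * row_fps g X"
  proof (rule fps_ext)
    fix j
    have RR: "ereal (norm X) < fps_conv_radius (fps_nth f l * fps_nth g k)" for l k
      using R(1)[of l] R(2)[of k] fps_conv_radius_mult[of "fps_nth f l" "fps_nth g k"] by (metis less_le_trans min_less_iff_conj)
    have "(\<lambda>i. \<Sum>l=0..j. fps_nth (fps_nth f l * fps_nth g (j - l)) i * X ^ i) sums (\<Sum>l=0..j. eval_fps (fps_nth f l * fps_nth g (j - l)) X)"
      by (intro sums_sum sums_eval_fps RR)
    moreover have "(\<lambda>i. \<Sum>l=0..j. fps_nth (fps_nth f l * fps_nth g (j - l)) i * X ^ i) = (\<lambda>i. fps_nth (fps_nth (f * g) j) i * X ^ i)"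
      by (simp add: fun_eq_iff fps_mult_nth[of f g] fps_sum_nth sum_distrib_right)
    ultimately have "eval_fps (fps_nth (f * g) j) X = (\<Sum>l=0..j. eval_fps (fps_nth f l * fps_nth g (j - l)) X)"
      unfolding eval_fps_def by (simp add: sums_iff)
    then show "fps_nth (row_fps (f * g) X) j = fps_nth (row_fps f X * row_fps g X) j"
      by (simp add: row_fps_def fps_mult_nth[of "Abs_fps _"] eval_fps_mult R)
  qed
qed

lemma ev_arith:
  assumes f: "convergent_bps r f" and g: "convergent_bps r g" and XY: "norm X < r" "norm Y < r"
  shows "ev (f + g) X Y = ev f X Y + ev g X Y" "ev (f - g) X Y = ev f X Y - ev g X Y" "ev (f * g) X Y = ev f X Y * ev g X Y"
proof -
  have "ereal (norm Y) < fps_conv_radius (row_fps f X)" "ereal (norm Y) < fps_conv_radius (row_fps g X)"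
    using outer_radius[OF f XY(1)] outer_radius[OF g XY(1)] XY(2) by (auto intro: less_le_trans[of _ "ereal r"])
  then show "ev (f + g) X Y = ev f X Y + ev g X Y" "ev (f - g) X Y = ev f X Y - ev g X Y" "ev (f * g) X Y = ev f X Y * ev g X Y"
    unfolding ev_def row_fps_arith[OF f g XY(1)] by (simp_all add: eval_fps_add eval_fps_diff eval_fps_mult)
qed

lemma ev_const: "ev (bC c) X Y = c" "ev 1 X Y = 1" "ev bX X Y = X" "ev bY X Y = Y" "ev (numeral k) X Y = numeral k"
proof -
  have c: "ev (bC c) X Y = c" for c
  proof -
    have "row_fps (bC c) X = fps_const c" by (auto simp: fps_eq_iff row_fps_def bC_def)
    then show ?thesis by (simp add: ev_def)
  qed
  then show "ev (bC c) X Y = c" "ev 1 X Y = 1" "ev (numeral k) X Y = numeral k"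
    using c[of c] c[of 1] c[of "numeral k"] by (simp_all add: bC_simps)
  have "row_fps bX X = fps_const X" "row_fps bY X = fps_X"
    by (auto simp: fps_eq_iff row_fps_def bX_def bY_def)
  then show "ev bX X Y = X" "ev bY X Y = Y" by (simp_all add: ev_def)
qed

text \<open>The majorant bounds all finite partial sums of absolute values, so the double family is
  summable in any order; Fubini identifies the sum with the iterated one.\<close>

lemma ev_has_sum:
  assumes c: "convergent_bps r f" "norm X < r" "norm Y < r"
  shows "((\<lambda>(j, i). cf f i j * X ^ i * Y ^ j) has_sum ev f X Y) UNIV"
proof -
  obtain M where M: "majorized r f M" "r > 0" using c(1) by (auto simp: convergent_bps_def)
  have "(\<lambda>(j, i). norm (cf f i j * X ^ i * Y ^ j)) summable_on UNIV"
  proof (rule nonneg_bdd_above_summable_on)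
    show "bdd_above (sum (\<lambda>(j, i). norm (cf f i j * X ^ i * Y ^ j)) ` {F. F \<subseteq> UNIV \<and> finite F})"
    proof (rule bdd_aboveI2)
      fix F :: "(nat \<times> nat) set" assume "F \<in> {F. F \<subseteq> UNIV \<and> finite F}"
      then have fin: "finite F" by simp
      obtain n where n: "F \<subseteq> {..<n} \<times> {..<n}"
      proof -
        obtain m1 m2 where "\<forall>a\<in>fst ` F. a \<le> m1" "\<forall>a\<in>snd ` F. a \<le> m2"
          using fin finite_nat_set_iff_bounded_le[of "fst ` F"] finite_nat_set_iff_bounded_le[of "snd ` F"] by auto
        then have "F \<subseteq> {..<Suc (max m1 m2)} \<times> {..<Suc (max m1 m2)}" by (force simp: less_Suc_eq_le)
        then show thesis by (rule that)
      qed
      have "(\<Sum>(j, i)\<in>F. norm (cf f i j * X ^ i * Y ^ j)) \<le> (\<Sum>(j, i)\<in>{..<n} \<times> {..<n}. norm (cf f i j) * r ^ (i + j))"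
      proof (rule order_trans[OF sum_mono])
        show "(case x of (j, i) \<Rightarrow> norm (cf f i j * X ^ i * Y ^ j)) \<le> (case x of (j, i) \<Rightarrow> norm (cf f i j) * r ^ (i + j))" if "x \<in> F" for x
          using c(2,3) M(2) by (auto simp: norm_mult norm_power power_add mult.assoc split: prod.split intro!: mult_left_mono mult_mono power_mono)
        show "(\<Sum>(j, i)\<in>F. norm (cf f i j) * r ^ (i + j)) \<le> (\<Sum>(j, i)\<in>{..<n} \<times> {..<n}. norm (cf f i j) * r ^ (i + j))"
          using n M(2) by (intro sum_mono2) auto
      qed
      also have "\<dots> = (\<Sum>j<n. \<Sum>i<n. norm (cf f i j) * r ^ (i + j))" by (simp add: sum.cartesian_product)
      also have "\<dots> \<le> M" using M(1) by (simp add: majorized_def)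
      finally show "(\<Sum>(j, i)\<in>F. norm (cf f i j * X ^ i * Y ^ j)) \<le> M" .
    qed
  qed auto
  then have "(\<lambda>x. norm ((\<lambda>(j, i). cf f i j * X ^ i * Y ^ j) x)) summable_on UNIV"
    by (simp add: case_prod_unfold)
  then have sm: "(\<lambda>(j, i). cf f i j * X ^ i * Y ^ j) summable_on UNIV" by (rule abs_summable_summable)
  define S where "S = infsum (\<lambda>(j, i). cf f i j * X ^ i * Y ^ j) UNIV"
  have hs: "((\<lambda>(j, i). cf f i j * X ^ i * Y ^ j) has_sum S) (Sigma UNIV (\<lambda>_. UNIV))"
    using has_sum_infsum[OF sm] by (simp add: S_def)
  have inner: "((\<lambda>i. (\<lambda>(j, i). cf f i j * X ^ i * Y ^ j) (j, i)) has_sum fps_nth (row_fps f X) j * Y ^ j) UNIV" for j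
  proof -
    have "summable (\<lambda>i. norm (cf f i j * X ^ i))"
      unfolding cf_def using row_radius[OF c(1), of j] c(2) by (intro norm_summable_fps) (auto intro: less_le_trans[of _ "ereal r"])
    then have "((\<lambda>i. cf f i j * X ^ i) has_sum fps_nth (row_fps f X) j) UNIV"
      using row_sums[OF c(1,2)] by (rule norm_summable_imp_has_sum)
    then show ?thesis using has_sum_cmult_left[of "\<lambda>i. cf f i j * X ^ i" UNIV _ "Y ^ j"] by simp
  qed
  have "((\<lambda>j. fps_nth (row_fps f X) j * Y ^ j) has_sum S) UNIV"
    by (rule has_sum_SigmaD[OF hs inner])
  then have "S = ev f X Y"
    by (rule sums_unique2[OF has_sum_imp_sums ev_sums[OF c]])
  then show ?thesis using hs by simp
qed

text \<open>Termwise differentiation over the rows: each row is a power series in \<open>X\<close>,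
  and its chain rule derivative is the corresponding row of \<open>bD s f\<close>.\<close>

lemma ev_derivative:
  assumes c: "convergent_bps r f" and \<xi>: "norm (exp (s * \<xi>)) < r" "norm (exp ((1 - s) * \<xi>)) < r"
  shows "((\<lambda>\<xi>. ev f (exp (s * \<xi>)) (exp ((1 - s) * \<xi>))) has_field_derivative
    ev (bD s f) (exp (s * \<xi>)) (exp ((1 - s) * \<xi>))) (at \<xi>)"
proof -
  obtain M where M: "majorized r f M" "r > 0" using c by (auto simp: convergent_bps_def)
  \<comment> \<open>A radius strictly below \<open>r\<close> for \<open>Y\<close>, so that the rows
    are dominated by a convergent geometric series on a neighbourhood of
    \<open>\<xi>\<close>.\<close>
  obtain r' where r': "norm (exp ((1 - s) * \<xi>)) < r'" "r' < r" using \<xi>(2) dense by blast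
  have r'0: "0 < r'" using r'(1) norm_ge_zero le_less_trans by blast
  define S where "S = {\<xi>. norm (exp (s * \<xi>)) < r} \<inter> {\<xi>. norm (exp ((1 - s) * \<xi>)) < r'}"
  have S: "open S" "\<xi> \<in> S"
    unfolding S_def using \<xi>(1) r'(1) by (auto intro!: open_Int open_Collect_less continuous_intros)
  have bDrow: "fps_nth (bD s f) n = fps_const s * (fps_X * fps_deriv (fps_nth f n)) + fps_const ((1 - s) * of_nat n) * fps_nth f n" for n
  proof (rule fps_ext)
    fix i show "fps_nth (fps_nth (bD s f) n) i = fps_nth (fps_const s * (fps_X * fps_deriv (fps_nth f n)) + fps_const ((1 - s) * of_nat n) * fps_nth f n) i"
      by (cases i) (simp_all add: bD_def weight_def cf_def algebra_simps)
  qed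
  define F where "F n \<xi> = fps_nth (row_fps f (exp (s * \<xi>))) n * exp ((1 - s) * \<xi>) ^ n" for n \<xi>
  define F' where "F' n \<xi> = fps_nth (row_fps (bD s f) (exp (s * \<xi>))) n * exp ((1 - s) * \<xi>) ^ n" for n \<xi>
  have der: "(F n has_field_derivative F' n x) (at x)" if x: "x \<in> S" for n x
  proof -
    have R: "ereal (norm (exp (s * x))) < fps_conv_radius (fps_nth f n)"
      using row_radius[OF c, of n] x by (auto simp: S_def intro: less_le_trans[of _ "ereal r"])
    have Rd: "ereal (norm (exp (s * x))) < fps_conv_radius (fps_deriv (fps_nth f n))"
      using R fps_conv_radius_deriv[of "fps_nth f n"] by (rule less_le_trans)
    have RX: "ereal (norm (exp (s * x))) < fps_conv_radius (fps_X * fps_deriv (fps_nth f n))"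
      using Rd fps_conv_radius_mult[of fps_X "fps_deriv (fps_nth f n)"] by (auto intro: less_le_trans)
    have RsX: "ereal (norm (exp (s * x))) < fps_conv_radius (fps_const s * (fps_X * fps_deriv (fps_nth f n)))"
      using RX fps_conv_radius_mult[of "fps_const s" "fps_X * fps_deriv (fps_nth f n)"] by (auto intro: less_le_trans)
    have Rc: "ereal (norm (exp (s * x))) < fps_conv_radius (fps_const ((1 - s) * of_nat n) * fps_nth f n)"
      using R fps_conv_radius_mult[of "fps_const ((1 - s) * of_nat n)" "fps_nth f n"] by (auto intro: less_le_trans)
    have v: "F' n x = (s * (exp (s * x) * eval_fps (fps_deriv (fps_nth f n)) (exp (s * x))) + ((1 - s) * of_nat n) * eval_fps (fps_nth f n) (exp (s * x))) * exp ((1 - s) * x) ^ n"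
      unfolding F'_def row_fps_def fps_nth_Abs_fps bDrow
      by (subst eval_fps_add[OF RsX Rc], subst eval_fps_mult, simp, rule RX, subst eval_fps_mult, simp, rule Rd, subst eval_fps_mult, simp, rule R) simp
    have d1: "((\<lambda>\<xi>. eval_fps (fps_nth f n) (exp (s * \<xi>))) has_field_derivative eval_fps (fps_deriv (fps_nth f n)) (exp (s * x)) * (exp (s * x) * s)) (at x)"
    proof (rule DERIV_chain2[where f = "eval_fps (fps_nth f n)" and g = "\<lambda>\<xi>. exp (s * \<xi>)"])
      show "(eval_fps (fps_nth f n) has_field_derivative eval_fps (fps_deriv (fps_nth f n)) (exp (s * x))) (at (exp (s * x)))"
        by (rule has_field_derivative_eval_fps[OF R])
    qed (auto intro!: derivative_eq_intros)
    have d2: "((\<lambda>\<xi>. exp ((1 - s) * \<xi>) ^ n) has_field_derivative ((1 - s) * of_nat n) * exp ((1 - s) * x) ^ n) (at x)"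
    proof -
      have "((\<lambda>\<xi>. exp (of_nat n * ((1 - s) * \<xi>))) has_field_derivative exp (of_nat n * ((1 - s) * x)) * (of_nat n * (1 - s))) (at x)"
        by (rule DERIV_cong, (rule derivative_eq_intros refl)+) simp
      then show ?thesis unfolding exp_of_nat_mult by (simp add: mult_ac)
    qed
    show ?thesis unfolding v F_def[abs_def] row_fps_def fps_nth_Abs_fps
      using DERIV_mult[OF d1 d2] by (rule DERIV_cong) (simp add: algebra_simps)
  qed
  have bound: "\<forall>x\<in>S. norm (F n x) \<le> M * (r' / r) ^ n" for n
  proof
    fix x assume x: "x \<in> S"
    have "norm (F n x) = norm (fps_nth (row_fps f (exp (s * x))) n) * norm (exp ((1 - s) * x)) ^ n" by (simp add: F_def norm_mult norm_power)
    also have "\<dots> \<le> (M * (1 / r) ^ n) * r' ^ n"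
    proof (rule mult_mono)
      show "norm (fps_nth (row_fps f (exp (s * x))) n) \<le> M * (1 / r) ^ n"
        by (rule row_coeff_bound[OF c _ M(1)]) (use x in \<open>simp add: S_def\<close>)
      show "norm (exp ((1 - s) * x)) ^ n \<le> r' ^ n"
        using x by (intro power_mono) (auto simp: S_def)
    qed (use M majorized_nonneg[OF M(1)] in auto)
    finally show "norm (F n x) \<le> M * (r' / r) ^ n" by (simp add: power_divide)
  qed
  have sm: "summable (\<lambda>n. M * (r' / r) ^ n)"
    using r'0 r'(2) M(2) by (intro summable_mult summable_geometric) auto
  obtain g g' where g: "\<forall>x\<in>S. ((\<lambda>n. F n x) sums g x) \<and> ((\<lambda>n. F' n x) sums g' x) \<and> (g has_field_derivative g' x) (at x)"
    by (rule series_and_derivative_comparison[OF S(1) sm der always_eventually[OF allI[OF bound]]])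
  have e1: "g x = ev f (exp (s * x)) (exp ((1 - s) * x))" if "x \<in> S" for x
    using g that unfolding ev_def eval_fps_def F_def by (auto dest: sums_unique)
  have e2: "g' \<xi> = ev (bD s f) (exp (s * \<xi>)) (exp ((1 - s) * \<xi>))"
    using g S(2) unfolding ev_def eval_fps_def F'_def by (auto dest: sums_unique)
  show ?thesis
    unfolding e2[symmetric]
    by (rule has_field_derivative_transform_within_open[of g _ _ S]) (use g S e1 in auto)
qed

text \<open>Every monomial present has degree at least 1, so passing from radius \<open>r\<close> to
  \<open>t\<close> gains a factor \<open>t / r\<close>.\<close>

lemma majorized_shrink:
  assumes f: "majorized r f M" and z: "cf f 0 0 = 0" and t: "0 \<le> t" "t \<le> r" "0 < r"
  shows "majorized t f (t / r * M)"
  unfolding majorized_def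
proof
  fix n
  have "norm (cf f i j) * t ^ (i + j) \<le> t / r * (norm (cf f i j) * r ^ (i + j))" for i j
  proof (cases "i + j")
    case (Suc k)
    have "t ^ k \<le> r ^ k" by (rule power_mono[OF t(2,1)])
    then have "t * t ^ k \<le> t / r * (r * r ^ k)" using t by (simp add: mult_left_mono)
    then have "norm (cf f i j) * (t * t ^ k) \<le> norm (cf f i j) * (t / r * (r * r ^ k))" by (rule mult_left_mono) simp
    then show ?thesis unfolding Suc using t by (simp add: mult_ac)
  qed (use z in auto)
  then have "(\<Sum>j<n. \<Sum>i<n. norm (cf f i j) * t ^ (i + j)) \<le> t / r * (\<Sum>j<n. \<Sum>i<n. norm (cf f i j) * r ^ (i + j))"
    unfolding sum_distrib_left by (intro sum_mono)
  also have "\<dots> \<le> t / r * M"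
    using f t by (intro mult_left_mono) (auto simp: majorized_def)
  finally show "(\<Sum>j<n. \<Sum>i<n. norm (cf f i j) * t ^ (i + j)) \<le> t / r * M" .
qed

text \<open>With \<open>E\<close> and \<open>F\<close> bounded by 3/2, the two conditions involving
  \<open>norm a\<close> force \<open>y\<close> and \<open>e = x / y\<close> into the open unit disc.
  All singular values \<open>y = 0, 1, x\<close> and \<open>x = 1\<close> are then excluded at
  once.\<close>

locale pvi_functions = pvi_solution +
  fixes r :: real
  assumes r: "0 < r" "r < 1" "r * norm a \<le> 1/4" "r / norm a \<le> 1/4"
    and bounded: "bounded5 r (sE, sF, sz, sP, sK)"
begin

definition dom :: "complex set" where
  "dom = {\<xi>. norm (exp (s * \<xi>)) < r \<and> norm (exp ((1 - s) * \<xi>)) < r}"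

definition val :: "bps \<Rightarrow> complex \<Rightarrow> complex" where
  "val f \<xi> = ev f (exp (s * \<xi>)) (exp ((1 - s) * \<xi>))"

lemma open_dom: "open dom"
proof -
  have "dom = {\<xi>. norm (exp (s * \<xi>)) < r} \<inter> {\<xi>. norm (exp ((1 - s) * \<xi>)) < r}" by (auto simp: dom_def)
  then show ?thesis by (auto intro!: open_Int open_Collect_less continuous_intros)
qed

lemma conv_arith:
  "convergent_bps r f \<Longrightarrow> convergent_bps r g \<Longrightarrow> convergent_bps r (f + g)"
  "convergent_bps r f \<Longrightarrow> convergent_bps r g \<Longrightarrow> convergent_bps r (f - g)"
  "convergent_bps r f \<Longrightarrow> convergent_bps r g \<Longrightarrow> convergent_bps r (f * g)"
  by (rule convergent_bps_arith; assumption)+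

lemma conv_series: "convergent_bps r sE" "convergent_bps r sF" "convergent_bps r sz" "convergent_bps r sP" "convergent_bps r sK"
proof -
  have b: "majorized r (sE - 1) (1/2)" "majorized r (sF - 1) (1/2)" "majorized r sz 1" "majorized r sP 2" "majorized r sK 2"
    using bounded by (auto simp: bounded5_def)
  show "convergent_bps r sz" "convergent_bps r sP" "convergent_bps r sK" using b r(1) by (auto simp: convergent_bps_def)
  have "convergent_bps r (sE - 1)" "convergent_bps r (sF - 1)" using b r(1) by (auto simp: convergent_bps_def)
  from this[THEN conv_arith(1)[OF _ convergent_bps_const(2)[OF r(1)]]]
  show "convergent_bps r sE" "convergent_bps r sF" by simp_all
qed

lemmas conv = conv_series conv_arith convergent_bps_const[OF r(1)]

lemma conv_f: "convergent_bps r fe" "convergent_bps r fy" "convergent_bps r fz" "convergent_bps r fJ"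
  "convergent_bps r fG" "convergent_bps r fg" "convergent_bps r (bI s fJ)"
proof -
  show e: "convergent_bps r fe" and y: "convergent_bps r fy" and z: "convergent_bps r fz"
    unfolding fe_def fy_def fz_def e_of_def y_of_def z_of_def by (simp_all add: conv)
  show J: "convergent_bps r fJ" unfolding fJ_eq by (simp add: conv e y)
  show "convergent_bps r fG" unfolding fG_eq by (simp add: conv e z J)
  show "convergent_bps r fg" unfolding fg_def by (simp add: conv z J)
  show "convergent_bps r (bI s fJ)" by (rule convergent_bps_bI[OF J s])
qed

lemma val_arith:
  assumes "\<xi> \<in> dom"
  shows "convergent_bps r f \<Longrightarrow> convergent_bps r g \<Longrightarrow> val (f + g) \<xi> = val f \<xi> + val g \<xi>"
    "convergent_bps r f \<Longrightarrow> convergent_bps r g \<Longrightarrow> val (f - g) \<xi> = val f \<xi> - val g \<xi>"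
    "convergent_bps r f \<Longrightarrow> convergent_bps r g \<Longrightarrow> val (f * g) \<xi> = val f \<xi> * val g \<xi>"
  using assms ev_arith[of r f g "exp (s * \<xi>)" "exp ((1 - s) * \<xi>)"] unfolding val_def dom_def by auto

lemma val_const: "val (bC c) \<xi> = c" "val 1 \<xi> = 1" "val bX \<xi> = exp (s * \<xi>)" "val bY \<xi> = exp ((1 - s) * \<xi>)" "val (numeral k) \<xi> = numeral k"
  by (simp_all add: val_def ev_const)

lemmas val_simps = val_arith val_const conv conv_f

lemma val_deriv:
  assumes "convergent_bps r f" "\<xi> \<in> dom"
  shows "(val f has_field_derivative val (bD s f) \<xi>) (at \<xi>)"
  using assms ev_derivative[of r f s \<xi>] unfolding val_def[abs_def] dom_def by auto

lemma norm_val_le: "convergent_bps r f \<Longrightarrow> \<xi> \<in> dom \<Longrightarrow> majorized r f M \<Longrightarrow> norm (val f \<xi>) \<le> M"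
  unfolding val_def dom_def using r(1) by (intro norm_ev_le[of r f]) auto

text \<open>The shrunk majorant is taken at the radius \<open>t = max |X| |Y|\<close>. This is the
  source of the error term \<open>max (|x| powr (1 - Re s)) (|x| powr Re s)\<close>.\<close>

lemma norm_val_linear:
  assumes f: "convergent_bps r f"
  obtains C where "C \<ge> 0" "\<And>\<xi>. \<xi> \<in> dom \<Longrightarrow> norm (val f \<xi> - cf f 0 0) \<le> C * max (norm (exp (s * \<xi>))) (norm (exp ((1 - s) * \<xi>)))"
proof -
  define f0 where "f0 = f - bC (cf f 0 0)"
  have f0: "convergent_bps r f0" unfolding f0_def by (simp add: conv f)
  obtain M where M: "majorized r f0 M" using f0 by (auto simp: convergent_bps_def)
  have "norm (val f \<xi> - cf f 0 0) \<le> (M / r) * max (norm (exp (s * \<xi>))) (norm (exp ((1 - s) * \<xi>)))" if \<xi>: "\<xi> \<in> dom" for \<xi>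
  proof -
    define t where "t = max (norm (exp (s * \<xi>))) (norm (exp ((1 - s) * \<xi>)))"
    have t: "0 < t" "t < r" using \<xi> by (auto simp: t_def dom_def less_max_iff_disj)
    have "majorized t f0 (t / r * M)"
      by (rule majorized_shrink[OF M]) (use t r in \<open>auto simp: f0_def\<close>)
    then have "norm (val f0 \<xi>) \<le> t / r * M"
      unfolding val_def using \<xi> t by (intro norm_ev_le[OF f0]) (auto simp: dom_def t_def)
    moreover have "val f0 \<xi> = val f \<xi> - cf f 0 0" unfolding f0_def by (simp add: val_simps f \<xi>)
    ultimately show ?thesis by (simp add: t_def mult_ac)
  qed
  then show thesis using that[of "M / r"] majorized_nonneg[OF M] r(1) by auto
qed

abbreviation "y \<equiv> val fy"
abbreviation "e \<equiv> val fe"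
abbreviation "g \<equiv> val fg"

lemma y_eq: "\<xi> \<in> dom \<Longrightarrow> y \<xi> = a * exp ((1 - s) * \<xi>) * val sE \<xi>"
  unfolding fy_def y_of_def by (simp add: val_simps)

lemma y_e: "\<xi> \<in> dom \<Longrightarrow> y \<xi> * e \<xi> = exp \<xi>"
  using arg_cong[OF fye, of "\<lambda>f. val f \<xi>"] by (simp add: val_simps flip: exp_add) (simp add: algebra_simps)

lemma norm_e_y:
  assumes \<xi>: "\<xi> \<in> dom"
  shows "norm (e \<xi>) < 1" "norm (y \<xi>) < 1" "norm (val sE \<xi>) \<le> 3/2" "norm (val sF \<xi>) \<le> 3/2"
proof -
  have b: "majorized r (sE - 1) (1/2)" "majorized r (sF - 1) (1/2)" using bounded by (auto simp: bounded5_def)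
  have "norm (val (sE - 1) \<xi>) \<le> 1/2" "norm (val (sF - 1) \<xi>) \<le> 1/2"
    by (rule norm_val_le[OF _ \<xi> b(1)], simp add: conv, rule norm_val_le[OF _ \<xi> b(2)], simp add: conv)
  then have "norm (val sE \<xi> - 1) \<le> 1/2" "norm (val sF \<xi> - 1) \<le> 1/2" using \<xi> by (simp_all add: val_simps)
  then show E: "norm (val sE \<xi>) \<le> 3/2" and F: "norm (val sF \<xi>) \<le> 3/2"
    using norm_triangle_ineq2[of "val sE \<xi>" 1] norm_triangle_ineq2[of "val sF \<xi>" 1] by simp_all
  have X: "norm (exp (s * \<xi>)) \<le> r" "norm (exp ((1 - s) * \<xi>)) \<le> r" using \<xi> by (auto simp: dom_def)
  have "norm (y \<xi>) = (norm (exp ((1 - s) * \<xi>)) * norm a) * norm (val sE \<xi>)" unfolding y_eq[OF \<xi>] by (simp add: norm_mult)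
  also have "\<dots> \<le> (r * norm a) * (3/2)" using X E r(1) by (intro mult_mono) auto
  finally show "norm (y \<xi>) < 1" using r(3) by simp
  have "e \<xi> = exp (s * \<xi>) / a * val sF \<xi>" unfolding fe_def e_of_def using \<xi> by (simp add: val_simps)
  then have "norm (e \<xi>) = (norm (exp (s * \<xi>)) / norm a) * norm (val sF \<xi>)" by (simp add: norm_mult norm_divide)
  also have "\<dots> \<le> (r / norm a) * (3/2)" using X F r(1) by (intro mult_mono divide_right_mono) auto
  finally show "norm (e \<xi>) < 1" using r(4) by simp
qed

lemma nonsingular:
  assumes \<xi>: "\<xi> \<in> dom"
  shows "exp \<xi> \<noteq> 1" "y \<xi> \<noteq> 0" "y \<xi> \<noteq> 1" "y \<xi> \<noteq> exp \<xi>" "e \<xi> = exp \<xi> / y \<xi>" "e \<xi> \<noteq> 1"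
proof -
  show y0: "y \<xi> \<noteq> 0" using y_e[OF \<xi>] by auto
  show y1: "y \<xi> \<noteq> 1" and e1: "e \<xi> \<noteq> 1" using norm_e_y[OF \<xi>] by auto
  have "norm (y \<xi>) * norm (e \<xi>) < 1 * 1" using norm_e_y[OF \<xi>] by (intro mult_strict_mono) auto
  then have "norm (exp \<xi>) < 1" unfolding y_e[OF \<xi>, symmetric] norm_mult by simp
  then show "exp \<xi> \<noteq> 1" by (metis less_irrefl norm_one)
  show e: "e \<xi> = exp \<xi> / y \<xi>" using y_e[OF \<xi>] y0 by (simp add: field_simps)
  then show "y \<xi> \<noteq> exp \<xi>" using e1 y0 by auto
qed

lemma val_K: "\<xi> \<in> dom \<Longrightarrow> val sK \<xi> = 1 / (1 - exp \<xi>)"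
  using arg_cong[OF sK_eq, of "\<lambda>f. val f \<xi>"] y_e[of \<xi>] nonsingular(1)[of \<xi>] by (simp add: val_simps field_simps)

lemma val_P: "\<xi> \<in> dom \<Longrightarrow> val sP \<xi> = 1 / (1 - e \<xi>)"
  using arg_cong[OF sP_eq, of "\<lambda>f. val f \<xi>"] nonsingular(6)[of \<xi>] by (simp add: val_simps field_simps)

lemma val_J: "\<xi> \<in> dom \<Longrightarrow> val fJ \<xi> = (y \<xi> - exp \<xi>) / (1 - exp \<xi>)"
  unfolding fJ_eq by (simp add: val_simps val_K right_diff_distrib[of "y \<xi>"] y_e)

lemma deriv_y: "\<xi> \<in> dom \<Longrightarrow> (y has_field_derivative g \<xi> * y \<xi>) (at \<xi>)"
  using val_deriv[of fy \<xi>] by (simp add: D_fy val_simps)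

lemma cf_fJ_00: "cf fJ 0 0 = 0"
  unfolding fJ_def by (rule zero_coeffs)

text \<open>The primitive of \<open>J\<close> that vanishes at \<open>x = 0\<close>; its exponential
  is the common factor of the off-diagonal entries in the Schlesinger system.\<close>

lemma deriv_psi: "\<xi> \<in> dom \<Longrightarrow> (val (bI s fJ) has_field_derivative (y \<xi> - exp \<xi>) / (1 - exp \<xi>)) (at \<xi>)"
  using val_deriv[OF conv_f(7), of \<xi>] bD_bI[OF s, of fJ] by (simp add: val_J cf_fJ_00)

end

section \<open>The solution of PVI near the origin\<close>

text \<open>The right-hand side of PVI in terms of \<open>g = (dy/d\<xi>) / y\<close>, where \<open>x = exp \<xi>\<close>.\<close>

definition pvi_log_rhs ::
  "complex \<Rightarrow> complex \<Rightarrow> complex \<Rightarrow> complex \<Rightarrow> complex \<Rightarrow> complex \<Rightarrow> complex \<Rightarrow> complex" where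
  "pvi_log_rhs \<alpha> \<beta> \<gamma> \<delta> x y g =
     1/2 * (1 + y/(y - 1) + y/(y - x)) * g\<^sup>2 - (1 + x/(x - 1) + x/(y - x)) * g
     + (y - 1) * (y - x) / (x - 1)\<^sup>2 * (\<alpha> + \<beta> * (x / y\<^sup>2) + \<gamma> * ((x - 1) / (y - 1)\<^sup>2) + \<delta> * (x * (x - 1) / (y - x)\<^sup>2))
     - g\<^sup>2 + g"

lemma PVI_rhs_log:
  assumes "x \<noteq> 0" "y \<noteq> 0"
  shows "PVI_rhs \<alpha> \<beta> \<gamma> \<delta> x y (g * y / x) = y / x\<^sup>2 * (pvi_log_rhs \<alpha> \<beta> \<gamma> \<delta> x y g + g\<^sup>2 - g)"
proof -
  define W where "W = \<alpha> + \<beta> * (x / y\<^sup>2) + \<gamma> * ((x - 1) / (y - 1)\<^sup>2) + \<delta> * (x * (x - 1) / (y - x)\<^sup>2)"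
  define Z where "Z = (y - 1) * (y - x) / (x - 1)\<^sup>2"
  define m q n where "m = 1 / (y - 1)" and "q = 1 / (y - x)" and "n = 1 / (x - 1)"
  have d: "y / (y - 1) = y * m" "y / (y - x) = y * q" "x / (y - x) = x * q" "x / (x - 1) = x * n"
    "y * (y - 1) * (y - x) / (x\<^sup>2 * (x - 1)\<^sup>2) = y / x\<^sup>2 * Z"
    by (simp_all add: m_def q_def n_def Z_def)
  have t: "1/2 * (1/y + m + q) * (g * y / x)\<^sup>2 = y / x\<^sup>2 * (1/2 * (1 + y * m + y * q) * g\<^sup>2)"
    "(1/x + n + q) * (g * y / x) = y / x\<^sup>2 * ((1 + x * n + x * q) * g)"
    using assms by (simp_all add: power2_eq_square field_simps)
  have "c * T1 - c * T2 + c * Z * W = c * (T1 - T2 + Z * W - g\<^sup>2 + g + g\<^sup>2 - g)" for c T1 T2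
    by (simp add: algebra_simps)
  then show ?thesis
    unfolding PVI_rhs_def pvi_log_rhs_def W_def[symmetric] d m_def[symmetric] q_def[symmetric] n_def[symmetric] Z_def[symmetric] t .
qed

lemma solves_PVI_log:
  assumes S: "open S"
    and nz: "\<And>\<xi>. \<xi> \<in> S \<Longrightarrow> exp \<xi> \<noteq> 1 \<and> y \<xi> \<noteq> 0 \<and> y \<xi> \<noteq> 1 \<and> y \<xi> \<noteq> exp \<xi>"
    and y: "\<And>\<xi>. \<xi> \<in> S \<Longrightarrow> (y has_field_derivative g \<xi> * y \<xi>) (at \<xi>)"
    and g: "\<And>\<xi>. \<xi> \<in> S \<Longrightarrow> (g has_field_derivative pvi_log_rhs \<alpha> \<beta> \<gamma> \<delta> (exp \<xi>) (y \<xi>) (g \<xi>)) (at \<xi>)"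
  shows "solves_PVI \<alpha> \<beta> \<gamma> \<delta> S y"
  unfolding solves_PVI_def
proof (intro conjI ballI)
  show "y holomorphic_on S" using y S by (auto simp: holomorphic_on_open)
  fix \<xi> assume \<xi>: "\<xi> \<in> S"
  show "exp \<xi> \<noteq> 1" "y \<xi> \<noteq> 0" "y \<xi> \<noteq> 1" "y \<xi> \<noteq> exp \<xi>" using nz[OF \<xi>] by auto
  have y': "deriv_x y z = g z * y z / exp z" if "z \<in> S" for z
    unfolding deriv_x_def using DERIV_imp_deriv[OF y[OF that]] by simp
  let ?R = "pvi_log_rhs \<alpha> \<beta> \<gamma> \<delta> (exp \<xi>) (y \<xi>) (g \<xi>)"
  have "((\<lambda>z. g z * y z / exp z) has_field_derivative
      ((?R * y \<xi> + g \<xi> * y \<xi> * g \<xi>) * exp \<xi> - g \<xi> * y \<xi> * exp \<xi>) / (exp \<xi> * exp \<xi>)) (at \<xi>)"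
    by (rule DERIV_cong[OF DERIV_divide[OF DERIV_mult[OF g[OF \<xi>] y[OF \<xi>]] DERIV_exp]]) (simp_all add: mult_ac)
  then have "(deriv_x y has_field_derivative ((?R * y \<xi> + g \<xi> * y \<xi> * g \<xi>) * exp \<xi> - g \<xi> * y \<xi> * exp \<xi>) / (exp \<xi> * exp \<xi>)) (at \<xi>)"
    by (rule has_field_derivative_transform_within_open[OF _ S \<xi>]) (simp add: y')
  then have "deriv_x (deriv_x y) \<xi> = ((?R * y \<xi> + g \<xi> * y \<xi> * g \<xi>) * exp \<xi> - g \<xi> * y \<xi> * exp \<xi>) / (exp \<xi> * exp \<xi>) / exp \<xi>"
    unfolding deriv_x_def[of "deriv_x y"] by (simp add: DERIV_imp_deriv)
  also have "\<dots> = y \<xi> / (exp \<xi>)\<^sup>2 * (?R + (g \<xi>)\<^sup>2 - g \<xi>)"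
    by (simp add: power2_eq_square field_simps)
  finally show "deriv_x (deriv_x y) \<xi> = PVI_rhs \<alpha> \<beta> \<gamma> \<delta> (exp \<xi>) (y \<xi>) (deriv_x y \<xi>)"
    unfolding y'[OF \<xi>] using nz[OF \<xi>] by (simp add: PVI_rhs_log)
qed

context pvi_functions
begin

lemma deriv_g:
  assumes \<xi>: "\<xi> \<in> dom"
    and rho: "rho = - (ti + t1) / 2" and A: "A = t0\<^sup>2 / 4" and B: "B = rho\<^sup>2 - tx\<^sup>2 / 4"
    and th: "t0\<^sup>2 = - 2 * \<beta>" "tx\<^sup>2 = 1 - 2 * \<delta>" "t1\<^sup>2 = 2 * \<gamma>" "(ti - 1)\<^sup>2 = 2 * \<alpha>"
  shows "(g has_field_derivative pvi_log_rhs \<alpha> \<beta> \<gamma> \<delta> (exp \<xi>) (y \<xi>) (g \<xi>)) (at \<xi>)"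
proof -
  define J where "J = (\<lambda>\<xi>. (y \<xi> - exp \<xi>) / (1 - exp \<xi>))"
  define DJ where "DJ = (g \<xi> * y \<xi> - exp \<xi>) / (1 - exp \<xi>) + (y \<xi> - exp \<xi>) * exp \<xi> / (1 - exp \<xi>)\<^sup>2"
  have J: "val fJ z = J z" if "z \<in> dom" for z using val_J[OF that] by (simp add: J_def)
  have n: "1 - exp \<xi> \<noteq> 0" using nonsingular(1)[OF \<xi>] by auto
  have dJ: "(J has_field_derivative DJ) (at \<xi>)"
  proof -
    have "(p * v - q * (0 - x)) / (v * v) = p / v + q * x / v\<^sup>2" if "v \<noteq> 0" for p q v x :: complex
      using that by (simp add: field_simps power2_eq_square)
    from this[OF n] show ?thesis
      unfolding J_def DJ_def
      by (intro DERIV_cong[OF DERIV_divide[OF DERIV_diff[OF deriv_y[OF \<xi>] DERIV_exp] DERIV_diff[OF DERIV_const DERIV_exp] n]])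
  qed
  have gz: "g z = 1 - 2 * (val fz z * (1 - J z) - rho) - (1 - ti) * J z" if z: "z \<in> dom" for z
    using z unfolding fg_def by (simp add: val_simps J)
  have dz: "(val fz has_field_derivative val fG \<xi>) (at \<xi>)" using val_deriv[OF conv_f(3) \<xi>] by (simp add: D_fz)
  have "((\<lambda>z. 1 - 2 * (val fz z * (1 - J z) - rho) - (1 - ti) * J z) has_field_derivative
      - 2 * val fG \<xi> * (1 - J \<xi>) + (2 * val fz \<xi> - 1 + ti) * DJ) (at \<xi>)"
    by (rule DERIV_cong, (rule derivative_intros dz dJ refl)+) (simp add: algebra_simps)
  then have "(g has_field_derivative - 2 * val fG \<xi> * (1 - J \<xi>) + (2 * val fz \<xi> - 1 + ti) * DJ) (at \<xi>)"
    by (rule has_field_derivative_transform_within_open[OF _ open_dom \<xi>]) (simp add: gz)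
  moreover have "- 2 * val fG \<xi> * (1 - J \<xi>) + (2 * val fz \<xi> - 1 + ti) * DJ = pvi_log_rhs \<alpha> \<beta> \<gamma> \<delta> (exp \<xi>) (y \<xi>) (g \<xi>)"
    unfolding pvi_log_rhs_def
  proof (rule PVI_identity[OF _ nonsingular(1-5)[OF \<xi>] val_K[OF \<xi>] val_P[OF \<xi>] _ rho A B _ gz[OF \<xi>] DJ_def th])
    show "J \<xi> = y \<xi> * (val sK \<xi> * (1 - e \<xi>))" using J[OF \<xi>] \<xi> unfolding fJ_eq by (simp add: val_simps)
    show "val fG \<xi> = J \<xi> * ((1 - ti) * val fz \<xi> - val fz \<xi> * val fz \<xi>) + e \<xi> * val sP \<xi> * (2 * rho * val fz \<xi> - val fz \<xi> * val fz \<xi> - B)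
      - e \<xi> * (A * val sK \<xi> * (1 - e \<xi>))"
      using \<xi> unfolding fG_eq by (simp add: val_simps J)
  qed simp
  ultimately show ?thesis by simp
qed

text \<open>Since \<open>x = X Y\<close>, the monomial \<open>X^i Y^n\<close> is \<open>x^n\<close>
  times \<open>x^(m s)\<close> with \<open>m = i - n\<close>. The support
  \<open>i \<le> 2 n + 2\<close> turns row \<open>n\<close> into the finite inner sum up to
  \<open>m = n + 2\<close>.\<close>

lemma val_sE_sums:
  assumes \<xi>: "\<xi> \<in> dom"
  shows "(\<lambda>n. exp (of_nat n * \<xi>) * (\<Sum>m=- int n..int n + 2. cf sE (nat (int n + m)) n * exp (of_int m * s * \<xi>))) sums val sE \<xi>"
proof -
  have X: "norm (exp (s * \<xi>)) < r" "norm (exp ((1 - s) * \<xi>)) < r" using \<xi> by (auto simp: dom_def)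
  have "exp (of_nat n * \<xi>) * (\<Sum>m=- int n..int n + 2. cf sE (nat (int n + m)) n * exp (of_int m * s * \<xi>))
      = fps_nth (row_fps sE (exp (s * \<xi>))) n * exp ((1 - s) * \<xi>) ^ n" for n
  proof -
    have "(\<lambda>i. cf sE i n * exp (s * \<xi>) ^ i) sums (\<Sum>i\<le>2 * n + 2. cf sE i n * exp (s * \<xi>) ^ i)"
      by (rule sums_finite) (auto simp: sE_support)
    then have row: "fps_nth (row_fps sE (exp (s * \<xi>))) n = (\<Sum>i\<le>2 * n + 2. cf sE i n * exp (s * \<xi>) ^ i)"
      using row_sums[OF conv_series(1) X(1)] by (rule sums_unique2[rotated])
    have "exp (of_nat n * \<xi>) * (\<Sum>m=- int n..int n + 2. cf sE (nat (int n + m)) n * exp (of_int m * s * \<xi>))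
      = (\<Sum>i\<le>2 * n + 2. cf sE i n * exp (s * \<xi>) ^ i * exp ((1 - s) * \<xi>) ^ n)"
      unfolding sum_distrib_left
    proof (rule sum.reindex_bij_witness[of _ "\<lambda>i. int i - int n" "\<lambda>m. nat (int n + m)"])
      fix m assume m: "m \<in> {- int n..int n + 2}"
      have "exp (of_nat n * \<xi>) * exp (of_int m * s * \<xi>) = exp (of_nat (nat (int n + m)) * (s * \<xi>)) * exp (of_nat n * ((1 - s) * \<xi>))"
        using m unfolding exp_add[symmetric] by (simp add: algebra_simps)
      then show "cf sE (nat (int n + m)) n * exp (s * \<xi>) ^ nat (int n + m) * exp ((1 - s) * \<xi>) ^ n
        = exp (of_nat n * \<xi>) * (cf sE (nat (int n + m)) n * exp (of_int m * s * \<xi>))"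
        by (simp only: exp_of_nat_mult) (simp add: mult_ac)
    qed auto
    then show ?thesis unfolding row sum_distrib_right .
  qed
  then show ?thesis using ev_sums[OF conv_series(1) X] by (simp add: val_def)
qed

text \<open>The index \<open>nat (int m2 + (int m1 - int m2))\<close> is just \<open>m1\<close>, in
  the form in which the coefficient with second index \<open>m1 - m2\<close> unfolds. Subtracting 1
  removes the pair (0, 0).\<close>

lemma val_sE_has_sum:
  assumes \<xi>: "\<xi> \<in> dom"
  shows "((\<lambda>(m1, m2). cf sE (nat (int m2 + (int m1 - int m2))) m2 * exp (of_nat m1 * s * \<xi>) * exp (of_nat m2 * (1 - s) * \<xi>))
    has_sum (val sE \<xi> - 1)) {(m1, m2). m1 \<le> 2 * m2 + 2 \<and> 1 \<le> m1 + m2}"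
proof -
  have X: "norm (exp (s * \<xi>)) < r" "norm (exp ((1 - s) * \<xi>)) < r" using \<xi> by (auto simp: dom_def)
  define h where "h = (\<lambda>(i, j). cf sE i j * exp (s * \<xi>) ^ i * exp ((1 - s) * \<xi>) ^ j)"
  have "((\<lambda>(j, i). cf sE i j * exp (s * \<xi>) ^ i * exp ((1 - s) * \<xi>) ^ j) has_sum val sE \<xi>) UNIV"
    unfolding val_def by (rule ev_has_sum[OF conv_series(1) X])
  then have "(h has_sum val sE \<xi>) UNIV"
    by (rule has_sum_reindex_bij_witness[of UNIV prod.swap prod.swap, THEN iffD1, rotated -1]) (auto simp: h_def)
  moreover have "(h has_sum 1) {(0, 0)}"
    using has_sum_finite[of "{(0, 0)}" h] by (simp add: h_def cf_sE_00)
  ultimately have "(h has_sum (val sE \<xi> - 1)) (UNIV - {(0, 0)})"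
    by (rule has_sum_Diff) simp
  then have "(h has_sum (val sE \<xi> - 1)) {(m1, m2). m1 \<le> 2 * m2 + 2 \<and> 1 \<le> m1 + m2}"
    by (rule has_sum_cong_neutral[THEN iffD1, rotated -1]) (auto simp: h_def sE_support)
  moreover have "exp (of_nat m1 * s * \<xi>) = exp (s * \<xi>) ^ m1" "exp (of_nat m2 * (1 - s) * \<xi>) = exp ((1 - s) * \<xi>) ^ m2" for m1 m2
    by (simp_all only: exp_of_nat_mult mult.assoc)
  ultimately show ?thesis by (simp add: h_def)
qed

end

text \<open>The modulus of \<open>x^p\<close> is \<open>|x|\<close> to the power \<open>Re p\<close>
  times \<open>exp (- Im p * arg x)\<close>, and the argument is bounded.\<close>

lemma norm_exp_sector:
  assumes "\<bar>Im \<xi>\<bar> \<le> \<phi>"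
  shows "norm (exp (p * \<xi>)) \<le> exp (\<bar>Im p\<bar> * \<phi>) * norm (exp \<xi>) powr Re p"
proof -
  have "- (Im p * Im \<xi>) \<le> \<bar>Im p\<bar> * \<bar>Im \<xi>\<bar>" by (metis abs_ge_minus_self abs_mult)
  also have "\<dots> \<le> \<bar>Im p\<bar> * \<phi>" using assms by (rule mult_left_mono) simp
  finally have "exp (Re p * Re \<xi> - Im p * Im \<xi>) \<le> exp (\<bar>Im p\<bar> * \<phi> + Re p * Re \<xi>)" by simp
  then show ?thesis by (simp add: powr_def exp_add)
qed

lemma cover_sector_small:
  assumes p: "0 < Re p" and r: "0 < r"
  obtains \<epsilon> where "\<epsilon> > 0" "\<And>\<xi>. norm (exp \<xi>) < \<epsilon> \<Longrightarrow> \<bar>Im \<xi>\<bar> < \<phi> \<Longrightarrow> norm (exp (p * \<xi>)) < r"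
proof
  define C where "C = exp (\<bar>Im p\<bar> * \<phi>)"
  have C: "C > 0" by (simp add: C_def)
  show "(r / C) powr (1 / Re p) > 0" using r C by simp
  fix \<xi> assume \<xi>: "norm (exp \<xi>) < (r / C) powr (1 / Re p)" "\<bar>Im \<xi>\<bar> < \<phi>"
  have "norm (exp \<xi>) powr Re p < ((r / C) powr (1 / Re p)) powr Re p"
    by (rule powr_less_mono2[OF p _ \<xi>(1)]) simp
  also have "\<dots> = r / C" using p r C by (simp add: powr_powr)
  finally have "C * norm (exp \<xi>) powr Re p < r" using C by (simp add: field_simps)
  then show "norm (exp (p * \<xi>)) < r" using norm_exp_sector[of \<xi> \<phi> p] \<xi>(2) by (simp add: C_def)
qed

context pvi_functions
begin

lemma cover_sector_subset_dom:
  obtains \<epsilon> where "\<epsilon> > 0" "cover_sector \<epsilon> \<phi> \<subseteq> dom"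
proof -
  obtain \<epsilon>1 where 1: "\<epsilon>1 > 0" "\<And>\<xi>. norm (exp \<xi>) < \<epsilon>1 \<Longrightarrow> \<bar>Im \<xi>\<bar> < \<phi> \<Longrightarrow> norm (exp (s * \<xi>)) < r"
    using cover_sector_small[of s r \<phi>] s r by auto
  obtain \<epsilon>2 where 2: "\<epsilon>2 > 0" "\<And>\<xi>. norm (exp \<xi>) < \<epsilon>2 \<Longrightarrow> \<bar>Im \<xi>\<bar> < \<phi> \<Longrightarrow> norm (exp ((1 - s) * \<xi>)) < r"
    using cover_sector_small[of "1 - s" r \<phi>] s r by auto
  show thesis
    by (rule that[of "min \<epsilon>1 \<epsilon>2"]) (use 1 2 in \<open>auto simp: cover_sector_def dom_def\<close>)
qed

lemma val_sE_bigo: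
  "(\<lambda>\<xi>. norm (val sE \<xi> - 1)) \<in> O[cover_at_0 \<phi>](\<lambda>\<xi>. max (norm (exp \<xi>) powr (1 - Re s)) (norm (exp \<xi>) powr Re s))"
proof -
  obtain C where C: "C \<ge> 0" "\<And>\<xi>. \<xi> \<in> dom \<Longrightarrow> norm (val sE \<xi> - cf sE 0 0) \<le> C * max (norm (exp (s * \<xi>))) (norm (exp ((1 - s) * \<xi>)))"
    using norm_val_linear[OF conv_series(1)] by metis
  obtain \<epsilon> where \<epsilon>: "\<epsilon> > 0" "cover_sector \<epsilon> \<phi> \<subseteq> dom" by (rule cover_sector_subset_dom)
  define K where "K = exp (\<bar>Im s\<bar> * \<phi>)"
  have "norm (val sE \<xi> - 1) \<le> (C * K) * max (norm (exp \<xi>) powr (1 - Re s)) (norm (exp \<xi>) powr Re s)"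
    if \<xi>: "\<bar>Im \<xi>\<bar> < \<phi>" "Re \<xi> < ln \<epsilon>" for \<xi>
  proof -
    define M where "M = max (norm (exp \<xi>) powr (1 - Re s)) (norm (exp \<xi>) powr Re s)"
    have "norm (exp \<xi>) < \<epsilon>" using \<xi>(2) \<epsilon>(1) by (metis exp_less_cancel_iff exp_ln norm_exp_eq_Re)
    then have d: "\<xi> \<in> dom" using \<epsilon>(2) \<xi>(1) by (auto simp: cover_sector_def)
    have K: "K > 0" by (simp add: K_def)
    have "norm (exp (s * \<xi>)) \<le> K * norm (exp \<xi>) powr Re s" "norm (exp ((1 - s) * \<xi>)) \<le> K * norm (exp \<xi>) powr (1 - Re s)"
      using norm_exp_sector[of \<xi> \<phi> s] norm_exp_sector[of \<xi> \<phi> "1 - s"] \<xi>(1) by (simp_all add: K_def)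
    moreover have "K * norm (exp \<xi>) powr Re s \<le> K * M" "K * norm (exp \<xi>) powr (1 - Re s) \<le> K * M"
      using K by (auto simp: M_def)
    ultimately have "max (norm (exp (s * \<xi>))) (norm (exp ((1 - s) * \<xi>))) \<le> K * M" by linarith
    then have "C * max (norm (exp (s * \<xi>))) (norm (exp ((1 - s) * \<xi>))) \<le> C * (K * M)"
      using C(1) by (rule mult_left_mono)
    then show ?thesis using C(2)[OF d] unfolding cf_sE_00 mult.assoc M_def by (rule order_trans[rotated])
  qed
  moreover have "\<forall>\<^sub>F \<xi> in cover_at_0 \<phi>. \<bar>Im \<xi>\<bar> < \<phi> \<and> Re \<xi> < ln \<epsilon>"
    unfolding cover_at_0_def eventually_inf_principal eventually_filtercomap
    by (rule exI[of _ "\<lambda>x. x < ln \<epsilon>"]) (auto simp: eventually_at_bot_dense)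
  ultimately have "\<forall>\<^sub>F \<xi> in cover_at_0 \<phi>. norm (norm (val sE \<xi> - 1)) \<le> (C * K) * norm (max (norm (exp \<xi>) powr (1 - Re s)) (norm (exp \<xi>) powr Re s))"
    by (auto elim!: eventually_mono simp: abs_of_nonneg le_max_iff_disj)
  then show ?thesis by (rule bigoI)
qed

end

section \<open>Schlesinger systems with a given solution\<close>

definition tl_mat :: "complex \<Rightarrow> complex \<Rightarrow> complex \<Rightarrow> cmat2" where
  "tl_mat p q w = (\<chi> i j. if i = 1 then (if j = 1 then p else q) else (if j = 1 then w else - p))"

lemma tl_mat_nth [simp]: "tl_mat p q w $ 1 $ 1 = p" "tl_mat p q w $ 1 $ 2 = q" "tl_mat p q w $ 2 $ 1 = w" "tl_mat p q w $ 2 $ 2 = - p"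
  by (simp_all add: tl_mat_def)

lemma tl_mat_eq: "M $ 2 $ 2 = - M $ 1 $ 1 \<Longrightarrow> M = tl_mat (M $ 1 $ 1) (M $ 1 $ 2) (M $ 2 $ 1)"
  by (simp add: vec_eq_iff forall_2)

lemma commutator_tl_mat:
  "commutator (tl_mat p q w) (tl_mat a b c) = tl_mat (q * c - b * w) (2 * (p * b - q * a)) (2 * (w * a - p * c))"
  by (simp add: commutator_def vec_eq_iff forall_2 matrix_matrix_mult_def sum_2 algebra_simps)

text \<open>The eigenvalues of a traceless matrix are the square roots of minus its determinant, and
  the set of square roots determines the number; this covers the case of the double eigenvalue
  0.\<close>

lemma traceless_with_eigenvalues_iff:
  "traceless_with_eigenvalues \<epsilon> M \<longleftrightarrow> M $ 2 $ 2 = - M $ 1 $ 1 \<and> M $ 1 $ 1 ^ 2 + M $ 1 $ 2 * M $ 2 $ 1 = \<epsilon>\<^sup>2"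
proof -
  have ev: "(\<exists>v. v \<noteq> 0 \<and> M *v v = \<mu> *s v) \<longleftrightarrow> det (M - mat \<mu>) = 0" for \<mu>
  proof -
    have "M *v v = \<mu> *s v \<longleftrightarrow> (M - mat \<mu>) *v v = 0" for v :: "complex^2"
      by (simp add: vec_eq_iff forall_2 matrix_vector_mult_def sum_2 mat_def algebra_simps)
    then show ?thesis
      using invertible_det_nz[of "M - mat \<mu>"] matrix_left_invertible_ker[of "M - mat \<mu>"] invertible_left_inverse[of "M - mat \<mu>"]
      by metis
  qed
  have tr: "trace M = 0 \<longleftrightarrow> M $ 2 $ 2 = - M $ 1 $ 1"
    by (simp add: trace_def sum_2 add_eq_0_iff)
  have "{\<mu>. \<exists>v. v \<noteq> 0 \<and> M *v v = \<mu> *s v} = {\<epsilon>, - \<epsilon>} \<longleftrightarrow> M $ 1 $ 1 ^ 2 + M $ 1 $ 2 * M $ 2 $ 1 = \<epsilon>\<^sup>2"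
    if t: "M $ 2 $ 2 = - M $ 1 $ 1"
  proof -
    have "det (M - mat \<mu>) = \<mu>\<^sup>2 - (M $ 1 $ 1 ^ 2 + M $ 1 $ 2 * M $ 2 $ 1)" for \<mu>
      by (simp add: det_2x2 mat_def t power2_eq_square algebra_simps)
    then have "{\<mu>. \<exists>v. v \<noteq> 0 \<and> M *v v = \<mu> *s v} = {\<mu>. \<mu>\<^sup>2 = M $ 1 $ 1 ^ 2 + M $ 1 $ 2 * M $ 2 $ 1}" unfolding ev by simp
    moreover have "{\<mu>. \<mu>\<^sup>2 = \<epsilon>\<^sup>2} = {\<epsilon>, - \<epsilon>}" by (auto simp: power2_eq_iff)
    ultimately have e: "{\<mu>. \<exists>v. v \<noteq> 0 \<and> M *v v = \<mu> *s v} = {\<epsilon>, - \<epsilon>} \<longleftrightarrow>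
        {\<mu>. \<mu>\<^sup>2 = M $ 1 $ 1 ^ 2 + M $ 1 $ 2 * M $ 2 $ 1} = {\<mu>. \<mu>\<^sup>2 = \<epsilon>\<^sup>2}" by simp
    have "C = \<epsilon>\<^sup>2" if "{\<mu>. \<mu>\<^sup>2 = C} = {\<mu>. \<mu>\<^sup>2 = \<epsilon>\<^sup>2}" for C
    proof -
      have "\<epsilon> \<in> {\<mu>. \<mu>\<^sup>2 = \<epsilon>\<^sup>2}" by simp
      then have "\<epsilon> \<in> {\<mu>. \<mu>\<^sup>2 = C}" unfolding that .
      then show ?thesis by simp
    qed
    then show ?thesis unfolding e by auto
  qed
  then show ?thesis unfolding traceless_with_eigenvalues_def tr by blast
qed

text \<open>Only the analytic properties of the branch are kept, so the exponents may be any roots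
  belonging to the same \<alpha>, \<beta>, \<gamma>, \<delta>. \<open>\<psi>\<close> is a primitive
  of \<open>J\<close>, and \<open>k\<close> is the free constant of diagonal conjugation.\<close>

locale pvi_branch =
  fixes S :: "complex set" and y g \<psi> :: "complex \<Rightarrow> complex" and \<alpha> \<beta> \<gamma> \<delta> t0 tx t1 ti k :: complex
  assumes S: "open S" "connected S"
    and nz: "\<And>\<xi>. \<xi> \<in> S \<Longrightarrow> exp \<xi> \<noteq> 1 \<and> y \<xi> \<noteq> 0 \<and> y \<xi> \<noteq> 1 \<and> y \<xi> \<noteq> exp \<xi>"
    and Dy: "\<And>\<xi>. \<xi> \<in> S \<Longrightarrow> (y has_field_derivative g \<xi> * y \<xi>) (at \<xi>)"
    and Dg: "\<And>\<xi>. \<xi> \<in> S \<Longrightarrow> (g has_field_derivative pvi_log_rhs \<alpha> \<beta> \<gamma> \<delta> (exp \<xi>) (y \<xi>) (g \<xi>)) (at \<xi>)"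
    and D\<psi>: "\<And>\<xi>. \<xi> \<in> S \<Longrightarrow> (\<psi> has_field_derivative (y \<xi> - exp \<xi>) / (1 - exp \<xi>)) (at \<xi>)"
    and th: "PVI_exponents \<alpha> \<beta> \<gamma> \<delta> t0 tx t1 ti"
    and k: "k \<noteq> 0"
begin

text \<open>
  The associated solution \<open>y\<close> determines the entries \<open>12\<close> of the three matrices up to the common factor
  \<open>d\<close>, the equation for \<open>A0\<close> then gives \<open>A0\<^sub>1\<^sub>1 + \<eta> u = u z\<close>, where \<open>\<eta>\<close> parametrizes \<open>A1\<^sub>1\<^sub>1\<close>, and
  \<open>\<eta>\<close> follows because the entries \<open>21\<close>, known from the determinants, add up to \<open>0\<close>.
\<close>

definition "\<rho> = - (ti + t1) / 2"
definition "A = t0\<^sup>2 / 4"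
definition "B = \<rho>\<^sup>2 - tx\<^sup>2 / 4"
definition "K \<xi> = 1 / (1 - exp \<xi>)"
definition "e \<xi> = exp \<xi> / y \<xi>"
definition "P \<xi> = 1 / (1 - e \<xi>)"
definition "J \<xi> = y \<xi> * (K \<xi> * (1 - e \<xi>))"
definition "L \<xi> = 1 - J \<xi>"
definition "z \<xi> = ((1 - g \<xi> - (1 - ti) * J \<xi>) / 2 + \<rho>) / L \<xi>"
definition "G \<xi> = J \<xi> * ((1 - ti) * z \<xi> - z \<xi> * z \<xi>) + (e \<xi> * P \<xi>) * (2 * \<rho> * z \<xi> - z \<xi> * z \<xi> - B) - e \<xi> * (A * K \<xi> * (1 - e \<xi>))"
definition "Om \<xi> = A * e \<xi> + (1 - y \<xi> * e \<xi>) * P \<xi> * (B * e \<xi> - 2 * \<rho> * z \<xi>) + (1 - y \<xi>) * P \<xi> * z \<xi> * z \<xi>"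
definition "\<eta> \<xi> = Om \<xi> / ti"
definition "d \<xi> = k * exp ((1 - ti) * \<psi> \<xi>)"
definition "u \<xi> = y \<xi> / exp \<xi>"
definition "DJ \<xi> = (g \<xi> * y \<xi> - exp \<xi>) / (1 - exp \<xi>) + (y \<xi> - exp \<xi>) * exp \<xi> / (1 - exp \<xi>)\<^sup>2"

text \<open>\<open>f\<close> drives the equation of \<open>\<eta>\<close>, as
  \<open>D \<eta> = - f + (1 - ti) J \<eta>\<close>. \<open>H\<close> is common to the two diagonal
  derivatives, which are \<open>u H\<close> for \<open>A0\<close> and \<open>y K H\<close> for
  \<open>A1\<close>.\<close>

definition "f \<xi> = y \<xi> * K \<xi> * (e \<xi> * Om \<xi> - A * e \<xi> * e \<xi> + z \<xi> * z \<xi>)"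
definition "H \<xi> = L \<xi> * (A * e \<xi> * e \<xi> - z \<xi> * z \<xi>) + 2 * L \<xi> * z \<xi> * \<eta> \<xi> + t1 * \<eta> \<xi>"

definition "c1 \<xi> = (t1 * \<eta> \<xi> + \<eta> \<xi> * \<eta> \<xi> * L \<xi>) / d \<xi>"
definition "c0 \<xi> = (A * e \<xi> - u \<xi> * (z \<xi> - \<eta> \<xi>)\<^sup>2) / d \<xi>"

definition "A0 \<xi> = tl_mat (u \<xi> * z \<xi> - \<eta> \<xi> * u \<xi>) (d \<xi> * u \<xi>) (c0 \<xi>)"
definition "A1 \<xi> = tl_mat (t1 / 2 + \<eta> \<xi> * L \<xi>) (- d \<xi> * L \<xi>) (c1 \<xi>)"
definition "Ax \<xi> = tl_mat (\<rho> - u \<xi> * z \<xi> + \<eta> \<xi> * (u \<xi> - L \<xi>)) (d \<xi> * (L \<xi> - u \<xi>)) (- c0 \<xi> - c1 \<xi>)"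

lemma ti: "ti \<noteq> 0" using th by (simp add: PVI_exponents_def)

lemma exps: "t0\<^sup>2 = - 2 * \<beta>" "tx\<^sup>2 = 1 - 2 * \<delta>" "t1\<^sup>2 = 2 * \<gamma>" "(ti - 1)\<^sup>2 = 2 * \<alpha>"
  using th by (simp_all add: PVI_exponents_def)

context
  fixes \<xi> :: complex
  assumes \<xi>: "\<xi> \<in> S"
begin

lemma nz': "1 - exp \<xi> \<noteq> 0" "y \<xi> \<noteq> 0" "e \<xi> \<noteq> 1" "d \<xi> \<noteq> 0" "u \<xi> \<noteq> 0" "y \<xi> * e \<xi> = exp \<xi>" "u \<xi> * e \<xi> = 1" "u \<xi> * exp \<xi> = y \<xi>"
  using nz[OF \<xi>] k by (auto simp: e_def d_def u_def)

lemma P_eq: "P \<xi> = 1 + e \<xi> * P \<xi>" and K_eq: "K \<xi> = 1 + y \<xi> * e \<xi> * K \<xi>" and K_eq': "K \<xi> * (1 - exp \<xi>) = 1"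
  using nz' by (simp_all add: P_def K_def field_simps)

lemma L_eq: "L \<xi> = K \<xi> * (1 - y \<xi>)"
  unfolding L_def by (rule one_minus_J[OF K_eq J_def])

lemma L_nz: "L \<xi> \<noteq> 0"
  using nz[OF \<xi>] by (simp add: L_eq K_def)

lemma J_eq: "J \<xi> = (y \<xi> - exp \<xi>) / (1 - exp \<xi>)"
proof -
  have "J \<xi> = K \<xi> * (y \<xi> - y \<xi> * e \<xi>)" by (simp add: J_def algebra_simps)
  then show ?thesis unfolding nz' by (simp add: K_def)
qed

lemma g_eq: "g \<xi> = 1 - 2 * (z \<xi> * (1 - J \<xi>) - \<rho>) - (1 - ti) * J \<xi>"
proof -
  have "z \<xi> * (1 - J \<xi>) = (1 - g \<xi> - (1 - ti) * J \<xi>) / 2 + \<rho>" using L_nz by (simp add: z_def L_def)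
  then show ?thesis by (simp add: field_simps)
qed

lemma D_e: "(e has_field_derivative (1 - g \<xi>) * e \<xi>) (at \<xi>)"
  unfolding e_def
  by (rule DERIV_cong[OF DERIV_divide[OF DERIV_exp Dy[OF \<xi>] nz'(2)]]) (use nz'(2) in \<open>simp add: field_simps power2_eq_square\<close>)

lemma D_u: "(u has_field_derivative (g \<xi> - 1) * u \<xi>) (at \<xi>)"
  unfolding u_def
  by (rule DERIV_cong[OF DERIV_divide[OF Dy[OF \<xi>] DERIV_exp]]) (simp_all add: field_simps power2_eq_square)

lemma D_K: "(K has_field_derivative exp \<xi> * K \<xi> * K \<xi>) (at \<xi>)"
  unfolding K_def
  by (rule DERIV_cong[OF DERIV_divide[OF DERIV_const DERIV_diff[OF DERIV_const DERIV_exp] nz'(1)]]) simp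

lemma D_P: "(P has_field_derivative P \<xi> * P \<xi> * ((1 - g \<xi>) * e \<xi>)) (at \<xi>)"
  unfolding P_def
  by (rule DERIV_cong[OF DERIV_divide[OF DERIV_const DERIV_diff[OF DERIV_const D_e]]]) (use nz'(3) in simp_all)

lemma DJ_eq: "DJ \<xi> = K \<xi> * (g \<xi> * y \<xi> - exp \<xi> * L \<xi>)"
proof -
  have "DJ \<xi> = K \<xi> * (g \<xi> * y \<xi> - exp \<xi> + (y \<xi> - exp \<xi>) * exp \<xi> * K \<xi>)"
    unfolding DJ_def K_def by (simp add: power2_eq_square divide_simps distrib_left)
  also have "(y \<xi> - exp \<xi>) * exp \<xi> * K \<xi> = exp \<xi> * J \<xi>" by (simp add: J_eq K_def)
  finally show ?thesis by (simp add: L_def algebra_simps)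
qed

lemma D_J: "(J has_field_derivative DJ \<xi>) (at \<xi>)"
proof -
  have "(J has_field_derivative g \<xi> * y \<xi> * (K \<xi> * (1 - e \<xi>)) + (exp \<xi> * K \<xi> * K \<xi> * (1 - e \<xi>) + (0 - (1 - g \<xi>) * e \<xi>) * K \<xi>) * y \<xi>) (at \<xi>)"
    unfolding J_def by (intro DERIV_mult Dy[OF \<xi>] D_K DERIV_diff DERIV_const D_e)
  moreover have "g \<xi> * y \<xi> * (K \<xi> * (1 - e \<xi>)) + (exp \<xi> * K \<xi> * K \<xi> * (1 - e \<xi>) + (0 - (1 - g \<xi>) * e \<xi>) * K \<xi>) * y \<xi> = DJ \<xi>"
  proof -
    have "g \<xi> * y \<xi> * (K \<xi> * (1 - e \<xi>)) + (exp \<xi> * K \<xi> * K \<xi> * (1 - e \<xi>) + (0 - (1 - g \<xi>) * e \<xi>) * K \<xi>) * y \<xi>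
      = K \<xi> * (g \<xi> * y \<xi> - y \<xi> * e \<xi> + exp \<xi> * (y \<xi> * (K \<xi> * (1 - e \<xi>))))" by (simp add: algebra_simps)
    then show ?thesis unfolding J_def[symmetric] nz'(6) DJ_eq L_def by (simp add: algebra_simps)
  qed
  ultimately show ?thesis by simp
qed

lemma D_L: "(L has_field_derivative - DJ \<xi>) (at \<xi>)"
  using DERIV_diff[OF DERIV_const[of 1] D_J] unfolding L_def[abs_def] by simp

text \<open>Here PVI is the hypothesis: \<open>D g\<close> is known, and \<open>PVI_identity\<close>
  lets it be solved for \<open>D z\<close> because \<open>L\<close> does not vanish.\<close>

lemma D_z: "(z has_field_derivative G \<xi>) (at \<xi>)"
proof -
  define R where "R = pvi_log_rhs \<alpha> \<beta> \<gamma> \<delta> (exp \<xi>) (y \<xi>) (g \<xi>)"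
  have R: "- 2 * G \<xi> * (1 - J \<xi>) + (2 * z \<xi> - 1 + ti) * DJ \<xi> = R"
    unfolding R_def pvi_log_rhs_def
    by (rule PVI_identity[OF _ _ _ _ _ e_def K_def P_def J_def \<rho>_def A_def B_def G_def g_eq DJ_def exps]) (use nz[OF \<xi>] in auto)
  define N where "N = (\<lambda>\<xi>. (1 - g \<xi> - (1 - ti) * J \<xi>) / 2 + \<rho>)"
  have N: "(N has_field_derivative (0 - R - (1 - ti) * DJ \<xi>) / 2 + 0) (at \<xi>)"
    unfolding N_def R_def by (intro DERIV_add DERIV_cdivide DERIV_diff DERIV_const DERIV_cmult Dg[OF \<xi>] D_J)
  have NL: "N \<xi> = z \<xi> * L \<xi>" using L_nz by (simp add: z_def N_def)
  have "(z has_field_derivative (((0 - R - (1 - ti) * DJ \<xi>) / 2 + 0) * L \<xi> - N \<xi> * - DJ \<xi>) / (L \<xi> * L \<xi>)) (at \<xi>)"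
    using DERIV_divide[OF N D_L L_nz] unfolding z_def[abs_def] N_def .
  moreover have "((0 - R - (1 - ti) * DJ \<xi>) / 2 + 0) * L \<xi> - N \<xi> * - DJ \<xi> = G \<xi> * (L \<xi> * L \<xi>)"
    unfolding R[symmetric] NL L_def[symmetric] by (simp add: field_simps)
  ultimately show ?thesis using L_nz by simp
qed


lemma D_Om: "(Om has_field_derivative - ti * f \<xi> + (1 - ti) * J \<xi> * Om \<xi>) (at \<xi>)"
proof -
  have "(Om has_field_derivative A * ((1 - g \<xi>) * e \<xi>) + (- (g \<xi> * y \<xi> * e \<xi> + y \<xi> * ((1 - g \<xi>) * e \<xi>))) * P \<xi> * (B * e \<xi> - 2 * \<rho> * z \<xi>)
     + (1 - y \<xi> * e \<xi>) * (P \<xi> * P \<xi> * ((1 - g \<xi>) * e \<xi>)) * (B * e \<xi> - 2 * \<rho> * z \<xi>)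
     + (1 - y \<xi> * e \<xi>) * P \<xi> * (B * ((1 - g \<xi>) * e \<xi>) - 2 * \<rho> * G \<xi>) - g \<xi> * y \<xi> * P \<xi> * z \<xi> * z \<xi>
     + (1 - y \<xi>) * (P \<xi> * P \<xi> * ((1 - g \<xi>) * e \<xi>)) * z \<xi> * z \<xi> + (1 - y \<xi>) * P \<xi> * (2 * z \<xi> * G \<xi>)) (at \<xi>)"
    unfolding Om_def
    by (rule DERIV_cong, (rule derivative_intros Dy[OF \<xi>] D_e D_P D_z refl)+) (simp add: algebra_simps)
  also have "A * ((1 - g \<xi>) * e \<xi>) + (- (g \<xi> * y \<xi> * e \<xi> + y \<xi> * ((1 - g \<xi>) * e \<xi>))) * P \<xi> * (B * e \<xi> - 2 * \<rho> * z \<xi>)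
     + (1 - y \<xi> * e \<xi>) * (P \<xi> * P \<xi> * ((1 - g \<xi>) * e \<xi>)) * (B * e \<xi> - 2 * \<rho> * z \<xi>)
     + (1 - y \<xi> * e \<xi>) * P \<xi> * (B * ((1 - g \<xi>) * e \<xi>) - 2 * \<rho> * G \<xi>) - g \<xi> * y \<xi> * P \<xi> * z \<xi> * z \<xi>
     + (1 - y \<xi>) * (P \<xi> * P \<xi> * ((1 - g \<xi>) * e \<xi>)) * z \<xi> * z \<xi> + (1 - y \<xi>) * P \<xi> * (2 * z \<xi> * G \<xi>)
     = - ti * (y \<xi> * e \<xi> * K \<xi> * Om \<xi> - A * y \<xi> * e \<xi> * K \<xi> * e \<xi> + y \<xi> * K \<xi> * z \<xi> * z \<xi>) + (1 - ti) * J \<xi> * Om \<xi>"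
    by (rule Om_identity[OF P_eq K_eq J_def G_def g_eq Om_def refl refl])
  finally show ?thesis by (simp add: f_def algebra_simps)
qed

lemma D_\<eta>: "(\<eta> has_field_derivative - f \<xi> + (1 - ti) * J \<xi> * \<eta> \<xi>) (at \<xi>)"
  using DERIV_cdivide[OF D_Om, of ti] ti unfolding \<eta>_def[abs_def] by (simp add: diff_divide_distrib add_divide_distrib)

lemma D_d: "(d has_field_derivative (1 - ti) * J \<xi> * d \<xi>) (at \<xi>)"
proof -
  have "(d has_field_derivative k * (exp ((1 - ti) * \<psi> \<xi>) * ((1 - ti) * ((y \<xi> - exp \<xi>) / (1 - exp \<xi>))))) (at \<xi>)"
    unfolding d_def by (intro DERIV_cmult DERIV_fun_exp D\<psi>[OF \<xi>])
  then show ?thesis by (simp add: d_def J_eq mult_ac)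
qed


lemma two_rho: "2 * \<rho> = - ti - t1" by (simp add: \<rho>_def)

lemma ti_\<eta>: "ti * \<eta> \<xi> = Om \<xi>" using ti by (simp add: \<eta>_def)

lemma Lax0_11: "((\<lambda>\<xi>. u \<xi> * z \<xi> - \<eta> \<xi> * u \<xi>) has_field_derivative u \<xi> * H \<xi>) (at \<xi>)"
proof -
  have "((\<lambda>\<xi>. u \<xi> * z \<xi> - \<eta> \<xi> * u \<xi>) has_field_derivative ((g \<xi> - 1) * u \<xi> * z \<xi> + G \<xi> * u \<xi>) -
     ((- f \<xi> + (1 - ti) * J \<xi> * \<eta> \<xi>) * u \<xi> + (g \<xi> - 1) * u \<xi> * \<eta> \<xi>)) (at \<xi>)"
    by (intro DERIV_diff DERIV_mult D_u D_z D_\<eta>)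
  moreover have "((g \<xi> - 1) * u \<xi> * z \<xi> + G \<xi> * u \<xi>) - ((- f \<xi> + (1 - ti) * J \<xi> * \<eta> \<xi>) * u \<xi> + (g \<xi> - 1) * u \<xi> * \<eta> \<xi>)
     = u \<xi> * ((g \<xi> - 1) * z \<xi> + G \<xi> + f \<xi> - (1 - ti) * J \<xi> * \<eta> \<xi> - (g \<xi> - 1) * \<eta> \<xi>)" by (simp add: algebra_simps)
  moreover have "(g \<xi> - 1) * z \<xi> + G \<xi> + f \<xi> - (1 - ti) * J \<xi> * \<eta> \<xi> - (g \<xi> - 1) * \<eta> \<xi> = H \<xi>"
  proof -
    have 1: "(g \<xi> - 1) * z \<xi> + G \<xi> = L \<xi> * (A * e \<xi> * e \<xi> - z \<xi> * z \<xi>) - Om \<xi> * (K \<xi> - y \<xi> * e \<xi> * K \<xi>) - f \<xi>"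
      unfolding G_identity[OF P_eq K_eq J_def G_def g_eq Om_def] f_def L_eq by (simp add: algebra_simps)
    have 2: "K \<xi> - y \<xi> * e \<xi> * K \<xi> = 1" using K_eq by (metis add_diff_cancel_right')
    have 3: "(g \<xi> - 1) * \<eta> \<xi> = 2 * \<rho> * \<eta> \<xi> - 2 * L \<xi> * z \<xi> * \<eta> \<xi> - (1 - ti) * J \<xi> * \<eta> \<xi>"
      unfolding g_eq L_def by (simp add: algebra_simps)
    show ?thesis unfolding 1 2 3 two_rho H_def ti_\<eta>[symmetric] by (simp add: algebra_simps)
  qed
  ultimately show ?thesis by simp
qed

lemma Lax0_12: "((\<lambda>\<xi>. d \<xi> * u \<xi>) has_field_derivative 2 * d \<xi> * u \<xi> * (\<rho> - z \<xi> * L \<xi>)) (at \<xi>)"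
  by (rule DERIV_cong[OF DERIV_mult[OF D_d D_u]]) (simp add: g_eq L_def algebra_simps)

lemma Lax1_11: "((\<lambda>\<xi>. t1 / 2 + \<eta> \<xi> * L \<xi>) has_field_derivative y \<xi> * K \<xi> * H \<xi>) (at \<xi>)"
proof -
  have "((\<lambda>\<xi>. t1 / 2 + \<eta> \<xi> * L \<xi>) has_field_derivative 0 + ((- f \<xi> + (1 - ti) * J \<xi> * \<eta> \<xi>) * L \<xi> + - DJ \<xi> * \<eta> \<xi>)) (at \<xi>)"
    by (intro DERIV_add DERIV_const DERIV_mult D_\<eta> D_L)
  moreover have "0 + ((- f \<xi> + (1 - ti) * J \<xi> * \<eta> \<xi>) * L \<xi> + - DJ \<xi> * \<eta> \<xi>) = y \<xi> * K \<xi> * H \<xi>"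
  proof -
    have f: "f \<xi> = y \<xi> * K \<xi> * (z \<xi> * z \<xi> - A * e \<xi> * e \<xi>) + K \<xi> * exp \<xi> * ti * \<eta> \<xi>"
      unfolding f_def nz'(6)[symmetric] ti_\<eta>[symmetric] by (simp add: algebra_simps)
    have g: "g \<xi> = 1 - 2 * z \<xi> * L \<xi> - ti - t1 - (1 - ti) * (1 - L \<xi>)"
      using g_eq two_rho unfolding L_def by (simp add: algebra_simps)
    show ?thesis unfolding DJ_eq f g H_def using L_eq K_eq' unfolding L_def by algebra
  qed
  ultimately show ?thesis by simp
qed

lemma Lax1_12: "((\<lambda>\<xi>. - d \<xi> * L \<xi>) has_field_derivative 2 * d \<xi> * K \<xi> * (exp \<xi> * L \<xi> * \<rho> - y \<xi> * L \<xi> * z \<xi> - J \<xi> * (t1 / 2))) (at \<xi>)"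
proof -
  have "((\<lambda>\<xi>. - d \<xi> * L \<xi>) has_field_derivative - ((1 - ti) * J \<xi> * d \<xi>) * L \<xi> + - DJ \<xi> * - d \<xi>) (at \<xi>)"
    by (intro DERIV_mult DERIV_minus D_d D_L)
  moreover have "- ((1 - ti) * J \<xi> * d \<xi>) * L \<xi> + - DJ \<xi> * - d \<xi> = d \<xi> * K \<xi> * (exp \<xi> * L \<xi> * (2 * \<rho>) - 2 * y \<xi> * L \<xi> * z \<xi> - J \<xi> * t1)"
  proof -
    have g: "g \<xi> = 1 - 2 * z \<xi> * L \<xi> - ti - t1 - (1 - ti) * (1 - L \<xi>)"
      using g_eq two_rho unfolding L_def by (simp add: algebra_simps)
    show ?thesis unfolding DJ_eq g two_rho using L_eq K_eq' unfolding L_def by algebra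
  qed
  ultimately have "((\<lambda>\<xi>. - d \<xi> * L \<xi>) has_field_derivative d \<xi> * K \<xi> * (exp \<xi> * L \<xi> * (2 * \<rho>) - 2 * y \<xi> * L \<xi> * z \<xi> - J \<xi> * t1)) (at \<xi>)"
    by (simp only:)
  then show ?thesis by (rule DERIV_cong) (simp add: algebra_simps)
qed

lemma Lu: "(L \<xi> - u \<xi>) * (1 - exp \<xi>) = 1 - u \<xi>" "L \<xi> - u \<xi> \<noteq> 0"
proof -
  show 1: "(L \<xi> - u \<xi>) * (1 - exp \<xi>) = 1 - u \<xi>"
    using L_eq K_eq' nz'(8) by algebra
  have "u \<xi> \<noteq> 1" using nz[OF \<xi>] by (auto simp: u_def)
  then show "L \<xi> - u \<xi> \<noteq> 0" using 1 by auto
qed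

text \<open>As \<open>u e = 1\<close>, one has \<open>(1 - u) P = - u\<close>, so multiplication by
  \<open>L - u = (1 - u) / (1 - x)\<close> removes \<open>P\<close>. In this form \<open>Om\<close>
  appears in the determinant of \<open>Ax\<close>.\<close>

lemma Lu_Om: "(L \<xi> - u \<xi>) * Om \<xi> = (L \<xi> - u \<xi>) * A * e \<xi> - B + 2 * \<rho> * u \<xi> * z \<xi> - u \<xi> * L \<xi> * z \<xi> * z \<xi>"
proof -
  have uP: "(1 - u \<xi>) * P \<xi> = - u \<xi>" using P_eq nz'(7) by algebra
  then have wP: "(L \<xi> - u \<xi>) * ((1 - exp \<xi>) * P \<xi>) = - u \<xi>" unfolding Lu(1)[symmetric] by (simp only: mult.assoc)
  have wL: "(L \<xi> - u \<xi>) * ((1 - y \<xi>) * P \<xi>) = - u \<xi> * L \<xi>"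
  proof -
    have "1 - y \<xi> = L \<xi> * (1 - exp \<xi>)" using L_eq K_eq' by algebra
    then show ?thesis using wP by algebra
  qed
  have "(L \<xi> - u \<xi>) * Om \<xi> = (L \<xi> - u \<xi>) * A * e \<xi> + (L \<xi> - u \<xi>) * ((1 - exp \<xi>) * P \<xi>) * (B * e \<xi> - 2 * \<rho> * z \<xi>) + (L \<xi> - u \<xi>) * ((1 - y \<xi>) * P \<xi>) * z \<xi> * z \<xi>"
    unfolding Om_def nz'(6) by (simp only: distrib_left mult.assoc)
  also have "\<dots> = (L \<xi> - u \<xi>) * A * e \<xi> - (u \<xi> * e \<xi>) * B + 2 * \<rho> * u \<xi> * z \<xi> - u \<xi> * L \<xi> * z \<xi> * z \<xi>"
    unfolding wP wL by (simp add: algebra_simps)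
  finally show ?thesis unfolding nz'(7) by simp
qed

lemma c_d: "c0 \<xi> * d \<xi> = A * e \<xi> - u \<xi> * (z \<xi> - \<eta> \<xi>)\<^sup>2" "c1 \<xi> * d \<xi> = t1 * \<eta> \<xi> + \<eta> \<xi> * \<eta> \<xi> * L \<xi>"
  using nz'(4) by (simp_all add: c0_def c1_def)

text \<open>The first two relations hold by the choice of \<open>c0\<close> and \<open>c1\<close>.
  The third is linear in \<open>\<eta>\<close>, its quadratic terms cancelling, and is the one that
  forces \<open>ti * \<eta> = Om\<close>.\<close>

lemma dets:
  "(u \<xi> * z \<xi> - \<eta> \<xi> * u \<xi>)\<^sup>2 + d \<xi> * u \<xi> * c0 \<xi> = (t0 / 2)\<^sup>2"
  "(t1 / 2 + \<eta> \<xi> * L \<xi>)\<^sup>2 + (- d \<xi> * L \<xi>) * c1 \<xi> = (t1 / 2)\<^sup>2"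
  "(\<rho> - u \<xi> * z \<xi> + \<eta> \<xi> * (u \<xi> - L \<xi>))\<^sup>2 + d \<xi> * (L \<xi> - u \<xi>) * (- c0 \<xi> - c1 \<xi>) = (tx / 2)\<^sup>2"
proof -
  have "d \<xi> * u \<xi> * c0 \<xi> = u \<xi> * (A * e \<xi> - u \<xi> * (z \<xi> - \<eta> \<xi>)\<^sup>2)" unfolding c_d(1)[symmetric] by (simp add: mult_ac)
  also have "\<dots> = A * (u \<xi> * e \<xi>) - (u \<xi> * z \<xi> - \<eta> \<xi> * u \<xi>)\<^sup>2" by (simp add: power2_eq_square algebra_simps)
  finally show "(u \<xi> * z \<xi> - \<eta> \<xi> * u \<xi>)\<^sup>2 + d \<xi> * u \<xi> * c0 \<xi> = (t0 / 2)\<^sup>2"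
    unfolding nz'(7) by (simp add: A_def power_divide)
  have "(- d \<xi> * L \<xi>) * c1 \<xi> = - L \<xi> * (t1 * \<eta> \<xi> + \<eta> \<xi> * \<eta> \<xi> * L \<xi>)" unfolding c_d(2)[symmetric] by (simp add: mult_ac)
  then have e: "(- d \<xi> * L \<xi>) * c1 \<xi> = - L \<xi> * (t1 * \<eta> \<xi> + \<eta> \<xi> * \<eta> \<xi> * L \<xi>)" .
  show "(t1 / 2 + \<eta> \<xi> * L \<xi>)\<^sup>2 + (- d \<xi> * L \<xi>) * c1 \<xi> = (t1 / 2)\<^sup>2" unfolding e by (simp add: power2_eq_square field_simps)
  have "d \<xi> * (L \<xi> - u \<xi>) * (- c0 \<xi> - c1 \<xi>) = - (L \<xi> - u \<xi>) * (A * e \<xi> - u \<xi> * (z \<xi> - \<eta> \<xi>)\<^sup>2 + (t1 * \<eta> \<xi> + \<eta> \<xi> * \<eta> \<xi> * L \<xi>))"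
    unfolding c_d[symmetric] by (simp add: algebra_simps)
  then have "(\<rho> - u \<xi> * z \<xi> + \<eta> \<xi> * (u \<xi> - L \<xi>))\<^sup>2 + d \<xi> * (L \<xi> - u \<xi>) * (- c0 \<xi> - c1 \<xi>)
    = (\<rho> - u \<xi> * z \<xi>)\<^sup>2 - (L \<xi> - u \<xi>) * (A * e \<xi> - u \<xi> * z \<xi> * z \<xi>) - (L \<xi> - u \<xi>) * \<eta> \<xi> * (2 * \<rho> + t1)"
    by (simp add: power2_eq_square algebra_simps)
  also have "2 * \<rho> + t1 = - ti" by (simp add: two_rho)
  also have "(L \<xi> - u \<xi>) * \<eta> \<xi> * - ti = - ((L \<xi> - u \<xi>) * Om \<xi>)" unfolding ti_\<eta>[symmetric] by (simp add: mult_ac)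
  finally show "(\<rho> - u \<xi> * z \<xi> + \<eta> \<xi> * (u \<xi> - L \<xi>))\<^sup>2 + d \<xi> * (L \<xi> - u \<xi>) * (- c0 \<xi> - c1 \<xi>) = (tx / 2)\<^sup>2"
    unfolding Lu_Om B_def by (simp add: power2_eq_square algebra_simps)
qed

end

end

text \<open>A constant determinant expresses \<open>c\<close> through \<open>a\<close> and the
  nonvanishing \<open>b\<close>, so the third entry of a Lax equation follows from the other two;
  \<open>c0\<close> and \<open>c1\<close> need not be differentiated.\<close>

lemma lax_third_entry:
  assumes S: "open S" "\<xi> \<in> S"
    and const: "\<And>\<zeta>. \<zeta> \<in> S \<Longrightarrow> (a \<zeta>)\<^sup>2 + b \<zeta> * c \<zeta> = C" "\<And>\<zeta>. \<zeta> \<in> S \<Longrightarrow> b \<zeta> \<noteq> 0"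
    and a: "(a has_field_derivative l * (q * c \<xi> - b \<xi> * w)) (at \<xi>)"
    and b: "(b has_field_derivative l * (2 * (p * b \<xi> - q * a \<xi>))) (at \<xi>)"
  shows "(c has_field_derivative l * (2 * (w * a \<xi> - p * c \<xi>))) (at \<xi>)"
proof -
  have c: "c \<zeta> = (C - (a \<zeta>)\<^sup>2) / b \<zeta>" if "\<zeta> \<in> S" for \<zeta>
    using const[OF that] by (simp add: field_simps)
  define a' where "a' = l * (q * c \<xi> - b \<xi> * w)"
  define b' where "b' = l * (2 * (p * b \<xi> - q * a \<xi>))"
  have "((\<lambda>\<zeta>. (C - (a \<zeta>)\<^sup>2) / b \<zeta>) has_field_derivative ((0 - of_nat 2 * (a' * a \<xi> ^ (2 - Suc 0))) * b \<xi> - (C - (a \<xi>)\<^sup>2) * b') / (b \<xi> * b \<xi>)) (at \<xi>)"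
    unfolding a'_def b'_def by (intro DERIV_divide DERIV_diff DERIV_const DERIV_power a b const(2) S)
  moreover have "C - (a \<xi>)\<^sup>2 = b \<xi> * c \<xi>" using const(1)[OF S(2)] by (simp add: algebra_simps)
  moreover have "(0 - of_nat 2 * (a' * a \<xi> ^ (2 - Suc 0))) * b \<xi> - b \<xi> * c \<xi> * b' = (l * (2 * (w * a \<xi> - p * c \<xi>))) * (b \<xi> * b \<xi>)"
    unfolding a'_def b'_def by (simp add: algebra_simps)
  ultimately have "((\<lambda>\<zeta>. (C - (a \<zeta>)\<^sup>2) / b \<zeta>) has_field_derivative l * (2 * (w * a \<xi> - p * c \<xi>))) (at \<xi>)"
    using const(2)[OF S(2)] by simp
  then show ?thesis
    by (rule has_field_derivative_transform_within_open[OF _ S]) (simp add: c)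
qed

context pvi_branch
begin

lemma deriv_A0:
  assumes \<xi>: "\<xi> \<in> S"
  shows "((\<lambda>\<xi>. A0 \<xi> $ i $ j) has_field_derivative commutator (Ax \<xi>) (A0 \<xi>) $ i $ j) (at \<xi>)"
proof -
  note n = nz'[OF \<xi>]
  have 11: "((\<lambda>\<xi>. u \<xi> * z \<xi> - \<eta> \<xi> * u \<xi>) has_field_derivative
      1 * ((d \<xi> * (L \<xi> - u \<xi>)) * c0 \<xi> - (d \<xi> * u \<xi>) * (- c0 \<xi> - c1 \<xi>))) (at \<xi>)"
  proof (rule DERIV_cong[OF Lax0_11[OF \<xi>]])
    have "1 * ((d \<xi> * (L \<xi> - u \<xi>)) * c0 \<xi> - (d \<xi> * u \<xi>) * (- c0 \<xi> - c1 \<xi>)) = L \<xi> * (c0 \<xi> * d \<xi>) + u \<xi> * (c1 \<xi> * d \<xi>)"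
      by (simp add: algebra_simps)
    also have "\<dots> = L \<xi> * A * e \<xi> * 1 - L \<xi> * u \<xi> * (z \<xi> - \<eta> \<xi>)\<^sup>2 + u \<xi> * (t1 * \<eta> \<xi> + \<eta> \<xi> * \<eta> \<xi> * L \<xi>)"
      unfolding c_d[OF \<xi>] by (simp add: algebra_simps)
    also have "\<dots> = u \<xi> * H \<xi>"
      unfolding n(7)[symmetric] H_def by (simp add: power2_eq_square algebra_simps)
    finally show "u \<xi> * H \<xi> = 1 * ((d \<xi> * (L \<xi> - u \<xi>)) * c0 \<xi> - (d \<xi> * u \<xi>) * (- c0 \<xi> - c1 \<xi>))" by simp
  qed
  have 12: "((\<lambda>\<xi>. d \<xi> * u \<xi>) has_field_derivative
      1 * (2 * ((\<rho> - u \<xi> * z \<xi> + \<eta> \<xi> * (u \<xi> - L \<xi>)) * (d \<xi> * u \<xi>) - (d \<xi> * (L \<xi> - u \<xi>)) * (u \<xi> * z \<xi> - \<eta> \<xi> * u \<xi>)))) (at \<xi>)"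
    by (rule DERIV_cong[OF Lax0_12[OF \<xi>]]) (simp add: algebra_simps)
  have 21: "(c0 has_field_derivative 1 * (2 * ((- c0 \<xi> - c1 \<xi>) * (u \<xi> * z \<xi> - \<eta> \<xi> * u \<xi>) - (\<rho> - u \<xi> * z \<xi> + \<eta> \<xi> * (u \<xi> - L \<xi>)) * c0 \<xi>))) (at \<xi>)"
    by (rule lax_third_entry[OF S(1) \<xi> dets(1) _ 11 12]) (use nz' in auto)
  show ?thesis
    using 11 12 21 DERIV_minus[OF 11] exhaust_2[of i] exhaust_2[of j]
    unfolding A0_def Ax_def commutator_tl_mat by auto
qed

lemma deriv_A1:
  assumes \<xi>: "\<xi> \<in> S"
  shows "((\<lambda>\<xi>. A1 \<xi> $ i $ j) has_field_derivative exp \<xi> / (exp \<xi> - 1) * commutator (Ax \<xi>) (A1 \<xi>) $ i $ j) (at \<xi>)"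
proof -
  note n = nz'[OF \<xi>]
  have l: "exp \<xi> / (exp \<xi> - 1) = - exp \<xi> * K \<xi>"
    unfolding K_def using n(1) by (simp add: field_simps)
  have 11: "((\<lambda>\<xi>. t1 / 2 + \<eta> \<xi> * L \<xi>) has_field_derivative
      (- exp \<xi> * K \<xi>) * ((d \<xi> * (L \<xi> - u \<xi>)) * c1 \<xi> - (- d \<xi> * L \<xi>) * (- c0 \<xi> - c1 \<xi>))) (at \<xi>)"
  proof (rule DERIV_cong[OF Lax1_11[OF \<xi>]])
    have "(d \<xi> * (L \<xi> - u \<xi>)) * c1 \<xi> - (- d \<xi> * L \<xi>) * (- c0 \<xi> - c1 \<xi>) = - (L \<xi> * (c0 \<xi> * d \<xi>) + u \<xi> * (c1 \<xi> * d \<xi>))"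
      by (simp add: algebra_simps)
    also have "\<dots> = - (L \<xi> * A * e \<xi> * 1 - L \<xi> * u \<xi> * (z \<xi> - \<eta> \<xi>)\<^sup>2 + u \<xi> * (t1 * \<eta> \<xi> + \<eta> \<xi> * \<eta> \<xi> * L \<xi>))"
      unfolding c_d[OF \<xi>] by (simp add: algebra_simps)
    also have "\<dots> = - (u \<xi> * H \<xi>)"
      unfolding n(7)[symmetric] H_def by (simp add: power2_eq_square algebra_simps)
    finally have "(- exp \<xi> * K \<xi>) * ((d \<xi> * (L \<xi> - u \<xi>)) * c1 \<xi> - (- d \<xi> * L \<xi>) * (- c0 \<xi> - c1 \<xi>)) = (u \<xi> * exp \<xi>) * K \<xi> * H \<xi>"
      by (simp only: mult_minus_left mult_minus_right minus_minus mult_ac)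
    then show "y \<xi> * K \<xi> * H \<xi> = (- exp \<xi> * K \<xi>) * ((d \<xi> * (L \<xi> - u \<xi>)) * c1 \<xi> - (- d \<xi> * L \<xi>) * (- c0 \<xi> - c1 \<xi>))"
      unfolding n(8) by simp
  qed
  have 12: "((\<lambda>\<xi>. - d \<xi> * L \<xi>) has_field_derivative
      (- exp \<xi> * K \<xi>) * (2 * ((\<rho> - u \<xi> * z \<xi> + \<eta> \<xi> * (u \<xi> - L \<xi>)) * (- d \<xi> * L \<xi>) - (d \<xi> * (L \<xi> - u \<xi>)) * (t1 / 2 + \<eta> \<xi> * L \<xi>)))) (at \<xi>)"
  proof (rule DERIV_cong[OF Lax1_12[OF \<xi>]])
    have J: "J \<xi> = u \<xi> * exp \<xi> - exp \<xi> * L \<xi>"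
      using L_eq[OF \<xi>] K_eq'[OF \<xi>] n(8) unfolding L_def by algebra
    show "2 * d \<xi> * K \<xi> * (exp \<xi> * L \<xi> * \<rho> - y \<xi> * L \<xi> * z \<xi> - J \<xi> * (t1 / 2)) =
      (- exp \<xi> * K \<xi>) * (2 * ((\<rho> - u \<xi> * z \<xi> + \<eta> \<xi> * (u \<xi> - L \<xi>)) * (- d \<xi> * L \<xi>) - (d \<xi> * (L \<xi> - u \<xi>)) * (t1 / 2 + \<eta> \<xi> * L \<xi>)))"
      unfolding J n(8)[symmetric] by (simp add: algebra_simps)
  qed
  have 21: "(c1 has_field_derivative (- exp \<xi> * K \<xi>) * (2 * ((- c0 \<xi> - c1 \<xi>) * (t1 / 2 + \<eta> \<xi> * L \<xi>) - (\<rho> - u \<xi> * z \<xi> + \<eta> \<xi> * (u \<xi> - L \<xi>)) * c1 \<xi>))) (at \<xi>)"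
    by (rule lax_third_entry[OF S(1) \<xi> dets(2) _ 11 12]) (use nz' L_nz in auto)
  show ?thesis
    using 11 12 21 DERIV_minus[OF 11] exhaust_2[of i] exhaust_2[of j]
    unfolding A1_def Ax_def commutator_tl_mat l by (elim disjE) (simp_all only: tl_mat_nth mult_minus_right)
qed

lemma A_sum: "A0 \<xi> + Ax \<xi> + A1 \<xi> = diag2 (- ti / 2) (ti / 2)"
  unfolding A0_def Ax_def A1_def by (simp add: vec_eq_iff forall_2 diag2_def \<rho>_def field_simps)

text \<open>The three matrices have a constant sum, so this equation is minus the sum of the other
  two.\<close>

lemma deriv_Ax:
  assumes \<xi>: "\<xi> \<in> S"
  shows "((\<lambda>\<xi>. Ax \<xi> $ i $ j) has_field_derivative commutator (A0 \<xi>) (Ax \<xi>) $ i $ j + exp \<xi> / (exp \<xi> - 1) * commutator (A1 \<xi>) (Ax \<xi>) $ i $ j) (at \<xi>)"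
proof -
  have "(\<lambda>\<xi>. Ax \<xi> $ i $ j) = (\<lambda>\<xi>. diag2 (- ti / 2) (ti / 2) $ i $ j - A0 \<xi> $ i $ j - A1 \<xi> $ i $ j)"
  proof
    fix \<zeta> show "Ax \<zeta> $ i $ j = diag2 (- ti / 2) (ti / 2) $ i $ j - A0 \<zeta> $ i $ j - A1 \<zeta> $ i $ j"
      using arg_cong[OF A_sum[of \<zeta>], of "\<lambda>M. M $ i $ j"] by (simp add: algebra_simps)
  qed
  note e = this
  have c: "commutator N M $ i $ j = 0 - commutator M N $ i $ j" for M N by (simp add: commutator_def)
  have "commutator (A0 \<xi>) (Ax \<xi>) $ i $ j + exp \<xi> / (exp \<xi> - 1) * commutator (A1 \<xi>) (Ax \<xi>) $ i $ j
    = 0 - commutator (Ax \<xi>) (A0 \<xi>) $ i $ j - exp \<xi> / (exp \<xi> - 1) * commutator (Ax \<xi>) (A1 \<xi>) $ i $ j"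
    unfolding c[of "A0 \<xi>"] c[of "A1 \<xi>"] by simp
  then show ?thesis
    unfolding e by (rule DERIV_cong[OF DERIV_diff[OF DERIV_diff[OF DERIV_const deriv_A0[OF \<xi>]] deriv_A1[OF \<xi>]] sym])
qed

lemma Schlesinger_solution: "Schlesinger_system t0 tx t1 ti S A0 Ax A1"
  unfolding Schlesinger_system_def
proof (intro conjI allI ballI)
  show "(\<lambda>\<xi>. A0 \<xi> $ i $ j) holomorphic_on S" "(\<lambda>\<xi>. Ax \<xi> $ i $ j) holomorphic_on S" "(\<lambda>\<xi>. A1 \<xi> $ i $ j) holomorphic_on S" for i j
    unfolding holomorphic_on_open[OF S(1)] using deriv_A0 deriv_Ax deriv_A1 by blast+
  fix \<xi> assume \<xi>: "\<xi> \<in> S"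
  show "traceless_with_eigenvalues (t0 / 2) (A0 \<xi>)" "traceless_with_eigenvalues (tx / 2) (Ax \<xi>)" "traceless_with_eigenvalues (t1 / 2) (A1 \<xi>)"
    unfolding traceless_with_eigenvalues_iff A0_def A1_def Ax_def tl_mat_nth using dets[OF \<xi>] by simp_all
  show "A0 \<xi> + Ax \<xi> + A1 \<xi> = diag2 (- ti / 2) (ti / 2)" by (rule A_sum)
  fix i j
  show "deriv_x (\<lambda>\<zeta>. A0 \<zeta> $ i $ j) \<xi> = commutator (Ax \<xi>) (A0 \<xi>) $ i $ j / exp \<xi>"
    "deriv_x (\<lambda>\<zeta>. A1 \<zeta> $ i $ j) \<xi> = commutator (Ax \<xi>) (A1 \<xi>) $ i $ j / (exp \<xi> - 1)"
    "deriv_x (\<lambda>\<zeta>. Ax \<zeta> $ i $ j) \<xi> = commutator (A0 \<xi>) (Ax \<xi>) $ i $ j / exp \<xi> + commutator (A1 \<xi>) (Ax \<xi>) $ i $ j / (exp \<xi> - 1)"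
    unfolding deriv_x_def DERIV_imp_deriv[OF deriv_A0[OF \<xi>]] DERIV_imp_deriv[OF deriv_A1[OF \<xi>]] DERIV_imp_deriv[OF deriv_Ax[OF \<xi>]]
    by (simp_all add: add_divide_distrib)
qed

lemma associated: "associated_solution S A0 A1 y"
  unfolding associated_solution_def Let_def
proof
  fix \<xi> assume \<xi>: "\<xi> \<in> S"
  have "exp \<xi> * (A0 \<xi> $ 1 $ 2 + A1 \<xi> $ 1 $ 2) - A1 \<xi> $ 1 $ 2 = d \<xi>"
  proof -
    have "exp \<xi> * (A0 \<xi> $ 1 $ 2 + A1 \<xi> $ 1 $ 2) - A1 \<xi> $ 1 $ 2 = d \<xi> * (u \<xi> * exp \<xi> + L \<xi> * (1 - exp \<xi>))"
      by (simp add: A0_def A1_def algebra_simps)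
    also have "u \<xi> * exp \<xi> + L \<xi> * (1 - exp \<xi>) = 1"
      using L_eq[OF \<xi>] K_eq'[OF \<xi>] nz'(8)[OF \<xi>] by algebra
    finally show ?thesis by simp
  qed
  moreover have "exp \<xi> * A0 \<xi> $ 1 $ 2 / d \<xi> = y \<xi>"
    using nz'(4,8)[OF \<xi>] by (simp add: A0_def mult_ac)
  ultimately show "exp \<xi> * (A0 \<xi> $ 1 $ 2 + A1 \<xi> $ 1 $ 2) - A1 \<xi> $ 1 $ 2 \<noteq> 0 \<and>
      y \<xi> = exp \<xi> * A0 \<xi> $ 1 $ 2 / (exp \<xi> * (A0 \<xi> $ 1 $ 2 + A1 \<xi> $ 1 $ 2) - A1 \<xi> $ 1 $ 2)"
    using nz'(4)[OF \<xi>] by simp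
qed

end

section \<open>Uniqueness of the Schlesinger system up to a constant diagonal conjugation\<close>

definition assoc_denom :: "(complex \<Rightarrow> cmat2) \<Rightarrow> (complex \<Rightarrow> cmat2) \<Rightarrow> complex \<Rightarrow> complex" where
  "assoc_denom B0 B1 \<xi> = exp \<xi> * (B0 \<xi> $ 1 $ 2 + B1 \<xi> $ 1 $ 2) - B1 \<xi> $ 1 $ 2"

lemma Schlesinger_derivs:
  assumes B: "Schlesinger_system \<theta>0 \<theta>x \<theta>1 \<theta>i S B0 Bx B1" and S: "open S" "\<xi> \<in> S"
  shows "((\<lambda>\<xi>. B0 \<xi> $ i $ j) has_field_derivative commutator (Bx \<xi>) (B0 \<xi>) $ i $ j) (at \<xi>)"
    "exp \<xi> \<noteq> 1 \<Longrightarrow> ((\<lambda>\<xi>. B1 \<xi> $ i $ j) has_field_derivative exp \<xi> / (exp \<xi> - 1) * commutator (Bx \<xi>) (B1 \<xi>) $ i $ j) (at \<xi>)"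
proof -
  have h: "(\<lambda>\<xi>. B0 \<xi> $ i $ j) holomorphic_on S" "(\<lambda>\<xi>. B1 \<xi> $ i $ j) holomorphic_on S"
    "deriv (\<lambda>\<zeta>. B0 \<zeta> $ i $ j) \<xi> / exp \<xi> = commutator (Bx \<xi>) (B0 \<xi>) $ i $ j / exp \<xi>"
    "deriv (\<lambda>\<zeta>. B1 \<zeta> $ i $ j) \<xi> / exp \<xi> = commutator (Bx \<xi>) (B1 \<xi>) $ i $ j / (exp \<xi> - 1)"
    using B S(2) unfolding Schlesinger_system_def deriv_x_def by auto
  have "deriv (\<lambda>\<zeta>. B0 \<zeta> $ i $ j) \<xi> = commutator (Bx \<xi>) (B0 \<xi>) $ i $ j" using h(3) by simp
  then show "((\<lambda>\<xi>. B0 \<xi> $ i $ j) has_field_derivative commutator (Bx \<xi>) (B0 \<xi>) $ i $ j) (at \<xi>)"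
    using holomorphic_derivI[OF h(1) S] by simp
  assume "exp \<xi> \<noteq> 1"
  then have "deriv (\<lambda>\<zeta>. B1 \<zeta> $ i $ j) \<xi> = exp \<xi> / (exp \<xi> - 1) * commutator (Bx \<xi>) (B1 \<xi>) $ i $ j" using h(4) by (simp add: field_simps)
  then show "((\<lambda>\<xi>. B1 \<xi> $ i $ j) has_field_derivative exp \<xi> / (exp \<xi> - 1) * commutator (Bx \<xi>) (B1 \<xi>) $ i $ j) (at \<xi>)"
    using holomorphic_derivI[OF h(2) S] by simp
qed

context pvi_branch
begin

context
  fixes B0 Bx B1 :: "complex \<Rightarrow> cmat2"
  assumes B: "Schlesinger_system t0 tx t1 ti S B0 Bx B1" and assoc: "associated_solution S B0 B1 y"
begin

abbreviation "dd \<equiv> assoc_denom B0 B1"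

lemma B_tl:
  assumes \<xi>: "\<xi> \<in> S"
  shows "B0 \<xi> = tl_mat (B0 \<xi> $ 1 $ 1) (B0 \<xi> $ 1 $ 2) (B0 \<xi> $ 2 $ 1)"
    "Bx \<xi> = tl_mat (Bx \<xi> $ 1 $ 1) (Bx \<xi> $ 1 $ 2) (Bx \<xi> $ 2 $ 1)"
    "B1 \<xi> = tl_mat (B1 \<xi> $ 1 $ 1) (B1 \<xi> $ 1 $ 2) (B1 \<xi> $ 2 $ 1)"
proof -
  have e: "traceless_with_eigenvalues (t0 / 2) (B0 \<xi>)" "traceless_with_eigenvalues (tx / 2) (Bx \<xi>)" "traceless_with_eigenvalues (t1 / 2) (B1 \<xi>)"
    using B \<xi> unfolding Schlesinger_system_def by auto
  show "B0 \<xi> = tl_mat (B0 \<xi> $ 1 $ 1) (B0 \<xi> $ 1 $ 2) (B0 \<xi> $ 2 $ 1)"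
    "Bx \<xi> = tl_mat (Bx \<xi> $ 1 $ 1) (Bx \<xi> $ 1 $ 2) (Bx \<xi> $ 2 $ 1)"
    "B1 \<xi> = tl_mat (B1 \<xi> $ 1 $ 1) (B1 \<xi> $ 1 $ 2) (B1 \<xi> $ 2 $ 1)"
    using e[unfolded traceless_with_eigenvalues_iff] by (blast intro: tl_mat_eq)+
qed

lemma B_facts:
  assumes \<xi>: "\<xi> \<in> S"
  shows "B0 \<xi> $ 1 $ 1 ^ 2 + B0 \<xi> $ 1 $ 2 * B0 \<xi> $ 2 $ 1 = (t0 / 2)\<^sup>2"
    "Bx \<xi> $ 1 $ 1 ^ 2 + Bx \<xi> $ 1 $ 2 * Bx \<xi> $ 2 $ 1 = (tx / 2)\<^sup>2"
    "B1 \<xi> $ 1 $ 1 ^ 2 + B1 \<xi> $ 1 $ 2 * B1 \<xi> $ 2 $ 1 = (t1 / 2)\<^sup>2"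
    "Bx \<xi> $ 1 $ 1 = - ti / 2 - B0 \<xi> $ 1 $ 1 - B1 \<xi> $ 1 $ 1" "Bx \<xi> $ 1 $ 2 = - B0 \<xi> $ 1 $ 2 - B1 \<xi> $ 1 $ 2"
    "Bx \<xi> $ 2 $ 1 = - B0 \<xi> $ 2 $ 1 - B1 \<xi> $ 2 $ 1"
    "dd \<xi> \<noteq> 0" "B0 \<xi> $ 1 $ 2 = dd \<xi> * u \<xi>" "B1 \<xi> $ 1 $ 2 = - dd \<xi> * L \<xi>"
proof -
  have s: "B0 \<xi> + Bx \<xi> + B1 \<xi> = diag2 (- ti / 2) (ti / 2)"
    and e: "traceless_with_eigenvalues (t0 / 2) (B0 \<xi>)" "traceless_with_eigenvalues (tx / 2) (Bx \<xi>)" "traceless_with_eigenvalues (t1 / 2) (B1 \<xi>)"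
    using B \<xi> unfolding Schlesinger_system_def by auto
  show "B0 \<xi> $ 1 $ 1 ^ 2 + B0 \<xi> $ 1 $ 2 * B0 \<xi> $ 2 $ 1 = (t0 / 2)\<^sup>2"
    "Bx \<xi> $ 1 $ 1 ^ 2 + Bx \<xi> $ 1 $ 2 * Bx \<xi> $ 2 $ 1 = (tx / 2)\<^sup>2"
    "B1 \<xi> $ 1 $ 1 ^ 2 + B1 \<xi> $ 1 $ 2 * B1 \<xi> $ 2 $ 1 = (t1 / 2)\<^sup>2"
    using e unfolding traceless_with_eigenvalues_iff by auto
  have s': "Bx \<xi> $ i $ j = diag2 (- ti / 2) (ti / 2) $ i $ j - B0 \<xi> $ i $ j - B1 \<xi> $ i $ j" for i j
    unfolding s[symmetric] by simp
  show "Bx \<xi> $ 1 $ 1 = - ti / 2 - B0 \<xi> $ 1 $ 1 - B1 \<xi> $ 1 $ 1" "Bx \<xi> $ 1 $ 2 = - B0 \<xi> $ 1 $ 2 - B1 \<xi> $ 1 $ 2"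
    "Bx \<xi> $ 2 $ 1 = - B0 \<xi> $ 2 $ 1 - B1 \<xi> $ 2 $ 1"
    unfolding s'[of 1 1] s'[of 1 2] s'[of 2 1] by (simp_all add: diag2_def)
  have y: "dd \<xi> \<noteq> 0" "y \<xi> = exp \<xi> * (B0 \<xi> $ 1 $ 2) / dd \<xi>"
    using assoc \<xi> unfolding associated_solution_def assoc_denom_def Let_def by auto
  then show "dd \<xi> \<noteq> 0" and b0: "B0 \<xi> $ 1 $ 2 = dd \<xi> * u \<xi>" by (simp_all add: u_def)
  have "B1 \<xi> $ 1 $ 2 * (1 - exp \<xi>) = dd \<xi> * (u \<xi> * exp \<xi>) - dd \<xi>"
    using b0 assoc_denom_def[of B0 B1 \<xi>] by algebra
  then have "B1 \<xi> $ 1 $ 2 * (K \<xi> * (1 - exp \<xi>)) = K \<xi> * (dd \<xi> * y \<xi> - dd \<xi>)"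
    unfolding nz'(8)[OF \<xi>] by (simp add: mult_ac)
  then show "B1 \<xi> $ 1 $ 2 = - dd \<xi> * L \<xi>" unfolding K_eq'[OF \<xi>] L_eq[OF \<xi>] by (simp add: algebra_simps)
qed

lemma B_derivs:
  assumes \<xi>: "\<xi> \<in> S"
  shows "((\<lambda>\<xi>. B0 \<xi> $ 1 $ 2) has_field_derivative 2 * (Bx \<xi> $ 1 $ 1 * B0 \<xi> $ 1 $ 2 - Bx \<xi> $ 1 $ 2 * B0 \<xi> $ 1 $ 1)) (at \<xi>)"
    "((\<lambda>\<xi>. B1 \<xi> $ 1 $ 2) has_field_derivative - exp \<xi> * K \<xi> * (2 * (Bx \<xi> $ 1 $ 1 * B1 \<xi> $ 1 $ 2 - Bx \<xi> $ 1 $ 2 * B1 \<xi> $ 1 $ 1))) (at \<xi>)"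
proof -
  have c: "commutator (Bx \<xi>) (B0 \<xi>) $ 1 $ 2 = 2 * (Bx \<xi> $ 1 $ 1 * B0 \<xi> $ 1 $ 2 - Bx \<xi> $ 1 $ 2 * B0 \<xi> $ 1 $ 1)"
    "commutator (Bx \<xi>) (B1 \<xi>) $ 1 $ 2 = 2 * (Bx \<xi> $ 1 $ 1 * B1 \<xi> $ 1 $ 2 - Bx \<xi> $ 1 $ 2 * B1 \<xi> $ 1 $ 1)"
    by (metis B_tl[OF \<xi>] commutator_tl_mat tl_mat_nth(2))+
  have l: "exp \<xi> / (exp \<xi> - 1) = - exp \<xi> * K \<xi>"
    unfolding K_def using nz'(1)[OF \<xi>] by (simp add: field_simps)
  show "((\<lambda>\<xi>. B0 \<xi> $ 1 $ 2) has_field_derivative 2 * (Bx \<xi> $ 1 $ 1 * B0 \<xi> $ 1 $ 2 - Bx \<xi> $ 1 $ 2 * B0 \<xi> $ 1 $ 1)) (at \<xi>)"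
    using Schlesinger_derivs(1)[OF B S(1) \<xi>, of 1 2] unfolding c .
  show "((\<lambda>\<xi>. B1 \<xi> $ 1 $ 2) has_field_derivative - exp \<xi> * K \<xi> * (2 * (Bx \<xi> $ 1 $ 1 * B1 \<xi> $ 1 $ 2 - Bx \<xi> $ 1 $ 2 * B1 \<xi> $ 1 $ 1))) (at \<xi>)"
    using Schlesinger_derivs(2)[OF B S(1) \<xi>, of 1 2] nz[OF \<xi>] unfolding c l by simp
qed

text \<open>This is the same linear equation as that of \<open>d\<close>, so the denominator of any
  system with associated solution \<open>y\<close> is a constant multiple of
  \<open>d\<close>.\<close>

lemma deriv_dd:
  assumes \<xi>: "\<xi> \<in> S"
  shows "(dd has_field_derivative (1 - ti) * J \<xi> * dd \<xi>) (at \<xi>)"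
proof -
  define a0 a1 b0 b1 where "a0 = B0 \<xi> $ 1 $ 1" and "a1 = B1 \<xi> $ 1 $ 1" and "b0 = B0 \<xi> $ 1 $ 2" and "b1 = B1 \<xi> $ 1 $ 2"
  define b0' where "b0' = 2 * ((- ti / 2 - a0 - a1) * b0 - (- b0 - b1) * a0)"
  define b1' where "b1' = 2 * ((- ti / 2 - a0 - a1) * b1 - (- b0 - b1) * a1)"
  have d: "((\<lambda>\<xi>. B0 \<xi> $ 1 $ 2) has_field_derivative b0') (at \<xi>)" "((\<lambda>\<xi>. B1 \<xi> $ 1 $ 2) has_field_derivative - exp \<xi> * K \<xi> * b1') (at \<xi>)"
    using B_derivs[OF \<xi>] unfolding B_facts(4,5)[OF \<xi>] b0'_def b1'_def a0_def a1_def b0_def b1_def by simp_all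
  have D: "(dd has_field_derivative exp \<xi> * (b0 + b1) + (b0' + - exp \<xi> * K \<xi> * b1') * exp \<xi> - - exp \<xi> * K \<xi> * b1') (at \<xi>)"
    unfolding assoc_denom_def b0_def b1_def by (intro DERIV_diff DERIV_mult DERIV_add DERIV_exp d)
  have "exp \<xi> * (b0 + b1) + (b0' + - exp \<xi> * K \<xi> * b1') * exp \<xi> - - exp \<xi> * K \<xi> * b1' = exp \<xi> * (b0 + b1) + exp \<xi> * b0' + exp \<xi> * (K \<xi> * (1 - exp \<xi>)) * b1'"
    by (simp add: algebra_simps)
  also have "\<dots> = exp \<xi> * (b0 + b1) * (1 - ti)"
    unfolding K_eq'[OF \<xi>] b0'_def b1'_def by (simp add: algebra_simps)
  also have jd: "exp \<xi> * (b0 + b1) = J \<xi> * dd \<xi>"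
  proof -
    have 1: "exp \<xi> * (b0 + b1) = dd \<xi> + b1" by (simp add: assoc_denom_def b0_def b1_def)
    show ?thesis unfolding 1 unfolding b1_def B_facts(9)[OF \<xi>] by (simp add: L_def algebra_simps)
  qed
  also have "J \<xi> * dd \<xi> * (1 - ti) = (1 - ti) * J \<xi> * dd \<xi>" by (simp only: mult_ac)
  finally show ?thesis by (rule DERIV_cong[OF D[unfolded jd]])
qed

lemma dd_exp: obtains k' where "k' \<noteq> 0" "\<And>\<xi>. \<xi> \<in> S \<Longrightarrow> dd \<xi> = k' * exp ((1 - ti) * \<psi> \<xi>)"
proof (cases "S = {}")
  case False
  have d0: "((\<lambda>\<xi>. dd \<xi> / d \<xi>) has_field_derivative 0) (at \<xi>)" if \<xi>: "\<xi> \<in> S" for \<xi>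
    by (rule DERIV_cong[OF DERIV_divide[OF deriv_dd[OF \<xi>] D_d[OF \<xi>] nz'(4)[OF \<xi>]]]) simp
  then have "continuous_on S (\<lambda>\<xi>. dd \<xi> / d \<xi>)"
    by (intro continuous_at_imp_continuous_on ballI DERIV_isCont)
  then obtain c where c: "\<And>\<xi>. \<xi> \<in> S \<Longrightarrow> dd \<xi> / d \<xi> = c"
    using DERIV_zero_connected_constant[of S "{}" "\<lambda>\<xi>. dd \<xi> / d \<xi>"] S d0 by auto
  show thesis
  proof (rule that)
    show "dd \<xi> = (c * k) * exp ((1 - ti) * \<psi> \<xi>)" if "\<xi> \<in> S" for \<xi>
      using c[OF that] nz'(4)[OF that] by (simp add: d_def field_simps)
    show "c * k \<noteq> 0" using False c B_facts(7) nz'(4) k by fastforce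
  qed
qed (use that[of 1] in auto)

text \<open>\<open>y\<close> and the denominator fix the entries 12. The equation for the entry 12
  of \<open>B0\<close> then ties its diagonal to that of \<open>B1\<close>, the determinants give
  the entries 21, and the determinant of \<open>Bx\<close> fixes the last free parameter
  \<open>h\<close>.\<close>

lemma B_unique:
  assumes \<xi>: "\<xi> \<in> S" and dd: "\<And>\<xi>. \<xi> \<in> S \<Longrightarrow> dd \<xi> = d \<xi>"
  shows "B0 \<xi> = A0 \<xi>" "Bx \<xi> = Ax \<xi>" "B1 \<xi> = A1 \<xi>"
proof -
  note n = nz'[OF \<xi>] and b = B_facts[OF \<xi>, unfolded dd[OF \<xi>]]
  define h where "h = (B1 \<xi> $ 1 $ 1 - t1 / 2) / L \<xi>"
  have a1: "B1 \<xi> $ 1 $ 1 = t1 / 2 + h * L \<xi>" using L_nz[OF \<xi>] by (simp add: h_def)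
  have "((\<lambda>\<xi>. B0 \<xi> $ 1 $ 2) has_field_derivative 2 * d \<xi> * u \<xi> * (\<rho> - z \<xi> * L \<xi>)) (at \<xi>)"
    by (rule has_field_derivative_transform_within_open[OF Lax0_12[OF \<xi>] S(1) \<xi>]) (simp add: B_facts dd)
  then have "2 * d \<xi> * u \<xi> * (\<rho> - z \<xi> * L \<xi>) = 2 * (Bx \<xi> $ 1 $ 1 * B0 \<xi> $ 1 $ 2 - Bx \<xi> $ 1 $ 2 * B0 \<xi> $ 1 $ 1)"
    using B_derivs(1)[OF \<xi>] by (rule DERIV_unique)
  then have "2 * d \<xi> * u \<xi> * (\<rho> - z \<xi> * L \<xi>) = 2 * ((\<rho> - h * L \<xi> - B0 \<xi> $ 1 $ 1) * (d \<xi> * u \<xi>) - d \<xi> * (L \<xi> - u \<xi>) * B0 \<xi> $ 1 $ 1)"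
    unfolding b(4,5,8,9) a1 \<rho>_def by (simp add: algebra_simps add_divide_distrib diff_divide_distrib)
  then have "2 * d \<xi> * L \<xi> * (B0 \<xi> $ 1 $ 1 - (u \<xi> * z \<xi> - h * u \<xi>)) = 0"
    by (simp add: algebra_simps)
  then have a0: "B0 \<xi> $ 1 $ 1 = u \<xi> * z \<xi> - h * u \<xi>" using n(4) L_nz[OF \<xi>] by simp
  have c0: "B0 \<xi> $ 2 $ 1 * d \<xi> = A * e \<xi> - u \<xi> * (z \<xi> - h)\<^sup>2"
  proof -
    have "u \<xi> * (B0 \<xi> $ 2 $ 1 * d \<xi>) = A - (u \<xi> * z \<xi> - h * u \<xi>)\<^sup>2"
      using b(1) unfolding a0 b(8) A_def by (simp add: power_divide algebra_simps)
    also have "\<dots> = u \<xi> * (A * e \<xi> - u \<xi> * (z \<xi> - h)\<^sup>2)" using n(7) by algebra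
    finally show ?thesis using n(5) by simp
  qed
  have c1: "B1 \<xi> $ 2 $ 1 * d \<xi> = t1 * h + h * h * L \<xi>"
  proof -
    have "(t1 / 2 + h * L \<xi>)\<^sup>2 = (t1 / 2)\<^sup>2 + L \<xi> * (t1 * h + h * h * L \<xi>)"
      by (simp add: power2_eq_square field_simps)
    then have "L \<xi> * (B1 \<xi> $ 2 $ 1 * d \<xi>) = L \<xi> * (t1 * h + h * h * L \<xi>)"
      using b(3) unfolding a1 b(9) by (simp add: algebra_simps)
    then show ?thesis using L_nz[OF \<xi>] by simp
  qed
  have "h = \<eta> \<xi>"
  proof -
    have "Bx \<xi> $ 1 $ 1 = \<rho> - u \<xi> * z \<xi> + h * (u \<xi> - L \<xi>)"
      unfolding b(4) a0 a1 \<rho>_def by (simp add: algebra_simps add_divide_distrib diff_divide_distrib)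
    moreover have "Bx \<xi> $ 1 $ 2 * Bx \<xi> $ 2 $ 1 = - ((L \<xi> - u \<xi>) * (B0 \<xi> $ 2 $ 1 * d \<xi> + B1 \<xi> $ 2 $ 1 * d \<xi>))"
      unfolding b(5,6,8,9) by (simp add: algebra_simps)
    ultimately have "(\<rho> - u \<xi> * z \<xi> + h * (u \<xi> - L \<xi>))\<^sup>2 - (L \<xi> - u \<xi>) * (A * e \<xi> - u \<xi> * (z \<xi> - h)\<^sup>2 + (t1 * h + h * h * L \<xi>)) = \<rho>\<^sup>2 - B"
      using b(2) unfolding c0 c1 B_def by (simp add: power_divide)
    moreover have "(\<rho> - u \<xi> * z \<xi> + h * (u \<xi> - L \<xi>))\<^sup>2 - (L \<xi> - u \<xi>) * (A * e \<xi> - u \<xi> * (z \<xi> - h)\<^sup>2 + (t1 * h + h * h * L \<xi>)) =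
        (\<rho> - u \<xi> * z \<xi>)\<^sup>2 - (L \<xi> - u \<xi>) * (A * e \<xi> - u \<xi> * z \<xi> * z \<xi>) - (L \<xi> - u \<xi>) * h * (2 * \<rho> + t1)"
      by (simp add: power2_eq_square algebra_simps)
    moreover have "2 * \<rho> + t1 = - ti" using two_rho[OF \<xi>] by simp
    ultimately have "(\<rho> - u \<xi> * z \<xi>)\<^sup>2 - (L \<xi> - u \<xi>) * (A * e \<xi> - u \<xi> * z \<xi> * z \<xi>) + (L \<xi> - u \<xi>) * h * ti = \<rho>\<^sup>2 - B"
      by simp
    then have "(L \<xi> - u \<xi>) * h * ti = (L \<xi> - u \<xi>) * Om \<xi>"
      unfolding Lu_Om[OF \<xi>] by (simp add: power2_eq_square algebra_simps)
    then have "(L \<xi> - u \<xi>) * (h * ti) = (L \<xi> - u \<xi>) * Om \<xi>" by (simp only: mult.assoc)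
    then have "h * ti = Om \<xi>" using Lu(2)[OF \<xi>] by simp
    then show ?thesis using ti by (simp add: \<eta>_def eq_divide_eq)
  qed
  then have c: "B0 \<xi> $ 2 $ 1 = c0 \<xi>" "B1 \<xi> $ 2 $ 1 = c1 \<xi>"
    using c0 c1 n(4) by (simp_all add: c0_def c1_def field_simps)
  show 0: "B0 \<xi> = A0 \<xi>"
    by (subst B_tl(1)[OF \<xi>]) (simp only: A0_def a0 b(8) c \<open>h = \<eta> \<xi>\<close>)
  show 1: "B1 \<xi> = A1 \<xi>"
    by (subst B_tl(3)[OF \<xi>]) (simp only: A1_def a1 b(9) c \<open>h = \<eta> \<xi>\<close>)
  have "B0 \<xi> + Bx \<xi> + B1 \<xi> = diag2 (- ti / 2) (ti / 2)"
    using B \<xi> unfolding Schlesinger_system_def by auto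
  then have "A0 \<xi> + Bx \<xi> + A1 \<xi> = A0 \<xi> + Ax \<xi> + A1 \<xi>" unfolding A_sum 0 1 .
  then show "Bx \<xi> = Ax \<xi>" by (simp only: add_right_cancel add_left_cancel)
qed

end

end

section \<open>The trace around 0 and x\<close>

lemma continues_along_affine:
  assumes \<Phi>: "continues_along A h 0 1 \<Phi>" and m: "m > 0"
    and g: "\<And>t. t \<in> {a..b} \<Longrightarrow> m * t + k \<in> {0..1} \<and> g t = h (m * t + k)"
  shows "continues_along A g a b (\<lambda>t. \<Phi> (m * t + k))"
  unfolding continues_along_def
proof (intro ballI conjI)
  fix t assume t: "t \<in> {a..b}"
  show "solves_linear_near A (g t) (\<Phi> (m * t + k))"
    using \<Phi> g[OF t] by (auto simp: continues_along_def)
  have "\<forall>\<^sub>F s in at (m * t + k) within {0..1}. germ_eq (h s) (\<Phi> s) (\<Phi> (m * t + k))"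
    using \<Phi> g[OF t] by (auto simp: continues_along_def)
  then obtain d where d: "d > 0" "\<And>s. s \<in> {0..1} \<Longrightarrow> s \<noteq> m * t + k \<Longrightarrow> dist s (m * t + k) < d \<Longrightarrow> germ_eq (h s) (\<Phi> s) (\<Phi> (m * t + k))"
    unfolding eventually_at by auto
  show "\<forall>\<^sub>F s in at t within {a..b}. germ_eq (g s) (\<Phi> (m * s + k)) (\<Phi> (m * t + k))"
    unfolding eventually_at
  proof (intro exI[of _ "d / m"] conjI ballI impI)
    show "0 < d / m" using d m by simp
    fix s assume s: "s \<in> {a..b}" "s \<noteq> t \<and> dist s t < d / m"
    have "dist (m * s + k) (m * t + k) = m * dist s t"
      using m by (simp add: dist_real_def abs_mult flip: right_diff_distrib)
    then have "dist (m * s + k) (m * t + k) < d" using s(2) m by (simp add: field_simps)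
    then show "germ_eq (g s) (\<Phi> (m * s + k)) (\<Phi> (m * t + k))"
      using d(2)[of "m * s + k"] g[OF s(1)] s(2) m by auto
  qed
qed

text \<open>After \<open>g0\<close> the germ is \<open>\<Psi> ** M0\<close>, and continuing it along
  \<open>gx\<close> gives \<open>\<Psi> ** Mx ** M0\<close>: the matrices compose in the reverse
  order, which the trace does not see.\<close>

lemma loop_trace_join:
  assumes g: "path g0" "path gx" "pathfinish g0 = pathstart g0" "pathfinish gx = pathstart gx" "pathstart g0 = pathstart gx"
    and sol: "det (\<Psi> (pathstart g0)) \<noteq> 0"
    and M: "monodromy_along A \<Psi> g0 M0" "monodromy_along A \<Psi> gx Mx"
  shows "loop_trace A (g0 +++ gx) (trace (M0 ** Mx))"
proof -
  obtain \<Phi>0 where 0: "continues_along A g0 0 1 \<Phi>0" "germ_eq (g0 0) (\<Phi>0 0) \<Psi>" "germ_eq (g0 0) (\<Phi>0 1) (\<lambda>w. \<Psi> w ** M0)"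
    using M(1) g(3) unfolding monodromy_along_def continues_along_def germ_eq_def pathstart_def pathfinish_def by auto
  obtain \<Phi>x where x: "continues_along A gx 0 1 \<Phi>x" "germ_eq (g0 0) (\<Phi>x 0) \<Psi>" "germ_eq (g0 0) (\<Phi>x 1) (\<lambda>w. \<Psi> w ** Mx)"
    using M(2) g(4,5) unfolding monodromy_along_def continues_along_def germ_eq_def pathstart_def pathfinish_def by auto
  let ?g = "g0 +++ gx"
  define \<Phi> where "\<Phi> = (\<lambda>t. if t \<le> 1/2 then \<Phi>0 (2 * t + 0) else (\<lambda>w. \<Phi>x (2 * t + (- 1)) w ** M0))"
  have p: "path ?g" using g by simp
  have h: "g0 1 = g0 0" "gx 0 = g0 0" "gx 1 = g0 0" using g by (simp_all add: pathstart_def pathfinish_def)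
  have 1: "continues_along A ?g 0 (1/2) (\<lambda>t. \<Phi>0 (2 * t + 0))"
    by (rule continues_along_affine[OF 0(1)]) (auto simp: joinpaths_def)
  have 2: "continues_along A ?g (1/2) 1 (\<lambda>t w. \<Phi>x (2 * t + (- 1)) w ** M0)"
    by (rule continues_along_mult[OF continues_along_affine[OF x(1)]]) (use h in \<open>auto simp: joinpaths_def field_simps\<close>)
  have c: "continues_along A ?g 0 1 \<Phi>"
    unfolding \<Phi>_def
  proof (rule continues_along_join[OF 1 2])
    show "continuous_on {0..1} ?g" using p by (simp add: path_def)
    have "germ_eq (g0 0) (\<Phi>0 1) (\<lambda>w. \<Phi>x 0 w ** M0)"
      by (rule germ_eq_trans[OF 0(3) germ_eq_mult[OF germ_eq_sym[OF x(2)]]])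
    then show "germ_eq (?g (1/2)) (\<Phi>0 (2 * (1/2) + 0)) (\<lambda>w. \<Phi>x (2 * (1/2) + (- 1)) w ** M0)"
      using h by (simp add: joinpaths_def)
  qed auto
  have s: "?g 0 = g0 0" by (simp add: joinpaths_def)
  have "germ_eq (g0 0) (\<lambda>w. \<Phi>x 1 w ** M0) (\<lambda>w. (\<Psi> w ** Mx) ** M0)" by (rule germ_eq_mult[OF x(3)])
  moreover have "germ_eq (g0 0) (\<lambda>w. \<Psi> w ** (Mx ** M0)) (\<lambda>w. \<Phi>0 0 w ** (Mx ** M0))"
    by (rule germ_eq_mult[OF germ_eq_sym[OF 0(2)]])
  ultimately have "germ_eq (?g 0) (\<Phi> 1) (\<lambda>w. \<Phi> 0 w ** (Mx ** M0))"
    unfolding s \<Phi>_def matrix_mul_assoc[symmetric] by (auto intro: germ_eq_trans)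
  moreover have "det (\<Phi> 0 (?g 0)) \<noteq> 0"
    using sol germ_eq_at[OF 0(2)] unfolding s \<Phi>_def by (simp add: pathstart_def)
  ultimately show ?thesis
    unfolding loop_trace_def using c trace_mul_sym[of M0 Mx] by blast
qed

definition unit_mat :: "2 \<Rightarrow> 2 \<Rightarrow> cmat2" where
  "unit_mat p q = (\<chi> i j. if i = p \<and> j = q then 1 else 0)"

lemma cmat2_decomp:
  "M = smult (M $ 1 $ 1) (unit_mat 1 1) + smult (M $ 1 $ 2) (unit_mat 1 2) + smult (M $ 2 $ 1) (unit_mat 2 1) + smult (M $ 2 $ 2) (unit_mat 2 2)"
  by (simp add: vec_eq_iff forall_2 smult_def unit_mat_def)

lemma continuous_on_cmat2:
  assumes "\<And>i j. continuous_on T (\<lambda>t. M t $ i $ j)"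
  shows "continuous_on T (M :: _ \<Rightarrow> cmat2)"
proof -
  have "continuous_on T (\<lambda>t. smult (M t $ 1 $ 1) (unit_mat 1 1) + smult (M t $ 1 $ 2) (unit_mat 1 2)
      + smult (M t $ 2 $ 1) (unit_mat 2 1) + smult (M t $ 2 $ 2) (unit_mat 2 2))"
    by (intro continuous_on_add sm.continuous_on assms continuous_on_const)
  then show ?thesis by (simp only: cmat2_decomp[symmetric])
qed

lemma has_vector_derivative_cmat2:
  assumes "\<And>i j. ((\<lambda>t. M t $ i $ j) has_vector_derivative M' $ i $ j) (at t)"
  shows "(M has_vector_derivative (M' :: cmat2)) (at t)"
proof -
  have "((\<lambda>t. smult (M t $ 1 $ 1) (unit_mat 1 1) + smult (M t $ 1 $ 2) (unit_mat 1 2)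
      + smult (M t $ 2 $ 1) (unit_mat 2 1) + smult (M t $ 2 $ 2) (unit_mat 2 2)) has_vector_derivative
      smult (M' $ 1 $ 1) (unit_mat 1 1) + smult (M' $ 1 $ 2) (unit_mat 1 2) + smult (M' $ 2 $ 1) (unit_mat 2 1) + smult (M' $ 2 $ 2) (unit_mat 2 2)) (at t)"
    by (intro has_vector_derivative_add bounded_linear.has_vector_derivative[OF sm.bounded_linear_left] assms)
  then show ?thesis by (simp only: cmat2_decomp[symmetric])
qed

lemma continuous_on_from_right_limit:
  fixes H :: "real \<Rightarrow> 'a :: t2_space"
  assumes H: "\<And>t. 0 < t \<Longrightarrow> t \<le> 1 \<Longrightarrow> isCont H t" and l: "(H \<longlongrightarrow> l) (at_right 0)"
  shows "continuous_on {0..1} (\<lambda>t. if t = 0 then l else H t)"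
  unfolding continuous_on_eq_continuous_within
proof
  let ?f = "\<lambda>t. if t = 0 then l else H t"
  fix t :: real assume t: "t \<in> {0..1}"
  show "continuous (at t within {0..1}) ?f"
  proof (cases "t = 0")
    case True
    have "\<forall>\<^sub>F s in at_right 0. H s = ?f s"
      using eventually_at_right_less[of "0::real"] by (rule eventually_mono) auto
    then have "(?f \<longlongrightarrow> l) (at_right 0)" by (rule Lim_transform_eventually[OF l])
    then show ?thesis unfolding True continuous_within by (simp add: at_within_Icc_at_right)
  next
    case False
    then have t': "0 < t" "t \<le> 1" using t by auto
    have "\<forall>\<^sub>F s in nhds t. H s = ?f s"
      by (rule eventually_mono[OF eventually_nhds_in_open[of "{0<..}" t]]) (use t' in auto)
    then have "isCont ?f t" using isCont_cong[of H ?f t] H[OF t'] by blast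
    then show ?thesis by (rule continuous_at_imp_continuous_within)
  qed
qed

text \<open>With \<open>c\<close> the speed of \<open>\<xi>\<close> along the path, the right side
  is the derivative of the Fuchsian coefficient given by the Schlesinger equations, the left side
  the zero curvature form required for transport by \<open>\<beta> / (l - x)\<close>. Partial
  fractions in \<open>l\<close> match them.\<close>

lemma flatness_identity:
  fixes l x c :: complex and A0 Ax A1 :: cmat2
  assumes "l \<noteq> 0" "l \<noteq> 1" "l \<noteq> x" "x \<noteq> 1"
  defines "\<beta> \<equiv> smult (- c) (smult x Ax)" and "\<A> \<equiv> Fuchsian_coeff A0 Ax A1 x l"
  shows "(smult (- 1 / (l - x)\<^sup>2) \<beta> + smult (1 / (l - x)) (\<beta> ** \<A> - \<A> ** \<beta>)) $ i $ j =
    c * (commutator Ax A0 $ i $ j / l + ((commutator A0 Ax $ i $ j + x / (x - 1) * commutator A1 Ax $ i $ j) * (l - x) + x * Ax $ i $ j) / (l - x)\<^sup>2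
      + x / (x - 1) * commutator Ax A1 $ i $ j / (l - 1))"
proof -
  define p0 p1 where "p0 = commutator Ax A0 $ i $ j" and "p1 = commutator Ax A1 $ i $ j"
  have c: "commutator A0 Ax $ i $ j = - p0" "commutator A1 Ax $ i $ j = - p1"
    by (simp_all add: p0_def p1_def commutator_def)
  define Q where "Q = p0 / l + p1 / (l - 1)"
  have m: "(\<beta> ** \<A> - \<A> ** \<beta>) $ i $ j = - c * x * Q"
    unfolding Q_def p0_def p1_def commutator_def \<beta>_def \<A>_def
    by (simp add: Fuchsian_coeff_def smult_def matrix_matrix_mult_def sum_2 algebra_simps add_divide_distrib diff_divide_distrib)
  have b: "\<beta> $ i $ j = - c * (x * Ax $ i $ j)" by (simp add: \<beta>_def smult_def)
  have v: "(smult a X + smult b Y) $ i $ j = a * X $ i $ j + b * Y $ i $ j" for a b X Y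
    by (simp add: smult_def)
  have "- 1 / D2 * (- c * (x * a)) + 1 / D1 * (- c * x * Q) = c * (x * a / D2 - x * Q / D1)" for D1 D2 a
    by (simp add: algebra_simps)
  then have "(smult (- 1 / (l - x)\<^sup>2) \<beta> + smult (1 / (l - x)) (\<beta> ** \<A> - \<A> ** \<beta>)) $ i $ j =
     c * (x * Ax $ i $ j / (l - x)\<^sup>2 - x * (p0 / l + p1 / (l - 1)) / (l - x))"
    unfolding v m b Q_def[symmetric] .
  also have "\<dots> = c * (p0 / l + ((- p0 + x / (x - 1) * - p1) * (l - x) + x * Ax $ i $ j) / (l - x)\<^sup>2 + x / (x - 1) * p1 / (l - 1))"
  proof -
    define L m n where "L = l - x" and "m = l - 1" and "n = x - 1"
    have nz: "L \<noteq> 0" "m \<noteq> 0" "n \<noteq> 0" using assms by (auto simp: L_def m_def n_def)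
    have 0: "p0 / l - p0 / L = - (x * (p0 / l) / L)"
      using assms(1) nz by (simp add: field_simps L_def)
    have 1: "x / n * p1 / m - x / n * p1 / L = - (x * (p1 / m) / L)"
    proof -
      have "x / n * p1 / m - x / n * p1 / L = x * p1 * (L - m) / (n * m * L)" using nz by (simp add: field_simps)
      also have "L - m = - n" by (simp add: L_def m_def n_def)
      finally show ?thesis using nz by simp
    qed
    have "((- p0 + x / n * - p1) * L + x * Ax $ i $ j) / L\<^sup>2 = x * Ax $ i $ j / L\<^sup>2 - p0 / L - x / n * p1 / L"
      using nz(1) by (simp add: add_divide_distrib diff_divide_distrib power2_eq_square algebra_simps)
    then have "p0 / l + ((- p0 + x / n * - p1) * L + x * Ax $ i $ j) / L\<^sup>2 + x / n * p1 / m
      = x * Ax $ i $ j / L\<^sup>2 + (p0 / l - p0 / L) + (x / n * p1 / m - x / n * p1 / L)" by simp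
    also have "\<dots> = x * Ax $ i $ j / L\<^sup>2 - x * (p0 / l + p1 / m) / L"
      unfolding 0 1 by (simp add: distrib_left add_divide_distrib)
    finally show ?thesis unfolding L_def m_def n_def by simp
  qed
  finally show ?thesis unfolding c p0_def p1_def .
qed

text \<open>A ray moves \<open>\<xi>\<close> to the left, so \<open>x\<close> tends to 0 with fixed
  argument. Only \<open>y\<close> needs a rate of decay, to make the transport integrable down to
  \<open>x = 0\<close>; \<open>g\<close> tending to \<open>1 - \<sigma>\<close> carries the
  exponent.\<close>

locale pvi_monodromy = pvi_branch +
  fixes \<sigma> :: complex
  assumes \<sigma>: "0 < Re \<sigma>" "Re \<sigma> < 1"
    and ray: "\<And>\<xi> t. \<xi> \<in> S \<Longrightarrow> t \<le> 0 \<Longrightarrow> \<xi> + of_real t \<in> S"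
    and y_ray: "\<And>\<xi>. \<xi> \<in> S \<Longrightarrow> \<exists>C. \<forall>t\<le>0. norm (y (\<xi> + of_real t)) \<le> C * exp ((1 - Re \<sigma>) * t)"
    and e_ray: "\<And>\<xi>. \<xi> \<in> S \<Longrightarrow> ((\<lambda>t. exp (\<xi> + of_real t) / y (\<xi> + of_real t)) \<longlongrightarrow> 0) at_bot"
    and g_ray: "\<And>\<xi>. \<xi> \<in> S \<Longrightarrow> ((\<lambda>t. g (\<xi> + of_real t)) \<longlongrightarrow> 1 - \<sigma>) at_bot"
    and \<psi>_ray: "\<And>\<xi>. \<xi> \<in> S \<Longrightarrow> ((\<lambda>t. \<psi> (\<xi> + of_real t)) \<longlongrightarrow> 0) at_bot"
begin

text \<open>Limits at \<open>x = 0\<close> of \<open>\<eta>\<close>, \<open>c1\<close>,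
  \<open>A1\<close> and of the sum \<open>A0 + Ax\<close>. The last exists although
  \<open>u = y / x\<close> is unbounded in both summands.\<close>

definition "\<eta>l = (\<sigma>\<^sup>2 / 4 - \<rho>\<^sup>2) / ti"
definition "c1l = (t1 * \<eta>l + \<eta>l * \<eta>l) / k"
definition "A1l = tl_mat (t1 / 2 + \<eta>l) (- k) c1l"
definition "\<Lambda>l = tl_mat (\<rho> - \<eta>l) k (- c1l)"
text \<open>\<open>x Ax\<close> divided by \<open>y\<close>. All entries of this quotient have
  limits, so \<open>x Ax\<close> decays at the rate of \<open>y\<close>.\<close>

definition "bm \<xi> = tl_mat (\<rho> * e \<xi> - z \<xi> + \<eta> \<xi> * (K \<xi> * (1 - e \<xi>))) (- d \<xi> * (K \<xi> * (1 - e \<xi>)))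
   (- (A * e \<xi> * e \<xi> - (z \<xi> - \<eta> \<xi>)\<^sup>2) / d \<xi> - e \<xi> * c1 \<xi>)"

lemma x_Ax: "\<xi> \<in> S \<Longrightarrow> exp \<xi> * Ax \<xi> $ i $ j = y \<xi> * bm \<xi> $ i $ j"
proof -
  assume \<xi>: "\<xi> \<in> S"
  note n = nz'[OF \<xi>]
  have J: "exp \<xi> * (u \<xi> - L \<xi>) = y \<xi> * (K \<xi> * (1 - e \<xi>))"
    unfolding J_def[symmetric] using L_eq[OF \<xi>] K_eq'[OF \<xi>] n(8) unfolding L_def by algebra
  have 11: "exp \<xi> * (\<rho> - u \<xi> * z \<xi> + \<eta> \<xi> * (u \<xi> - L \<xi>)) = y \<xi> * (\<rho> * e \<xi> - z \<xi> + \<eta> \<xi> * (K \<xi> * (1 - e \<xi>)))"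
  proof -
    have "exp \<xi> * (\<rho> - u \<xi> * z \<xi> + \<eta> \<xi> * (u \<xi> - L \<xi>)) = \<rho> * exp \<xi> - (u \<xi> * exp \<xi>) * z \<xi> + \<eta> \<xi> * (exp \<xi> * (u \<xi> - L \<xi>))"
      by (simp add: algebra_simps)
    then show ?thesis unfolding J n(8) unfolding n(6)[symmetric] by (simp add: algebra_simps)
  qed
  have 12: "exp \<xi> * (d \<xi> * (L \<xi> - u \<xi>)) = y \<xi> * (- d \<xi> * (K \<xi> * (1 - e \<xi>)))"
  proof -
    have "exp \<xi> * (d \<xi> * (L \<xi> - u \<xi>)) = - d \<xi> * (exp \<xi> * (u \<xi> - L \<xi>))" by (simp add: algebra_simps)
    then show ?thesis unfolding J by (simp add: algebra_simps)
  qed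
  have 21: "exp \<xi> * (- c0 \<xi> - c1 \<xi>) = y \<xi> * (- (A * e \<xi> * e \<xi> - (z \<xi> - \<eta> \<xi>)\<^sup>2) / d \<xi> - e \<xi> * c1 \<xi>)"
  proof -
    have "exp \<xi> * (- c0 \<xi> - c1 \<xi>) = - (exp \<xi> * (A * e \<xi>) - (u \<xi> * exp \<xi>) * (z \<xi> - \<eta> \<xi>)\<^sup>2) / d \<xi> - exp \<xi> * c1 \<xi>"
      unfolding c0_def using n(4) by (simp add: field_simps)
    then show ?thesis unfolding n(8) unfolding n(6)[symmetric] using n(4) by (simp add: field_simps)
  qed
  show "exp \<xi> * Ax \<xi> $ i $ j = y \<xi> * bm \<xi> $ i $ j"
    using 11 12 21 exhaust_2[of i] exhaust_2[of j] unfolding Ax_def bm_def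
    by (elim disjE) (simp_all only: tl_mat_nth mult_minus_right)
qed

section \<open>Limits and deformation along the ray towards \<open>x = 0\<close>\<close>

context
  fixes \<xi> :: complex
  assumes \<xi>: "\<xi> \<in> S"
begin

lemma ray_eventually: "\<forall>\<^sub>F t in at_bot. \<xi> + of_real t \<in> S"
  by (rule eventually_mono[OF eventually_le_at_bot[of 0]]) (simp add: ray \<xi>)

lemma ray_limits:
  "((\<lambda>t. y (\<xi> + of_real t)) \<longlongrightarrow> 0) at_bot" "((\<lambda>t. e (\<xi> + of_real t)) \<longlongrightarrow> 0) at_bot"
  "((\<lambda>t. exp (\<xi> + of_real t)) \<longlongrightarrow> 0) at_bot" "((\<lambda>t. K (\<xi> + of_real t)) \<longlongrightarrow> 1) at_bot"
  "((\<lambda>t. J (\<xi> + of_real t)) \<longlongrightarrow> 0) at_bot" "((\<lambda>t. L (\<xi> + of_real t)) \<longlongrightarrow> 1) at_bot"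
  "((\<lambda>t. z (\<xi> + of_real t)) \<longlongrightarrow> \<rho> + \<sigma> / 2) at_bot" "((\<lambda>t. \<eta> (\<xi> + of_real t)) \<longlongrightarrow> \<eta>l) at_bot"
  "((\<lambda>t. d (\<xi> + of_real t)) \<longlongrightarrow> k) at_bot" "((\<lambda>t. c1 (\<xi> + of_real t)) \<longlongrightarrow> c1l) at_bot"
proof -
  obtain C where C: "\<forall>t\<le>0. norm (y (\<xi> + of_real t)) \<le> C * exp ((1 - Re \<sigma>) * t)" using y_ray[OF \<xi>] by blast
  have "((\<lambda>t. C * exp ((1 - Re \<sigma>) * t)) \<longlongrightarrow> C * 0) at_bot"
    using \<sigma> by (intro tendsto_mult tendsto_const filterlim_compose[OF exp_at_bot]
        filterlim_tendsto_pos_mult_at_bot[OF tendsto_const] filterlim_ident) auto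
  then have C0: "((\<lambda>t. C * exp ((1 - Re \<sigma>) * t)) \<longlongrightarrow> 0) at_bot" by simp
  show y: "((\<lambda>t. y (\<xi> + of_real t)) \<longlongrightarrow> 0) at_bot"
    by (rule Lim_null_comparison[OF _ C0]) (use C in \<open>auto intro: eventually_mono[OF eventually_le_at_bot[of 0]]\<close>)
  show e: "((\<lambda>t. e (\<xi> + of_real t)) \<longlongrightarrow> 0) at_bot" unfolding e_def by (rule e_ray[OF \<xi>])
  have "((\<lambda>t. y (\<xi> + of_real t) * e (\<xi> + of_real t)) \<longlongrightarrow> 0 * 0) at_bot" by (intro tendsto_mult y e)
  moreover have "\<forall>\<^sub>F t in at_bot. y (\<xi> + of_real t) * e (\<xi> + of_real t) = exp (\<xi> + of_real t)"
    by (rule eventually_mono[OF ray_eventually]) (rule nz'(6))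
  ultimately show x: "((\<lambda>t. exp (\<xi> + of_real t)) \<longlongrightarrow> 0) at_bot"
    using Lim_transform_eventually by fastforce
  have "((\<lambda>t. 1 / (1 - exp (\<xi> + of_real t))) \<longlongrightarrow> 1 / (1 - 0)) at_bot" by (intro tendsto_intros x) simp
  then show K: "((\<lambda>t. K (\<xi> + of_real t)) \<longlongrightarrow> 1) at_bot" by (simp add: K_def)
  have "((\<lambda>t. y (\<xi> + of_real t) * (K (\<xi> + of_real t) * (1 - e (\<xi> + of_real t)))) \<longlongrightarrow> 0 * (1 * (1 - 0))) at_bot"
    by (intro tendsto_intros y K e)
  then show J: "((\<lambda>t. J (\<xi> + of_real t)) \<longlongrightarrow> 0) at_bot" by (simp add: J_def)
  have "((\<lambda>t. 1 - J (\<xi> + of_real t)) \<longlongrightarrow> 1 - 0) at_bot" by (intro tendsto_intros J)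
  then show L: "((\<lambda>t. L (\<xi> + of_real t)) \<longlongrightarrow> 1) at_bot" by (simp add: L_def)
  have "((\<lambda>t. ((1 - g (\<xi> + of_real t) - (1 - ti) * J (\<xi> + of_real t)) / 2 + \<rho>) / L (\<xi> + of_real t)) \<longlongrightarrow>
      ((1 - (1 - \<sigma>) - (1 - ti) * 0) / 2 + \<rho>) / 1) at_bot"
    by (intro tendsto_intros g_ray[OF \<xi>] J L) auto
  then show z: "((\<lambda>t. z (\<xi> + of_real t)) \<longlongrightarrow> \<rho> + \<sigma> / 2) at_bot" by (simp add: z_def add.commute)
  have "((\<lambda>t. 1 / (1 - e (\<xi> + of_real t))) \<longlongrightarrow> 1 / (1 - 0)) at_bot" by (intro tendsto_intros e) simp
  then have P: "((\<lambda>t. P (\<xi> + of_real t)) \<longlongrightarrow> 1) at_bot" by (simp add: P_def)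
  have "((\<lambda>t. Om (\<xi> + of_real t)) \<longlongrightarrow> A * 0 + (1 - 0 * 0) * 1 * (B * 0 - 2 * \<rho> * (\<rho> + \<sigma> / 2)) + (1 - 0) * 1 * (\<rho> + \<sigma> / 2) * (\<rho> + \<sigma> / 2)) at_bot"
    unfolding Om_def by (intro tendsto_intros y e P z)
  also have "A * 0 + (1 - 0 * 0) * 1 * (B * 0 - 2 * \<rho> * (\<rho> + \<sigma> / 2)) + (1 - 0) * 1 * (\<rho> + \<sigma> / 2) * (\<rho> + \<sigma> / 2) = \<sigma>\<^sup>2 / 4 - \<rho>\<^sup>2"
    by (simp add: power2_eq_square field_simps)
  finally have "((\<lambda>t. Om (\<xi> + of_real t) / ti) \<longlongrightarrow> (\<sigma>\<^sup>2 / 4 - \<rho>\<^sup>2) / ti) at_bot" using ti by (intro tendsto_divide tendsto_const)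
  then show \<eta>: "((\<lambda>t. \<eta> (\<xi> + of_real t)) \<longlongrightarrow> \<eta>l) at_bot" by (simp add: \<eta>_def \<eta>l_def)
  have "((\<lambda>t. k * exp ((1 - ti) * \<psi> (\<xi> + of_real t))) \<longlongrightarrow> k * exp ((1 - ti) * 0)) at_bot" by (intro tendsto_intros \<psi>_ray[OF \<xi>])
  then show d: "((\<lambda>t. d (\<xi> + of_real t)) \<longlongrightarrow> k) at_bot" by (simp add: d_def)
  have "((\<lambda>t. c1 (\<xi> + of_real t)) \<longlongrightarrow> (t1 * \<eta>l + \<eta>l * \<eta>l * 1) / k) at_bot"
    unfolding c1_def using k by (intro tendsto_intros \<eta> L d)
  then show "((\<lambda>t. c1 (\<xi> + of_real t)) \<longlongrightarrow> c1l) at_bot" by (simp add: c1l_def)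
qed

lemma A1_limit: "((\<lambda>t. A1 (\<xi> + of_real t) $ i $ j) \<longlongrightarrow> A1l $ i $ j) at_bot"
proof -
  have 11: "((\<lambda>t. t1 / 2 + \<eta> (\<xi> + of_real t) * L (\<xi> + of_real t)) \<longlongrightarrow> t1 / 2 + \<eta>l * 1) at_bot"
    by (intro tendsto_intros ray_limits)
  have 12: "((\<lambda>t. - d (\<xi> + of_real t) * L (\<xi> + of_real t)) \<longlongrightarrow> - k * 1) at_bot"
    by (intro tendsto_intros ray_limits)
  show ?thesis
    using exhaust_2[of i] exhaust_2[of j] 11 12 tendsto_minus[OF 11] ray_limits(10) unfolding A1_def A1l_def by auto
qed

lemma bm_limit: "\<exists>l. ((\<lambda>t. bm (\<xi> + of_real t) $ i $ j) \<longlongrightarrow> l) at_bot"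
proof -
  note T = tendsto_intros ray_limits
  have 11: "((\<lambda>t. \<rho> * e (\<xi> + of_real t) - z (\<xi> + of_real t) + \<eta> (\<xi> + of_real t) * (K (\<xi> + of_real t) * (1 - e (\<xi> + of_real t)))) \<longlongrightarrow>
      \<rho> * 0 - (\<rho> + \<sigma> / 2) + \<eta>l * (1 * (1 - 0))) at_bot" by (intro T)
  have 12: "((\<lambda>t. - d (\<xi> + of_real t) * (K (\<xi> + of_real t) * (1 - e (\<xi> + of_real t)))) \<longlongrightarrow> - k * (1 * (1 - 0))) at_bot"
    by (intro T)
  have 21: "((\<lambda>t. - (A * e (\<xi> + of_real t) * e (\<xi> + of_real t) - (z (\<xi> + of_real t) - \<eta> (\<xi> + of_real t))\<^sup>2) / d (\<xi> + of_real t)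
      - e (\<xi> + of_real t) * c1 (\<xi> + of_real t)) \<longlongrightarrow> - (A * 0 * 0 - (\<rho> + \<sigma> / 2 - \<eta>l)\<^sup>2) / k - 0 * c1l) at_bot"
    by (intro T k)
  show ?thesis
    using exhaust_2[of i] exhaust_2[of j] 11 12 tendsto_minus[OF 11] 21 unfolding bm_def
    by (elim disjE) (simp_all only: tl_mat_nth, blast+)
qed

text \<open>
  The path \<open>sc\<close> runs from \<open>x = 0\<close> to \<open>\<xi>\<close>. Since \<open>x Ax = O(exp ((1 - Re \<sigma>) t))\<close> along \<open>\<xi> + t\<close>, the factor
  \<open>2 / (1 - Re \<sigma>)\<close> makes \<open>x Ax / \<tau>\<close> vanish at \<open>\<tau> = 0\<close>, so that \<open>\<beta>p\<close> is continuous there.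
\<close>

definition "sc \<tau> = \<xi> + of_real (2 / (1 - Re \<sigma>) * ln \<tau>)"
definition "X \<tau> = (if \<tau> = 0 then 0 else exp (sc \<tau>))"
definition "\<beta>p \<tau> = (if \<tau> = 0 then 0 else smult (- of_real (2 / (1 - Re \<sigma>) / \<tau>)) (smult (exp (sc \<tau>)) (Ax (sc \<tau>))))"
definition "\<A> \<tau> l = (if \<tau> = 0 then smult (1 / l) \<Lambda>l + smult (1 / (l - 1)) A1l
   else Fuchsian_coeff (A0 (sc \<tau>)) (Ax (sc \<tau>)) (A1 (sc \<tau>)) (exp (sc \<tau>)) l)"

lemma sc_S: "0 < \<tau> \<Longrightarrow> \<tau> \<le> 1 \<Longrightarrow> sc \<tau> \<in> S"
  unfolding sc_def using \<sigma> by (intro ray \<xi> mult_nonneg_nonpos) auto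

lemma sc_1: "sc 1 = \<xi>" by (simp add: sc_def)

lemma sc_limit:
  fixes h :: "complex \<Rightarrow> complex"
  assumes "((\<lambda>t. h (\<xi> + of_real t)) \<longlongrightarrow> l) at_bot"
  shows "((\<lambda>\<tau>. h (sc \<tau>)) \<longlongrightarrow> l) (at_right 0)"
  unfolding sc_def
proof (rule filterlim_compose[OF assms])
  show "filterlim (\<lambda>\<tau>. 2 / (1 - Re \<sigma>) * ln \<tau>) at_bot (at_right 0)"
    by (rule filterlim_tendsto_pos_mult_at_bot[OF tendsto_const _ ln_at_0]) (use \<sigma> in auto)
qed

lemma sc_deriv:
  fixes h :: "complex \<Rightarrow> complex"
  assumes \<tau>: "0 < \<tau>" and h: "(h has_field_derivative h') (at (sc \<tau>))"
  shows "((\<lambda>\<tau>. h (sc \<tau>)) has_vector_derivative of_real (2 / (1 - Re \<sigma>) / \<tau>) * h') (at \<tau>)"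
proof -
  have "((\<lambda>\<tau>. 2 / (1 - Re \<sigma>) * ln \<tau>) has_real_derivative 2 / (1 - Re \<sigma>) * (1 / \<tau>)) (at \<tau>)"
    by (intro DERIV_cmult DERIV_ln_divide \<tau>)
  then have "((\<lambda>\<tau>. complex_of_real (2 / (1 - Re \<sigma>) * ln \<tau>)) has_vector_derivative of_real (2 / (1 - Re \<sigma>) * (1 / \<tau>))) (at \<tau>)"
    by (intro has_vector_derivative_of_real) (simp add: has_real_derivative_iff_has_vector_derivative)
  then have "(sc has_vector_derivative 0 + of_real (2 / (1 - Re \<sigma>) * (1 / \<tau>))) (at \<tau>)"
    unfolding sc_def by (intro has_vector_derivative_add has_vector_derivative_const)
  from field_vector_diff_chain_at[OF this h] show ?thesis by (simp add: o_def)
qed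

lemma sc_isCont:
  fixes h :: "complex \<Rightarrow> complex"
  shows "0 < \<tau> \<Longrightarrow> (h has_field_derivative h') (at (sc \<tau>)) \<Longrightarrow> isCont (\<lambda>\<tau>. h (sc \<tau>)) \<tau>"
  by (rule has_vector_derivative_continuous[OF sc_deriv])

lemma X_segment:
  assumes "\<tau> \<in> {0..1}"
  shows "X \<tau> \<in> closed_segment 0 (exp \<xi>)"
proof (cases "\<tau> = 0")
  case False
  have "X \<tau> = of_real (exp (2 / (1 - Re \<sigma>) * ln \<tau>)) * exp \<xi>"
    using False by (simp add: X_def sc_def exp_add exp_of_real[symmetric] del: exp_of_real)
  moreover have "exp (2 / (1 - Re \<sigma>) * ln \<tau>) \<le> exp 0"
    unfolding exp_le_cancel_iff using assms False \<sigma> by (intro mult_nonneg_nonpos) auto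
  ultimately show ?thesis
    unfolding closed_segment_def mem_Collect_eq
    by (intro exI[of _ "exp (2 / (1 - Re \<sigma>) * ln \<tau>)"]) (simp add: scaleR_conv_of_real)
qed (simp add: X_def)

lemma X_cont: "continuous_on {0..1} X"
  unfolding X_def[abs_def]
  by (rule continuous_on_from_right_limit) (auto intro!: sc_isCont DERIV_exp sc_limit[OF ray_limits(3)])

lemma x_Ax_limit: "((\<lambda>\<tau>. of_real (1 / \<tau>) * (exp (sc \<tau>) * Ax (sc \<tau>) $ i $ j)) \<longlongrightarrow> 0) (at_right 0)"
proof -
  obtain l where "((\<lambda>t. bm (\<xi> + of_real t) $ i $ j) \<longlongrightarrow> l) at_bot" using bm_limit by blast
  then have l: "((\<lambda>\<tau>. bm (sc \<tau>) $ i $ j) \<longlongrightarrow> l) (at_right 0)" by (rule sc_limit[of "\<lambda>\<zeta>. bm \<zeta> $ i $ j"])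
  obtain C where C: "\<forall>t\<le>0. norm (y (\<xi> + of_real t)) \<le> C * exp ((1 - Re \<sigma>) * t)" using y_ray[OF \<xi>] by blast
  have in01: "\<forall>\<^sub>F \<tau> in at_right (0::real). 0 < \<tau> \<and> \<tau> < 1"
    using eventually_at_right_less[of "0::real"] eventually_at_right_field[of _ "0::real"] by (auto intro: eventually_conj exI[of _ 1])
  have "((\<lambda>\<tau>. of_real (1 / \<tau>) * y (sc \<tau>)) \<longlongrightarrow> 0) (at_right 0)"
  proof (rule Lim_null_comparison)
    show "((\<lambda>\<tau>. C * \<tau>) \<longlongrightarrow> 0) (at_right 0)" by (auto intro!: tendsto_eq_intros)
    show "\<forall>\<^sub>F \<tau> in at_right 0. norm (of_real (1 / \<tau>) * y (sc \<tau>)) \<le> C * \<tau>"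
    proof (rule eventually_mono[OF in01])
      fix \<tau> :: real assume \<tau>: "0 < \<tau> \<and> \<tau> < 1"
      have "2 / (1 - Re \<sigma>) * ln \<tau> \<le> 0" using \<tau> \<sigma> by (intro mult_nonneg_nonpos) auto
      then have "norm (y (sc \<tau>)) \<le> C * exp ((1 - Re \<sigma>) * (2 / (1 - Re \<sigma>) * ln \<tau>))" using C unfolding sc_def by blast
      \<comment> \<open>In the parameter \<open>\<tau>\<close> the solution decays like
        \<open>\<tau>^2\<close>: one power pays for the factor \<open>1 / \<tau>\<close> from the
        speed of the path, the other yields the limit 0.\<close>
      also have "(1 - Re \<sigma>) * (2 / (1 - Re \<sigma>) * ln \<tau>) = ln \<tau> + ln \<tau>" using \<sigma> by simp
      also have "exp \<dots> = \<tau> * \<tau>" unfolding exp_add using \<tau> by simp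
      finally show "norm (of_real (1 / \<tau>) * y (sc \<tau>)) \<le> C * \<tau>" using \<tau> by (simp add: norm_mult norm_divide field_simps)
    qed
  qed
  from tendsto_mult[OF this l] have "((\<lambda>\<tau>. of_real (1 / \<tau>) * y (sc \<tau>) * bm (sc \<tau>) $ i $ j) \<longlongrightarrow> 0) (at_right 0)" by simp
  moreover have "\<forall>\<^sub>F \<tau> in at_right 0. of_real (1 / \<tau>) * y (sc \<tau>) * bm (sc \<tau>) $ i $ j = of_real (1 / \<tau>) * (exp (sc \<tau>) * Ax (sc \<tau>) $ i $ j)"
    by (rule eventually_mono[OF in01]) (simp add: x_Ax sc_S)
  ultimately show ?thesis by (rule Lim_transform_eventually)
qed

lemma \<beta>p_cont: "continuous_on {0..1} \<beta>p"
proof (rule continuous_on_cmat2)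
  fix i j
  define h where "h = (\<lambda>\<tau>. - of_real (2 / (1 - Re \<sigma>)) * (of_real (1 / \<tau>) * (exp (sc \<tau>) * Ax (sc \<tau>) $ i $ j)))"
  have e: "(\<lambda>\<tau>. \<beta>p \<tau> $ i $ j) = (\<lambda>\<tau>. if \<tau> = 0 then 0 else h \<tau>)"
    by (auto simp: fun_eq_iff \<beta>p_def h_def smult_def)
  show "continuous_on {0..1} (\<lambda>\<tau>. \<beta>p \<tau> $ i $ j)"
    unfolding e
  proof (rule continuous_on_from_right_limit)
    show "isCont h \<tau>" if \<tau>: "0 < \<tau>" "\<tau> \<le> 1" for \<tau>
    proof -
      have "isCont (\<lambda>\<tau>. complex_of_real (1 / \<tau>)) \<tau>" using \<tau> by (auto intro!: continuous_intros)
      moreover have "isCont (\<lambda>\<tau>. exp (sc \<tau>)) \<tau>" by (rule sc_isCont[OF \<tau>(1) DERIV_exp])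
      moreover have "isCont (\<lambda>\<tau>. Ax (sc \<tau>) $ i $ j) \<tau>"
        by (rule sc_isCont[of \<tau> "\<lambda>\<zeta>. Ax \<zeta> $ i $ j", OF \<tau>(1) deriv_Ax[OF sc_S[OF \<tau>]]])
      ultimately show ?thesis unfolding h_def by (intro isCont_mult continuous_const)
    qed
    show "(h \<longlongrightarrow> 0) (at_right 0)"
      unfolding h_def by (rule tendsto_mult_right_zero[OF x_Ax_limit])
  qed
qed

lemma \<beta>p_traceless: "\<beta>p \<tau> $ 2 $ 2 = - \<beta>p \<tau> $ 1 $ 1"
proof -
  have "Ax \<zeta> $ 2 $ 2 = - Ax \<zeta> $ 1 $ 1" for \<zeta> by (simp add: Ax_def)
  then show ?thesis by (simp add: \<beta>p_def smult_def)
qed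

lemma \<A>_deriv:
  assumes l: "l \<noteq> 0" "l \<noteq> 1" "l \<noteq> X \<tau>" and \<tau>: "0 < \<tau>" "\<tau> \<le> 1"
  shows "((\<lambda>\<tau>. Fuchsian_coeff (A0 (sc \<tau>)) (Ax (sc \<tau>)) (A1 (sc \<tau>)) (exp (sc \<tau>)) l) has_vector_derivative
      smult (- 1 / (l - X \<tau>)\<^sup>2) (\<beta>p \<tau>) + smult (1 / (l - X \<tau>)) (\<beta>p \<tau> ** \<A> \<tau> l - \<A> \<tau> l ** \<beta>p \<tau>)) (at \<tau>)"
proof (rule has_vector_derivative_cmat2)
  fix i j
  let ?c = "of_real (2 / (1 - Re \<sigma>) / \<tau>) :: complex" and ?x = "exp (sc \<tau>)"
  note s = sc_S[OF \<tau>]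
  have x: "l - exp (sc \<tau>) \<noteq> 0" using l(3) \<tau> by (simp add: X_def)
  have "((\<lambda>\<zeta>. A0 \<zeta> $ i $ j / l + Ax \<zeta> $ i $ j / (l - exp \<zeta>) + A1 \<zeta> $ i $ j / (l - 1)) has_field_derivative
     commutator (Ax (sc \<tau>)) (A0 (sc \<tau>)) $ i $ j / l
     + ((commutator (A0 (sc \<tau>)) (Ax (sc \<tau>)) $ i $ j + ?x / (?x - 1) * commutator (A1 (sc \<tau>)) (Ax (sc \<tau>)) $ i $ j) * (l - ?x)
         - Ax (sc \<tau>) $ i $ j * (0 - ?x)) / ((l - ?x) * (l - ?x))
     + ?x / (?x - 1) * commutator (Ax (sc \<tau>)) (A1 (sc \<tau>)) $ i $ j / (l - 1)) (at (sc \<tau>))"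
    by (intro DERIV_add DERIV_cdivide DERIV_divide DERIV_diff DERIV_const DERIV_exp deriv_A0 deriv_A1 deriv_Ax s x)
  from sc_deriv[OF \<tau>(1) this]
  have "((\<lambda>\<tau>. Fuchsian_coeff (A0 (sc \<tau>)) (Ax (sc \<tau>)) (A1 (sc \<tau>)) (exp (sc \<tau>)) l $ i $ j) has_vector_derivative
     ?c * (commutator (Ax (sc \<tau>)) (A0 (sc \<tau>)) $ i $ j / l
     + ((commutator (A0 (sc \<tau>)) (Ax (sc \<tau>)) $ i $ j + ?x / (?x - 1) * commutator (A1 (sc \<tau>)) (Ax (sc \<tau>)) $ i $ j) * (l - ?x)
         + ?x * Ax (sc \<tau>) $ i $ j) / (l - ?x)\<^sup>2
     + ?x / (?x - 1) * commutator (Ax (sc \<tau>)) (A1 (sc \<tau>)) $ i $ j / (l - 1))) (at \<tau>)"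
    by (simp add: Fuchsian_coeff_def power2_eq_square mult.commute)
  then show "((\<lambda>\<tau>. Fuchsian_coeff (A0 (sc \<tau>)) (Ax (sc \<tau>)) (A1 (sc \<tau>)) (exp (sc \<tau>)) l $ i $ j) has_vector_derivative
     (smult (- 1 / (l - X \<tau>)\<^sup>2) (\<beta>p \<tau>) + smult (1 / (l - X \<tau>)) (\<beta>p \<tau> ** \<A> \<tau> l - \<A> \<tau> l ** \<beta>p \<tau>)) $ i $ j) (at \<tau>)"
    using flatness_identity[of l ?x ?c "Ax (sc \<tau>)" "A0 (sc \<tau>)" "A1 (sc \<tau>)" i j] l x nz[OF s] \<tau>
    by (simp add: X_def \<beta>p_def \<A>_def)
qed

text \<open>\<open>A0 / l + Ax / (l - x)\<close> is regrouped as
  \<open>(A0 + Ax) / l + x Ax / (l (l - x))\<close>. The sum \<open>A0 + Ax\<close> is a constant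
  minus \<open>A1\<close> and converges, while \<open>x Ax\<close> tends to 0.\<close>

lemma \<A>_cont:
  assumes l: "l \<noteq> 0" "l \<noteq> 1" "\<And>\<tau>. \<tau> \<in> {0..1} \<Longrightarrow> l \<noteq> X \<tau>"
  shows "continuous_on {0..1} (\<lambda>\<tau>. \<A> \<tau> l)"
  unfolding \<A>_def
proof (rule continuous_on_from_right_limit)
  fix \<tau> :: real assume \<tau>: "0 < \<tau>" "\<tau> \<le> 1"
  show "isCont (\<lambda>\<tau>. Fuchsian_coeff (A0 (sc \<tau>)) (Ax (sc \<tau>)) (A1 (sc \<tau>)) (exp (sc \<tau>)) l) \<tau>"
    by (rule has_vector_derivative_continuous[OF \<A>_deriv]) (use l \<tau> in auto)
next
  have \<Lambda>: "\<Lambda>l = diag2 (- ti / 2) (ti / 2) - A1l"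
    by (simp add: \<Lambda>l_def A1l_def vec_eq_iff forall_2 diag2_def \<rho>_def field_simps)
  show "((\<lambda>\<tau>. Fuchsian_coeff (A0 (sc \<tau>)) (Ax (sc \<tau>)) (A1 (sc \<tau>)) (exp (sc \<tau>)) l) \<longlongrightarrow>
      smult (1 / l) \<Lambda>l + smult (1 / (l - 1)) A1l) (at_right 0)"
  proof (intro vec_tendstoI)
    fix i j
    define D where "D = diag2 (- ti / 2) (ti / 2) $ i $ j"
    have a: "((\<lambda>\<tau>. A1 (sc \<tau>) $ i $ j) \<longlongrightarrow> A1l $ i $ j) (at_right 0)" by (rule sc_limit[of "\<lambda>\<zeta>. A1 \<zeta> $ i $ j", OF A1_limit])
    have x: "((\<lambda>\<tau>. exp (sc \<tau>)) \<longlongrightarrow> 0) (at_right 0)" by (rule sc_limit[OF ray_limits(3)])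
    have "((\<lambda>\<tau>. of_real \<tau> * (of_real (1 / \<tau>) * (exp (sc \<tau>) * Ax (sc \<tau>) $ i $ j))) \<longlongrightarrow> of_real 0 * 0) (at_right 0)"
      by (intro tendsto_mult x_Ax_limit tendsto_of_real tendsto_ident_at)
    then have xA: "((\<lambda>\<tau>. of_real \<tau> * (of_real (1 / \<tau>) * (exp (sc \<tau>) * Ax (sc \<tau>) $ i $ j))) \<longlongrightarrow> 0) (at_right 0)" by simp
    have "((\<lambda>\<tau>. (D - A1 (sc \<tau>) $ i $ j) / l
        + of_real \<tau> * (of_real (1 / \<tau>) * (exp (sc \<tau>) * Ax (sc \<tau>) $ i $ j)) / (l * (l - exp (sc \<tau>))) + A1 (sc \<tau>) $ i $ j / (l - 1))
        \<longlongrightarrow> (D - A1l $ i $ j) / l + 0 / (l * (l - 0)) + A1l $ i $ j / (l - 1)) (at_right 0)"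
      using l by (intro tendsto_intros a x xA) auto
    also have "(D - A1l $ i $ j) / l + 0 / (l * (l - 0)) + A1l $ i $ j / (l - 1) = (smult (1 / l) \<Lambda>l + smult (1 / (l - 1)) A1l) $ i $ j"
      unfolding \<Lambda> by (simp add: smult_def D_def)
    finally have lim: "((\<lambda>\<tau>. (D - A1 (sc \<tau>) $ i $ j) / l
        + of_real \<tau> * (of_real (1 / \<tau>) * (exp (sc \<tau>) * Ax (sc \<tau>) $ i $ j)) / (l * (l - exp (sc \<tau>))) + A1 (sc \<tau>) $ i $ j / (l - 1))
        \<longlongrightarrow> (smult (1 / l) \<Lambda>l + smult (1 / (l - 1)) A1l) $ i $ j) (at_right 0)" .
    have "\<forall>\<^sub>F \<tau> in at_right (0::real). \<tau> \<in> {0<..<1}" by (rule eventually_at_right_real) simp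
    then have "\<forall>\<^sub>F \<tau> in at_right 0. (D - A1 (sc \<tau>) $ i $ j) / l
        + of_real \<tau> * (of_real (1 / \<tau>) * (exp (sc \<tau>) * Ax (sc \<tau>) $ i $ j)) / (l * (l - exp (sc \<tau>))) + A1 (sc \<tau>) $ i $ j / (l - 1)
        = Fuchsian_coeff (A0 (sc \<tau>)) (Ax (sc \<tau>)) (A1 (sc \<tau>)) (exp (sc \<tau>)) l $ i $ j"
    proof (rule eventually_mono)
      fix \<tau> :: real assume \<tau>: "\<tau> \<in> {0<..<1}"
      have n: "l - exp (sc \<tau>) \<noteq> 0" using l(3)[of \<tau>] \<tau> by (auto simp: X_def)
      have D: "D - A1 (sc \<tau>) $ i $ j = A0 (sc \<tau>) $ i $ j + Ax (sc \<tau>) $ i $ j"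
        unfolding D_def A_sum[of "sc \<tau>", symmetric] by simp
      have "(p + q) / l + X * q / (l * (l - X)) = p / l + q / (l - X)" if "l - X \<noteq> 0" for p q X
        using l(1) that by (simp add: divide_simps) (simp add: algebra_simps)
      from this[OF n] show "(D - A1 (sc \<tau>) $ i $ j) / l
        + of_real \<tau> * (of_real (1 / \<tau>) * (exp (sc \<tau>) * Ax (sc \<tau>) $ i $ j)) / (l * (l - exp (sc \<tau>))) + A1 (sc \<tau>) $ i $ j / (l - 1)
        = Fuchsian_coeff (A0 (sc \<tau>)) (Ax (sc \<tau>)) (A1 (sc \<tau>)) (exp (sc \<tau>)) l $ i $ j"
        unfolding D using \<tau> by (simp add: Fuchsian_coeff_def)
    qed
    then show "((\<lambda>\<tau>. Fuchsian_coeff (A0 (sc \<tau>)) (Ax (sc \<tau>)) (A1 (sc \<tau>)) (exp (sc \<tau>)) l $ i $ j) \<longlongrightarrow>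
        (smult (1 / l) \<Lambda>l + smult (1 / (l - 1)) A1l) $ i $ j) (at_right 0)"
      by (rule Lim_transform_eventually[OF lim])
  qed
qed

text \<open>\<open>\<eta>l\<close> multiplied by \<open>ti\<close> is
  \<open>\<sigma>^2 / 4 - \<rho>^2\<close>; in the determinant this cancels \<open>\<rho>^2\<close>
  and leaves the eigenvalues \<open>\<plusminus> \<sigma> / 2\<close>.\<close>

lemma \<Lambda>l_det: "\<Lambda>l $ 2 $ 2 = - \<Lambda>l $ 1 $ 1" "\<Lambda>l $ 1 $ 1 ^ 2 + \<Lambda>l $ 1 $ 2 * \<Lambda>l $ 2 $ 1 = \<sigma>\<^sup>2 / 4"
proof -
  have "k * - c1l = - (t1 * \<eta>l + \<eta>l * \<eta>l)" using k by (simp add: c1l_def)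
  then have "(\<rho> - \<eta>l)\<^sup>2 + k * - c1l = \<rho>\<^sup>2 - \<eta>l * (2 * \<rho> + t1)"
    by (simp only:) (simp add: power2_eq_square algebra_simps)
  also have "2 * \<rho> + t1 = - ti" by (simp add: \<rho>_def field_simps)
  also have "\<rho>\<^sup>2 - \<eta>l * - ti = \<sigma>\<^sup>2 / 4" using ti by (simp add: \<eta>l_def)
  finally show "\<Lambda>l $ 1 $ 1 ^ 2 + \<Lambda>l $ 1 $ 2 * \<Lambda>l $ 2 $ 1 = \<sigma>\<^sup>2 / 4" by (simp add: \<Lambda>l_def)
qed (simp add: \<Lambda>l_def)

text \<open>The trace along the simple loop \<open>c\<close> is computed twice: for the system at
  \<open>x\<close> through the two generators, and for the limit system through a small circle. The
  gauge transformation, defined near \<open>c\<close>, identifies the two.\<close>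

theorem p0x_value:
  assumes "is_p0x (A0 \<xi>) (Ax \<xi>) (A1 \<xi>) (exp \<xi>) p"
  shows "2 * cos (of_real pi * \<sigma>) = p"
proof -
  define F where "F = Fuchsian_coeff (A0 \<xi>) (Ax \<xi>) (A1 \<xi>) (exp \<xi>)"
  obtain g0 gx \<Psi> M0 Mx where adm: "admissible_loops (exp \<xi>) g0 gx"
    and M: "det (\<Psi> (pathstart g0)) \<noteq> 0" "monodromy_along F \<Psi> g0 M0" "monodromy_along F \<Psi> gx Mx"
    and p: "p = trace (M0 ** Mx)"
    using assms unfolding is_p0x_def F_def by blast
  obtain c where c: "simple_path c" "pathfinish c = pathstart c" "closed_segment 0 (exp \<xi>) \<subseteq> inside (path_image c)"
    "1 \<in> outside (path_image c)" "homotopic_loops (- {0, exp \<xi>, 1}) (g0 +++ gx) c"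
    and g: "pathstart g0 = pathstart gx" "ccw_loop_around {0, exp \<xi>, 1} 0 g0" "ccw_loop_around {0, exp \<xi>, 1} (exp \<xi>) gx"
    using adm unfolding admissible_loops_def by blast
  have gp: "path g0" "path gx" "pathfinish g0 = pathstart g0" "pathfinish gx = pathstart gx"
    using g(2,3) unfolding ccw_loop_around_def by (auto dest: homotopic_loops_imp_path homotopic_loops_imp_loop)
  have "loop_trace F (g0 +++ gx) p"
    unfolding p by (rule loop_trace_join[OF gp g(1) M])
  moreover have Fhol: "(\<lambda>l. F l $ i $ j) holomorphic_on - {0, exp \<xi>, 1}" for i j
    unfolding F_def Fuchsian_coeff_def by (auto intro!: holomorphic_intros)
  ultimately have cF: "loop_trace F c p"
    by (rule loop_trace_homotopic[OF _ _ c(5), rotated 2]) auto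
  define F0 where "F0 = (\<lambda>l. smult (1 / l) \<Lambda>l + smult (1 / (l - 1)) A1l)"
  have F0: "F0 l $ i $ j = \<Lambda>l $ i $ j / l + A1l $ i $ j / (l - 1)" for l i j by (simp add: F0_def smult_def)
  have "(\<lambda>l. smult (1 / (l - 1)) A1l $ i $ j) holomorphic_on ball 0 1" for i j
    unfolding smult_def by (auto intro!: holomorphic_intros)
  then obtain \<delta>0 where \<delta>0: "\<delta>0 > 0" "\<And>r \<kappa>. 0 < r \<Longrightarrow> r < \<delta>0 \<Longrightarrow> \<kappa> \<in> {1, -1} \<Longrightarrow> loop_trace F0 (turn_path \<kappa> r) (2 * cos (of_real pi * \<sigma>))"
    by (rule small_loop_trace[OF \<Lambda>l_det \<sigma>, of "\<lambda>l. smult (1 / (l - 1)) A1l" 1 F0]) (auto simp: F0 smult_def)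
  obtain \<kappa> r where r: "\<kappa> \<in> {1, -1}" "0 < r" "r < \<delta>0" "homotopic_loops (- {0, 1}) (turn_path \<kappa> r) c"
    by (rule simple_loop_homotopic_turn_path[OF c(1,2) _ c(4) \<delta>0(1)]) (use c(3) in auto)
  \<comment> \<open>Contracting \<open>c\<close> to a small circle may sweep across
    \<open>x\<close>. This is admissible for the limit system, whose only finite poles are 0 and
    1.\<close>
  have cF0: "loop_trace F0 c (2 * cos (of_real pi * \<sigma>))"
  proof (rule loop_trace_homotopic[OF _ _ r(4) \<delta>0(2)[OF r(2,3,1)]])
    show "(\<lambda>l. F0 l $ i $ j) holomorphic_on - {0, 1}" for i j
      unfolding F0 by (auto intro!: holomorphic_intros)
  qed auto
  \<comment> \<open>The gauge transformation needs \<open>l\<close> to avoid the moving pole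
    \<open>X \<tau>\<close>, which stays on the segment, as well as 1. The loop \<open>c\<close>
    surrounds that segment and leaves 1 outside.\<close>
  define \<Omega> where "\<Omega> = - insert 1 (closed_segment 0 (exp \<xi>))"
  have \<Omega>: "l \<noteq> 0" "l \<noteq> 1" "\<tau> \<in> {0..1} \<Longrightarrow> l \<noteq> X \<tau>" if "l \<in> \<Omega>" for l \<tau>
    using that X_segment by (auto simp: \<Omega>_def)
  have op: "open \<Omega>" unfolding \<Omega>_def by (intro open_Compl closed_insert) simp
  have cO: "path_image c \<subseteq> \<Omega>"
    using c(3,4) inside_no_overlap[of "path_image c"] outside_no_overlap[of "path_image c"] unfolding \<Omega>_def by blast
  obtain G where G: "\<And>l. l \<in> \<Omega> \<Longrightarrow> det (G l) \<noteq> 0"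
    "\<And>l i j. l \<in> \<Omega> \<Longrightarrow> ((\<lambda>l. G l $ i $ j) has_field_derivative (\<A> 1 l ** G l - G l ** \<A> 0 l) $ i $ j) (at l)"
  proof (rule isomonodromic_gauge[OF \<beta>p_cont \<beta>p_traceless X_cont, of \<Omega> \<A>])
    show "l \<noteq> X t" if "l \<in> \<Omega>" "t \<in> {0..1}" for l t using \<Omega>(3) that by blast
    show "continuous_on {0..1} (\<lambda>t. \<A> t l)" if "l \<in> \<Omega>" for l by (rule \<A>_cont) (use \<Omega> that in auto)
    show "((\<lambda>t. \<A> t l) has_vector_derivative smult (- 1 / (l - X t)\<^sup>2) (\<beta>p t) + smult (1 / (l - X t)) (\<beta>p t ** \<A> t l - \<A> t l ** \<beta>p t)) (at t)"
      if l: "l \<in> \<Omega>" and t: "t \<in> {0<..<1}" for l t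
    proof (rule has_vector_derivative_transform_within_open[of _ _ t "{0<..}"])
      show "((\<lambda>\<tau>. Fuchsian_coeff (A0 (sc \<tau>)) (Ax (sc \<tau>)) (A1 (sc \<tau>)) (exp (sc \<tau>)) l) has_vector_derivative
          smult (- 1 / (l - X t)\<^sup>2) (\<beta>p t) + smult (1 / (l - X t)) (\<beta>p t ** \<A> t l - \<A> t l ** \<beta>p t)) (at t)"
        by (rule \<A>_deriv) (use \<Omega> l t in auto)
    qed (use t in \<open>auto simp: \<A>_def\<close>)
  qed blast
  have A01: "\<A> 0 = F0" "\<A> 1 = F" by (simp_all add: \<A>_def F0_def F_def sc_1 fun_eq_iff)
  have "loop_trace F c (2 * cos (of_real pi * \<sigma>))"
    by (rule loop_trace_gauge[OF G[unfolded A01] op cO cF0])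
  then show ?thesis
    using loop_trace_unique[OF _ cF] simple_path_imp_path[OF c(1)] c(2) by blast
qed

end

end

section \<open>Behaviour of the series solution along rays\<close>

context pvi_functions
begin

lemma norm_exp_ray: "norm (exp (p * (\<xi> + of_real t))) = norm (exp (p * \<xi>)) * exp (Re p * t)"
  by (simp add: distrib_left exp_add norm_mult)

lemma dom_ray:
  assumes \<xi>: "\<xi> \<in> dom" and t: "t \<le> 0"
  shows "\<xi> + of_real t \<in> dom"
proof -
  have "norm (exp (p * (\<xi> + of_real t))) \<le> norm (exp (p * \<xi>))" if "0 < Re p" for p
    unfolding norm_exp_ray using that t by (intro mult_right_le_one_le) (auto simp: mult_nonneg_nonpos)
  from this[of s] this[of "1 - s"] show ?thesis using \<xi> s by (simp add: dom_def del: norm_exp_eq_Re)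
qed

lemma val_ray_limit:
  assumes f: "convergent_bps r f" and \<xi>: "\<xi> \<in> dom"
  shows "((\<lambda>t. val f (\<xi> + of_real t)) \<longlongrightarrow> cf f 0 0) at_bot"
proof -
  obtain C where C: "\<And>\<zeta>. \<zeta> \<in> dom \<Longrightarrow> norm (val f \<zeta> - cf f 0 0) \<le> C * max (norm (exp (s * \<zeta>))) (norm (exp ((1 - s) * \<zeta>)))"
    using norm_val_linear[OF f] by metis
  have lim: "((\<lambda>t. exp (c * t)) \<longlongrightarrow> 0) at_bot" if "c > 0" for c :: real
    using that by (intro filterlim_compose[OF exp_at_bot] filterlim_tendsto_pos_mult_at_bot[OF tendsto_const] filterlim_ident)
  have "((\<lambda>t. C * max (norm (exp (s * \<xi>)) * exp (Re s * t)) (norm (exp ((1 - s) * \<xi>)) * exp (Re (1 - s) * t))) \<longlongrightarrow>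
      C * max (norm (exp (s * \<xi>)) * 0) (norm (exp ((1 - s) * \<xi>)) * 0)) at_bot"
    by (intro tendsto_mult tendsto_max tendsto_const lim) (use s in auto)
  then have "((\<lambda>t. C * max (norm (exp (s * (\<xi> + of_real t)))) (norm (exp ((1 - s) * (\<xi> + of_real t))))) \<longlongrightarrow> 0) at_bot"
    unfolding norm_exp_ray by simp
  then have "((\<lambda>t. val f (\<xi> + of_real t) - cf f 0 0) \<longlongrightarrow> 0) at_bot"
    by (rule Lim_null_comparison[rotated]) (auto intro!: eventually_mono[OF eventually_le_at_bot[of 0]] C dom_ray \<xi> simp del: norm_exp_eq_Re)
  then show ?thesis by (rule Lim_null[THEN iffD2])
qed

end

lemma cover_sector_properties:
  assumes "\<epsilon> > 0"
  shows "open (cover_sector \<epsilon> \<phi>)" "connected (cover_sector \<epsilon> \<phi>)"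
    "\<xi> \<in> cover_sector \<epsilon> \<phi> \<Longrightarrow> t \<le> 0 \<Longrightarrow> \<xi> + of_real t \<in> cover_sector \<epsilon> \<phi>"
proof -
  have eq: "cover_sector \<epsilon> \<phi> = {\<xi>. Re \<xi> < ln \<epsilon>} \<inter> ({\<xi>. Im \<xi> < \<phi>} \<inter> {\<xi>. - \<phi> < Im \<xi>})"
  proof -
    have "exp x < \<epsilon> \<longleftrightarrow> x < ln \<epsilon>" for x using assms by (metis exp_less_cancel_iff exp_ln)
    then have "cover_sector \<epsilon> \<phi> = {\<xi>. Re \<xi> < ln \<epsilon> \<and> \<bar>Im \<xi>\<bar> < \<phi>}"
      unfolding cover_sector_def norm_exp_eq_Re by (simp only:)
    also have "\<dots> = {\<xi>. Re \<xi> < ln \<epsilon>} \<inter> ({\<xi>. Im \<xi> < \<phi>} \<inter> {\<xi>. - \<phi> < Im \<xi>})"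
      unfolding abs_less_iff by auto
    finally show ?thesis .
  qed
  show "open (cover_sector \<epsilon> \<phi>)"
    unfolding eq by (intro open_Int open_Collect_less continuous_intros)
  have "convex {\<xi>. Re \<xi> < ln \<epsilon>}" "convex {\<xi>. Im \<xi> < \<phi>}" "convex {\<xi>. - \<phi> < Im \<xi>}"
    by (rule convex_halfspace_Re_lt convex_halfspace_Im_lt convex_halfspace_Im_gt)+
  then show "connected (cover_sector \<epsilon> \<phi>)"
    unfolding eq by (intro convex_connected convex_Int)
  show "\<xi> + of_real t \<in> cover_sector \<epsilon> \<phi>" if "\<xi> \<in> cover_sector \<epsilon> \<phi>" "t \<le> 0"
    using that unfolding eq by auto
qed

text \<open>The unprimed exponents are the roots from which the series was built; the primed ones
  are arbitrary for the same PVI. The two meet only in the equation for \<open>g\<close>, which does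
  not mention exponents.\<close>

lemma (in pvi_functions) pvi_monodromy_sector:
  assumes rho: "rho = - (ti + t1) / 2" and A: "A = t0\<^sup>2 / 4" and B: "B = rho\<^sup>2 - tx\<^sup>2 / 4"
    and th: "t0\<^sup>2 = - 2 * \<beta>" "tx\<^sup>2 = 1 - 2 * \<delta>" "t1\<^sup>2 = 2 * \<gamma>" "(ti - 1)\<^sup>2 = 2 * \<alpha>"
    and \<epsilon>: "\<epsilon> > 0" "cover_sector \<epsilon> \<phi> \<subseteq> dom"
    and e': "PVI_exponents \<alpha> \<beta> \<gamma> \<delta> t0' tx' t1' ti'" and k: "k \<noteq> 0"
  shows "pvi_monodromy (cover_sector \<epsilon> \<phi>) y g (val (bI s fJ)) \<alpha> \<beta> \<gamma> \<delta> t0' tx' t1' ti' k s"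
proof
  show "open (cover_sector \<epsilon> \<phi>)" "connected (cover_sector \<epsilon> \<phi>)" by (rule cover_sector_properties[OF \<epsilon>(1)])+
  fix \<xi> assume S: "\<xi> \<in> cover_sector \<epsilon> \<phi>"
  then have \<xi>: "\<xi> \<in> dom" using \<epsilon>(2) by auto
  show "exp \<xi> \<noteq> 1 \<and> y \<xi> \<noteq> 0 \<and> y \<xi> \<noteq> 1 \<and> y \<xi> \<noteq> exp \<xi>" using nonsingular[OF \<xi>] by auto
  show "(y has_field_derivative g \<xi> * y \<xi>) (at \<xi>)" by (rule deriv_y[OF \<xi>])
  show "(g has_field_derivative pvi_log_rhs \<alpha> \<beta> \<gamma> \<delta> (exp \<xi>) (y \<xi>) (g \<xi>)) (at \<xi>)" by (rule deriv_g[OF \<xi> rho A B th])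
  show "(val (bI s fJ) has_field_derivative (y \<xi> - exp \<xi>) / (1 - exp \<xi>)) (at \<xi>)" by (rule deriv_psi[OF \<xi>])
  show "\<xi> + of_real t \<in> cover_sector \<epsilon> \<phi>" if "t \<le> 0" for t
    by (rule cover_sector_properties(3)[OF \<epsilon>(1) S that])
  show "\<exists>C. \<forall>t\<le>0. norm (y (\<xi> + of_real t)) \<le> C * exp ((1 - Re s) * t)"
  proof (intro exI[of _ "norm a * norm (exp ((1 - s) * \<xi>)) * (3/2)"] allI impI)
    fix t :: real assume t: "t \<le> 0"
    have d: "\<xi> + of_real t \<in> dom" by (rule dom_ray[OF \<xi> t])
    have "norm (y (\<xi> + of_real t)) = norm a * (norm (exp ((1 - s) * \<xi>)) * exp (Re (1 - s) * t)) * norm (val sE (\<xi> + of_real t))"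
      unfolding y_eq[OF d] norm_mult norm_exp_ray ..
    also have "\<dots> \<le> norm a * (norm (exp ((1 - s) * \<xi>)) * exp (Re (1 - s) * t)) * (3/2)"
      by (rule mult_left_mono[OF norm_e_y(3)[OF d]]) simp
    also have "\<dots> = norm a * norm (exp ((1 - s) * \<xi>)) * (3/2) * exp ((1 - Re s) * t)"
      by (simp only: mult_ac minus_complex.simps one_complex.simps)
    finally show "norm (y (\<xi> + of_real t)) \<le> norm a * norm (exp ((1 - s) * \<xi>)) * (3/2) * exp ((1 - Re s) * t)" .
  qed
  have "((\<lambda>t. e (\<xi> + of_real t)) \<longlongrightarrow> 0) at_bot"
    using val_ray_limit[OF conv_f(1) \<xi>] by (simp add: fe_def zero_coeffs)
  moreover have "\<forall>\<^sub>F t in at_bot. e (\<xi> + of_real t) = exp (\<xi> + of_real t) / y (\<xi> + of_real t)"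
    by (rule eventually_mono[OF eventually_le_at_bot[of 0]]) (rule nonsingular(5)[OF dom_ray[OF \<xi>]])
  ultimately show "((\<lambda>t. exp (\<xi> + of_real t) / y (\<xi> + of_real t)) \<longlongrightarrow> 0) at_bot"
    by (rule Lim_transform_eventually)
  have z: "cf fz 0 0 = rho + s / 2" using arg_cong[OF sol_eqs(3), of "\<lambda>f. cf f 0 0"] by (simp add: fz_def z_of_def)
  have two: "cf 2 0 0 = 2" using cf_bC[of 2 0 0] by (simp add: bC_simps)
  have "cf fg 0 0 = 1 - s" unfolding fg_def by (simp add: cf_mult z two cf_fJ_00)
  then show "((\<lambda>t. g (\<xi> + of_real t)) \<longlongrightarrow> 1 - s) at_bot" using val_ray_limit[OF conv_f(6) \<xi>] by simp
  show "((\<lambda>t. val (bI s fJ) (\<xi> + of_real t)) \<longlongrightarrow> 0) at_bot"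
    using val_ray_limit[OF conv_f(7) \<xi>] by (simp add: cf_fJ_00)
qed (use e' k s in auto)

text \<open>The hypothesis covers all \<open>k\<close> because the constant is known only once a
  system is given: it is read off from its denominator, and the system is then the explicit one for
  that \<open>k\<close>.\<close>

lemma Schlesinger_systems_p0x:
  assumes m: "\<And>k. k \<noteq> 0 \<Longrightarrow> pvi_monodromy S y g \<psi> \<alpha> \<beta> \<gamma> \<delta> t0 tx t1 ti k \<sigma>"
  shows "\<exists>A0 Ax A1. Schlesinger_system t0 tx t1 ti S A0 Ax A1 \<and> associated_solution S A0 A1 y"
    and "\<lbrakk>Schlesinger_system t0 tx t1 ti S A0 Ax A1; associated_solution S A0 A1 y; \<xi> \<in> S;
      is_p0x (A0 \<xi>) (Ax \<xi>) (A1 \<xi>) (exp \<xi>) p\<rbrakk> \<Longrightarrow> 2 * cos (of_real pi * \<sigma>) = p"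
proof -
  interpret m1: pvi_monodromy S y g \<psi> \<alpha> \<beta> \<gamma> \<delta> t0 tx t1 ti 1 \<sigma> by (rule m) simp
  show "\<exists>A0 Ax A1. Schlesinger_system t0 tx t1 ti S A0 Ax A1 \<and> associated_solution S A0 A1 y"
    using m1.Schlesinger_solution m1.associated by blast
  assume B: "Schlesinger_system t0 tx t1 ti S A0 Ax A1" "associated_solution S A0 A1 y" and \<xi>: "\<xi> \<in> S"
    and p: "is_p0x (A0 \<xi>) (Ax \<xi>) (A1 \<xi>) (exp \<xi>) p"
  obtain k where k: "k \<noteq> 0" "\<And>\<xi>. \<xi> \<in> S \<Longrightarrow> assoc_denom A0 A1 \<xi> = k * exp ((1 - ti) * \<psi> \<xi>)"
    using m1.dd_exp[OF B] by blast
  interpret mk: pvi_monodromy S y g \<psi> \<alpha> \<beta> \<gamma> \<delta> t0 tx t1 ti k \<sigma> by (rule m) (rule k(1))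
  have q: "assoc_denom A0 A1 \<zeta> = mk.d \<zeta>" if "\<zeta> \<in> S" for \<zeta> using k(2)[OF that] by (simp add: mk.d_def)
  have "A0 \<xi> = mk.A0 \<xi>" "Ax \<xi> = mk.Ax \<xi>" "A1 \<xi> = mk.A1 \<xi>" by (rule mk.B_unique[OF B \<xi> q]; assumption)+
  then show "2 * cos (of_real pi * \<sigma>) = p" using mk.p0x_value[OF \<xi>] p by simp
qed

theorem proposition2:
  fixes \<alpha> \<beta> \<gamma> \<delta> :: complex
  shows "\<exists>c :: nat \<Rightarrow> int \<Rightarrow> complex \<Rightarrow> complex \<Rightarrow> complex.
    (\<forall>n. \<forall>m\<in>{- int n..int n + 2}.
       rational_fun2_on {(\<sigma>, a). a \<noteq> 0 \<and> 0 < Re \<sigma> \<and> Re \<sigma> < 1} (c n m)) \<and>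
    (\<forall>a \<sigma>. a \<noteq> 0 \<longrightarrow> 0 < Re \<sigma> \<longrightarrow> Re \<sigma> < 1 \<longrightarrow>
       c 0 0 \<sigma> a = 1 \<and>
       (\<exists>y dl :: complex \<Rightarrow> complex. \<forall>\<phi>>0.
          (\<lambda>\<xi>. norm (dl \<xi>)) \<in> O[cover_at_0 \<phi>](\<lambda>\<xi>.
              max (norm (exp \<xi>) powr (1 - Re \<sigma>)) (norm (exp \<xi>) powr Re \<sigma>)) \<and>
          (\<exists>\<epsilon>>0.
             solves_PVI \<alpha> \<beta> \<gamma> \<delta> (cover_sector \<epsilon> \<phi>) y \<and>
             (\<forall>\<xi>\<in>cover_sector \<epsilon> \<phi>.
                y \<xi> = a * exp ((1 - \<sigma>) * \<xi>) * (1 + dl \<xi>) \<and>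
                (\<exists>s. (\<lambda>n. exp (of_nat n * \<xi>) *
                        (\<Sum>m=- int n..int n + 2. c n m \<sigma> a * exp (of_int m * \<sigma> * \<xi>))) sums s \<and>
                     dl \<xi> = - 1 + s) \<and>
                ((\<lambda>(m1, m2). c m2 (int m1 - int m2) \<sigma> a *
                     exp (of_nat m1 * \<sigma> * \<xi>) * exp (of_nat m2 * (1 - \<sigma>) * \<xi>))
                   has_sum dl \<xi>) {(m1, m2). m1 \<le> 2 * m2 + 2 \<and> 1 \<le> m1 + m2}) \<and>
             (\<forall>\<theta>0 \<theta>x \<theta>1 \<theta>i. PVI_exponents \<alpha> \<beta> \<gamma> \<delta> \<theta>0 \<theta>x \<theta>1 \<theta>i \<longrightarrow>
                (\<exists>A0 Ax A1. Schlesinger_system \<theta>0 \<theta>x \<theta>1 \<theta>i (cover_sector \<epsilon> \<phi>) A0 Ax A1 \<and>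
                   associated_solution (cover_sector \<epsilon> \<phi>) A0 A1 y) \<and>
                (\<forall>A0 Ax A1. Schlesinger_system \<theta>0 \<theta>x \<theta>1 \<theta>i (cover_sector \<epsilon> \<phi>) A0 Ax A1 \<longrightarrow>
                   associated_solution (cover_sector \<epsilon> \<phi>) A0 A1 y \<longrightarrow>
                   (\<forall>\<xi>\<in>cover_sector \<epsilon> \<phi>. \<forall>p.
                      is_p0x (A0 \<xi>) (Ax \<xi>) (A1 \<xi>) (exp \<xi>) p \<longrightarrow>
                      2 * cos (of_real pi * \<sigma>) = p))))))"
proof -
  \<comment> \<open>A choice depending on \<alpha>, \<beta>, \<gamma>, \<delta> only: the
    coefficients are fixed before the exponents of the monodromy claim are quantified.\<close>
  define t0 tx t1 ti where "t0 = csqrt (- 2 * \<beta>)" and "tx = csqrt (1 - 2 * \<delta>)" and "t1 = csqrt (2 * \<gamma>)" and "ti = 1 + csqrt (2 * \<alpha>)"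
  define rho A where "rho = - (ti + t1) / 2" and "A = t0\<^sup>2 / 4"
  define B where "B = rho\<^sup>2 - tx\<^sup>2 / 4"
  have th: "t0\<^sup>2 = - 2 * \<beta>" "tx\<^sup>2 = 1 - 2 * \<delta>" "t1\<^sup>2 = 2 * \<gamma>" "(ti - 1)\<^sup>2 = 2 * \<alpha>"
    by (simp_all only: t0_def tx_def t1_def ti_def power2_csqrt add_diff_cancel_left')
  \<comment> \<open>The power \<open>x^n x^(m s)\<close> is \<open>X^(n + m) Y^n\<close>; on the
    index range \<open>m \<ge> - n\<close>, so \<open>nat\<close> does not truncate there.\<close>
  define c where "c = (\<lambda>n m s a. cf (pvi_series.sE ti A rho B s a) (nat (int n + m)) n)"
  show ?thesis
  proof (intro exI[of _ c] conjI allI ballI impI, goal_cases)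
    case (1 n m)
    show ?case using rational_sE[of ti A rho B "nat (int n + m)" n] unfolding c_def .
  next
    case (2 a \<sigma>)
    then interpret pvi_solution ti A rho B \<sigma> a by unfold_locales auto
    show ?case by (simp add: c_def cf_sE_00)
  next
    case (3 a \<sigma>)
    then interpret pvi_solution ti A rho B \<sigma> a by unfold_locales auto
    obtain r where r: "r > 0" "r < 1" "r * norm a \<le> 1/4" "r / norm a \<le> 1/4" "bounded5 r (sE, sF, sz, sP, sK)"
      by (rule sol_bounded[OF s a])
    interpret pvi_functions ti A rho B \<sigma> a r by unfold_locales (use r in auto)
    show ?case
    \<comment> \<open>\<open>y\<close> and its correction term are chosen before
      \<open>\<phi>\<close>: the convergence domain \<open>dom\<close> does not depend on the
      sector, only the radius \<open>\<epsilon>\<close> does.\<close>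
    proof (rule exI[of _ y], rule exI[of _ "\<lambda>\<xi>. val sE \<xi> - 1"], intro allI impI, goal_cases)
      case (1 \<phi>)
      obtain \<epsilon> where \<epsilon>: "\<epsilon> > 0" "cover_sector \<epsilon> \<phi> \<subseteq> dom" by (rule cover_sector_subset_dom)
      note m = pvi_monodromy_sector[OF rho_def A_def B_def th \<epsilon>]
      show ?case
      proof (intro conjI val_sE_bigo exI[of _ \<epsilon>] ballI allI impI)
        show "\<epsilon> > 0" by (rule \<epsilon>(1))
        show "solves_PVI \<alpha> \<beta> \<gamma> \<delta> (cover_sector \<epsilon> \<phi>) y"
          by (rule solves_PVI_log[OF cover_sector_properties(1)[OF \<epsilon>(1)] _ deriv_y deriv_g[OF _ rho_def A_def B_def th]])
            (use \<epsilon>(2) nonsingular in auto)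
        show "\<exists>A0 Ax A1. Schlesinger_system \<theta>0 \<theta>x \<theta>1 \<theta>i (cover_sector \<epsilon> \<phi>) A0 Ax A1 \<and> associated_solution (cover_sector \<epsilon> \<phi>) A0 A1 y"
          if "PVI_exponents \<alpha> \<beta> \<gamma> \<delta> \<theta>0 \<theta>x \<theta>1 \<theta>i" for \<theta>0 \<theta>x \<theta>1 \<theta>i
          by (rule Schlesinger_systems_p0x(1)[OF m[OF that]])
        show "2 * cos (of_real pi * \<sigma>) = p"
          if "PVI_exponents \<alpha> \<beta> \<gamma> \<delta> \<theta>0 \<theta>x \<theta>1 \<theta>i" "Schlesinger_system \<theta>0 \<theta>x \<theta>1 \<theta>i (cover_sector \<epsilon> \<phi>) A0 Ax A1"
            "associated_solution (cover_sector \<epsilon> \<phi>) A0 A1 y" "\<xi> \<in> cover_sector \<epsilon> \<phi>" "is_p0x (A0 \<xi>) (Ax \<xi>) (A1 \<xi>) (exp \<xi>) p"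
          for \<theta>0 \<theta>x \<theta>1 \<theta>i A0 Ax A1 \<xi> p
          by (rule Schlesinger_systems_p0x(2)[OF m[OF that(1)] that(2-5)])
        fix \<xi> assume "\<xi> \<in> cover_sector \<epsilon> \<phi>"
        then have \<xi>: "\<xi> \<in> dom" using \<epsilon>(2) by auto
        show "y \<xi> = a * exp ((1 - \<sigma>) * \<xi>) * (1 + (val sE \<xi> - 1))" using y_eq[OF \<xi>] by simp
        show "\<exists>s. (\<lambda>n. exp (of_nat n * \<xi>) *
             (\<Sum>m=- int n..int n + 2. c n m \<sigma> a * exp (of_int m * \<sigma> * \<xi>))) sums s \<and> val sE \<xi> - 1 = - 1 + s"
          using val_sE_sums[OF \<xi>] unfolding c_def by (intro exI[of _ "val sE \<xi>"]) simp
        show "((\<lambda>(m1, m2). c m2 (int m1 - int m2) \<sigma> a *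
             exp (of_nat m1 * \<sigma> * \<xi>) * exp (of_nat m2 * (1 - \<sigma>) * \<xi>))
            has_sum (val sE \<xi> - 1)) {(m1, m2). m1 \<le> 2 * m2 + 2 \<and> 1 \<le> m1 + m2}"
          using val_sE_has_sum[OF \<xi>] unfolding c_def .
      qed
    qed
  qed
qed

end
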